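(* Let $A$ be a $J$-dissipative operator in the Krein space $(\mathcal H,[\cdot,\cdot])$ with dense domain $\mathcal D(A)=\mathcal D^+\oplus\mathcal D^-$, and let $\overline A$ denote its closure. Assume: (i) $-A_{22}$ is m-dissipative in $\mathcal H^-$ (so $(A_{22}-\mu)^{-1}$ exists and is bounded for all $\mu\in\mathbb C^-$); (ii) for some (equivalently, for all) $\mu\in\mathbb C^-$ the operator $F(\mu)=(A_{22}-\mu)^{-1}A_{21}$ is bounded on its domain $\mathcal D^+$ (hence has a bounded closure on $\mathcal H^+$); (iii) for some (equivalently, for all) $\mu\in\mathbb C^-$ the operator $G(\mu)=A_{12}(A_{22}-\mu)^{-1}:\mathcal H^-\to\mathcal H^+$ is compact. Then there exists a maximal nonnegative subspace of $(\mathcal H,[\cdot,\cdot])$ which is $\overline A$-invariant. Moreover, if $\overline A$ is $J$-m-dissipative, then there exists a maximal nonnegative $\overline A$-invariant subspace $\mathcal L^+$ such that the spectrum of the restriction $A_+=\overline A|_{\mathcal L^+}$ is contained in the closed left half-plane $\{\operatorname{Re}\lambda\le 0\}$; and such a subspace exists only if $\overline A$ is $J$-m-dissipative.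
   Context: $\mathcal H$ is a separable Hilbert space with inner product $(\cdot,\cdot)$; $P_+,P_-$ are complementary orthogonal projections ($P_++P_-=I$), both of infinite rank, $J=P_+-P_-$, $\mathcal H^\pm=P_\pm\mathcal H$, and $[x,y]=(Jx,y)$ (a Krein space). Vectors $x=x_++x_-$, $x_\pm\in\mathcal H^\pm$, are written as columns $(x_+,x_-)^T$. $A$ is a linear operator in $\mathcal H$ with domain $\mathcal D(A)=\mathcal D^+\oplus\mathcal D^-$, $\mathcal D^\pm\subset\mathcal H^\pm$, and $A_{11}=P_+A|_{\mathcal D^+}$, $A_{12}=P_+A|_{\mathcal D^-}$, $A_{21}=P_-A|_{\mathcal D^+}$, $A_{22}=P_-A|_{\mathcal D^-}$, with $A_{22}$ regarded as an operator in $\mathcal H^-$ with domain $\mathcal D^-$; thus $A(x_+,x_-)^T=(A_{11}x_++A_{12}x_-,\ A_{21}x_++A_{22}x_-)^T$. An operator $T$ in a Hilbert space is dissipative if $\operatorname{Re}(Tx,x)\le 0$ for all $x\in\mathcal D(T)$, and m-dissipative if it is dissipative and has no proper dissipative extension (equivalently, dissipative with $T-\lambda$ boundedly invertible for all $\operatorname{Re}\lambda>0$). $A$ is $J$-dissipative ($J$-m-dissipative) if $JA$ is dissipative (m-dissipative) in $\mathcal H$. $\mathbb C^-=\{\mu:\operatorname{Re}\mu<0\}$. A subspace (closed linear subspace) $\mathcal L$ is nonnegative if $[x,x]\ge0$ for all $x\in\mathcal L$, and maximal nonnegative if it has no proper nonnegative extension. A subspace $\mathcal L$ is called $T$-invariant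 (for a linear operator $T$) if $\mathcal D(T)\cap\mathcal L$ is dense in $\mathcal L$ and $Tx\in\mathcal L$ for all $x\in\mathcal D(T)\cap\mathcal L$; the restriction $T|_{\mathcal L}$ is the operator in $\mathcal L$ with domain $\mathcal D(T)\cap\mathcal L$. *)

theory Defs
  imports "HOL-Analysis.Analysis"
begin

class cvec = real_vector +
  fixes scaleC :: "complex \<Rightarrow> 'a \<Rightarrow> 'a" (infixr \<open>*\<^sub>C\<close> 75)
  assumes scaleC_add_right: "a *\<^sub>C (x + y) = a *\<^sub>C x + a *\<^sub>C y"
    and scaleC_add_left: "(a + b) *\<^sub>C x = a *\<^sub>C x + b *\<^sub>C x"
    and scaleC_scaleC: "a *\<^sub>C (b *\<^sub>C x) = (a * b) *\<^sub>C x"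
    and scaleC_one: "1 *\<^sub>C x = x"
    and scaleR_scaleC: "scaleR r x = complex_of_real r *\<^sub>C x"

text \<open>Complex inner product space; the inner product is linear in the first
  argument and conjugate linear in the second; the norm is the induced one.
  Completeness is imposed separately via the sort complete_space.\<close>
class cinner_space = cvec + real_normed_vector +
  fixes cinner :: "'a \<Rightarrow> 'a \<Rightarrow> complex"
  assumes cinner_commute: "cinner x y = cnj (cinner y x)"
    and cinner_add_left: "cinner (x + y) z = cinner x z + cinner y z"
    and cinner_scaleC_left: "cinner (r *\<^sub>C x) y = r * cinner x y"
    and cinner_real_nonneg: "Im (cinner x x) = 0 \<and> 0 \<le> Re (cinner x x)"
    and cinner_eq_zero_iff: "cinner x x = 0 \<longleftrightarrow> x = 0"
    and norm_eq_sqrt_cinner: "norm x = sqrt (Re (cinner x x))"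

definition csubspace :: "'a::cvec set \<Rightarrow> bool" where
  "csubspace S \<longleftrightarrow> 0 \<in> S \<and> (\<forall>x\<in>S. \<forall>y\<in>S. x + y \<in> S) \<and> (\<forall>c. \<forall>x\<in>S. c *\<^sub>C x \<in> S)"

definition closed_csubspace :: "'a::{cvec,topological_space} set \<Rightarrow> bool" where
  "closed_csubspace S \<longleftrightarrow> csubspace S \<and> closed S"

definition clinear_on :: "'a::cvec set \<Rightarrow> ('a \<Rightarrow> 'b::cvec) \<Rightarrow> bool" where
  "clinear_on D T \<longleftrightarrow> (\<forall>x\<in>D. \<forall>y\<in>D. T (x + y) = T x + T y) \<and>
                       (\<forall>c. \<forall>x\<in>D. T (c *\<^sub>C x) = c *\<^sub>C T x)"

definition clinear_map :: "('a::cvec \<Rightarrow> 'b::cvec) \<Rightarrow> bool" where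
  "clinear_map T \<longleftrightarrow> clinear_on UNIV T"

definition orth_proj :: "('a::cinner_space \<Rightarrow> 'a) \<Rightarrow> bool" where
  "orth_proj P \<longleftrightarrow> clinear_map P \<and> (\<forall>x. P (P x) = P x) \<and>
                   (\<forall>x y. cinner (P x) y = cinner x (P y))"

definition infinite_dim :: "'a::cinner_space set \<Rightarrow> bool" where
  "infinite_dim V \<longleftrightarrow> (\<forall>n::nat. \<exists>e::nat \<Rightarrow> 'a. (\<forall>i<n. e i \<in> V) \<and>
       (\<forall>i<n. \<forall>j<n. cinner (e i) (e j) = (if i = j then 1 else 0)))"

definition separable_space :: "'a::topological_space itself \<Rightarrow> bool" where
  "separable_space _ \<longleftrightarrow> (\<exists>S::'a set. countable S \<and> closure S = UNIV)"

text \<open>An operator in the Hilbert space V (a closed subspace of the ambient space),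
  with domain D and action T.\<close>
definition operator_in :: "'a::cinner_space set \<Rightarrow> 'a set \<Rightarrow> ('a \<Rightarrow> 'a) \<Rightarrow> bool" where
  "operator_in V D T \<longleftrightarrow> D \<subseteq> V \<and> csubspace D \<and> clinear_on D T \<and> T ` D \<subseteq> V"

definition dissipative_in :: "'a::cinner_space set \<Rightarrow> 'a set \<Rightarrow> ('a \<Rightarrow> 'a) \<Rightarrow> bool" where
  "dissipative_in V D T \<longleftrightarrow> operator_in V D T \<and> (\<forall>x\<in>D. Re (cinner (T x) x) \<le> 0)"

definition m_dissipative_in :: "'a::cinner_space set \<Rightarrow> 'a set \<Rightarrow> ('a \<Rightarrow> 'a) \<Rightarrow> bool" where
  "m_dissipative_in V D T \<longleftrightarrow> dissipative_in V D T \<and>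
     \<not> (\<exists>D' T'. dissipative_in V D' T' \<and> D \<subset> D' \<and> (\<forall>x\<in>D. T' x = T x))"

definition graph :: "'a set \<Rightarrow> ('a \<Rightarrow> 'b) \<Rightarrow> ('a \<times> 'b) set" where
  "graph D T = {(x, T x) | x. x \<in> D}"

definition closure_dom :: "'a::real_normed_vector set \<Rightarrow> ('a \<Rightarrow> 'a) \<Rightarrow> 'a set" where
  "closure_dom D T = fst ` closure (graph D T)"

definition closure_op :: "'a::real_normed_vector set \<Rightarrow> ('a \<Rightarrow> 'a) \<Rightarrow> 'a \<Rightarrow> 'a" where
  "closure_op D T x = (THE y. (x, y) \<in> closure (graph D T))"

definition resolvent_op :: "'a set \<Rightarrow> ('a \<Rightarrow> 'a::cvec) \<Rightarrow> complex \<Rightarrow> 'a \<Rightarrow> 'a" where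
  "resolvent_op D T \<mu> y = (THE x. x \<in> D \<and> T x - \<mu> *\<^sub>C x = y)"

definition compact_op_on :: "'a::metric_space set \<Rightarrow> ('a \<Rightarrow> 'b::metric_space) \<Rightarrow> bool" where
  "compact_op_on V T \<longleftrightarrow> (\<forall>B. B \<subseteq> V \<longrightarrow> bounded B \<longrightarrow> compact (closure (T ` B)))"

definition resolvent_set_in :: "'a::cinner_space set \<Rightarrow> 'a set \<Rightarrow> ('a \<Rightarrow> 'a) \<Rightarrow> complex set" where
  "resolvent_set_in V D T = {z. bij_betw (\<lambda>x. T x - z *\<^sub>C x) D V \<and>
       (\<exists>C. \<forall>x\<in>D. norm x \<le> C * norm (T x - z *\<^sub>C x))}"

definition spectrum_in :: "'a::cinner_space set \<Rightarrow> 'a set \<Rightarrow> ('a \<Rightarrow> 'a) \<Rightarrow> complex set" where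
  "spectrum_in V D T = UNIV - resolvent_set_in V D T"

section \<open>Krein space notions (J = Pp - Pm, [x,y] = (Jx,y))\<close>

definition nonneg_subspace :: "('a::cinner_space \<Rightarrow> 'a) \<Rightarrow> 'a set \<Rightarrow> bool" where
  "nonneg_subspace J L \<longleftrightarrow> closed_csubspace L \<and> (\<forall>x\<in>L. 0 \<le> Re (cinner (J x) x))"

definition max_nonneg_subspace :: "('a::cinner_space \<Rightarrow> 'a) \<Rightarrow> 'a set \<Rightarrow> bool" where
  "max_nonneg_subspace J L \<longleftrightarrow> nonneg_subspace J L \<and>
     (\<forall>L'. nonneg_subspace J L' \<longrightarrow> L \<subseteq> L' \<longrightarrow> L' = L)"

definition invariant_subspace :: "'a::topological_space set \<Rightarrow> ('a \<Rightarrow> 'a) \<Rightarrow> 'a set \<Rightarrow> bool" where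
  "invariant_subspace D T L \<longleftrightarrow> L \<subseteq> closure (D \<inter> L) \<and> (\<forall>x\<in>D \<inter> L. T x \<in> L)"

end

theory Submission
  imports Defs "HOL-Complex_Analysis.Complex_Analysis"
    "HOL-Computational_Algebra.Fundamental_Theorem_Algebra" "Jordan_Normal_Form.Determinant"
begin

text \<open>With \<open>\<mu> = - m\<close>, \<open>m > 0\<close>, put \<open>R = (A\<^sub>2\<^sub>2 - \<mu>)\<inverse>\<close>, \<open>F = R A\<^sub>2\<^sub>1\<close>, \<open>G = A\<^sub>1\<^sub>2 R\<close>, and let
  \<open>S = A\<^sub>1\<^sub>1 - A\<^sub>1\<^sub>2 F\<close>, which is dissipative. A maximal nonnegative subspace is the graph of a contraction
  \<open>K\<close> from \<open>H\<^sup>+\<close> to \<open>H\<^sup>-\<close>. Eliminating the unbounded operators by \<open>R\<close>, its invariance reads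
  \<open>K x + F x = R K v\<close> with \<open>v = (A\<^sub>+ - \<mu>) x\<close> and \<open>v - G K v = (S - \<mu>) x\<close>, where \<open>A\<^sub>+\<close> is the restriction to the
  graph, regarded as an operator in \<open>H\<^sup>+\<close>. For the compressions of \<open>A - \<epsilon> J\<close>
  to \<open>span X \<oplus> H\<^sup>-\<close>, with \<open>X\<close> a finite subset of the domain, such contractions exist: the inverse of
  the compression is bounded, and for bounded operators a further Galerkin approximation reduces to matrices,
  where an eigenvector is split off at a time. These contractions converge weakly along an ultrafilter of pairs
  \<open>(X, \<epsilon>)\<close>, and the limit satisfies the same equation because \<open>G\<close> is compact and, for \<open>m\<close> large, small.

  For the spectrum one has \<open>(1 - G K) (A\<^sub>+ - l) = S - l + (l - \<mu>) G K\<close>. If \<open>A\<close> has a \<open>J\<close>-m-dissipative closure, the closure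
  of \<open>S\<close> is m-dissipative; splitting \<open>G\<close> into a finite-rank part and a small remainder, invertibility for \<open>l\<close>
  in a bounded region becomes the nonvanishing of a holomorphic determinant. It is the limit
  of the determinants of the finite sections, which do not vanish in the right half-plane, and it is nonzero at
  \<open>l = m\<close>; hence it does not vanish by the theorem of Hurwitz. Conversely, a contraction mapping argument turns
  surjectivity of \<open>A\<^sub>+ - m\<close> into surjectivity of the closure of \<open>S - m\<close>, whence \<open>A\<close> has a \<open>J\<close>-m-dissipative closure.\<close>

section \<open>Complex inner product spaces\<close>

text \<open>The equation of an invariant graph, \<open>K (A11 + A12 K) = A21 + A22 K\<close>, is
  quadratic in \<open>K\<close>, and products do not survive weak limits. In the form with
  \<open>v\<close> they do: compactness turns the weak limit \<open>K v\<close> of the vectors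
  \<open>k i v\<close> into a norm limit of \<open>G (k i v)\<close>, so the vectors
  \<open>v\<close> of the sections converge in norm, and weakly convergent contractions may be
  applied to norm convergent vectors. The term \<open>\<epsilon> J\<close> makes each section
  strictly dissipative: its inverse is bounded by \<open>1/\<epsilon>\<close>, and its eigenvectors
  are not neutral. That \<open>G\<close> is small for large \<open>m\<close> rests on the resolvent
  identity and on \<open>m R \<rightarrow> 1\<close>, needed for the adjoint of \<open>m R\<close>;
  a Cauchy-Schwarz inequality for the form \<open>(x,y) - (m R x, m R y)\<close> supplies it. For
  the spectrum, weak convergence \<open>k i \<rightarrow> K\<close> gives no norm convergence of
  resolvents. Behind a finite-rank factor it does give convergence of finitely many matrix entries,
  which is why the question is moved to determinants. The bound \<open>1/8\<close> on
  \<open>G\<close> serves three times: for \<open>1 - G K\<close>, for the nonzero determinant at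
  \<open>l = m\<close>, where the factor \<open>l - \<mu>\<close> is \<open>2 m\<close>, and for the
  contraction constant \<open>1/2\<close> in the converse.\<close>

interpretation cvs: vector_space "scaleC :: complex \<Rightarrow> 'a \<Rightarrow> 'a::cvec"
  by unfold_locales (simp_all add: scaleC_add_right scaleC_add_left scaleC_scaleC scaleC_one)

lemma scaleC_minus_one: "- x = (-1) *\<^sub>C (x::'a::cvec)"
  by (simp add: scaleC_one)

lemma csubspace_iff: "csubspace V \<longleftrightarrow> cvs.subspace V"
  by (auto simp: csubspace_def cvs.subspace_def)

lemma csubspaceD:
  assumes "csubspace V"
  shows csubspace_zero: "0 \<in> V"
    and csubspace_add: "x \<in> V \<Longrightarrow> y \<in> V \<Longrightarrow> x + y \<in> V"
    and csubspace_scale: "x \<in> V \<Longrightarrow> c *\<^sub>C x \<in> V"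
    and csubspace_diff: "x \<in> V \<Longrightarrow> y \<in> V \<Longrightarrow> x - y \<in> V"
    and csubspace_neg: "x \<in> V \<Longrightarrow> - x \<in> V"
    and csubspace_scaleR: "x \<in> V \<Longrightarrow> r *\<^sub>R x \<in> V"
    and csubspace_sum: "(\<And>i. i \<in> I \<Longrightarrow> f i \<in> V) \<Longrightarrow> sum f I \<in> V"
  using assms unfolding csubspace_iff
  by (auto simp: cvs.subspace_0 cvs.subspace_add cvs.subspace_scale cvs.subspace_diff cvs.subspace_neg
      cvs.subspace_sum scaleR_scaleC)

lemma clinear_onD:
  assumes "clinear_on V T" "csubspace V"
  shows clinear_on_add: "x \<in> V \<Longrightarrow> y \<in> V \<Longrightarrow> T (x + y) = T x + T y"
    and clinear_on_scale: "x \<in> V \<Longrightarrow> T (c *\<^sub>C x) = c *\<^sub>C T x"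
    and clinear_on_neg: "x \<in> V \<Longrightarrow> T (- x) = - T x"
    and clinear_on_diff: "x \<in> V \<Longrightarrow> y \<in> V \<Longrightarrow> T (x - y) = T x - T y"
    and clinear_on_zero: "T 0 = 0"
proof -
  show add: "T (x + y) = T x + T y" if "x \<in> V" "y \<in> V" for x y
    using assms that by (auto simp: clinear_on_def)
  show scale: "T (c *\<^sub>C x) = c *\<^sub>C T x" if "x \<in> V" for x c
    using assms that by (auto simp: clinear_on_def)
  show neg: "T (- x) = - T x" if "x \<in> V" for x
    using scale[OF that, of "-1"] by simp
  show "T (x - y) = T x - T y" if "x \<in> V" "y \<in> V" for x y
    using add[OF that(1) csubspace_neg[OF assms(2) that(2)]] neg[OF that(2)] by simp
  show "T 0 = 0"
    using scale[OF csubspace_zero[OF assms(2)], of 0] by simp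
qed

lemma csubspace_UNIV: "csubspace UNIV"
  by (simp add: csubspace_def)

lemma clinear_mapD:
  assumes "clinear_map T"
  shows clinear_map_add: "T (x + y) = T x + T y"
    and clinear_map_scale: "T (c *\<^sub>C x) = c *\<^sub>C T x"
    and clinear_map_neg: "T (- x) = - T x"
    and clinear_map_diff: "T (x - y) = T x - T y"
    and clinear_map_zero: "T 0 = 0"
    and clinear_map_sum: "T (sum f I) = (\<Sum>i\<in>I. T (f i))"
    and clinear_map_scaleR: "T (r *\<^sub>R x) = r *\<^sub>R T x"
proof -
  note * = assms[unfolded clinear_map_def] csubspace_UNIV
  show add: "T (x + y) = T x + T y" for x y
    using clinear_on_add[OF *] by simp
  show "T (c *\<^sub>C x) = c *\<^sub>C T x" "T (- x) = - T x" "T (x - y) = T x - T y" "T (r *\<^sub>R x) = r *\<^sub>R T x"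
    using clinear_on_scale[OF *] clinear_on_neg[OF *] clinear_on_diff[OF *] by (simp_all add: scaleR_scaleC)
  show zero: "T 0 = 0" using clinear_on_zero[OF *] .
  show "T (sum f I) = (\<Sum>i\<in>I. T (f i))"
    by (induction I rule: infinite_finite_induct) (simp_all add: zero add)
qed

lemma clinear_mapI:
  assumes "\<And>x y. T (x + y) = T x + T y" "\<And>c x. T (c *\<^sub>C x) = c *\<^sub>C T x"
  shows "clinear_map T"
  using assms by (simp add: clinear_map_def clinear_on_def)

lemma cinner_add_right: "cinner (x::'a::cinner_space) (y + z) = cinner x y + cinner x z"
  by (metis cinner_add_left cinner_commute complex_cnj_add)

lemma cinner_scaleC_right: "cinner (x::'a::cinner_space) (r *\<^sub>C y) = cnj r * cinner x y"
  by (metis cinner_commute cinner_scaleC_left complex_cnj_mult)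

lemma cinner_minus_left: "cinner (- x) (y::'a::cinner_space) = - cinner x y"
  using cinner_scaleC_left[of "-1" x y] by simp

lemma cinner_minus_right: "cinner x (- y::'a::cinner_space) = - cinner x y"
  using cinner_scaleC_right[of x "-1" y] by simp

lemma cinner_diff_left: "cinner (x - y) (z::'a::cinner_space) = cinner x z - cinner y z"
  using cinner_add_left[of x "- y" z] by (simp add: cinner_minus_left)

lemma cinner_diff_right: "cinner z (x - y::'a::cinner_space) = cinner z x - cinner z y"
  using cinner_add_right[of z x "- y"] by (simp add: cinner_minus_right)

lemma cinner_zero_left [simp]: "cinner 0 (x::'a::cinner_space) = 0"
  using cinner_scaleC_left[of 0 x x] by simp

lemma cinner_zero_right [simp]: "cinner (x::'a::cinner_space) 0 = 0"
  using cinner_scaleC_right[of x 0 x] by simp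

lemma cinner_sum_left: "cinner (sum f I) (x::'a::cinner_space) = (\<Sum>i\<in>I. cinner (f i) x)"
  by (induction I rule: infinite_finite_induct) (simp_all add: cinner_add_left)

lemma cinner_sum_right: "cinner (x::'a::cinner_space) (sum f I) = (\<Sum>i\<in>I. cinner x (f i))"
  by (induction I rule: infinite_finite_induct) (simp_all add: cinner_add_right)

lemma cinner_scaleR_left: "cinner (r *\<^sub>R x) (y::'a::cinner_space) = of_real r * cinner x y"
  by (simp add: scaleR_scaleC cinner_scaleC_left)

lemma cinner_scaleR_right: "cinner (x::'a::cinner_space) (r *\<^sub>R y) = of_real r * cinner x y"
  by (simp add: scaleR_scaleC cinner_scaleC_right)

lemmas cinner_simps = cinner_add_left cinner_add_right cinner_diff_left cinner_diff_right
  cinner_minus_left cinner_minus_right cinner_scaleC_left cinner_scaleC_right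
  cinner_scaleR_left cinner_scaleR_right

lemma cinner_self: "cinner x x = complex_of_real ((norm (x::'a::cinner_space))\<^sup>2)"
  using cinner_real_nonneg[of x] by (simp add: complex_eq_iff norm_eq_sqrt_cinner)

lemma Re_cinner_self: "Re (cinner x x) = (norm (x::'a::cinner_space))\<^sup>2"
  by (simp add: cinner_self)

lemma Re_cinner_commute: "Re (cinner x (y::'a::cinner_space)) = Re (cinner y x)"
  by (subst cinner_commute) simp

lemma cmod_cinner_commute: "cmod (cinner x (y::'a::cinner_space)) = cmod (cinner y x)"
  by (subst cinner_commute) simp

lemma norm_add_sq: "(norm (x + y::'a::cinner_space))\<^sup>2 = (norm x)\<^sup>2 + 2 * Re (cinner x y) + (norm y)\<^sup>2"
  unfolding Re_cinner_self[symmetric] using Re_cinner_commute[of x y] by (simp add: cinner_simps)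

lemma norm_diff_sq: "(norm (x - y::'a::cinner_space))\<^sup>2 = (norm x)\<^sup>2 - 2 * Re (cinner x y) + (norm y)\<^sup>2"
  unfolding Re_cinner_self[symmetric] using Re_cinner_commute[of x y] by (simp add: cinner_simps)

lemma norm_scaleC: "norm (c *\<^sub>C (x::'a::cinner_space)) = cmod c * norm x"
proof -
  have "(norm (c *\<^sub>C x))\<^sup>2 = Re (c * cnj c * cinner x x)"
    by (simp only: Re_cinner_self[symmetric] cinner_scaleC_left cinner_scaleC_right mult_ac)
  also have "\<dots> = Re (of_real ((cmod c)\<^sup>2) * of_real ((norm x)\<^sup>2))"
    by (simp only: complex_norm_square cinner_self)
  also have "\<dots> = (cmod c * norm x)\<^sup>2"
    by (simp only: of_real_mult[symmetric] Re_complex_of_real power_mult_distrib)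
  finally show ?thesis by (simp add: power2_eq_iff_nonneg)
qed

text \<open>Here \<open>a\<close>, \<open>b\<close> and \<open>w\<close> stand for the values of a
  semidefinite form on a pair of vectors. Stating it for numbers lets it serve the inner product,
  the first variation in the Riesz theorem and the defect form of a contraction.\<close>

lemma semi_inner_Cauchy_Schwarz:
  fixes a b :: real and w :: complex
  assumes "\<And>c. 0 \<le> a + 2 * Re (c * w) + (cmod c)\<^sup>2 * b" "0 \<le> a" "0 \<le> b"
  shows "(cmod w)\<^sup>2 \<le> a * b"
proof (cases "b = 0")
  case True
  have "w = 0"
  proof (rule ccontr)
    assume "w \<noteq> 0"
    \<comment> \<open>With this \<open>t\<close> the quadratic expression takes the negative value
      \<open>a - 2 (a + 1)\<close>.\<close>
    define t where "t = (a + 1) / (cmod w)\<^sup>2"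
    have "0 \<le> a + 2 * Re (of_real (- t) * cnj w * w)"
      using assms(1)[of "of_real (- t) * cnj w"] True by simp
    also have "of_real (- t) * cnj w * w = of_real (- t * (cmod w)\<^sup>2)"
      using complex_norm_square[of w] by (simp add: mult.commute mult.left_commute)
    finally have "0 \<le> a - 2 * (a + 1)" using \<open>w \<noteq> 0\<close> by (simp add: t_def)
    then show False using assms by simp
  qed
  then show ?thesis using True by simp
next
  case False
  then have b: "b > 0" using assms by simp
  \<comment> \<open>The minimiser of the quadratic expression in \<open>c\<close>.\<close>
  define c where "c = of_real (- 1 / b) * cnj w"
  have "c * w = of_real (- (cmod w)\<^sup>2 / b)"
    using complex_norm_square[of w] by (simp add: c_def mult.commute mult.left_commute)
  moreover have "(cmod c)\<^sup>2 = (cmod w)\<^sup>2 / b\<^sup>2"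
    by (simp add: c_def norm_mult norm_divide power_mult_distrib power_divide)
  ultimately have "0 \<le> a + 2 * (- (cmod w)\<^sup>2 / b) + (cmod w)\<^sup>2 / b\<^sup>2 * b"
    using assms(1)[of c] by (metis Re_complex_of_real)
  then show ?thesis using b by (simp add: field_simps power2_eq_square)
qed

lemma cinner_Cauchy_Schwarz: "cmod (cinner x (y::'a::cinner_space)) \<le> norm x * norm y"
proof -
  have "(cmod (cinner y x))\<^sup>2 \<le> (norm x)\<^sup>2 * (norm y)\<^sup>2"
  proof (rule semi_inner_Cauchy_Schwarz)
    fix c
    have "0 \<le> (norm (x + c *\<^sub>C y))\<^sup>2" by simp
    also have "\<dots> = (norm x)\<^sup>2 + 2 * Re (c * cinner y x) + (cmod c)\<^sup>2 * (norm y)\<^sup>2"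
      by (subst norm_add_sq) (simp add: Re_cinner_commute[of x] cinner_scaleC_left norm_scaleC power_mult_distrib)
    finally show "0 \<le> \<dots>" .
  qed auto
  then show ?thesis
    by (metis cmod_cinner_commute abs_le_square_iff abs_norm_cancel abs_mult power_mult_distrib)
qed

lemma bounded_bilinear_cinner: "bounded_bilinear (cinner :: 'a::cinner_space \<Rightarrow> _)"
  using cinner_Cauchy_Schwarz
  by unfold_locales (auto simp: cinner_simps scaleR_conv_of_real intro!: exI[of _ 1])

lemmas tendsto_cinner [tendsto_intros] = bounded_bilinear.tendsto[OF bounded_bilinear_cinner]

lemma bounded_bilinear_scaleC: "bounded_bilinear (scaleC :: complex \<Rightarrow> 'a \<Rightarrow> 'a::cinner_space)"
  by unfold_locales (auto simp: scaleC_add_left scaleC_add_right scaleR_scaleC scaleC_scaleC norm_scaleC scaleR_conv_of_real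
      mult.commute intro!: exI[of _ 1])

lemmas tendsto_scaleC [tendsto_intros] = bounded_bilinear.tendsto[OF bounded_bilinear_scaleC]

lemma cinner_eqI:
  fixes x y :: "'a::cinner_space"
  assumes "csubspace V" "x \<in> V" "y \<in> V" "\<And>z. z \<in> V \<Longrightarrow> cinner x z = cinner y z"
  shows "x = y"
proof -
  have "cinner (x - y) (x - y) = 0"
    using assms(4)[OF csubspace_diff[OF assms(1-3)]] by (simp add: cinner_diff_left)
  then show ?thesis by (simp add: cinner_eq_zero_iff)
qed

lemma bounded_linear_if_clinear:
  assumes "clinear_map T" "\<And>x. norm (T x) \<le> C * norm (x::'a::cinner_space)"
  shows "bounded_linear (T :: 'a \<Rightarrow> 'b::cinner_space)"
  by (rule bounded_linear_intro[of _ C])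
    (use assms in \<open>auto simp: clinear_map_add clinear_map_scaleR mult.commute\<close>)

lemma closed_csubspace_complete:
  fixes V :: "'a::{cinner_space, complete_space} set"
  assumes "closed V" "\<And>n. f n \<in> V" "Cauchy f"
  obtains l where "l \<in> V" "f \<longlonglongrightarrow> l"
proof -
  obtain l where "f \<longlonglongrightarrow> l" using assms(3) by (auto simp: Cauchy_convergent_iff convergent_def)
  then show ?thesis using that closed_sequentially[OF assms(1)] assms(2) by blast
qed

text \<open>The representing vector \<open>u\<close> is the minimiser of
  \<open>q x = |x|^2 - 2 Re (f x)\<close>, since \<open>q x = |x - u|^2 - |u|^2\<close>. The
  parallelogram law makes a minimising sequence Cauchy. The functional need only be linear on
  \<open>V\<close>, because closed subspaces are sets and not types here.\<close>

theorem riesz_on: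
  fixes V :: "'a::{cinner_space, complete_space} set"
  assumes V: "closed_csubspace V"
    and add: "\<And>x y. x \<in> V \<Longrightarrow> y \<in> V \<Longrightarrow> f (x + y) = f x + f y"
    and scale: "\<And>c x. x \<in> V \<Longrightarrow> f (c *\<^sub>C x) = c * f x"
    and bdd: "\<And>x. x \<in> V \<Longrightarrow> cmod (f x) \<le> C * norm x"
  obtains u where "u \<in> V" "\<And>x. x \<in> V \<Longrightarrow> f x = cinner x u"
proof -
  note Vs = V[unfolded closed_csubspace_def, THEN conjunct1]
  note Vc = V[unfolded closed_csubspace_def, THEN conjunct2]
  define q where "q x = (norm x)\<^sup>2 - 2 * Re (f x)" for x
  have q_lower: "- C\<^sup>2 \<le> q x" if "x \<in> V" for x
  proof -
    have "Re (f x) \<le> C * norm x" using bdd[OF that] complex_Re_le_cmod[of "f x"] by linarith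
    moreover have "0 \<le> (norm x - C)\<^sup>2" by simp
    ultimately show ?thesis by (simp add: q_def power2_eq_square algebra_simps)
  qed
  define I where "I = Inf (q ` V)"
  have bdd_below: "bdd_below (q ` V)" using q_lower by (auto intro!: bdd_belowI)
  have I_le: "I \<le> q x" if "x \<in> V" for x
    unfolding I_def using bdd_below that by (auto intro: cInf_lower)
  have "\<exists>x\<in>V. q x < I + 1 / real (Suc n)" for n
    using cInf_lessD[of "q ` V" "I + 1 / real (Suc n)"] csubspace_zero[OF Vs]
    by (auto simp: I_def)
  then obtain s where sV: "\<And>n. s n \<in> V" and sI: "\<And>n. q (s n) < I + 1 / real (Suc n)" by metis
  have para: "(norm (x - y))\<^sup>2 \<le> 2 * (q x - I) + 2 * (q y - I)" if "x \<in> V" "y \<in> V" for x y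
  proof -
    define z where "z = (1/2) *\<^sub>R (x + y)"
    have z: "z \<in> V" using that Vs by (simp add: z_def csubspace_add csubspace_scaleR)
    have "(norm z)\<^sup>2 = (norm (x + y))\<^sup>2 / 4" by (simp add: z_def power_divide)
    moreover have "f z = (f x + f y) / 2"
      using that Vs scale[of "x + y" "1/2"] add[of x y] by (simp add: z_def scaleR_scaleC csubspace_add)
    ultimately have "q z = (norm (x + y))\<^sup>2 / 4 - Re (f x) - Re (f y)" by (simp add: q_def add_divide_distrib del: eq_divide_eq_numeral1 divide_eq_eq_numeral1)
    then have "4 * I \<le> (norm (x + y))\<^sup>2 - 4 * Re (f x) - 4 * Re (f y)" using I_le[OF z] by simp
    moreover have "(norm (x - y))\<^sup>2 + (norm (x + y))\<^sup>2 = 2 * (norm x)\<^sup>2 + 2 * (norm y)\<^sup>2"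
      by (simp add: norm_add_sq norm_diff_sq)
    ultimately show ?thesis by (simp add: q_def)
  qed
  have "Cauchy s"
  proof (rule metric_CauchyI)
    fix e :: real assume e: "0 < e"
    obtain N where N: "4 * (1 / real (Suc N)) < e\<^sup>2"
      using e reals_Archimedean[of "e\<^sup>2 / 4"] by (auto simp: field_simps inverse_eq_divide)
    have "dist (s m) (s n) < e" if "m \<ge> N" "n \<ge> N" for m n
    proof -
      have "1 / real (Suc m) \<le> 1 / real (Suc N)" "1 / real (Suc n) \<le> 1 / real (Suc N)"
        using that by (auto intro!: divide_left_mono)
      then have "(norm (s m - s n))\<^sup>2 < e\<^sup>2"
        using para[OF sV sV, of m n] sI[of m] sI[of n] N by argo
      then show ?thesis using e by (simp add: dist_norm power_less_imp_less_base)
    qed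
    then show "\<exists>M. \<forall>m\<ge>M. \<forall>n\<ge>M. dist (s m) (s n) < e" by blast
  qed
  then obtain u where u: "u \<in> V" "s \<longlonglongrightarrow> u" using closed_csubspace_complete[OF Vc, of s] sV by blast
  have "q u \<le> I"
  proof -
    have "(\<lambda>n. f (s n)) \<longlonglongrightarrow> f u"
    proof (rule LIM_zero_cancel, rule Lim_null_comparison)
      show "\<forall>\<^sub>F n in sequentially. norm (f (s n) - f u) \<le> C * norm (s n - u)"
        using bdd[OF csubspace_diff[OF Vs sV u(1)]] add[OF csubspace_diff[OF Vs sV u(1)] u(1)]
        by (intro always_eventually allI) (metis add_diff_cancel_right' diff_add_cancel)
      show "(\<lambda>n. C * norm (s n - u)) \<longlonglongrightarrow> 0"
        using u(2) by (auto intro!: tendsto_eq_intros simp: LIM_zero_iff tendsto_norm_zero)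
    qed
    then have "(\<lambda>n. q (s n)) \<longlonglongrightarrow> q u" unfolding q_def using u(2) by (intro tendsto_intros)
    moreover have "(\<lambda>n. I + 1 / real (Suc n)) \<longlonglongrightarrow> I + 0"
      using LIMSEQ_inverse_real_of_nat by (intro tendsto_intros) (simp add: inverse_eq_divide)
    ultimately have "q u \<le> I + 0" by (rule LIMSEQ_le) (use sI in \<open>blast intro: less_imp_le\<close>)
    then show ?thesis by simp
  qed
  \<comment> \<open>The first variation of \<open>q\<close> at \<open>u\<close> vanishes. Moving
    only along real multiples of \<open>h\<close> gives the hypothesis of the Cauchy-Schwarz lemma
    with \<open>a = 0\<close>, which forces \<open>w = 0\<close>; imaginary parts follow by
    replacing \<open>h\<close> with \<open>- \<i> h\<close>.\<close>
  have Re_eq: "Re (f h) = Re (cinner h u)" if "h \<in> V" for h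
  proof -
    define w where "w = Re (cinner h u) - Re (f h)"
    have "w\<^sup>2 \<le> 0 * (norm h)\<^sup>2 "
    proof -
      have "(cmod (of_real w))\<^sup>2 \<le> 0 * (norm h)\<^sup>2"
      proof (rule semi_inner_Cauchy_Schwarz)
        fix c :: complex
        have "I \<le> q (u + Re c *\<^sub>R h)" using u that Vs by (intro I_le) (simp add: csubspace_add csubspace_scaleR)
        also have "\<dots> = q u + 2 * (Re c * w) + (Re c)\<^sup>2 * (norm h)\<^sup>2"
          using u that Vs add[of u "Re c *\<^sub>R h"] scale[of h "of_real (Re c)"]
          by (simp add: q_def norm_add_sq w_def scaleR_scaleC[symmetric] csubspace_scaleR cinner_simps
              power_mult_distrib Re_cinner_commute[of u h] algebra_simps)
        finally have "0 \<le> 2 * (Re c * w) + (Re c)\<^sup>2 * (norm h)\<^sup>2" using \<open>q u \<le> I\<close> by linarith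
        moreover have "(Re c)\<^sup>2 * (norm h)\<^sup>2 \<le> (cmod c)\<^sup>2 * (norm h)\<^sup>2"
          by (intro mult_right_mono) (auto simp: cmod_def)
        ultimately show "0 \<le> 0 + 2 * Re (c * of_real w) + (cmod c)\<^sup>2 * (norm h)\<^sup>2" by simp
      qed auto
      then show ?thesis by simp
    qed
    then show ?thesis by (simp add: w_def)
  qed
  have "f h = cinner h u" if "h \<in> V" for h
  proof (rule complex_eqI)
    show "Re (f h) = Re (cinner h u)" by (rule Re_eq[OF that])
    have "Re (f (- \<i> *\<^sub>C h)) = Re (cinner (- \<i> *\<^sub>C h) u)" using that Vs by (intro Re_eq) (simp add: csubspace_scale csubspace_neg)
    then show "Im (f h) = Im (cinner h u)" using scale[OF that, of "-\<i>"] cinner_scaleC_left[of "-\<i>" h u] by simp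
  qed
  then show ?thesis using that u(1) by blast
qed

section \<open>Ultrafilters, weak limits and finite-rank projections\<close>

definition ultra :: "'i filter \<Rightarrow> bool" where
  "ultra U \<longleftrightarrow> U \<noteq> bot \<and> (\<forall>P. eventually P U \<or> eventually (\<lambda>i. \<not> P i) U)"

text \<open>Zorn's lemma yields a minimal proper filter below \<open>F\<close>; chains are bounded
  by their infimum, which is proper because a false predicate would already hold eventually in a
  member. If the negation of \<open>P\<close> is not eventual, intersecting with \<open>P\<close>
  leaves a proper filter, so by minimality nothing changes.\<close>

lemma ultra_exists:
  assumes "F \<noteq> (bot :: 'i filter)"
  obtains U where "U \<le> F" "ultra U"
proof -
  define A where "A = {G. G \<le> F \<and> G \<noteq> bot}"
  have "\<exists>m\<in>A. \<forall>a\<in>A. m \<ge> a \<longrightarrow> a = m"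
  proof (rule predicate_Zorn)
    show "partial_order_on A (relation_of (\<ge>) A)"
      by (rule partial_order_on_relation_ofI) auto
    fix C assume C: "C \<in> Chains (relation_of (\<ge>) A)"
    show "\<exists>u\<in>A. \<forall>a\<in>C. u \<le> a"
    proof (cases "C = {}")
      case True
      then show ?thesis using assms by (auto simp: A_def)
    next
      case False
      have CA: "C \<subseteq> A" and lin: "\<And>a b. a \<in> C \<Longrightarrow> b \<in> C \<Longrightarrow> a \<le> b \<or> b \<le> a"
        using C by (auto simp: Chains_def relation_of_def)
      have "eventually (\<lambda>_. False) (Inf C) \<longleftrightarrow> (\<exists>b\<in>C. eventually (\<lambda>_. False) b)"
      proof (rule eventually_Inf_base[OF False])
        fix a b assume "a \<in> C" "b \<in> C"
        then show "\<exists>x\<in>C. x \<le> inf a b" using lin[of a b] by (meson le_inf_iff order_refl)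
      qed
      then have "\<not> eventually (\<lambda>_. False) (Inf C)"
        using CA by (auto simp: A_def trivial_limit_def)
      moreover have "Inf C \<le> F"
      proof -
        obtain c where "c \<in> C" using False by blast
        then show ?thesis using CA by (intro Inf_lower2[of c]) (auto simp: A_def)
      qed
      ultimately have "Inf C \<in> A" by (simp add: A_def trivial_limit_def)
      then show ?thesis by (auto intro: Inf_lower)
    qed
  qed
  then obtain m where m: "m \<le> F" "m \<noteq> bot" and max: "\<And>a. a \<le> F \<Longrightarrow> a \<noteq> bot \<Longrightarrow> a \<le> m \<Longrightarrow> a = m"
    by (auto simp: A_def)
  have "eventually P m \<or> eventually (\<lambda>i. \<not> P i) m" for P
  proof (rule disjCI)
    assume "\<not> eventually (\<lambda>i. \<not> P i) m"
    then have "inf m (principal {i. P i}) \<noteq> bot"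
      by (simp add: trivial_limit_def eventually_inf_principal)
    then have "inf m (principal {i. P i}) = m"
      using m by (intro max) (auto intro: le_infI1)
    moreover have "eventually P (inf m (principal {i. P i}))"
      by (simp add: eventually_inf_principal)
    ultimately show "eventually P m" by simp
  qed
  then show ?thesis using that m by (auto simp: ultra_def)
qed

lemma ultraD: "ultra U \<Longrightarrow> \<not> eventually P U \<Longrightarrow> eventually (\<lambda>i. \<not> P i) U"
  by (simp add: ultra_def) metis

text \<open>Compactness gives a cluster point, and an ultrafilter converges to each of its cluster
  points: were an open neighbourhood not eventual, its complement would be.\<close>

lemma ultra_compact_lim:
  fixes f :: "'i \<Rightarrow> 'b::topological_space"
  assumes U: "ultra U" and C: "compact C" and ev: "eventually (\<lambda>i. f i \<in> C) U"
  obtains l where "l \<in> C" "(f \<longlongrightarrow> l) U"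
proof -
  have nb: "filtermap f U \<noteq> bot" using U by (simp add: ultra_def filtermap_bot_iff)
  have evC: "eventually (\<lambda>x. x \<in> C) (filtermap f U)" using ev by (simp add: eventually_filtermap)
  obtain l where l: "l \<in> C" "inf (nhds l) (filtermap f U) \<noteq> bot"
    using C[unfolded compact_filter, rule_format, OF nb evC] by (elim bexE)
  have "(f \<longlongrightarrow> l) U"
  proof (rule topological_tendstoI, rule ccontr)
    fix S assume S: "open S" "l \<in> S" "\<not> eventually (\<lambda>i. f i \<in> S) U"
    have "eventually (\<lambda>i. f i \<notin> S) U"  by (rule ultraD[OF U S(3)])
    then have ev2: "eventually (\<lambda>x. x \<notin> S) (filtermap f U)" by (simp add: eventually_filtermap)
    have ev1: "eventually (\<lambda>x. x \<in> S) (nhds l)" using S(1,2) by (rule eventually_nhds_in_open)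
    have "eventually (\<lambda>_. False) (inf (nhds l) (filtermap f U))"
      using filter_leD[OF inf_le1 ev1] filter_leD[OF inf_le2 ev2] by eventually_elim simp
    then show False using l(2) unfolding trivial_limit_def by (elim notE)
  qed
  with l(1) show ?thesis by (rule that)
qed

definition weak_lim :: "('i \<Rightarrow> 'a::cinner_space) \<Rightarrow> 'a \<Rightarrow> 'i filter \<Rightarrow> bool" where
  "weak_lim f l F \<longleftrightarrow> (\<forall>y. ((\<lambda>i. cinner (f i) y) \<longlongrightarrow> cinner l y) F)"

lemma weak_limD: "weak_lim f l F \<Longrightarrow> ((\<lambda>i. cinner (f i) y) \<longlongrightarrow> cinner l y) F"
  by (simp add: weak_lim_def)

lemma weak_lim_unique:
  assumes "weak_lim f l F" "weak_lim f l' F" "F \<noteq> bot"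
  shows "l = l'"
  using assms by (intro cinner_eqI[OF csubspace_UNIV])
    (auto simp: weak_lim_def intro: tendsto_unique)

lemma weak_lim_if_tendsto: "(f \<longlongrightarrow> l) F \<Longrightarrow> weak_lim f l F"
  by (auto simp: weak_lim_def intro!: tendsto_intros)

lemma weak_lim_cong:
  assumes "weak_lim f l F" "eventually (\<lambda>i. f i = g i) F"
  shows "weak_lim g l F"
  unfolding weak_lim_def
proof
  fix y
  show "((\<lambda>i. cinner (g i) y) \<longlongrightarrow> cinner l y) F"
    by (rule Lim_transform_eventually[OF weak_limD[OF assms(1)]])
      (use assms(2) in eventually_elim, simp)
qed

lemma weak_lim_add: "weak_lim f l F \<Longrightarrow> weak_lim g m F \<Longrightarrow> weak_lim (\<lambda>i. f i + g i) (l + m) F"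
  by (simp add: weak_lim_def cinner_add_left tendsto_add)

lemma weak_lim_norm_le:
  assumes "weak_lim f l F" "F \<noteq> bot" "eventually (\<lambda>i. norm (f i) \<le> C) F"
  shows "norm l \<le> C"
proof -
  have "cmod (cinner l l) \<le> C * norm l"
  proof (rule tendsto_upperbound[OF _ _ assms(2)])
    show "((\<lambda>i. cmod (cinner (f i) l)) \<longlongrightarrow> cmod (cinner l l)) F"
      by (intro tendsto_norm weak_limD assms)
    show "eventually (\<lambda>i. cmod (cinner (f i) l) \<le> C * norm l) F"
      using assms(3) by eventually_elim (rule order_trans[OF cinner_Cauchy_Schwarz], simp add: mult_right_mono)
  qed
  then have *: "norm l * norm l \<le> C * norm l"
    by (simp add: cinner_self power2_eq_square norm_mult)
  have "0 \<le> C"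
    using eventually_happens'[OF assms(2,3)] norm_ge_zero order_trans by blast
  then show ?thesis using * by (cases "l = 0") auto
qed

lemma riesz:
  fixes f :: "'a::{cinner_space, complete_space} \<Rightarrow> complex"
  assumes "\<And>x y. f (x + y) = f x + f y" "\<And>c x. f (c *\<^sub>C x) = c * f x" "\<And>x. cmod (f x) \<le> C * norm x"
  obtains u where "\<And>x. f x = cinner x u"
proof (rule riesz_on[of UNIV f C])
  show "closed_csubspace (UNIV :: 'a set)" by (simp add: closed_csubspace_def csubspace_UNIV)
qed (use assms in auto)

text \<open>Weak compactness of balls without subsequences: for each \<open>y\<close> the scalars
  \<open>cinner y (f i)\<close> stay in a closed disc and converge along \<open>U\<close>. The
  limits form a bounded functional, linear in \<open>y\<close> because \<open>y\<close> stands in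
  the first slot, and the Riesz vector is the weak limit.\<close>

lemma weak_lim_exists:
  fixes f :: "'i \<Rightarrow> 'a::{cinner_space, complete_space}"
  assumes U: "ultra U" and bdd: "eventually (\<lambda>i. norm (f i) \<le> C) U"
  obtains l where "weak_lim f l U"
proof -
  have nb: "U \<noteq> bot" using U by (simp add: ultra_def)
  have ex: "\<exists>b. ((\<lambda>i. cinner y (f i)) \<longlongrightarrow> b) U \<and> cmod b \<le> C * norm y" for y
  proof -
    have "eventually (\<lambda>i. cinner y (f i) \<in> cball 0 (C * norm y)) U"
      using bdd
    proof eventually_elim
      case (elim i)
      have "cmod (cinner y (f i)) \<le> norm y * norm (f i)" by (rule cinner_Cauchy_Schwarz)
      also have "\<dots> \<le> norm y * C" by (intro mult_left_mono elim) auto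
      finally show ?case by (simp add: mult.commute)
    qed
    then obtain b where "b \<in> cball 0 (C * norm y)" "((\<lambda>i. cinner y (f i)) \<longlongrightarrow> b) U"
      by (rule ultra_compact_lim[OF U compact_cball])
    then show ?thesis by auto
  qed
  then obtain \<phi> where lim: "\<And>y. ((\<lambda>i. cinner y (f i)) \<longlongrightarrow> \<phi> y) U" and bd: "\<And>y. cmod (\<phi> y) \<le> C * norm y"
    by metis
  have "\<phi> (x + y) = \<phi> x + \<phi> y" for x y
    using tendsto_add[OF lim[of x] lim[of y]] lim[of "x + y"] nb
    by (auto simp: cinner_add_left intro: tendsto_unique)
  moreover have "\<phi> (c *\<^sub>C x) = c * \<phi> x" for c x
    using tendsto_mult[OF tendsto_const[of c] lim[of x]] lim[of "c *\<^sub>C x"] nb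
    by (auto simp: cinner_scaleC_left intro: tendsto_unique)
  ultimately obtain u where u: "\<And>y. \<phi> y = cinner y u"
    using riesz[of \<phi> C] bd by metis
  have "weak_lim f u U"
    unfolding weak_lim_def
  proof
    fix y
    show "((\<lambda>i. cinner (f i) y) \<longlongrightarrow> cinner u y) U"
      using tendsto_cnj[OF lim[of y]] unfolding u cinner_commute[of "f _" y] cinner_commute[of u y] .
  qed
  then show ?thesis by (rule that)
qed

lemma adjoint_exists:
  fixes T :: "'a::{cinner_space, complete_space} \<Rightarrow> 'a"
  assumes "clinear_map T" "\<And>x. norm (T x) \<le> C * norm x"
  obtains u where "\<And>x. cinner (T x) y = cinner x u"
proof -
  have "cmod (cinner (T x) y) \<le> (C * norm y) * norm x" for x
    using mult_right_mono[OF assms(2)[of x] norm_ge_zero[of y]] cinner_Cauchy_Schwarz[of "T x" y] by (simp add: mult_ac)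
  then show ?thesis
    by (intro riesz[of "\<lambda>x. cinner (T x) y" "C * norm y", OF _ _ _ that])
      (simp_all add: clinear_map_add[OF assms(1)] clinear_map_scale[OF assms(1)] cinner_simps)
qed

lemma weak_lim_clinear:
  fixes T :: "'a::{cinner_space, complete_space} \<Rightarrow> 'a"
  assumes "clinear_map T" "\<And>x. norm (T x) \<le> C * norm x" "weak_lim f l F"
  shows "weak_lim (\<lambda>i. T (f i)) (T l) F"
  unfolding weak_lim_def
proof
  fix y
  obtain u where u: "\<And>x. cinner (T x) y = cinner x u" using adjoint_exists[OF assms(1,2)] by blast
  show "((\<lambda>i. cinner (T (f i)) y) \<longlongrightarrow> cinner (T l) y) F"
    unfolding u by (rule weak_limD[OF assms(3)])
qed

text \<open>In a compact set the ultrafilter has a norm limit, which can only be the weak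
  one.\<close>

lemma weak_lim_compact:
  assumes U: "ultra U" and "weak_lim f l U" "compact C" "eventually (\<lambda>i. f i \<in> C) U"
  shows "(f \<longlongrightarrow> l) U"
  using ultra_compact_lim[OF U assms(3,4)] weak_lim_unique[OF assms(2) weak_lim_if_tendsto] U
  by (metis ultra_def)

text \<open>The error \<open>K i (v i - x)\<close> is at most \<open>|v i - x|\<close> by uniform
  contractivity. This is the only kind of product whose limit is ever taken: weakly convergent
  operators on norm convergent vectors.\<close>

lemma weak_lim_contraction_seq:
  assumes "weak_lim (\<lambda>i. K i x) (k x) F" "(v \<longlongrightarrow> x) F"
    and K: "eventually (\<lambda>i. clinear_map (K i) \<and> (\<forall>x. norm (K i x) \<le> norm x)) F"
  shows "weak_lim (\<lambda>i. K i (v i)) (k x) F"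
  unfolding weak_lim_def
proof
  fix y
  have "((\<lambda>i. cinner (K i (v i)) y - cinner (K i x) y) \<longlongrightarrow> 0) F"
  proof (rule Lim_null_comparison)
    show "eventually (\<lambda>i. norm (cinner (K i (v i)) y - cinner (K i x) y) \<le> norm (v i - x) * norm y) F"
      using K
    proof eventually_elim
      case (elim i)
      have "norm (cinner (K i (v i)) y - cinner (K i x) y) = cmod (cinner (K i (v i - x)) y)"
        using elim clinear_map_diff[of "K i"] by (simp add: cinner_diff_left)
      also have "\<dots> \<le> norm (K i (v i - x)) * norm y" by (rule cinner_Cauchy_Schwarz)
      also have "\<dots> \<le> norm (v i - x) * norm y" using elim by (intro mult_right_mono) auto
      finally show ?case .
    qed
    have "((\<lambda>i. norm (v i - x)) \<longlongrightarrow> 0) F"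
      by (rule tendsto_norm_zero) (use assms(2) in \<open>simp add: LIM_zero\<close>)
    then show "((\<lambda>i. norm (v i - x) * norm y) \<longlongrightarrow> 0) F" by (rule tendsto_mult_left_zero)
  qed
  from tendsto_add[OF this weak_limD[OF assms(1), of y]]
  show "((\<lambda>i. cinner (K i (v i)) y) \<longlongrightarrow> cinner (k x) y) F" by simp
qed

text \<open>One ultrafilter serves all vectors at once, so the weak limits at the single vectors fit
  together to a linear contraction.\<close>

lemma contraction_weak_limit:
  fixes K :: "'i \<Rightarrow> 'a::{cinner_space, complete_space} \<Rightarrow> 'a"
  assumes U: "ultra U"
    and K: "eventually (\<lambda>i. clinear_map (K i) \<and> (\<forall>x. norm (K i x) \<le> norm x)) U"
  obtains k where "clinear_map k" "\<And>x. norm (k x) \<le> norm x" "\<And>x. weak_lim (\<lambda>i. K i x) (k x) U"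
proof -
  have nb: "U \<noteq> bot" using U by (simp add: ultra_def)
  have "\<exists>l. weak_lim (\<lambda>i. K i x) l U" for x
  proof -
    have "eventually (\<lambda>i. norm (K i x) \<le> norm x) U" using K by eventually_elim simp
    from weak_lim_exists[OF U this] show ?thesis by blast
  qed
  then obtain k where k: "\<And>x. weak_lim (\<lambda>i. K i x) (k x) U" by metis
  have 1: "clinear_map k"
  proof (rule clinear_mapI)
    fix x y
    have "eventually (\<lambda>i. K i x + K i y = K i (x + y)) U"
      using K
    proof eventually_elim
      case (elim i)
      then show ?case using clinear_map_add[of "K i" x y] by simp
    qed
    then have "weak_lim (\<lambda>i. K i (x + y)) (k x + k y) U"
      by (rule weak_lim_cong[OF weak_lim_add[OF k k]])
    then show "k (x + y) = k x + k y" by (rule weak_lim_unique[OF k _ nb])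
  next
    fix c x
    have "weak_lim (\<lambda>i. c *\<^sub>C K i x) (c *\<^sub>C k x) U"
      using k[of x] by (simp add: weak_lim_def cinner_scaleC_left tendsto_mult_left)
    moreover have "eventually (\<lambda>i. c *\<^sub>C K i x = K i (c *\<^sub>C x)) U"
      using K
    proof eventually_elim
      case (elim i)
      then show ?case using clinear_map_scale[of "K i" c x] by simp
    qed
    ultimately have "weak_lim (\<lambda>i. K i (c *\<^sub>C x)) (c *\<^sub>C k x) U"
      by (rule weak_lim_cong)
    then show "k (c *\<^sub>C x) = c *\<^sub>C k x" by (rule weak_lim_unique[OF k _ nb])
  qed
  have 2: "norm (k x) \<le> norm x" for x
    by (rule weak_lim_norm_le[OF k nb]) (use K in eventually_elim, simp)
  show ?thesis by (rule that[OF 1 2 k])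
qed

section \<open>Finite orthonormal sets and their orthogonal projections\<close>

definition orthonormal :: "'a::cinner_space set \<Rightarrow> bool" where
  "orthonormal E \<longleftrightarrow> finite E \<and> (\<forall>e\<in>E. \<forall>f\<in>E. cinner e f = (if e = f then 1 else 0))"

definition proj :: "'a::cinner_space set \<Rightarrow> 'a \<Rightarrow> 'a" where
  "proj E x = (\<Sum>e\<in>E. cinner x e *\<^sub>C e)"

lemma csubspace_span: "csubspace (cvs.span S)"
  by (simp add: csubspace_iff)

lemma clinear_proj: "clinear_map (proj E)"
  by (rule clinear_mapI)
    (simp_all add: proj_def cinner_simps scaleC_add_left sum.distrib cvs.scale_sum_right)

lemma proj_in_span: "proj E x \<in> cvs.span E"
  unfolding proj_def by (intro csubspace_sum[OF csubspace_span] csubspace_scale[OF csubspace_span] cvs.span_base)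

lemma proj_selfadjoint: "cinner (proj E x) y = cinner x (proj E y)"
proof -
  have "cinner x e * cinner e y = cnj (cinner y e) * cinner x e" for e
    using cinner_commute[of e y] by simp
  then show ?thesis
    by (simp only: proj_def cinner_sum_left cinner_sum_right cinner_scaleC_left cinner_scaleC_right)
qed

lemma proj_base:
  assumes "orthonormal E" "e \<in> E"
  shows "proj E e = e"
proof -
  have "proj E e = (\<Sum>f\<in>E. if f = e then e else 0)"
    unfolding proj_def using assms by (intro sum.cong) (auto simp: orthonormal_def scaleC_one)
  then show ?thesis using assms by (simp add: orthonormal_def)
qed

lemma proj_span:
  assumes "orthonormal E" "x \<in> cvs.span E"
  shows "proj E x = x"
  using assms(2)
proof (induction rule: cvs.span_induct_alt)
  case base
  then show ?case by (simp add: clinear_map_zero[OF clinear_proj])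
next
  case (step c e y)
  then show ?case
    by (simp add: clinear_map_add[OF clinear_proj] clinear_map_scale[OF clinear_proj] proj_base[OF assms(1)])
qed

lemma proj_idem: "orthonormal E \<Longrightarrow> proj E (proj E x) = proj E x"
  by (simp add: proj_span proj_in_span)

lemma selfadjoint_proj_norm_le:
  assumes "\<And>x y. cinner (P x) y = cinner x (P y)" "\<And>x. P (P x) = P (x::'a::cinner_space)"
  shows "norm (P x) \<le> norm x"
proof -
  have "(norm (P x))\<^sup>2 = Re (cinner x (P x))"
    by (metis Re_cinner_self assms)
  also have "\<dots> \<le> norm x * norm (P x)"
    using cinner_Cauchy_Schwarz[of x "P x"] complex_Re_le_cmod order_trans by blast
  finally show ?thesis by (cases "P x = 0") (auto simp: power2_eq_square)
qed

lemma norm_proj_le: "orthonormal E \<Longrightarrow> norm (proj E x) \<le> norm x"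
  by (rule selfadjoint_proj_norm_le) (auto simp: proj_selfadjoint proj_idem)

lemma norm_diff_proj_le: "orthonormal E \<Longrightarrow> norm (x - proj E x) \<le> norm x"
  by (rule selfadjoint_proj_norm_le[where P = "\<lambda>x. x - proj E x"])
    (auto simp: cinner_diff_left cinner_diff_right proj_selfadjoint clinear_map_diff[OF clinear_proj] proj_idem)

text \<open>The complementary projection annihilates \<open>z\<close>, so it may be applied to
  \<open>x - z\<close> instead of \<open>x\<close>.\<close>

lemma norm_diff_proj_le_dist:
  assumes "orthonormal E" "z \<in> cvs.span E"
  shows "norm (x - proj E x) \<le> norm (x - z)"
  using norm_diff_proj_le[OF assms(1), of "x - z"] proj_span[OF assms]
  by (simp add: clinear_map_diff[OF clinear_proj])

lemma bounded_linear_proj: "orthonormal E \<Longrightarrow> bounded_linear (proj E)"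
  by (rule bounded_linear_if_clinear[OF clinear_proj, of _ 1]) (simp add: norm_proj_le)

lemma gram_schmidt:
  fixes S :: "'a::cinner_space set"
  assumes "finite S"
  shows "\<exists>E. orthonormal E \<and> cvs.span E = cvs.span S"
  using assms
proof induction
  case empty
  show ?case by (auto simp: orthonormal_def intro!: exI[of _ "{}"])
next
  case (insert s S)
  then obtain E where E: "orthonormal E" "cvs.span E = cvs.span S" by blast
  define t where "t = s - proj E s"
  have ts: "cvs.span (insert t E) = cvs.span (insert s S)"
  proof -
    have "cvs.span (insert t E) = cvs.span (insert s E)"
    proof (rule cvs.span_eq[THEN iffD2], intro conjI subsetI)
      fix x assume "x \<in> insert t E"
      moreover have "t \<in> cvs.span (insert s E)"
        unfolding t_def using cvs.span_mono[of E "insert s E"] proj_in_span[of E s]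
        by (intro csubspace_diff[OF csubspace_span]) (auto intro: cvs.span_base)
      ultimately show "x \<in> cvs.span (insert s E)" by (auto intro: cvs.span_base)
    next
      fix x assume "x \<in> insert s E"
      moreover have "t + proj E s \<in> cvs.span (insert t E)"
        using cvs.span_mono[of E "insert t E"] proj_in_span[of E s]
        by (intro csubspace_add[OF csubspace_span]) (auto intro: cvs.span_base)
      ultimately show "x \<in> cvs.span (insert t E)" by (auto simp: t_def intro: cvs.span_base)
    qed
    also have "\<dots> = cvs.span (insert s S)" using E(2) by (simp add: cvs.span_insert)
    finally show ?thesis .
  qed
  have orth: "cinner t e = 0" "cinner e t = 0" if "e \<in> E" for e
  proof -
    show "cinner t e = 0" using that proj_base[OF E(1) that] by (simp add: t_def cinner_diff_left proj_selfadjoint)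
    then show "cinner e t = 0" by (metis cinner_commute complex_cnj_zero)
  qed
  show ?case
  proof (cases "t = 0")
    case True
    then have "cvs.span E = cvs.span (insert s S)" using ts cvs.span_insert_0 by metis
    then show ?thesis using E by blast
  next
    case False
    define u where "u = of_real (1 / norm t) *\<^sub>C t"
    have "norm u = 1" using False by (simp add: u_def norm_scaleC norm_divide)
    then have uu: "cinner u u = 1" by (simp add: cinner_self)
    have "u \<notin> E"
    proof
      assume "u \<in> E"
      then have "cinner u u = 0" using orth[of u] by (simp add: u_def cinner_simps)
      then show False using uu by simp
    qed
    then have "orthonormal (insert u E)"
      using E uu orth by (auto simp: orthonormal_def u_def cinner_simps)
    moreover have "cvs.span (insert u E) = cvs.span (insert t E)"
    proof (rule cvs.span_eq[THEN iffD2], intro conjI subsetI)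
      have "u \<in> cvs.span (insert t E)"
        unfolding u_def by (intro csubspace_scale[OF csubspace_span] cvs.span_base) simp
      then show "x \<in> cvs.span (insert t E)" if "x \<in> insert u E" for x
        using that by (auto intro: cvs.span_base)
    next
      have "of_real (norm t) *\<^sub>C u = t"
        using False by (simp add: u_def scaleC_scaleC scaleC_one flip: of_real_mult)
      then have "t \<in> cvs.span (insert u E)"
        by (metis csubspace_scale[OF csubspace_span] cvs.span_base insertI1)
      then show "x \<in> cvs.span (insert u E)" if "x \<in> insert t E" for x
        using that by (auto intro: cvs.span_base)
    qed
    ultimately show ?thesis using ts by blast
  qed
qed

text \<open>A chosen orthonormal basis of the span of \<open>X\<close>. It allows arbitrary finite
  sets as indices; these are directed by inclusion, which orthonormal sets are not.\<close>

definition onb :: "'a::cinner_space set \<Rightarrow> 'a set" where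
  "onb X = (SOME E. orthonormal E \<and> cvs.span E = cvs.span X)"

lemma onb:
  assumes "finite X"
  shows orthonormal_onb: "orthonormal (onb X)" and span_onb: "cvs.span (onb X) = cvs.span X"
  using someI_ex[OF gram_schmidt[OF assms]] by (simp_all add: onb_def)

text \<open>The ultrafilter refines the product of the filter of finite subsets of \<open>A\<close>
  with \<open>\<epsilon> \<rightarrow> 0\<close> from the right. The bound \<open>snd i < 1\<close>
  is kept for estimates uniform in the index.\<close>

lemma index_ultrafilter:
  fixes A :: "'a set"
  obtains U :: "('a set \<times> real) filter" where "ultra U"
    "\<And>x. x \<in> A \<Longrightarrow> eventually (\<lambda>i. x \<in> fst i) U"
    "eventually (\<lambda>i. finite (fst i) \<and> fst i \<subseteq> A) U"
    "eventually (\<lambda>i. 0 < snd i \<and> snd i < 1) U" "(snd \<longlongrightarrow> 0) U"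
proof -
  let ?F = "finite_subsets_at_top A \<times>\<^sub>F at_right (0::real)"
  have "?F \<noteq> bot" by (simp add: prod_filter_eq_bot)
  then obtain U where U: "U \<le> ?F" "ultra U" by (rule ultra_exists)
  have fst: "filterlim fst (finite_subsets_at_top A) U"
    by (rule filterlim_mono[OF filterlim_fst order_refl U(1)])
  have snd: "filterlim snd (at_right (0::real)) U"
    by (rule filterlim_mono[OF filterlim_snd order_refl U(1)])
  have lim: "(snd \<longlongrightarrow> 0) U" and pos: "eventually (\<lambda>i. 0 < snd i) U"
    using snd by (auto simp: filterlim_at elim: eventually_mono)
  have "eventually (\<lambda>i. x \<in> fst i) U" if "x \<in> A" for x
  proof -
    have "eventually (\<lambda>X. x \<in> X) (finite_subsets_at_top A)"
      unfolding eventually_finite_subsets_at_top using that by (intro exI[of _ "{x}"]) auto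
    then show ?thesis using fst by (rule eventually_compose_filterlim)
  qed
  moreover have "eventually (\<lambda>i. finite (fst i) \<and> fst i \<subseteq> A) U"
  proof -
    have "eventually (\<lambda>X. finite X \<and> X \<subseteq> A) (finite_subsets_at_top A)"
      unfolding eventually_finite_subsets_at_top by (intro exI[of _ "{}"]) auto
    then show ?thesis using fst by (rule eventually_compose_filterlim)
  qed
  moreover have "eventually (\<lambda>i. 0 < snd i \<and> snd i < 1) U"
    using pos order_tendstoD(2)[OF lim, of 1] by (simp add: eventually_conj)
  ultimately show ?thesis using that[OF U(2)] lim by blast
qed

text \<open>A finite-rank projection sees only finitely many scalar products, so weak convergence
  becomes norm convergence.\<close>

lemma weak_lim_proj:
  assumes "weak_lim f l F"
  shows "((\<lambda>i. proj E (f i)) \<longlongrightarrow> proj E l) F"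
  unfolding proj_def by (intro tendsto_sum tendsto_scaleC weak_limD[OF assms] tendsto_const)

section \<open>Invariant subspaces in finite dimension\<close>

text \<open>An upper bound for the dimension, phrased through independent sets: it is inherited by
  subsets at once, and inductions can run on the bound.\<close>

definition cdim_le :: "'a::cvec set \<Rightarrow> nat \<Rightarrow> bool" where
  "cdim_le V n \<longleftrightarrow> (\<forall>b\<subseteq>V. cvs.independent b \<longrightarrow> finite b \<and> card b \<le> n)"

lemma cdim_leD: "cdim_le V n \<Longrightarrow> b \<subseteq> V \<Longrightarrow> cvs.independent b \<Longrightarrow> finite b \<and> card b \<le> n"
  by (simp add: cdim_le_def)

lemma cdim_le_span:
  assumes "finite T" "V \<subseteq> cvs.span T"
  shows "cdim_le V (card T)"
  unfolding cdim_le_def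
proof (intro allI impI)
  fix b assume "b \<subseteq> V" "cvs.independent b"
  then show "finite b \<and> card b \<le> card T"
    using assms by (intro cvs.independent_span_bound) auto
qed

lemma cdim_le_onb:
  assumes V: "csubspace V" and n: "cdim_le V n"
  obtains E where "orthonormal E" "cvs.span E = V"
proof -
  obtain b where b: "b \<subseteq> V" "cvs.independent b" "V \<subseteq> cvs.span b"
    using cvs.maximal_independent_subset[of V] by metis
  then have "finite b" using n by (auto simp: cdim_le_def)
  then obtain E where "orthonormal E" "cvs.span E = cvs.span b" using gram_schmidt by blast
  moreover have "cvs.span b = V"
    using b V by (intro equalityI cvs.span_minimal) (auto simp: csubspace_iff)
  ultimately show ?thesis using that by auto
qed

lemma cdim_le_drop:
  assumes "cdim_le V (Suc n)" "csubspace W" "W \<subseteq> V" "e \<in> V" "e \<notin> W"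
  shows "cdim_le W n"
  unfolding cdim_le_def
proof (intro allI impI)
  fix b assume b: "b \<subseteq> W" "cvs.independent b"
  then have "cvs.span b \<subseteq> W" using assms(2) by (intro cvs.span_minimal) (auto simp: csubspace_iff)
  then have "cvs.independent (insert e b)" using b assms(5) by (auto simp: cvs.independent_insert)
  moreover have "insert e b \<subseteq> V" using b assms by auto
  ultimately have "finite (insert e b) \<and> card (insert e b) \<le> Suc n"
    by (intro cdim_leD[OF assms(1)])
  moreover have "e \<notin> b" using b assms by auto
  ultimately show "finite b \<and> card b \<le> n" by (auto simp: card_insert_if)
qed

lemma clinear_on_sum:
  assumes "clinear_on V T" "csubspace V" "\<And>i. i \<in> I \<Longrightarrow> f i \<in> V"
  shows "T (sum f I) = (\<Sum>i\<in>I. T (f i))"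
  using assms(3)
  by (induction I rule: infinite_finite_induct)
    (simp_all add: clinear_on_zero[OF assms(1,2)] clinear_on_add[OF assms(1,2)] csubspace_sum[OF assms(2)])

text \<open>The vector \<open>p(B) v\<close>, evaluated by Horner's scheme. A polynomial
  annihilating a single vector replaces the matrix theory of operators on a finite-dimensional
  subspace.\<close>

definition pact :: "('a::cvec \<Rightarrow> 'a) \<Rightarrow> complex poly \<Rightarrow> 'a \<Rightarrow> 'a" where
  "pact B p v = fold_coeffs (\<lambda>a w. a *\<^sub>C v + B w) p 0"

lemma pact_0 [simp]: "pact B 0 v = 0"
  by (simp add: pact_def)

lemma pact_pCons:
  assumes "B 0 = 0"
  shows "pact B (pCons a p) v = a *\<^sub>C v + B (pact B p v)"
  using assms by (cases "p = 0 \<and> a = 0") (auto simp: pact_def)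

context
  fixes V :: "'a::cvec set" and B :: "'a \<Rightarrow> 'a"
  assumes V: "csubspace V" and B: "clinear_on V B" "B ` V \<subseteq> V"
begin

lemma pact_in:
  assumes "v \<in> V"
  shows "pact B p v \<in> V"
proof (induction p)
  case 0
  show ?case by (simp add: csubspace_zero[OF V])
next
  case (pCons a p)
  then show ?case
    using assms B(2) by (auto simp: pact_pCons[of B, OF clinear_on_zero[OF B(1) V]] intro!: csubspace_add[OF V] csubspace_scale[OF V])
qed

lemma pact_add:
  assumes "v \<in> V"
  shows "pact B (p + q) v = pact B p v + pact B q v"
proof (induction p q rule: poly_induct2)
  case 0
  show ?case by simp
next
  case (pCons a p b q)
  then show ?case
    by (simp add: pact_pCons[of B, OF clinear_on_zero[OF B(1) V]] clinear_on_add[OF B(1) V] pact_in[OF assms]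
        scaleC_add_left)
qed

lemma pact_smult:
  assumes "v \<in> V"
  shows "pact B (Polynomial.smult c p) v = c *\<^sub>C pact B p v"
proof (induction p)
  case 0
  show ?case by simp
next
  case (pCons a p)
  then show ?case
    by (simp add: pact_pCons[of B, OF clinear_on_zero[OF B(1) V]] clinear_on_scale[OF B(1) V] pact_in[OF assms]
        scaleC_add_right)
qed

lemma pact_monom:
  assumes "v \<in> V"
  shows "pact B (Polynomial.monom c k) v = c *\<^sub>C (B ^^ k) v"
proof -
  have *: "pact B (Polynomial.monom 1 k) v = (B ^^ k) v"
    by (induction k)
      (simp_all add: Polynomial.monom_0 Polynomial.monom_Suc pact_pCons[of B, OF clinear_on_zero[OF B(1) V]] scaleC_one
        clinear_on_zero[OF B(1) V])
  show ?thesis using pact_smult[OF assms, of c "Polynomial.monom 1 k"] * by (simp add: Polynomial.smult_monom)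
qed

lemma pact_sum:
  assumes "v \<in> V"
  shows "pact B (sum f I) v = (\<Sum>i\<in>I. pact B (f i) v)"
  by (induction I rule: infinite_finite_induct) (simp_all add: pact_add[OF assms])

lemma funpow_in: "v \<in> V \<Longrightarrow> (B ^^ k) v \<in> V"
  using B(2) by (induction k) auto

text \<open>Among \<open>v, B v, ..., B^n v\<close> there is a linear relation. Dependence is a
  property of the set of these vectors, where repetitions disappear; a repetition
  \<open>B^j v = B^k v\<close> therefore gets its own polynomial, a difference of two
  monomials.\<close>

lemma annihilating_poly:
  assumes n: "cdim_le V n" and v: "v \<in> V"
  shows "\<exists>p. p \<noteq> 0 \<and> pact B p v = 0"
proof (cases "inj_on (\<lambda>k. (B ^^ k) v) {..n}")
  case True
  let ?S = "(\<lambda>k. (B ^^ k) v) ` {..n}"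
  have "card ?S = Suc n" using True by (simp add: card_image)
  moreover have "?S \<subseteq> V" using funpow_in[OF v] by auto
  ultimately have "cvs.dependent ?S" using cdim_leD[OF n, of ?S] by auto
  then obtain u where u: "\<exists>x\<in>?S. u x \<noteq> 0" "(\<Sum>x\<in>?S. u x *\<^sub>C x) = 0"
    by (subst (asm) cvs.dependent_finite) auto
  define p where "p = (\<Sum>k\<le>n. Polynomial.monom (u ((B ^^ k) v)) k)"
  have "pact B p v = (\<Sum>k\<le>n. u ((B ^^ k) v) *\<^sub>C (B ^^ k) v)"
    by (simp add: p_def pact_sum[OF v] pact_monom[OF v])
  also have "\<dots> = 0" using u(2) True by (simp add: sum.reindex)
  finally have "pact B p v = 0" .
  moreover have "p \<noteq> 0"
  proof -
    obtain k where k: "k \<le> n" "u ((B ^^ k) v) \<noteq> 0" using u(1) by auto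
    then have "coeff p k \<noteq> 0" by (simp add: p_def coeff_sum)
    then show ?thesis by auto
  qed
  ultimately show ?thesis by blast
next
  case False
  then obtain j k where jk: "j \<noteq> k" "(B ^^ j) v = (B ^^ k) v" by (auto simp: inj_on_def)
  have "pact B (Polynomial.monom 1 j + Polynomial.monom (-1) k) v = 0"
    using jk by (simp add: pact_add[OF v] pact_monom[OF v])
  moreover have "coeff (Polynomial.monom 1 j + Polynomial.monom (-1) k) j = (1::complex)" using jk by simp
  then have "Polynomial.monom 1 j + Polynomial.monom (-1) k \<noteq> (0::complex poly)" by (metis coeff_0 zero_neq_one)
  ultimately show ?thesis by blast
qed

lemma minimal_annihilating_poly:
  assumes "cdim_le V n" "v \<in> V"
  obtains p where "p \<noteq> 0" "pact B p v = 0" "\<And>q. q \<noteq> 0 \<Longrightarrow> degree q < degree p \<Longrightarrow> pact B q v \<noteq> 0"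
  using exists_least_iff[of "\<lambda>d. \<exists>p. p \<noteq> 0 \<and> pact B p v = 0 \<and> degree p = d"] annihilating_poly[OF assms]
  by metis

text \<open>Take an annihilating polynomial of \<open>v\<close> of least degree and write it as
  \<open>a + X q\<close>. If \<open>a = 0\<close>, injectivity gives \<open>q(B) v = 0\<close>
  against minimality. Hence \<open>a\<close> can be divided out and \<open>v\<close> is the image of
  \<open>- q(B) v / a\<close>.\<close>

lemma inj_imp_surj_on:
  assumes n: "cdim_le V n" and inj: "\<And>x. x \<in> V \<Longrightarrow> B x = 0 \<Longrightarrow> x = 0" and v: "v \<in> V"
  obtains w where "w \<in> V" "B w = v"
proof -
  obtain p where p: "p \<noteq> 0" "pact B p v = 0" "\<And>q. q \<noteq> 0 \<Longrightarrow> degree q < degree p \<Longrightarrow> pact B q v \<noteq> 0"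
    using minimal_annihilating_poly[OF n v] by blast
  obtain a q where pq: "p = pCons a q" by (cases p)
  have eq: "a *\<^sub>C v + B (pact B q v) = 0"
    using p(2) by (simp add: pq pact_pCons[of B, OF clinear_on_zero[OF B(1) V]])
  have "a \<noteq> 0"
  proof
    assume "a = 0"
    then have "q \<noteq> 0" "pact B q v = 0"
      using p(1) pq eq inj[OF pact_in[OF v]] by auto
    then show False using p(3)[of q] pq by simp
  qed
  have "B ((- 1 / a) *\<^sub>C pact B q v) = (- 1 / a) *\<^sub>C B (pact B q v)"
    by (rule clinear_on_scale[OF B(1) V pact_in[OF v]])
  also have "B (pact B q v) = (- a) *\<^sub>C v"
    using eq by (simp add: add_eq_0_iff)
  also have "(- 1 / a) *\<^sub>C (- a) *\<^sub>C v = v" using \<open>a \<noteq> 0\<close> by (simp add: scaleC_one)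
  finally show ?thesis using that csubspace_scale[OF V pact_in[OF v]] by blast
qed

text \<open>Split a root off a minimal annihilating polynomial, \<open>p = (X - z) q\<close>. By
  minimality \<open>q(B) v\<close> is nonzero, and it is annihilated by
  \<open>B - z\<close>.\<close>

lemma eigenvalue_exists:
  assumes n: "cdim_le V n" and v: "v \<in> V" "v \<noteq> 0"
  obtains l e where "e \<in> V" "e \<noteq> 0" "B e = l *\<^sub>C e"
proof -
  obtain p where p: "p \<noteq> 0" "pact B p v = 0" "\<And>q. q \<noteq> 0 \<Longrightarrow> degree q < degree p \<Longrightarrow> pact B q v \<noteq> 0"
    using minimal_annihilating_poly[OF n v(1)] by blast
  note pc = pact_pCons[of B, OF clinear_on_zero[OF B(1) V]]
  have "degree p \<noteq> 0"
  proof
    assume "degree p = 0"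
    then obtain a where "p = [:a:]" by (rule degree_eq_zeroE)
    then show False using p(1,2) v(2) by (simp add: pc clinear_on_zero[OF B(1) V])
  qed
  then have "\<not> (\<exists>a l. a \<noteq> 0 \<and> l = 0 \<and> p = pCons a l)" by auto
  from fundamental_theorem_of_algebra_alt[OF this] obtain z where "poly p z = 0" by blast
  then obtain q where q: "p = [:-z, 1:] * q" using poly_eq_0_iff_dvd by (metis dvdE)
  then have "p = Polynomial.smult (- z) q + pCons 0 q" by simp
  then have "(- z) *\<^sub>C pact B q v + B (pact B q v) = 0"
    using p(2) by (simp only: pact_add[OF v(1)] pact_smult[OF v(1)] pc) simp
  then have eig: "B (pact B q v) = z *\<^sub>C pact B q v" by (simp add: add_eq_0_iff)
  have "q \<noteq> 0" using q p(1) by auto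
  moreover have "degree q < degree p"
    using \<open>q \<noteq> 0\<close> q by (simp add: degree_mult_eq del: mult_pCons_left)
  ultimately have "pact B q v \<noteq> 0" using p(3) by blast
  then show ?thesis using that eig pact_in[OF v(1)] by blast
qed

end

text \<open>In finite dimension the adjoint of a singular operator is singular: an injective adjoint
  \<open>C'\<close> would be onto, and \<open>e = C' f\<close> gives
  \<open>(e,e) = (C e, f) = 0\<close>. It supplies left eigenvectors.\<close>

lemma adjoint_kernel:
  fixes V :: "'a::cinner_space set"
  assumes V: "csubspace V" and n: "cdim_le V n" and C: "clinear_on V C" "C ` V \<subseteq> V"
    and e: "e \<in> V" "e \<noteq> 0" "C e = 0"
  obtains f where "f \<in> V" "f \<noteq> 0" "\<And>u. u \<in> V \<Longrightarrow> cinner (C u) f = 0"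
proof -
  obtain E where E: "orthonormal E" "cvs.span E = V" by (rule cdim_le_onb[OF V n])
  have EV: "E \<subseteq> V" using E(2) cvs.span_superset by blast
  define C' where "C' f = (\<Sum>x\<in>E. cinner f (C x) *\<^sub>C x)" for f
  have adj: "cinner (C u) f = cinner u (C' f)" if "u \<in> V" for u f
  proof -
    have "u = (\<Sum>x\<in>E. cinner u x *\<^sub>C x)" using proj_span[of E u] E that by (simp add: proj_def)
    then have "C u = C (\<Sum>x\<in>E. cinner u x *\<^sub>C x)" by simp
    also have "\<dots> = (\<Sum>x\<in>E. C (cinner u x *\<^sub>C x))"
      by (rule clinear_on_sum[OF C(1) V]) (use EV in \<open>auto intro: csubspace_scale[OF V]\<close>)
    also have "\<dots> = (\<Sum>x\<in>E. cinner u x *\<^sub>C C x)"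
      using EV by (intro sum.cong refl clinear_on_scale[OF C(1) V]) auto
    finally have "cinner (C u) f = (\<Sum>x\<in>E. cinner u x * cinner (C x) f)"
      by (simp only: cinner_sum_left cinner_scaleC_left)
    also have "\<dots> = (\<Sum>x\<in>E. cnj (cinner f (C x)) * cinner u x)"
      by (intro sum.cong refl) (metis cinner_commute mult.commute)
    also have "\<dots> = cinner u (C' f)"
      by (simp only: C'_def cinner_sum_right cinner_scaleC_right)
    finally show ?thesis .
  qed
  have lin: "clinear_on V C'"
    unfolding clinear_on_def C'_def
    by (simp add: cinner_simps scaleC_add_left sum.distrib cvs.scale_sum_right)
  have im: "C' ` V \<subseteq> V"
    unfolding C'_def using EV by (auto intro!: csubspace_sum[OF V] csubspace_scale[OF V])
  have "\<exists>f\<in>V. f \<noteq> 0 \<and> C' f = 0"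
  proof (rule ccontr)
    assume "\<not> ?thesis"
    then have inj: "x = 0" if "x \<in> V" "C' x = 0" for x using that by blast
    obtain f where "C' f = e" by (rule inj_imp_surj_on[OF V lin im n inj e(1)])
    then have "cinner e e = 0" using adj[OF e(1), of f] e(3) by simp
    then show False using e(2) by (simp add: cinner_eq_zero_iff)
  qed
  then obtain f where "f \<in> V" "f \<noteq> 0" "C' f = 0" by blast
  then show ?thesis using that adj by simp
qed

lemma csubspace_line_plus:
  assumes "csubspace L"
  shows "csubspace {c *\<^sub>C e + l | c l. l \<in> L}"
  unfolding csubspace_def
proof (intro conjI ballI allI)
  show "0 \<in> {c *\<^sub>C e + l | c l. l \<in> L}"
    using csubspace_zero[OF assms] by (auto intro!: exI[of _ 0])
next
  fix x y assume "x \<in> {c *\<^sub>C e + l | c l. l \<in> L}" "y \<in> {c *\<^sub>C e + l | c l. l \<in> L}"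
  then obtain c l d m where "x = c *\<^sub>C e + l" "y = d *\<^sub>C e + m" "l \<in> L" "m \<in> L" by blast
  then have "x + y = (c + d) *\<^sub>C e + (l + m)" "l + m \<in> L"
    using csubspace_add[OF assms] by (auto simp: scaleC_add_left)
  then show "x + y \<in> {c *\<^sub>C e + l | c l. l \<in> L}" by blast
next
  fix a x assume "x \<in> {c *\<^sub>C e + l | c l. l \<in> L}"
  then obtain c l where "x = c *\<^sub>C e + l" "l \<in> L" by blast
  then have "a *\<^sub>C x = (a * c) *\<^sub>C e + a *\<^sub>C l" "a *\<^sub>C l \<in> L"
    using csubspace_scale[OF assms] by (auto simp: scaleC_add_right)
  then show "a *\<^sub>C x \<in> {c *\<^sub>C e + l | c l. l \<in> L}" by blast
qed

text \<open>Induction on the dimension: an eigenvector \<open>e\<close> with eigenvalue in the left half-plane is \<open>J\<close>-positive and is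
  added to \<open>L\<close>; otherwise an eigenvector of the \<open>J\<close>-adjoint is \<open>J\<close>-negative and is added to the
  complement \<open>N\<close>, its \<open>J\<close>-orthogonal complement being invariant.\<close>

lemma finite_pontryagin:
  fixes J :: "'a::cinner_space \<Rightarrow> 'a"
  assumes J: "clinear_map J" "\<And>x y. cinner (J x) y = cinner x (J y)"
    and "csubspace V" "cdim_le V n" "clinear_on V B" "B ` V \<subseteq> V"
    and "\<And>z. z \<in> V \<Longrightarrow> z \<noteq> 0 \<Longrightarrow> Re (cinner (J (B z)) z) < 0"
  shows "\<exists>L N. csubspace L \<and> L \<subseteq> V \<and> B ` L \<subseteq> L \<and> (\<forall>z\<in>L. 0 \<le> Re (cinner (J z) z))
    \<and> csubspace N \<and> N \<subseteq> V \<and> (\<forall>z\<in>N. Re (cinner (J z) z) \<le> 0) \<and> (\<forall>v\<in>V. \<exists>l\<in>L. \<exists>m\<in>N. v = l + m)"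
  using assms(3-)
proof (induction n arbitrary: V B)
  case 0
  have "V = {0}"
  proof -
    have "v = 0" if "v \<in> V" for v
    proof (rule ccontr)
      assume "v \<noteq> 0"
      then have "cvs.independent {v}" by (simp add: cvs.dependent_single)
      then show False using that cdim_leD[OF 0(2), of "{v}"] by simp
    qed
    then show ?thesis using csubspace_zero[OF 0(1)] by auto
  qed
  then show ?case
    using clinear_on_zero[OF 0(3,1)] 0(1) by (intro exI[of _ "{0}"]) auto
next
  case (Suc n)
  note V = Suc.prems(1) and n = Suc.prems(2) and B = Suc.prems(3,4) and diss = Suc.prems(5)
  define h where "h x y = cinner (J x) y" for x y
  have h_commute: "h x y = cnj (h y x)" for x y
    unfolding h_def using cinner_commute J(2) by metis
  have h_real: "h x x = of_real (Re (h x x))" for x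
    using h_commute[of x x] by (metis Reals_cnj_iff of_real_Re)
  have h_simps: "h (x + y) z = h x z + h y z" "h (c *\<^sub>C x) z = c * h x z" "h (x - y) z = h x z - h y z"
    "h z (x + y) = h z x + h z y" "h z (c *\<^sub>C x) = cnj c * h z x" for x y z c
    by (simp_all add: h_def clinear_map_add[OF J(1)] clinear_map_scale[OF J(1)] clinear_map_diff[OF J(1)] cinner_simps)
  have dissh: "Re (h (B z) z) < 0" if "z \<in> V" "z \<noteq> 0" for z using diss that by (simp add: h_def)
  have sub: "csubspace {w \<in> V. h w g = 0}" for g
    unfolding csubspace_def using V h_simps(2)[of 0 0 g]
    by (auto simp: h_simps csubspace_zero[OF V] csubspace_add[OF V] csubspace_scale[OF V])
  have Re_h_scale: "Re (l * h x x) = Re l * Re (h x x)" for l x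
    by (subst h_real) simp
  have line: "Re (h (c *\<^sub>C e + l) (c *\<^sub>C e + l)) = (cmod c)\<^sup>2 * Re (h e e) + Re (h l l)" if "h l e = 0" for c e l
  proof -
    have "h e l = 0" using h_commute[of e l] that by simp
    then have "h (c *\<^sub>C e + l) (c *\<^sub>C e + l) = (c * cnj c) * h e e + h l l"
      using that by (simp add: h_simps)
    then show ?thesis by (simp only: complex_norm_square[symmetric] plus_complex.sel Re_h_scale Re_complex_of_real)
  qed
  show ?case
  proof (cases "V = {0}")
    case True
    then show ?thesis using clinear_on_zero[OF B(1) V] V by (intro exI[of _ "{0}"]) auto
  next
    case False
    then obtain v where v: "v \<in> V" "v \<noteq> 0" using csubspace_zero[OF V] by blast
    obtain l e where e: "e \<in> V" "e \<noteq> 0" "B e = l *\<^sub>C e" by (rule eigenvalue_exists[OF V B n v])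
    \<comment> \<open>Dissipativity at an eigenvector: \<open>h e e\<close> is nonzero and its sign
      is opposite to that of the real part of the eigenvalue.\<close>
    have le: "Re l * Re (h e e) < 0" using dissh[OF e(1,2)] by (simp only: e(3) h_simps Re_h_scale)
    show ?thesis
    proof (cases "Re l < 0")
      case True
      define a where "a = Re (h e e)"
      have a: "a > 0" "h e e = of_real a" using le True h_real[of e] by (auto simp: a_def mult_less_0_iff)
      define V' where "V' = {w \<in> V. h w e = 0}"
      \<comment> \<open>\<open>V'\<close> need not be invariant under \<open>B\<close>, so the
        component along \<open>e\<close> is removed. On \<open>V'\<close> this leaves
        \<open>h (B w) w\<close> unchanged because \<open>h e w = 0\<close>.\<close>
      define B' where "B' w = B w - (h (B w) e / a) *\<^sub>C e" for w
      have V': "csubspace V'" "V' \<subseteq> V" "e \<notin> V'" using sub a by (auto simp: V'_def)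
      have B'h: "h (B' w) w = h (B w) w" if "w \<in> V'" for w
        using that h_commute[of e w] by (simp add: B'_def V'_def h_simps)
      have "\<exists>L N. csubspace L \<and> L \<subseteq> V' \<and> B' ` L \<subseteq> L \<and> (\<forall>z\<in>L. 0 \<le> Re (cinner (J z) z))
        \<and> csubspace N \<and> N \<subseteq> V' \<and> (\<forall>z\<in>N. Re (cinner (J z) z) \<le> 0) \<and> (\<forall>v\<in>V'. \<exists>l\<in>L. \<exists>m\<in>N. v = l + m)"
      proof (rule Suc.IH)
        show "csubspace V'" by fact
        show "cdim_le V' n" by (rule cdim_le_drop[OF n V'(1,2) e(1) V'(3)])
        show "clinear_on V' B'"
          unfolding clinear_on_def B'_def using V'(2)
          by (auto simp: clinear_on_add[OF B(1) V] clinear_on_scale[OF B(1) V] subset_iff h_simps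
              add_divide_distrib scaleC_add_left cvs.scale_right_diff_distrib)
        show "B' ` V' \<subseteq> V'"
          using V' B(2) e a
          by (auto simp: V'_def B'_def h_simps intro!: csubspace_diff[OF V] csubspace_scale[OF V])
        show "Re (cinner (J (B' z)) z) < 0" if "z \<in> V'" "z \<noteq> 0" for z
          using dissh[of z] B'h[OF that(1)] that V'(2) by (auto simp: h_def)
      qed
      then obtain L N where L: "csubspace L" "L \<subseteq> V'" "B' ` L \<subseteq> L" "\<forall>z\<in>L. 0 \<le> Re (h z z)"
        and N: "csubspace N" "N \<subseteq> V'" "\<forall>z\<in>N. Re (h z z) \<le> 0" and dec: "\<forall>v\<in>V'. \<exists>l\<in>L. \<exists>m\<in>N. v = l + m"
        unfolding h_def by (elim exE conjE)
      let ?L = "{c *\<^sub>C e + l | c l. l \<in> L}"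
      have "csubspace ?L" by (rule csubspace_line_plus[OF L(1)])
      moreover have "?L \<subseteq> V" using L(2) V'(2) e(1) by (auto intro!: csubspace_add[OF V] csubspace_scale[OF V])
      moreover have "B ` ?L \<subseteq> ?L"
      proof (rule image_subsetI)
        fix z assume "z \<in> ?L"
        then obtain c x where z: "z = c *\<^sub>C e + x" "x \<in> L" by blast
        then have "B z = (c * l + h (B x) e / a) *\<^sub>C e + B' x"
          using L(2) V'(2) e clinear_on_add[OF B(1) V, of "c *\<^sub>C e" x] clinear_on_scale[OF B(1) V, of e c]
          by (auto simp: csubspace_scale[OF V] B'_def scaleC_add_left)
        then show "B z \<in> ?L" using L(3) z(2) by blast
      qed
      moreover have "\<forall>z\<in>?L. 0 \<le> Re (h z z)"
        using L(2,4) a line by (auto simp: V'_def subset_iff)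
      moreover have "\<exists>x\<in>?L. \<exists>m\<in>N. v = x + m" if "v \<in> V" for v
      proof -
        have "v - (h v e / a) *\<^sub>C e \<in> V'"
          using that e a by (auto simp: V'_def h_simps intro!: csubspace_diff[OF V] csubspace_scale[OF V])
        then obtain x m where "x \<in> L" "m \<in> N" "v - (h v e / a) *\<^sub>C e = x + m" using dec by blast
        then have "v = ((h v e / a) *\<^sub>C e + x) + m" by (simp add: algebra_simps)
        then show ?thesis using \<open>x \<in> L\<close> \<open>m \<in> N\<close> by blast
      qed
      ultimately show ?thesis using N V'(2) unfolding h_def by (intro exI[of _ ?L] exI[of _ N]) auto
    next
      case False
      then have l: "Re l > 0" using le by (metis less_eq_real_def linorder_neqE_linordered_idom mult_zero_left less_irrefl)
      obtain E where E: "orthonormal E" "cvs.span E = V" by (rule cdim_le_onb[OF V n])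
      \<comment> \<open>\<open>J\<close> may lead out of \<open>V\<close>, hence the projection back
        to \<open>V\<close>. A vector \<open>f\<close> orthogonal to the range of \<open>C\<close>
        satisfies \<open>h (B u) f = l * h u f\<close>, which makes its \<open>J\<close>-orthogonal
        complement invariant.\<close>
      define C where "C u = proj E (J (B u - l *\<^sub>C u))" for u
      have "clinear_on V C"
        unfolding clinear_on_def C_def
        by (auto simp: clinear_on_add[OF B(1) V] clinear_on_scale[OF B(1) V] clinear_map_diff[OF clinear_proj]
            clinear_map_add[OF clinear_proj] clinear_map_scale[OF clinear_proj] clinear_map_diff[OF J(1)]
            clinear_map_add[OF J(1)] clinear_map_scale[OF J(1)] scaleC_add_right cvs.scale_right_diff_distrib mult.commute)
      moreover have "C ` V \<subseteq> V" using proj_in_span E(2) by (auto simp: C_def)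
      moreover have "C e = 0" by (simp add: C_def e(3) clinear_map_zero[OF J(1)] clinear_map_zero[OF clinear_proj])
      ultimately obtain f where f: "f \<in> V" "f \<noteq> 0" and Cf: "\<And>u. u \<in> V \<Longrightarrow> cinner (C u) f = 0"
        using adjoint_kernel[OF V n _ _ e(1,2), of C] by blast
      have hf: "h (B u) f = l * h u f" if "u \<in> V" for u
      proof -
        have "h (B u - l *\<^sub>C u) f = cinner (J (B u - l *\<^sub>C u)) (proj E f)"
          using proj_span[of E f] E f(1) by (simp add: h_def)
        also have "\<dots> = 0" using Cf[OF that] by (simp add: C_def proj_selfadjoint)
        finally show ?thesis by (simp add: h_simps)
      qed
      define a where "a = Re (h f f)"
      \<comment> \<open>The left eigenvector relation is tested on \<open>u = f\<close> itself,
        where dissipativity fixes the sign of \<open>h f f\<close>.\<close>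
      have "Re l * a < 0" using dissh[OF f] by (simp only: hf[OF f(1)] Re_h_scale a_def)
      then have a: "a < 0" "h f f = of_real a" using l h_real[of f] by (auto simp: a_def mult_less_0_iff)
      define V' where "V' = {w \<in> V. h w f = 0}"
      have V': "csubspace V'" "V' \<subseteq> V" "f \<notin> V'" using sub a by (auto simp: V'_def)
      have "\<exists>L N. csubspace L \<and> L \<subseteq> V' \<and> B ` L \<subseteq> L \<and> (\<forall>z\<in>L. 0 \<le> Re (cinner (J z) z))
        \<and> csubspace N \<and> N \<subseteq> V' \<and> (\<forall>z\<in>N. Re (cinner (J z) z) \<le> 0) \<and> (\<forall>v\<in>V'. \<exists>l\<in>L. \<exists>m\<in>N. v = l + m)"
      proof (rule Suc.IH)
        show "csubspace V'" by fact
        show "cdim_le V' n" by (rule cdim_le_drop[OF n V'(1,2) f(1) V'(3)])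
        show "clinear_on V' B" using B(1) V'(2) unfolding clinear_on_def by blast
        show "B ` V' \<subseteq> V'" using B(2) hf by (auto simp: V'_def)
        show "Re (cinner (J (B z)) z) < 0" if "z \<in> V'" "z \<noteq> 0" for z
          using diss that V'(2) by auto
      qed
      then obtain L N where L: "csubspace L" "L \<subseteq> V'" "B ` L \<subseteq> L" "\<forall>z\<in>L. 0 \<le> Re (h z z)"
        and N: "csubspace N" "N \<subseteq> V'" "\<forall>z\<in>N. Re (h z z) \<le> 0" and dec: "\<forall>v\<in>V'. \<exists>l\<in>L. \<exists>m\<in>N. v = l + m"
        unfolding h_def by (elim exE conjE)
      let ?N = "{c *\<^sub>C f + m | c m. m \<in> N}"
      have "csubspace ?N" by (rule csubspace_line_plus[OF N(1)])
      moreover have "?N \<subseteq> V" using N(2) V'(2) f(1) by (auto intro!: csubspace_add[OF V] csubspace_scale[OF V])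
      moreover have "\<forall>z\<in>?N. Re (h z z) \<le> 0"
      proof
        fix z assume "z \<in> ?N"
        then obtain c m where z: "z = c *\<^sub>C f + m" "m \<in> N" by blast
        have "(cmod c)\<^sup>2 * a \<le> 0" using a by (simp add: mult_nonneg_nonpos)
        then show "Re (h z z) \<le> 0" using z N(2,3) line[of m f c] by (force simp: V'_def a_def)
      qed
      moreover have "\<exists>x\<in>L. \<exists>m\<in>?N. v = x + m" if "v \<in> V" for v
      proof -
        have "v - (h v f / a) *\<^sub>C f \<in> V'"
          using that f a by (auto simp: V'_def h_simps intro!: csubspace_diff[OF V] csubspace_scale[OF V])
        then obtain x m where "x \<in> L" "m \<in> N" "v - (h v f / a) *\<^sub>C f = x + m" using dec by blast
        then have "v = x + ((h v f / a) *\<^sub>C f + m)" by (simp add: algebra_simps)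
        then show ?thesis using \<open>x \<in> L\<close> \<open>m \<in> N\<close> by blast
      qed
      ultimately show ?thesis using L V'(2) unfolding h_def by (intro exI[of _ L] exI[of _ ?N]) auto
    qed
  qed
qed

section \<open>Pontryagin spaces: bounded operators\<close>

locale krein =
  fixes Pp Pm :: "'a::{cinner_space, complete_space} \<Rightarrow> 'a"
  assumes proj_p: "orth_proj Pp" and proj_m: "orth_proj Pm" and compl: "\<forall>x. Pp x + Pm x = x"
begin

definition J :: "'a \<Rightarrow> 'a" where "J x = Pp x - Pm x"

lemma clinear_Pp: "clinear_map Pp" and clinear_Pm: "clinear_map Pm"
  and Pp_Pp [simp]: "Pp (Pp x) = Pp x" and Pm_Pm [simp]: "Pm (Pm x) = Pm x"
  and Pp_sa: "cinner (Pp x) y = cinner x (Pp y)" and Pm_sa: "cinner (Pm x) y = cinner x (Pm y)"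
  using proj_p proj_m by (simp_all add: orth_proj_def)

lemma Pp_simps: "Pp (x + y) = Pp x + Pp y" "Pp (x - y) = Pp x - Pp y" "Pp (c *\<^sub>C x) = c *\<^sub>C Pp x"
  "Pp (- x) = - Pp x" "Pp 0 = 0" "Pp (r *\<^sub>R x) = r *\<^sub>R Pp x"
  by (simp_all add: clinear_mapD[OF clinear_Pp])

lemma Pm_simps: "Pm (x + y) = Pm x + Pm y" "Pm (x - y) = Pm x - Pm y" "Pm (c *\<^sub>C x) = c *\<^sub>C Pm x"
  "Pm (- x) = - Pm x" "Pm 0 = 0" "Pm (r *\<^sub>R x) = r *\<^sub>R Pm x"
  by (simp_all add: clinear_mapD[OF clinear_Pm])

lemma Pp_Pm_add: "Pp x + Pm x = x" using compl by blast

lemma Pp_Pm [simp]: "Pp (Pm x) = 0" and Pm_Pp [simp]: "Pm (Pp x) = 0"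
proof -
  show "Pp (Pm x) = 0" using Pp_Pm_add[of "Pm x"] by simp
  show "Pm (Pp x) = 0" using Pp_Pm_add[of "Pp x"] by simp
qed

lemma in_range_Pp: "x \<in> range Pp \<longleftrightarrow> Pp x = x" and in_range_Pm: "x \<in> range Pm \<longleftrightarrow> Pm x = x"
  by (metis Pp_Pp rangeE rangeI, metis Pm_Pm rangeE rangeI)

lemma Pm_range_Pp: "Pp x = x \<Longrightarrow> Pm x = 0" and Pp_range_Pm: "Pm x = x \<Longrightarrow> Pp x = 0"
  by (metis Pm_Pp, metis Pp_Pm)

lemma csubspace_range_Pp: "csubspace (range Pp)" and csubspace_range_Pm: "csubspace (range Pm)"
  unfolding csubspace_def in_range_Pp in_range_Pm Ball_def by (auto simp: Pp_simps Pm_simps)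

lemma norm_Pp_le: "norm (Pp x) \<le> norm x" and norm_Pm_le: "norm (Pm x) \<le> norm x"
  by (rule selfadjoint_proj_norm_le; simp add: Pp_sa Pm_sa)+

lemma bounded_linear_Pp: "bounded_linear Pp" and bounded_linear_Pm: "bounded_linear Pm"
  by (rule bounded_linear_if_clinear[OF clinear_Pp, of 1]; simp add: norm_Pp_le)
    (rule bounded_linear_if_clinear[OF clinear_Pm, of 1]; simp add: norm_Pm_le)

lemmas tendsto_Pp = bounded_linear.tendsto[OF bounded_linear_Pp]
lemmas tendsto_Pm = bounded_linear.tendsto[OF bounded_linear_Pm]

lemma cinner_Pp_Pm: "cinner (Pp x) (Pm y) = 0"
  by (simp add: Pp_sa)

lemma norm_sq_split: "(norm x)\<^sup>2 = (norm (Pp x))\<^sup>2 + (norm (Pm x))\<^sup>2"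
  using norm_add_sq[of "Pp x" "Pm x"] by (simp add: Pp_Pm_add cinner_Pp_Pm)

lemma clinear_J: "clinear_map J"
  by (rule clinear_mapI) (simp_all add: J_def Pp_simps Pm_simps scaleC_add_right cvs.scale_right_diff_distrib)

lemma J_simps: "J (x + y) = J x + J y" "J (x - y) = J x - J y" "J (c *\<^sub>C x) = c *\<^sub>C J x"
  "J (- x) = - J x" "J 0 = 0"
  by (simp_all add: clinear_mapD[OF clinear_J])

lemma J_sa: "cinner (J x) y = cinner x (J y)"
  by (simp add: J_def cinner_simps Pp_sa Pm_sa)

lemma J_J [simp]: "J (J x) = x"
  by (simp add: J_def Pp_simps Pm_simps Pp_Pm_add)

lemma Pp_J [simp]: "Pp (J x) = Pp x" and Pm_J [simp]: "Pm (J x) = - Pm x"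
  by (simp_all add: J_def Pp_simps Pm_simps)

lemma norm_J [simp]: "norm (J x) = norm x"
proof -
  have "(norm (J x))\<^sup>2 = (norm x)\<^sup>2" using norm_sq_split[of "J x"] norm_sq_split[of x] by simp
  then show ?thesis by simp
qed

lemma bounded_linear_J: "bounded_linear J"
  by (rule bounded_linear_if_clinear[OF clinear_J, of 1]) simp

lemma Re_J: "Re (cinner (J x) x) = (norm (Pp x))\<^sup>2 - (norm (Pm x))\<^sup>2"
proof -
  have "cinner (J x) x = cinner (Pp x) (Pp x) - cinner (Pm x) (Pm x)"
    by (simp add: J_def cinner_diff_left Pp_sa[symmetric] Pm_sa[symmetric])
  then show ?thesis by (simp add: Re_cinner_self)
qed

lemma cinner_J_split: "cinner (J x) y = cinner (Pp x) (Pp y) - cinner (Pm x) (Pm y)"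
  by (simp add: J_def cinner_diff_left Pp_sa[symmetric] Pm_sa[symmetric])

lemma span_subset_Pp: "E \<subseteq> range Pp \<Longrightarrow> x \<in> cvs.span E \<Longrightarrow> Pp x = x"
  using cvs.span_minimal[of E "range Pp"] csubspace_range_Pp by (auto simp: csubspace_iff in_range_Pp)

lemma span_subset_Pm: "E \<subseteq> range Pm \<Longrightarrow> x \<in> cvs.span E \<Longrightarrow> Pm x = x"
  using cvs.span_minimal[of E "range Pm"] csubspace_range_Pm by (auto simp: csubspace_iff in_range_Pm)

lemma proj_Pp: "E \<subseteq> range Pp \<Longrightarrow> proj E (Pp x) = proj E x"
  unfolding proj_def by (intro sum.cong refl) (use in_range_Pp in \<open>auto simp: Pp_sa\<close>)

lemma proj_Pm: "E \<subseteq> range Pm \<Longrightarrow> proj E (Pm x) = proj E x"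
  unfolding proj_def by (intro sum.cong refl) (use in_range_Pm in \<open>auto simp: Pm_sa\<close>)

lemma orth_span_Pp: "E \<subseteq> range Pp \<Longrightarrow> proj E (Pm x) = 0"
  using proj_Pp[of E "Pm x"] by (simp add: clinear_map_zero[OF clinear_proj])

text \<open>A nonnegative \<open>L\<close> is a graph over \<open>Pp\<close>
  L\<open>; the complement\<close>N\<open>shows that it lies over all of\<close>span
  E\<open>. If\<close>g\<open>in\<close>span E\<open>is orthogonal to\<close>Pp \<open>L\<close> and
  \<open>g = l + m\<close> with \<open>l\<close> in \<open>L\<close> and \<open>m\<close> in
  \<open>N\<close>, then \<open>J\<close>-orthogonality to \<open>l\<close> gives
  \<open>[g,g] = [m,m] - [l,l] \<le> 0\<close>, while \<open>[g,g] = |g|^2\<close>. Off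
  \<open>span E\<close> the contraction is extended by zero through \<open>proj E\<close>.\<close>

lemma finite_pontryagin_graph:
  assumes E: "orthonormal E" "E \<subseteq> range Pp" and Y: "orthonormal Y" "Y \<subseteq> range Pm"
    and B: "clinear_map B" "\<And>z. Pp z \<in> cvs.span E \<Longrightarrow> Pm z \<in> cvs.span Y \<Longrightarrow> Pp (B z) \<in> cvs.span E \<and> Pm (B z) \<in> cvs.span Y"
    and diss: "\<And>z. Pp z \<in> cvs.span E \<Longrightarrow> Pm z \<in> cvs.span Y \<Longrightarrow> z \<noteq> 0 \<Longrightarrow> Re (cinner (J (B z)) z) < 0"
  shows "\<exists>K. clinear_map K \<and> (\<forall>x. norm (K x) \<le> norm x) \<and> (\<forall>x. K (proj E x) = K x) \<and> (\<forall>x. Pm (K x) = K x)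
    \<and> (\<forall>x\<in>cvs.span E. Pm (B (x + K x)) = K (Pp (B (x + K x))))"
proof -
  define V where "V = {z. Pp z \<in> cvs.span E \<and> Pm z \<in> cvs.span Y}"
  have V: "csubspace V"
    unfolding V_def csubspace_def
    by (auto simp: Pp_simps Pm_simps csubspace_zero[OF csubspace_span] intro!: csubspace_add[OF csubspace_span] csubspace_scale[OF csubspace_span])
  have "V \<subseteq> cvs.span (E \<union> Y)"
  proof
    fix z assume "z \<in> V"
    then have "Pp z \<in> cvs.span (E \<union> Y)" "Pm z \<in> cvs.span (E \<union> Y)"
      using cvs.span_mono[of E "E \<union> Y"] cvs.span_mono[of Y "E \<union> Y"] by (auto simp: V_def)
    then show "z \<in> cvs.span (E \<union> Y)" using csubspace_add[OF csubspace_span] Pp_Pm_add by metis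
  qed
  then have n: "cdim_le V (card (E \<union> Y))" using E Y by (intro cdim_le_span) (auto simp: orthonormal_def)
  have BV: "clinear_on V B" "B ` V \<subseteq> V"
    using B unfolding clinear_map_def clinear_on_def by (auto simp: V_def)
  have dissV: "Re (cinner (J (B z)) z) < 0" if "z \<in> V" "z \<noteq> 0" for z using diss that by (simp add: V_def)
  obtain L N where L: "csubspace L" "L \<subseteq> V" "B ` L \<subseteq> L" "\<And>z. z \<in> L \<Longrightarrow> 0 \<le> Re (cinner (J z) z)"
    and N: "csubspace N" "N \<subseteq> V" "\<And>z. z \<in> N \<Longrightarrow> Re (cinner (J z) z) \<le> 0" and dec: "\<And>v. v \<in> V \<Longrightarrow> \<exists>l\<in>L. \<exists>m\<in>N. v = l + m"
  proof -
    have "\<exists>L N. csubspace L \<and> L \<subseteq> V \<and> B ` L \<subseteq> L \<and> (\<forall>z\<in>L. 0 \<le> Re (cinner (J z) z))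
      \<and> csubspace N \<and> N \<subseteq> V \<and> (\<forall>z\<in>N. Re (cinner (J z) z) \<le> 0) \<and> (\<forall>v\<in>V. \<exists>l\<in>L. \<exists>m\<in>N. v = l + m)"
      by (rule finite_pontryagin[OF clinear_J J_sa V n BV]) (rule dissV)
    then show ?thesis using that by (elim exE conjE) (metis (no_types, lifting))
  qed
  have contr: "norm (Pm l) \<le> norm (Pp l)" if "l \<in> L" for l
    using L(4)[OF that] by (simp add: Re_J abs_le_square_iff[symmetric])
  have inj: "l = m" if "l \<in> L" "m \<in> L" "Pp l = Pp m" for l m
  proof -
    have "Pp (l - m) = 0" using that by (simp add: Pp_simps)
    moreover have "Pm (l - m) = 0" using contr[OF csubspace_diff[OF L(1) that(1,2)]] \<open>Pp (l - m) = 0\<close> by simp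
    ultimately show ?thesis using Pp_Pm_add[of "l - m"] by simp
  qed
  have surj: "\<exists>l\<in>L. Pp l = v" if "v \<in> cvs.span E" for v
  proof -
    have M: "csubspace (Pp ` L)"
      unfolding csubspace_def
    proof (intro conjI ballI allI)
      show "0 \<in> Pp ` L" using csubspace_zero[OF L(1)] Pp_simps(5) by force
      show "x + y \<in> Pp ` L" if "x \<in> Pp ` L" "y \<in> Pp ` L" for x y
        using that csubspace_add[OF L(1)] Pp_simps(1)[symmetric] by auto
      show "c *\<^sub>C x \<in> Pp ` L" if "x \<in> Pp ` L" for c x
        using that csubspace_scale[OF L(1)] Pp_simps(3)[symmetric] by auto
    qed
    have "Pp ` L \<subseteq> cvs.span E" using L(2) by (auto simp: V_def)
    then have "cdim_le (Pp ` L) (card E)" using E by (intro cdim_le_span) (auto simp: orthonormal_def)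
    from cdim_le_onb[OF M this] obtain E' where E': "orthonormal E'" "cvs.span E' = Pp ` L" by blast
    define g where "g = v - proj E' v"
    have gE: "g \<in> cvs.span E"
      using that proj_in_span[of E' v] E'(2) \<open>Pp ` L \<subseteq> cvs.span E\<close> unfolding g_def
      by (intro csubspace_diff[OF csubspace_span]) auto
    have Ppg: "Pp g = g" using span_subset_Pp[OF E(2) gE] .
    have gV: "g \<in> V" using gE Pm_range_Pp[OF Ppg] by (simp add: V_def Ppg csubspace_zero[OF csubspace_span])
    have Jg: "J g = g" by (simp add: J_def Ppg Pm_range_Pp)
    have orth: "cinner (J g) l = 0" if "l \<in> L" for l
    proof -
      have "cinner g l = cinner g (Pp l)" using Pp_sa[of g l] Ppg by simp
      also have "\<dots> = 0" using proj_span[OF E'(1), of "Pp l"] that E'(2)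
        by (simp add: g_def cinner_diff_left proj_selfadjoint)
      finally show ?thesis by (simp add: Jg)
    qed
    obtain l m where lm: "l \<in> L" "m \<in> N" "g = l + m" using dec[OF gV] by blast
    have o1: "cinner (J l) l + cinner (J m) l = 0" using orth[OF lm(1)] lm(3) by (simp add: J_simps cinner_simps)
    have "Re (cinner (J m) l) = Re (cinner (J l) m)" by (metis J_sa Re_cinner_commute)
    moreover have "Re (cinner (J g) g) = Re (cinner (J l) l) + Re (cinner (J l) m) + Re (cinner (J m) l) + Re (cinner (J m) m)"
      by (simp add: lm(3) J_simps cinner_simps)
    moreover have "Re (cinner (J l) l) + Re (cinner (J m) l) = 0" using arg_cong[OF o1, of Re] by simp
    ultimately have "(norm g)\<^sup>2 \<le> 0" using L(4)[OF lm(1)] N(3)[OF lm(2)] by (simp add: Jg Re_cinner_self)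
    then have "v = proj E' v" by (simp add: g_def)
    then show ?thesis using proj_in_span[of E' v] E'(2) by auto
  qed
  define lift where "lift x = (SOME l. l \<in> L \<and> Pp l = proj E x)" for x
  have lift: "lift x \<in> L" "Pp (lift x) = proj E x" for x
    using someI_ex[of "\<lambda>l. l \<in> L \<and> Pp l = proj E x"] surj[OF proj_in_span[of E x]] unfolding lift_def by blast+
  have lift_eq: "lift x = l" if "l \<in> L" "Pp l = proj E x" for l x
    using inj[OF lift(1) that(1)] that(2) lift(2) by simp
  define K where "K x = Pm (lift x)" for x
  have "clinear_map K"
  proof (rule clinear_mapI)
    show "K (x + y) = K x + K y" for x y
      using lift_eq[of "lift x + lift y" "x + y"] lift csubspace_add[OF L(1)]
      by (simp add: K_def Pp_simps Pm_simps clinear_map_add[OF clinear_proj])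
    show "K (c *\<^sub>C x) = c *\<^sub>C K x" for c x
      using lift_eq[of "c *\<^sub>C lift x" "c *\<^sub>C x"] lift csubspace_scale[OF L(1)]
      by (simp add: K_def Pp_simps Pm_simps clinear_map_scale[OF clinear_proj])
  qed
  moreover have "norm (K x) \<le> norm x" for x
    using contr[OF lift(1)[of x]] norm_proj_le[OF E(1), of x] by (simp add: K_def lift)
  moreover have "K (proj E x) = K x" for x by (simp add: K_def lift_def proj_idem[OF E(1)])
  moreover have "Pm (K x) = K x" for x by (simp add: K_def)
  moreover have "Pm (B (x + K x)) = K (Pp (B (x + K x)))" if "x \<in> cvs.span E" for x
  proof -
    have "lift x = x + K x" using Pp_Pm_add[of "lift x"] proj_span[OF E(1) that] lift(2)[of x] by (simp add: K_def)
    then have BL: "B (x + K x) \<in> L" using lift(1)[of x] L(3) by auto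
    have "Pp (B (x + K x)) \<in> cvs.span E" using BL L(2) by (auto simp: V_def)
    then have "lift (Pp (B (x + K x))) = B (x + K x)" using BL by (intro lift_eq) (simp_all add: proj_span[OF E(1)])
    then show ?thesis by (simp add: K_def)
  qed
  ultimately show ?thesis by blast
qed

text \<open>Galerkin approximation in \<open>H\<^sup>-\<close> alone. The component in
  \<open>H\<^sup>+\<close> stays in a fixed finite-dimensional space, where weak and norm limits
  agree, and this is what makes the nonlinear invariance equation pass to the limit.\<close>

lemma bounded_pontryagin:
  assumes E: "orthonormal E" "E \<subseteq> range Pp"
    and B: "clinear_map B" "\<And>z. norm (B z) \<le> C * norm z" "\<And>z. Pp z \<in> cvs.span E \<Longrightarrow> Pp (B z) \<in> cvs.span E"
    and diss: "\<And>z. Pp z \<in> cvs.span E \<Longrightarrow> Re (cinner (J (B z)) z) \<le> 0"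
  shows "\<exists>K. clinear_map K \<and> (\<forall>x. norm (K x) \<le> norm x) \<and> (\<forall>x. K (proj E x) = K x) \<and> (\<forall>x. Pm (K x) = K x)
    \<and> (\<forall>x\<in>cvs.span E. Pm (B (x + K x)) = K (Pp (B (x + K x))))"
proof -
  obtain U :: "('a set \<times> real) filter" where U: "ultra U"
    "\<And>x. x \<in> range Pm \<Longrightarrow> eventually (\<lambda>i. x \<in> fst i) U"
    "eventually (\<lambda>i. finite (fst i) \<and> fst i \<subseteq> range Pm) U"
    "eventually (\<lambda>i. 0 < snd i \<and> snd i < 1) U" "(snd \<longlongrightarrow> 0) U"
    using index_ultrafilter[of "range Pm"] by blast
  have nb: "U \<noteq> bot" using U(1) by (simp add: ultra_def)
  define Y where "Y i = onb (fst i)" for i :: "'a set \<times> real"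
  \<comment> \<open>Subtracting a multiple of \<open>J\<close> lowers the real part of the form by
    \<open>snd i * |z|^2\<close>, which turns dissipativity into the strict inequality required in
    finite dimension.\<close>
  define Bi where "Bi i z = proj E (B z) + proj (Y i) (B z) - of_real (snd i) *\<^sub>C J z" for i z
  define good where "good i K \<longleftrightarrow> clinear_map K \<and> (\<forall>x. norm (K x) \<le> norm x) \<and> (\<forall>x. K (proj E x) = K x)
    \<and> (\<forall>x. Pm (K x) = K x) \<and> (\<forall>x\<in>cvs.span E. Pm (Bi i (x + K x)) = K (Pp (Bi i (x + K x))))" for i K
  have Yprops: "orthonormal (Y i)" "Y i \<subseteq> range Pm" "\<And>y. y \<in> fst i \<Longrightarrow> y \<in> cvs.span (Y i)"
    if "finite (fst i)" "fst i \<subseteq> range Pm" for i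
  proof -
    show "orthonormal (Y i)" using orthonormal_onb that by (simp add: Y_def)
    have *: "cvs.span (Y i) = cvs.span (fst i)" using span_onb that by (simp add: Y_def)
    have "Y i \<subseteq> cvs.span (fst i)" using * cvs.span_superset by blast
    also have "\<dots> \<subseteq> range Pm" using that csubspace_range_Pm by (intro cvs.span_minimal) (auto simp: csubspace_iff)
    finally show "Y i \<subseteq> range Pm" .
    show "y \<in> cvs.span (Y i)" if "y \<in> fst i" for y using that * cvs.span_base by simp
  qed
  have Bi_parts: "Pp (Bi i z) = proj E (B z) - of_real (snd i) *\<^sub>C Pp z"
    "Pm (Bi i z) = proj (Y i) (B z) + of_real (snd i) *\<^sub>C Pm z" if "finite (fst i)" "fst i \<subseteq> range Pm" for i z
    using span_subset_Pp[OF E(2) proj_in_span[of E "B z"]] span_subset_Pm[OF Yprops(2)[OF that] proj_in_span[of "Y i" "B z"]]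
      Pm_range_Pp[of "proj E (B z)"] Pp_range_Pm[of "proj (Y i) (B z)"]
    by (simp_all add: Bi_def Pp_simps Pm_simps)
  have "eventually (\<lambda>i. \<exists>K. good i K) U"
    using U(3,4)
  proof eventually_elim
    case (elim i)
    note Y = Yprops[of i]
    have fin: "finite (fst i)" "fst i \<subseteq> range Pm" and pos: "0 < snd i" using elim by auto
    show ?case
      unfolding good_def
    proof (rule finite_pontryagin_graph[OF E Y(1,2)])
      show "clinear_map (Bi i)"
        by (rule clinear_mapI)
          (simp_all add: Bi_def clinear_mapD(1,2)[OF B(1)] clinear_mapD(1,2)[OF clinear_proj] J_simps
            scaleC_add_right cvs.scale_right_diff_distrib mult.commute)
      show "Pp (Bi i z) \<in> cvs.span E \<and> Pm (Bi i z) \<in> cvs.span (Y i)" if "Pp z \<in> cvs.span E" "Pm z \<in> cvs.span (Y i)" for z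
        unfolding Bi_parts[OF fin] using that
        by (auto intro!: csubspace_diff[OF csubspace_span] csubspace_add[OF csubspace_span] csubspace_scale[OF csubspace_span] proj_in_span)
      show "Re (cinner (J (Bi i z)) z) < 0" if z: "Pp z \<in> cvs.span E" "Pm z \<in> cvs.span (Y i)" "z \<noteq> 0" for z
      proof -
        have "cinner (proj E (B z)) (Pp z) = cinner (Pp (B z)) (Pp z)"
          using proj_span[OF E(1) z(1)] by (simp add: proj_selfadjoint Pp_sa)
        moreover have "cinner (proj (Y i) (B z)) (Pm z) = cinner (Pm (B z)) (Pm z)"
          using proj_span[OF Y(1)[OF fin] z(2)] by (simp add: proj_selfadjoint Pm_sa)
        ultimately have "cinner (J (Bi i z)) z = cinner (J (B z)) z
            - of_real (snd i) * (cinner (Pp z) (Pp z) + cinner (Pm z) (Pm z))"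
          unfolding cinner_J_split Bi_parts[OF fin] by (simp add: cinner_simps algebra_simps)
        also have "cinner (Pp z) (Pp z) + cinner (Pm z) (Pm z) = of_real ((norm z)\<^sup>2)"
          by (simp only: norm_sq_split[of z] cinner_self of_real_add)
        finally have "Re (cinner (J (Bi i z)) z) = Re (cinner (J (B z)) z) - snd i * (norm z)\<^sup>2"
          by (simp only: of_real_mult[symmetric] minus_complex.sel Re_complex_of_real)
        moreover have "snd i * (norm z)\<^sup>2 > 0" using pos z(3) by simp
        ultimately show ?thesis using diss[OF z(1)] by linarith
      qed
    qed (use fin in auto)
  qed
  then have ev: "eventually (\<lambda>i. good i (SOME K. good i K)) U"
    by (simp add: some_eq_ex)
  define k where "k i = (SOME K. good i K)" for i
  have good: "eventually (\<lambda>i. good i (k i)) U" using ev by (simp add: k_def)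
  have contr: "eventually (\<lambda>i. clinear_map (k i) \<and> (\<forall>x. norm (k i x) \<le> norm x)) U"
    using good by eventually_elim (simp add: good_def)
  obtain K where K: "clinear_map K" "\<And>x. norm (K x) \<le> norm x" "\<And>x. weak_lim (\<lambda>i. k i x) (K x) U"
    using contraction_weak_limit[OF U(1) contr] by blast
  have "K (proj E x) = K x" for x
  proof (rule weak_lim_unique[OF K(3) _ nb])
    show "weak_lim (\<lambda>i. k i (proj E x)) (K x) U"
      by (rule weak_lim_cong[OF K(3)]) (use good in eventually_elim, simp add: good_def)
  qed
  moreover have PmK: "Pm (K x) = K x" for x
  proof (rule weak_lim_unique[OF _ K(3) nb])
    have "weak_lim (\<lambda>i. Pm (k i x)) (Pm (K x)) U"
      by (rule weak_lim_clinear[OF clinear_Pm, of 1]) (simp_all add: norm_Pm_le K)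
    then show "weak_lim (\<lambda>i. k i x) (Pm (K x)) U"
      by (rule weak_lim_cong) (use good in eventually_elim, simp add: good_def)
  qed
  moreover have "Pm (B (x + K x)) = K (Pp (B (x + K x)))" if x: "x \<in> cvs.span E" for x
  proof -
    have Ppx: "Pp x = x" "Pm x = 0" using span_subset_Pp[OF E(2) x] Pm_range_Pp by auto
    define z where "z i = x + k i x" for i
    have wz: "weak_lim z (x + K x) U"
      unfolding z_def by (intro weak_lim_add K weak_lim_if_tendsto tendsto_const)
    have wB: "weak_lim (\<lambda>i. B (z i)) (B (x + K x)) U" by (rule weak_lim_clinear[OF B(1,2) wz])
    \<comment> \<open>The plus component of \<open>Bi i (z i)\<close>. It lies in the span of
      \<open>E\<close>, so it converges in norm.\<close>
    define a where "a i = proj E (B (z i)) - of_real (snd i) *\<^sub>C x" for i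
    have "Pp (x + K x) \<in> cvs.span E" using x Ppx PmK[of x] Pp_range_Pm by (simp add: Pp_simps)
    then have "Pp (B (x + K x)) \<in> cvs.span E" by (rule B(3))
    then have prB: "proj E (B (x + K x)) = Pp (B (x + K x))"
      using proj_Pp[OF E(2), of "B (x + K x)"] proj_span[OF E(1)] by simp
    have s0: "((\<lambda>i. complex_of_real (snd i)) \<longlongrightarrow> of_real 0) U" by (intro tendsto_of_real U(5))
    have "(a \<longlongrightarrow> proj E (B (x + K x)) - of_real 0 *\<^sub>C x) U"
      unfolding a_def by (intro tendsto_diff tendsto_scaleC weak_lim_proj[OF wB] s0 tendsto_const)
    then have a: "(a \<longlongrightarrow> Pp (B (x + K x))) U" using prB by simp
    have w1: "weak_lim (\<lambda>i. k i (a i)) (K (Pp (B (x + K x)))) U"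
      by (rule weak_lim_contraction_seq[where K = k and k = K, OF K(3) a contr])
    \<comment> \<open>Tested against \<open>y\<close>, the projection onto the span of
      \<open>Y i\<close> moves to \<open>Pm y\<close>, which belongs to that span eventually; the
      projection then disappears.\<close>
    have w2: "weak_lim (\<lambda>i. k i (a i)) (Pm (B (x + K x))) U"
      unfolding weak_lim_def
    proof
      fix y
      have eq: "eventually (\<lambda>i. cinner (B (z i)) (Pm y) + of_real (snd i) * cinner (k i x) y = cinner (k i (a i)) y) U"
        using good U(3) U(2)[OF rangeI, of y]
      proof eventually_elim
        case (elim i)
        have fin: "finite (fst i)" "fst i \<subseteq> range Pm" using elim by auto
        have Ppz: "Pp (z i) = x" "Pm (z i) = k i x"
          using elim(1) Ppx Pp_range_Pm[of "k i x"] by (simp_all add: z_def Pp_simps Pm_simps good_def)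
        have "\<forall>x\<in>cvs.span E. Pm (Bi i (x + k i x)) = k i (Pp (Bi i (x + k i x)))"
          using elim(1) unfolding good_def by (elim conjE)
        from bspec[OF this x] have "Pm (Bi i (z i)) = k i (Pp (Bi i (z i)))" by (simp only: z_def)
        moreover have "Pp (Bi i (z i)) = a i" using Bi_parts(1)[OF fin, of "z i"] unfolding Ppz(1) a_def .
        ultimately have "k i (a i) = Pm (Bi i (z i))" by simp
        also have "\<dots> = proj (Y i) (B (z i)) + of_real (snd i) *\<^sub>C k i x" unfolding Bi_parts[OF fin] Ppz ..
        finally have "cinner (k i (a i)) y = cinner (B (z i)) (proj (Y i) y) + of_real (snd i) * cinner (k i x) y"
          by (simp add: cinner_simps proj_selfadjoint)
        also have "proj (Y i) y = Pm y"
          using proj_Pm[OF Yprops(2)[OF fin], of y] proj_span[OF Yprops(1)[OF fin] Yprops(3)[OF fin elim(3)]] by simp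
        finally show ?case by simp
      qed
      have "((\<lambda>i. cinner (B (z i)) (Pm y) + of_real (snd i) * cinner (k i x) y)
          \<longlongrightarrow> cinner (B (x + K x)) (Pm y) + of_real 0 * cinner (K x) y) U"
        by (intro tendsto_add tendsto_mult s0 weak_limD[OF wB] weak_limD[OF K(3)])
      then have "((\<lambda>i. cinner (B (z i)) (Pm y) + of_real (snd i) * cinner (k i x) y)
          \<longlongrightarrow> cinner (Pm (B (x + K x))) y) U" by (simp add: Pm_sa)
      then show "((\<lambda>i. cinner (k i (a i)) y) \<longlongrightarrow> cinner (Pm (B (x + K x))) y) U"
        by (rule Lim_transform_eventually) (rule eq)
    qed
    show ?thesis by (rule weak_lim_unique[OF w2 w1 nb])
  qed
  ultimately show ?thesis using K(1,2) by blast
qed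

end

section \<open>m-dissipative operators\<close>

lemma dissipative_lower_bound:
  assumes "Re (cinner (t::'a::cinner_space) x) \<le> 0"
  shows "Re l * norm x \<le> norm (t - l *\<^sub>C x)"
proof (cases "x = 0")
  case False
  have "Re (cinner (l *\<^sub>C x - t) x) = Re l * (norm x)\<^sup>2 - Re (cinner t x)"
    by (simp add: cinner_simps cinner_self)
  then have "Re l * (norm x)\<^sup>2 \<le> Re (cinner (l *\<^sub>C x - t) x)" using assms by simp
  also have "\<dots> \<le> norm (l *\<^sub>C x - t) * norm x"
    using cinner_Cauchy_Schwarz complex_Re_le_cmod order_trans by blast
  finally show ?thesis using False by (simp add: power2_eq_square norm_minus_commute mult.assoc[symmetric])
qed simp

lemma Re_affine_bounded_imp_zero:
  assumes "\<And>c. a + Re (c * b) \<le> (0::real)"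
  shows "b = 0"
proof (rule ccontr)
  assume b: "b \<noteq> 0"
  have "a + Re (of_real ((1 - a) / (cmod b)\<^sup>2) * cnj b * b) \<le> 0" by (rule assms)
  also have "of_real ((1 - a) / (cmod b)\<^sup>2) * cnj b * b = of_real ((1 - a) / (cmod b)\<^sup>2 * (cmod b)\<^sup>2)"
    using complex_norm_square[of b] by (simp add: mult_ac)
  finally show False using b by simp
qed

lemma dissipative_inD:
  assumes "dissipative_in V D T"
  shows "D \<subseteq> V" "csubspace D" "clinear_on D T" "x \<in> D \<Longrightarrow> T x \<in> V" "x \<in> D \<Longrightarrow> Re (cinner (T x) x) \<le> 0"
  using assms by (auto simp: dissipative_in_def operator_in_def)

text \<open>Maximality enters only through extensions by one vector \<open>g\<close> with prescribed
  image \<open>w\<close>. For \<open>g\<close> outside \<open>D\<close> such an extension is well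
  defined, so the inequality alone forces \<open>g\<close> into \<open>D\<close>.\<close>

lemma no_one_dim_extension:
  assumes V: "csubspace V" and m: "m_dissipative_in V D T" and g: "g \<in> V" "w \<in> V"
    and diss: "\<And>x c. x \<in> D \<Longrightarrow> Re (cinner (T x + c *\<^sub>C w) (x + c *\<^sub>C g)) \<le> 0"
  shows "g \<in> D"
proof (rule ccontr)
  assume gD: "g \<notin> D"
  have d: "dissipative_in V D T" using m by (simp add: m_dissipative_in_def)
  note D = dissipative_inD(2)[OF d] and T = dissipative_inD(3)[OF d]
  have uniq: "x = y \<and> c = d" if "x \<in> D" "y \<in> D" "x + c *\<^sub>C g = y + d *\<^sub>C g" for x y c d
  proof -
    have "c = d"
    proof (rule ccontr)
      assume cd: "c \<noteq> d"
      have "(c - d) *\<^sub>C g = y - x" using that(3) by (simp add: cvs.scale_left_diff_distrib algebra_simps)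
      then have "g = (1 / (c - d)) *\<^sub>C (y - x)" using cd by (metis cvs.scale_one cvs.scale_scale divide_self_if
            eq_iff_diff_eq_0 nonzero_eq_divide_eq times_divide_eq_left mult_1)
      then show False using gD csubspace_scale[OF D csubspace_diff[OF D that(2,1)]] by simp
    qed
    then show ?thesis using that by simp
  qed
  define D' where "D' = {x + c *\<^sub>C g | x c. x \<in> D}"
  define T' where "T' z = (THE u. \<exists>x c. x \<in> D \<and> z = x + c *\<^sub>C g \<and> u = T x + c *\<^sub>C w)" for z
  have T': "T' (x + c *\<^sub>C g) = T x + c *\<^sub>C w" if "x \<in> D" for x c
    unfolding T'_def
  proof (rule the_equality)
    show "\<exists>x' c'. x' \<in> D \<and> x + c *\<^sub>C g = x' + c' *\<^sub>C g \<and> T x + c *\<^sub>C w = T x' + c' *\<^sub>C w" using that by blast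
    fix u assume "\<exists>x' c'. x' \<in> D \<and> x + c *\<^sub>C g = x' + c' *\<^sub>C g \<and> u = T x' + c' *\<^sub>C w"
    then show "u = T x + c *\<^sub>C w" using uniq[OF that] by blast
  qed
  have "dissipative_in V D' T'"
    unfolding dissipative_in_def operator_in_def
  proof (intro conjI ballI)
    have "D' = {c *\<^sub>C g + x | c x. x \<in> D}" unfolding D'_def by (auto simp: add.commute)
    then show "csubspace D'" using csubspace_line_plus[OF D] by simp
    show "D' \<subseteq> V" using dissipative_inD(1)[OF d] g
      by (auto simp: D'_def intro!: csubspace_add[OF V] csubspace_scale[OF V])
    show "T' ` D' \<subseteq> V" using dissipative_inD(4)[OF d] g
      by (auto simp: D'_def T' intro!: csubspace_add[OF V] csubspace_scale[OF V])
    show "Re (cinner (T' x) x) \<le> 0" if "x \<in> D'" for x using that diss by (auto simp: D'_def T')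
    show "clinear_on D' T'"
      unfolding clinear_on_def
    proof (intro conjI ballI allI)
      fix x y assume "x \<in> D'" "y \<in> D'"
      then obtain a c b d where xy: "x = a + c *\<^sub>C g" "y = b + d *\<^sub>C g" "a \<in> D" "b \<in> D" by (auto simp: D'_def)
      have "x + y = (a + b) + (c + d) *\<^sub>C g" using xy by (simp add: scaleC_add_left)
      then have "T' (x + y) = T (a + b) + (c + d) *\<^sub>C w" using T' csubspace_add[OF D xy(3,4)] by simp
      then show "T' (x + y) = T' x + T' y"
        using xy by (simp add: T' clinear_on_add[OF T D] scaleC_add_left)
    next
      fix s x assume "x \<in> D'"
      then obtain a c where x: "x = a + c *\<^sub>C g" "a \<in> D" by (auto simp: D'_def)
      have "s *\<^sub>C x = s *\<^sub>C a + (s * c) *\<^sub>C g" using x by (simp add: scaleC_add_right)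
      then have "T' (s *\<^sub>C x) = T (s *\<^sub>C a) + (s * c) *\<^sub>C w" using T' csubspace_scale[OF D x(2)] by simp
      then show "T' (s *\<^sub>C x) = s *\<^sub>C T' x"
        using x by (simp add: T' clinear_on_scale[OF T D] scaleC_add_right)
    qed
  qed
  moreover have "D \<subset> D'"
  proof
    show "D \<subseteq> D'" by (force simp: D'_def intro: exI[of _ 0])
    have "0 + 1 *\<^sub>C g \<in> D'" unfolding D'_def using csubspace_zero[OF D] by blast
    then show "D \<noteq> D'" using gD by auto
  qed
  moreover have "\<forall>x\<in>D. T' x = T x" using T'[of _ 0] by simp
  ultimately show False using m unfolding m_dissipative_in_def by blast
qed

lemma proper_closed_subspace_orth:
  fixes M :: "'a::{cinner_space, complete_space} set"
  assumes "closed_csubspace M" "y \<notin> M"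
  obtains u where "u \<in> M" "\<And>h. h \<in> M \<Longrightarrow> cinner h (y - u) = 0" "y - u \<noteq> 0"
proof -
  have "cmod (cinner h y) \<le> norm y * norm h" for h using cinner_Cauchy_Schwarz[of h y] by (simp add: mult.commute)
  then obtain u where u: "u \<in> M" "\<And>h. h \<in> M \<Longrightarrow> cinner h y = cinner h u"
    using riesz_on[of M "\<lambda>h. cinner h y" "norm y"] assms(1) by (auto simp: cinner_simps)
  show ?thesis
  proof (rule that[OF u(1)])
    show "cinner h (y - u) = 0" if "h \<in> M" for h using u(2)[OF that] by (simp add: cinner_diff_right)
    show "y - u \<noteq> 0" using u(1) assms(2) by auto
  qed
qed

lemma csubspace_closure:
  assumes "csubspace (M :: 'a::cinner_space set)"
  shows "closed_csubspace (closure M)"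
  unfolding closed_csubspace_def csubspace_def
proof (intro conjI ballI allI)
  show "0 \<in> closure M" using csubspace_zero[OF assms] closure_subset by blast
  show "closed (closure M)" by simp
  fix x assume "x \<in> closure M"
  then obtain f where f: "\<And>n. f n \<in> M" "f \<longlonglongrightarrow> x" unfolding closure_sequential by blast
  show "c *\<^sub>C x \<in> closure M" for c
    unfolding closure_sequential
    by (intro exI[of _ "\<lambda>n. c *\<^sub>C f n"] conjI allI csubspace_scale[OF assms] f tendsto_scaleC tendsto_const)
  fix y assume "y \<in> closure M"
  then obtain g where g: "\<And>n. g n \<in> M" "g \<longlonglongrightarrow> y" unfolding closure_sequential by blast
  show "x + y \<in> closure M"
    unfolding closure_sequential
    by (intro exI[of _ "\<lambda>n. f n + g n"] conjI allI csubspace_add[OF assms] f g tendsto_add)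
qed

lemma csubspace_image:
  assumes "csubspace V" "clinear_on V T"
  shows "csubspace (T ` V)"
  unfolding csubspace_def
proof (intro conjI ballI allI)
  show "0 \<in> T ` V" using csubspace_zero[OF assms(1)] clinear_on_zero[OF assms(2,1)] by (intro image_eqI[of _ _ 0]) auto
  fix a assume "a \<in> T ` V"
  then obtain x where x: "x \<in> V" "a = T x" by blast
  show "c *\<^sub>C a \<in> T ` V" for c
    using x csubspace_scale[OF assms(1) x(1)] clinear_on_scale[OF assms(2,1) x(1)] by (intro image_eqI[of _ _ "c *\<^sub>C x"]) auto
  fix b assume "b \<in> T ` V"
  then obtain y where y: "y \<in> V" "b = T y" by blast
  show "a + b \<in> T ` V"
    using x y csubspace_add[OF assms(1) x(1) y(1)] clinear_on_add[OF assms(2,1) x(1) y(1)] by (intro image_eqI[of _ _ "x + y"]) auto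
qed

text \<open>For \<open>g\<close> orthogonal to the range, put \<open>T g = - cnj l g\<close>. The
  mixed terms become a number minus its conjugate and drop out of the real part, so the extension is
  dissipative. Hence \<open>g\<close> already lies in \<open>D\<close>, and orthogonality gives
  \<open>Re l * |g|^2 \<le> 0\<close>.\<close>

lemma m_dissipative_range_dense:
  fixes V :: "'a::{cinner_space, complete_space} set"
  assumes V: "closed_csubspace V" and m: "m_dissipative_in V D T" and l: "Re l > 0" and y: "y \<in> V"
  shows "y \<in> closure ((\<lambda>x. T x - l *\<^sub>C x) ` D)"
proof (rule ccontr)
  note Vs = V[unfolded closed_csubspace_def, THEN conjunct1]
  note Vc = V[unfolded closed_csubspace_def, THEN conjunct2]
  have d: "dissipative_in V D T" using m by (simp add: m_dissipative_in_def)
  note D = dissipative_inD(2)[OF d] and T = dissipative_inD(3)[OF d]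
  let ?R = "(\<lambda>x. T x - l *\<^sub>C x) ` D"
  assume "y \<notin> closure ?R"
  have R: "csubspace ?R"
    by (rule csubspace_image[OF D])
      (auto simp: clinear_on_def clinear_on_add[OF T D] clinear_on_scale[OF T D] scaleC_add_right
        cvs.scale_right_diff_distrib mult.commute)
  have RV: "closure ?R \<subseteq> V"
    using dissipative_inD(1,4)[OF d]
    by (intro closure_minimal Vc) (auto intro!: csubspace_diff[OF Vs] csubspace_scale[OF Vs])
  obtain u where u: "u \<in> closure ?R" "\<And>h. h \<in> closure ?R \<Longrightarrow> cinner h (y - u) = 0" "y - u \<noteq> 0"
    using proper_closed_subspace_orth[OF csubspace_closure[OF R] \<open>y \<notin> closure ?R\<close>] by blast
  define g where "g = y - u"
  have gV: "g \<in> V" using y u(1) RV csubspace_diff[OF Vs] by (auto simp: g_def)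
  have orth: "cinner (T x) g = l * cinner x g" if "x \<in> D" for x
    using u(2)[of "T x - l *\<^sub>C x"] that closure_subset[of ?R] by (auto simp: g_def[symmetric] cinner_simps)
  have "g \<in> D"
  proof (rule no_one_dim_extension[OF Vs m gV, of "- cnj l *\<^sub>C g"])
    show "- cnj l *\<^sub>C g \<in> V" using gV csubspace_scale[OF Vs] by blast
    fix x c assume x: "x \<in> D"
    have gx: "cinner g x = cnj (cinner x g)" by (rule cinner_commute)
    have "cinner (T x + c *\<^sub>C - cnj l *\<^sub>C g) (x + c *\<^sub>C g)
        = cinner (T x) x + (cnj c * (l * cinner x g) - cnj (cnj c * (l * cinner x g)))
          - (c * cnj c) * cnj l * cinner g g"
      by (simp add: cinner_simps orth[OF x] gx algebra_simps)
    also have "Re \<dots> = Re (cinner (T x) x) - (cmod c)\<^sup>2 * Re l * (norm g)\<^sup>2"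
    proof -
      have "Re (t + (s - cnj s) - of_real a * cnj l * of_real b) = Re t - a * Re l * b" for t s a b by simp
      then show ?thesis by (simp only: complex_norm_square[symmetric] cinner_self)
    qed
    finally show "Re (cinner (T x + c *\<^sub>C - cnj l *\<^sub>C g) (x + c *\<^sub>C g)) \<le> 0"
      using dissipative_inD(5)[OF d x] l by (smt (verit, best) mult_nonneg_nonneg zero_le_power2)
  qed
  have "Re (l * of_real ((norm g)\<^sup>2)) \<le> 0"
    using dissipative_inD(5)[OF d \<open>g \<in> D\<close>] unfolding orth[OF \<open>g \<in> D\<close>] cinner_self .
  then have "Re l * (norm g)\<^sup>2 \<le> 0" by simp
  then show False using l u(3) by (simp add: g_def mult_le_0_iff)
qed

text \<open>The dense range is closed. Preimages converge by the resolvent estimate, the limit pair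
  \<open>(x, w)\<close> can be adjoined dissipatively, so \<open>x\<close> lies in \<open>D\<close>
  by maximality; density of \<open>D\<close> then identifies \<open>w\<close> with
  \<open>T x\<close>.\<close>

lemma m_dissipative_range:
  fixes V :: "'a::{cinner_space, complete_space} set"
  assumes V: "closed_csubspace V" and m: "m_dissipative_in V D T" and dense: "V \<subseteq> closure D"
    and l: "Re l > 0" and y: "y \<in> V"
  obtains x where "x \<in> D" "T x - l *\<^sub>C x = y"
proof -
  note Vs = V[unfolded closed_csubspace_def, THEN conjunct1]
  note Vc = V[unfolded closed_csubspace_def, THEN conjunct2]
  have d: "dissipative_in V D T" using m by (simp add: m_dissipative_in_def)
  note D = dissipative_inD(2)[OF d] and T = dissipative_inD(3)[OF d]
  obtain f where f: "\<And>n. f n \<in> (\<lambda>x. T x - l *\<^sub>C x) ` D" "f \<longlonglongrightarrow> y"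
    using m_dissipative_range_dense[OF V m l y] unfolding closure_sequential by blast
  have "\<forall>n. \<exists>x. x \<in> D \<and> f n = T x - l *\<^sub>C x" using f(1) by (auto simp: image_iff)
  from choice[OF this] obtain s where s: "\<And>n. s n \<in> D" "\<And>n. f n = T (s n) - l *\<^sub>C s n" by blast
  have bound: "Re l * norm (s i - s j) \<le> norm (f i - f j)" for i j
  proof -
    have "f i - f j = T (s i - s j) - l *\<^sub>C (s i - s j)"
      using s by (simp add: clinear_on_diff[OF T D] cvs.scale_right_diff_distrib)
    then show ?thesis
      using dissipative_lower_bound[OF dissipative_inD(5)[OF d csubspace_diff[OF D s(1) s(1)]], of l i j] by simp
  qed
  have "Cauchy s"
  proof (rule metric_CauchyI)
    fix e :: real assume "0 < e"
    then obtain N where N: "\<And>i j. i \<ge> N \<Longrightarrow> j \<ge> N \<Longrightarrow> dist (f i) (f j) < Re l * e"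
      using metric_CauchyD[OF LIMSEQ_imp_Cauchy[OF f(2)], of "Re l * e"] l by auto
    have "dist (s i) (s j) < e" if "i \<ge> N" "j \<ge> N" for i j
      using N[OF that] bound[of i j] l by (simp add: dist_norm) (meson le_less_trans mult_less_cancel_left_pos)
    then show "\<exists>M. \<forall>i\<ge>M. \<forall>j\<ge>M. dist (s i) (s j) < e" by blast
  qed
  then obtain x where x: "x \<in> V" "s \<longlonglongrightarrow> x"
    using closed_csubspace_complete[OF Vc, of s] s(1) dissipative_inD(1)[OF d] by blast
  define w where "w = y + l *\<^sub>C x"
  have "(\<lambda>n. f n + l *\<^sub>C s n) \<longlonglongrightarrow> w"
    unfolding w_def by (intro tendsto_add f tendsto_scaleC tendsto_const x)
  then have Ts: "(\<lambda>n. T (s n)) \<longlonglongrightarrow> w" by (simp add: s(2))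
  have wV: "w \<in> V" using x y by (simp add: w_def csubspace_add[OF Vs] csubspace_scale[OF Vs])
  have lim: "Re (cinner (T z + c *\<^sub>C w) (z + c *\<^sub>C x)) \<le> 0" if "z \<in> D" for z c
  proof (rule LIMSEQ_le_const2)
    show "(\<lambda>n. Re (cinner (T z + c *\<^sub>C T (s n)) (z + c *\<^sub>C s n))) \<longlonglongrightarrow> Re (cinner (T z + c *\<^sub>C w) (z + c *\<^sub>C x))"
      by (intro tendsto_Re tendsto_cinner tendsto_add tendsto_scaleC tendsto_const Ts x)
    have "T (z + c *\<^sub>C s n) = T z + c *\<^sub>C T (s n)" for n
      using that s(1) by (simp add: clinear_on_add[OF T D] clinear_on_scale[OF T D] csubspace_scale[OF D])
    then show "\<exists>N. \<forall>n\<ge>N. Re (cinner (T z + c *\<^sub>C T (s n)) (z + c *\<^sub>C s n)) \<le> 0"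
      using dissipative_inD(5)[OF d csubspace_add[OF D that csubspace_scale[OF D s(1)]]] by metis
  qed
  have xD: "x \<in> D" by (rule no_one_dim_extension[OF Vs m x(1) wV lim])
  \<comment> \<open>Maximality gives \<open>x\<close> in \<open>D\<close> but not yet
    \<open>T x = w\<close>. Replacing \<open>z\<close> by \<open>z - c x\<close> in the inequality
    isolates the difference, and the free \<open>c\<close> makes it orthogonal to
    \<open>D\<close>.\<close>
  have orth: "cinner (w - T x) z = 0" if "z \<in> D" for z
  proof (rule Re_affine_bounded_imp_zero)
    fix c
    have "z - c *\<^sub>C x \<in> D" using that xD by (simp add: csubspace_diff[OF D] csubspace_scale[OF D])
    from lim[OF this, of c]
    have "Re (cinner (T (z - c *\<^sub>C x) + c *\<^sub>C w) z) \<le> 0" by simp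
    moreover have "T (z - c *\<^sub>C x) = T z - c *\<^sub>C T x"
      using that xD by (simp add: clinear_on_diff[OF T D] clinear_on_scale[OF T D] csubspace_scale[OF D])
    ultimately show "Re (cinner (T z) z) + Re (c * cinner (w - T x) z) \<le> 0"
      by (simp add: cinner_simps algebra_simps)
  qed
  have "w - T x \<in> closure D" using dense wV dissipative_inD(4)[OF d xD] csubspace_diff[OF Vs] by blast
  then obtain h where h: "\<And>n. h n \<in> D" "h \<longlonglongrightarrow> w - T x" unfolding closure_sequential by blast
  have "(\<lambda>n. cinner (w - T x) (h n)) \<longlonglongrightarrow> cinner (w - T x) (w - T x)"
    by (intro tendsto_cinner h tendsto_const)
  then have "cinner (w - T x) (w - T x) = 0" using orth[OF h(1)] by (simp add: LIMSEQ_const_iff)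
  then have "w = T x" by (simp add: cinner_eq_zero_iff)
  then have "T x - l *\<^sub>C x = y" unfolding w_def by (metis add_diff_cancel_right')
  then show ?thesis using that xD by blast
qed

section \<open>The block operator and its Schur complement\<close>

locale j_dissipative = krein Pp Pm
  for Pp Pm :: "'a::{cinner_space, complete_space} \<Rightarrow> 'a" +
  fixes Dp Dm :: "'a set" and A :: "'a \<Rightarrow> 'a"
  assumes Dp: "csubspace Dp" "Dp \<subseteq> range Pp"
    and Dm: "csubspace Dm" "Dm \<subseteq> range Pm"
    and A_lin: "clinear_on {x + y | x y. x \<in> Dp \<and> y \<in> Dm} A"
    and dense: "closure {x + y | x y. x \<in> Dp \<and> y \<in> Dm} = UNIV"
    and J_diss: "dissipative_in UNIV {x + y | x y. x \<in> Dp \<and> y \<in> Dm} (\<lambda>x. Pp (A x) - Pm (A x))"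
    and cond_i: "m_dissipative_in (range Pm) Dm (\<lambda>x. - Pm (A x))"
    and cond_iii: "\<exists>\<mu>. Re \<mu> < 0 \<and>
                     compact_op_on (range Pm) (\<lambda>y. Pp (A (resolvent_op Dm (\<lambda>z. Pm (A z)) \<mu> y)))"
begin

definition D :: "'a set" where "D = {x + y | x y. x \<in> Dp \<and> y \<in> Dm}"

lemma Pp_Dp: "x \<in> Dp \<Longrightarrow> Pp x = x" and Pm_Dp: "x \<in> Dp \<Longrightarrow> Pm x = 0"
  and Pm_Dm: "y \<in> Dm \<Longrightarrow> Pm y = y" and Pp_Dm: "y \<in> Dm \<Longrightarrow> Pp y = 0"
  using Dp(2) Dm(2) in_range_Pp in_range_Pm Pm_range_Pp Pp_range_Pm by blast+

lemma in_D_iff: "z \<in> D \<longleftrightarrow> Pp z \<in> Dp \<and> Pm z \<in> Dm"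
proof
  assume "z \<in> D"
  then obtain x y where "x \<in> Dp" "y \<in> Dm" "z = x + y" by (auto simp: D_def)
  then show "Pp z \<in> Dp \<and> Pm z \<in> Dm" by (simp add: Pp_simps Pm_simps Pp_Dp Pm_Dp Pp_Dm Pm_Dm)
next
  assume "Pp z \<in> Dp \<and> Pm z \<in> Dm"
  then show "z \<in> D" unfolding D_def using Pp_Pm_add[of z] by force
qed

lemma csubspace_D: "csubspace D"
  unfolding csubspace_def
  by (auto simp: in_D_iff Pp_simps Pm_simps csubspace_zero[OF Dp(1)] csubspace_zero[OF Dm(1)]
      csubspace_add[OF Dp(1)] csubspace_add[OF Dm(1)] csubspace_scale[OF Dp(1)] csubspace_scale[OF Dm(1)])

lemma add_in_D: "x \<in> Dp \<Longrightarrow> y \<in> Dm \<Longrightarrow> x + y \<in> D"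
  by (auto simp: D_def)

lemma Dp_D: "x \<in> Dp \<Longrightarrow> x \<in> D" and Dm_D: "y \<in> Dm \<Longrightarrow> y \<in> D"
  by (simp_all add: in_D_iff Pp_Dp Pm_Dp Pp_Dm Pm_Dm csubspace_zero[OF Dp(1)] csubspace_zero[OF Dm(1)])

lemma A_simps: "x \<in> D \<Longrightarrow> y \<in> D \<Longrightarrow> A (x + y) = A x + A y" "x \<in> D \<Longrightarrow> y \<in> D \<Longrightarrow> A (x - y) = A x - A y"
  "x \<in> D \<Longrightarrow> A (c *\<^sub>C x) = c *\<^sub>C A x" "x \<in> D \<Longrightarrow> A (- x) = - A x" "A 0 = 0"
  using clinear_onD[OF A_lin[folded D_def] csubspace_D] by blast+

lemma J_A_dissipative: "z \<in> D \<Longrightarrow> Re (cinner (J (A z)) z) \<le> 0"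
  using dissipative_inD(5)[OF J_diss[folded D_def]] by (simp add: J_def)

lemma dense_D: "z \<in> closure D"
  using dense by (simp add: D_def)

lemma dense_Dp:
  assumes "Pp g = g" "e > 0"
  obtains x where "x \<in> Dp" "norm (g - x) < e"
proof -
  obtain z where z: "z \<in> D" "dist z g < e" using dense_D[of g] assms(2) by (auto simp: closure_approachable)
  have "norm (g - Pp z) \<le> norm (g - z)" using norm_Pp_le[of "g - z"] assms(1) by (simp add: Pp_simps)
  then show ?thesis using that[of "Pp z"] z by (simp add: in_D_iff dist_norm norm_minus_commute)
qed

lemma dense_Dm:
  assumes "Pm g = g" "e > 0"
  obtains y where "y \<in> Dm" "norm (g - y) < e"
proof -
  obtain z where z: "z \<in> D" "dist z g < e" using dense_D[of g] assms(2) by (auto simp: closure_approachable)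
  have "norm (g - Pm z) \<le> norm (g - z)" using norm_Pm_le[of "g - z"] assms(1) by (simp add: Pm_simps)
  then show ?thesis using that[of "Pm z"] z by (simp add: in_D_iff dist_norm norm_minus_commute)
qed

lemma closed_csubspace_range_Pm: "closed_csubspace (range Pm)"
proof -
  have "closed {x. Pm x = x}"
    by (intro closed_Collect_eq continuous_intros bounded_linear.continuous_on[OF bounded_linear_Pm])
  moreover have "range Pm = {x. Pm x = x}" using in_range_Pm by blast
  ultimately have "closed (range Pm)" by (simp only:)
  then show ?thesis unfolding closed_csubspace_def using csubspace_range_Pm by (rule conjI[rotated])
qed

lemma A22_bound:
  assumes "y \<in> Dm"
  shows "- Re \<mu> * norm y \<le> norm (Pm (A y) - \<mu> *\<^sub>C y)"
proof -
  have d: "dissipative_in (range Pm) Dm (\<lambda>x. - Pm (A x))" using cond_i by (simp add: m_dissipative_in_def)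
  have "- Re \<mu> * norm y \<le> norm (- Pm (A y) - (- \<mu>) *\<^sub>C y)"
    using dissipative_lower_bound[OF dissipative_inD(5)[OF d assms], of "- \<mu>"] by simp
  also have "- Pm (A y) - (- \<mu>) *\<^sub>C y = - (Pm (A y) - \<mu> *\<^sub>C y)" by simp
  finally show ?thesis by (simp only: norm_minus_cancel)
qed

text \<open>Composition with \<open>Pm\<close> turns the resolvent in \<open>H\<^sup>-\<close> into
  an operator on the whole space, zero on \<open>H\<^sup>+\<close>.\<close>

definition R :: "complex \<Rightarrow> 'a \<Rightarrow> 'a" where
  "R \<mu> y = resolvent_op Dm (\<lambda>z. Pm (A z)) \<mu> (Pm y)"

lemma R_unique:
  assumes "Re \<mu> < 0" "x \<in> Dm" "y \<in> Dm" "Pm (A x) - \<mu> *\<^sub>C x = Pm (A y) - \<mu> *\<^sub>C y"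
  shows "x = y"
proof -
  have "Pm (A (x - y)) - \<mu> *\<^sub>C (x - y) = 0"
    using assms by (simp add: A_simps Dm_D Pm_simps algebra_simps)
  then have "- Re \<mu> * norm (x - y) \<le> 0" using A22_bound[OF csubspace_diff[OF Dm(1) assms(2,3)], of \<mu>] by simp
  then show ?thesis using assms(1) by (simp add: zero_le_mult_iff)
qed

lemma R_eqI:
  assumes "Re \<mu> < 0" "x \<in> Dm" "Pm (A x) - \<mu> *\<^sub>C x = Pm y"
  shows "R \<mu> y = x"
  unfolding R_def resolvent_op_def
proof (rule the_equality)
  show "x \<in> Dm \<and> Pm (A x) - \<mu> *\<^sub>C x = Pm y" using assms by simp
  show "x' = x" if "x' \<in> Dm \<and> Pm (A x') - \<mu> *\<^sub>C x' = Pm y" for x'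
    using R_unique[OF assms(1), of x' x] that assms by simp
qed

lemma R_props:
  assumes "Re \<mu> < 0"
  shows R_in: "R \<mu> y \<in> Dm" and R_eq: "Pm (A (R \<mu> y)) - \<mu> *\<^sub>C R \<mu> y = Pm y"
proof -
  have "range Pm \<subseteq> closure Dm"
  proof
    fix g assume "g \<in> range Pm"
    then have "Pm g = g" by (simp add: in_range_Pm)
    then show "g \<in> closure Dm"
      unfolding closure_approachable using dense_Dm by (metis dist_norm norm_minus_commute)
  qed
  then obtain x where x: "x \<in> Dm" "- Pm (A x) - (- \<mu>) *\<^sub>C x = - Pm y"
  proof (rule m_dissipative_range[OF closed_csubspace_range_Pm cond_i])
    show "0 < Re (- \<mu>)" using assms by simp
    show "- Pm y \<in> range Pm" by (rule csubspace_neg[OF csubspace_range_Pm rangeI])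
  qed blast+
  have "- (Pm (A x) - \<mu> *\<^sub>C x) = - Pm y" using x(2) by simp
  then have "Pm (A x) - \<mu> *\<^sub>C x = Pm y" by (simp only: neg_equal_iff_equal)
  then have "R \<mu> y = x" using R_eqI[OF assms x(1)] by blast
  then show "R \<mu> y \<in> Dm" "Pm (A (R \<mu> y)) - \<mu> *\<^sub>C R \<mu> y = Pm y"
    using x(1) \<open>Pm (A x) - \<mu> *\<^sub>C x = Pm y\<close> by simp_all
qed

lemma R_cancel:
  assumes "Re \<mu> < 0" "x \<in> Dm"
  shows "R \<mu> (Pm (A x) - \<mu> *\<^sub>C x) = x"
  by (rule R_eqI[OF assms]) (simp add: Pm_simps Pm_Dm assms)

lemma R_Pm: "R \<mu> (Pm y) = R \<mu> y"
  by (simp add: R_def)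

lemma R_D: "Re \<mu> < 0 \<Longrightarrow> R \<mu> y \<in> D"
  by (simp add: Dm_D R_in)

lemma clinear_R:
  assumes "Re \<mu> < 0"
  shows "clinear_map (R \<mu>)"
proof (rule clinear_mapI)
  note m = R_in[OF assms]
  show "R \<mu> (x + y) = R \<mu> x + R \<mu> y" for x y
    using R_eq[OF assms, of x] R_eq[OF assms, of y]
    by (intro R_eqI[OF assms] csubspace_add[OF Dm(1)] m)
      (simp add: A_simps R_D assms Pm_simps scaleC_add_right algebra_simps)
  show "R \<mu> (c *\<^sub>C x) = c *\<^sub>C R \<mu> x" for c x
  proof (intro R_eqI[OF assms] csubspace_scale[OF Dm(1)] m)
    have "Pm (A (c *\<^sub>C R \<mu> x)) - \<mu> *\<^sub>C c *\<^sub>C R \<mu> x = c *\<^sub>C (Pm (A (R \<mu> x)) - \<mu> *\<^sub>C R \<mu> x)"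
      by (simp add: A_simps R_D assms Pm_simps cvs.scale_right_diff_distrib mult.commute)
    then show "Pm (A (c *\<^sub>C R \<mu> x)) - \<mu> *\<^sub>C c *\<^sub>C R \<mu> x = Pm (c *\<^sub>C x)"
      by (simp add: R_eq[OF assms] Pm_simps)
  qed
qed

lemma norm_R_le:
  assumes "Re \<mu> < 0"
  shows "norm (R \<mu> y) \<le> norm (Pm y) / (- Re \<mu>)"
  using A22_bound[OF R_in[OF assms], of \<mu> y] assms unfolding R_eq[OF assms]
  by (simp add: field_simps)

lemma norm_R_le': "Re \<mu> < 0 \<Longrightarrow> norm (R \<mu> y) \<le> (1 / (- Re \<mu>)) * norm y"
  using norm_R_le[of \<mu> y] divide_right_mono[OF norm_Pm_le[of y], of "- Re \<mu>"] by simp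

definition F :: "complex \<Rightarrow> 'a \<Rightarrow> 'a" where "F \<mu> x = R \<mu> (A x)"
definition G :: "complex \<Rightarrow> 'a \<Rightarrow> 'a" where "G \<mu> y = Pp (A (R \<mu> y))"
definition S :: "complex \<Rightarrow> 'a \<Rightarrow> 'a" where "S \<mu> x = Pp (A (x - F \<mu> x))"

lemma F_in: "Re \<mu> < 0 \<Longrightarrow> F \<mu> x \<in> Dm" and F_D: "Re \<mu> < 0 \<Longrightarrow> F \<mu> x \<in> D"
  by (simp_all add: F_def R_in R_D)

lemma Pp_G [simp]: "Pp (G \<mu> y) = G \<mu> y" and Pp_S [simp]: "Pp (S \<mu> y) = S \<mu> y"
  and Pm_G [simp]: "Pm (G \<mu> y) = 0" and Pm_S [simp]: "Pm (S \<mu> y) = 0"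
  by (simp_all add: G_def S_def)

lemma clinear_G: "Re \<mu> < 0 \<Longrightarrow> clinear_map (G \<mu>)"
  unfolding G_def
  by (rule clinear_mapI)
    (simp_all add: clinear_mapD(1,2)[OF clinear_R] A_simps R_D Pp_simps)

lemma F_simps:
  assumes "Re \<mu> < 0" "x \<in> Dp" "y \<in> Dp"
  shows "F \<mu> (x + y) = F \<mu> x + F \<mu> y" "F \<mu> (x - y) = F \<mu> x - F \<mu> y" "F \<mu> (c *\<^sub>C x) = c *\<^sub>C F \<mu> x"
  using assms by (simp_all add: F_def A_simps Dp_D clinear_mapD(1,2,4)[OF clinear_R[OF assms(1)]])

lemma S_simps:
  assumes "Re \<mu> < 0" "x \<in> Dp" "y \<in> Dp"
  shows "S \<mu> (x + y) = S \<mu> x + S \<mu> y" "S \<mu> (x - y) = S \<mu> x - S \<mu> y" "S \<mu> (c *\<^sub>C x) = c *\<^sub>C S \<mu> x"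
proof -
  note 1 = csubspace_diff[OF csubspace_D] Dp_D F_D assms
  have "x + y - (F \<mu> x + F \<mu> y) = (x - F \<mu> x) + (y - F \<mu> y)"
    "x - y - (F \<mu> x - F \<mu> y) = (x - F \<mu> x) - (y - F \<mu> y)"
    "c *\<^sub>C x - c *\<^sub>C F \<mu> x = c *\<^sub>C (x - F \<mu> x)" by (simp_all add: cvs.scale_right_diff_distrib)
  then show "S \<mu> (x + y) = S \<mu> x + S \<mu> y" "S \<mu> (x - y) = S \<mu> x - S \<mu> y" "S \<mu> (c *\<^sub>C x) = c *\<^sub>C S \<mu> x"
    unfolding S_def F_simps[OF assms] by (simp_all only: A_simps(1-3) 1 Pp_simps)
qed

text \<open>Block elimination. From \<open>q = A21 x + (A22 - \<mu>) y\<close> one gets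
  \<open>y = R q - F x\<close>, so the upper row becomes \<open>A11 x - A12 F x + A12 R q\<close>.
  The unbounded blocks are afterwards touched only through these two identities.\<close>

lemma A_parts:
  assumes mu: "Re \<mu> < 0" and x: "x \<in> Dp" and y: "y \<in> Dm"
  defines "q \<equiv> Pm (A (x + y)) - \<mu> *\<^sub>C y"
  shows A_parts_R: "y + F \<mu> x = R \<mu> q" and A_parts_Pp: "Pp (A (x + y)) = S \<mu> x + G \<mu> q"
proof -
  have "Pm (A (F \<mu> x)) - \<mu> *\<^sub>C F \<mu> x = Pm (A x)" unfolding F_def by (rule R_eq[OF mu])
  then have "Pm (A (y + F \<mu> x)) - \<mu> *\<^sub>C (y + F \<mu> x) = Pm q"
    using x y F_D[OF mu] by (simp add: q_def A_simps Dp_D Dm_D Pm_simps Pm_Dm scaleC_add_right algebra_simps)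
  then show w: "y + F \<mu> x = R \<mu> q"
    using R_eqI[OF mu csubspace_add[OF Dm(1) y F_in[OF mu]]] by simp
  have "x + y = (x - F \<mu> x) + R \<mu> q" unfolding w[symmetric] by simp
  moreover have "A ((x - F \<mu> x) + R \<mu> q) = A (x - F \<mu> x) + A (R \<mu> q)"
    using x by (intro A_simps(1) csubspace_diff[OF csubspace_D] Dp_D F_D[OF mu] R_D[OF mu])
  ultimately have "A (x + y) = A (x - F \<mu> x) + A (R \<mu> q)" by (simp only:)
  then show "Pp (A (x + y)) = S \<mu> x + G \<mu> q" by (simp add: S_def G_def Pp_simps)
qed

lemma Pm_A_diff_F:
  assumes "Re \<mu> < 0" "x \<in> Dp"
  shows "Pm (A (x - F \<mu> x)) = - (\<mu> *\<^sub>C F \<mu> x)"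
  using R_eq[OF assms(1), of "A x"] assms
  by (simp add: A_simps Dp_D F_D Pm_simps) (simp add: F_def algebra_simps)

text \<open>Test \<open>J\<close>-dissipativity of \<open>A\<close> on \<open>x - F x\<close>, where
  the lower row of \<open>A\<close> is \<open>- \<mu> F x\<close>: the form equals
  \<open>(S x, x) - \<mu> |F x|^2\<close>, and \<open>Re \<mu> < 0\<close>.\<close>

lemma S_dissipative:
  assumes "Re \<mu> < 0" "x \<in> Dp"
  shows "Re (cinner (S \<mu> x) x) \<le> 0"
proof -
  let ?z = "x - F \<mu> x"
  have z: "?z \<in> D" using assms by (simp add: csubspace_diff[OF csubspace_D] Dp_D F_D)
  have "cinner (J (A ?z)) ?z = cinner (S \<mu> x) x - \<mu> * cinner (F \<mu> x) (F \<mu> x)"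
    unfolding cinner_J_split Pm_A_diff_F[OF assms] S_def[symmetric]
    using Pp_Dp[OF assms(2)] Pm_Dp[OF assms(2)] Pm_Dm[OF F_in[OF assms(1)]] Pp_Dm[OF F_in[OF assms(1)]]
    by (simp add: Pp_simps Pm_simps cinner_simps S_def)
  then have "Re (cinner (S \<mu> x) x) \<le> Re (\<mu> * of_real ((norm (F \<mu> x))\<^sup>2))"
    using J_A_dissipative[OF z] by (simp only: cinner_self minus_complex.sel)
  also have "\<dots> = Re \<mu> * (norm (F \<mu> x))\<^sup>2" by simp
  also have "\<dots> \<le> 0" using assms(1) by (simp add: mult_nonpos_nonneg)
  finally show ?thesis .
qed

lemma R_resolvent_identity:
  assumes "Re \<mu> < 0" "Re \<nu> < 0"
  shows "R \<mu> y = R \<nu> (y + (\<mu> - \<nu>) *\<^sub>C R \<mu> y)"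
proof (rule R_eqI[OF assms(2) R_in[OF assms(1)], symmetric])
  show "Pm (A (R \<mu> y)) - \<nu> *\<^sub>C R \<mu> y = Pm (y + (\<mu> - \<nu>) *\<^sub>C R \<mu> y)"
    using R_eq[OF assms(1), of y] Pm_Dm[OF R_in[OF assms(1)], of y]
    by (simp add: Pm_simps cvs.scale_left_diff_distrib algebra_simps)
qed

text \<open>It carries compactness from the one \<open>\<mu>\<close> of condition (iii) to every
  point of the left half-plane, and it is the source of the decay of \<open>G\<close>.\<close>

lemma G_resolvent_identity:
  assumes "Re \<mu> < 0" "Re \<nu> < 0"
  shows "G \<mu> y = G \<nu> (y + (\<mu> - \<nu>) *\<^sub>C R \<mu> y)"
  unfolding G_def using R_resolvent_identity[OF assms, of y] by simp

lemma G_compact: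
  assumes mu: "Re \<mu> < 0"
  obtains C where "compact C" "\<And>y. norm y \<le> r \<Longrightarrow> G \<mu> y \<in> C"
proof -
  obtain \<nu> where nu: "Re \<nu> < 0"
    and cpt: "compact_op_on (range Pm) (\<lambda>y. Pp (A (resolvent_op Dm (\<lambda>z. Pm (A z)) \<nu> y)))"
    using cond_iii by blast
  define r' where "r' = r + cmod (\<mu> - \<nu>) * (1 / (- Re \<mu>) * r)"
  let ?B = "range Pm \<inter> cball 0 r'"
  let ?g = "\<lambda>y. Pp (A (resolvent_op Dm (\<lambda>z. Pm (A z)) \<nu> y))"
  show ?thesis
  proof (rule that)
    show "compact (closure (?g ` ?B))" using cpt unfolding compact_op_on_def by blast
    fix y :: 'a assume y: "norm y \<le> r"
    define w where "w = y + (\<mu> - \<nu>) *\<^sub>C R \<mu> y"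
    have "norm (R \<mu> y) \<le> 1 / (- Re \<mu>) * r"
      using norm_R_le'[OF mu, of y] mult_left_mono[OF y, of "1 / (- Re \<mu>)"] mu by (simp add: divide_nonneg_neg)
    then have "norm w \<le> r'"
      unfolding w_def r'_def using norm_triangle_ineq[of y "(\<mu> - \<nu>) *\<^sub>C R \<mu> y"] y
        mult_left_mono[of "norm (R \<mu> y)" "1 / (- Re \<mu>) * r" "cmod (\<mu> - \<nu>)"]
      by (simp add: norm_scaleC)
    then have b: "Pm w \<in> ?B" using norm_Pm_le[of w] by simp
    have a: "G \<mu> y = ?g (Pm w)"
      using G_resolvent_identity[OF mu nu, of y] by (simp add: w_def G_def R_def)
    show "G \<mu> y \<in> closure (?g ` ?B)" by (rule subsetD[OF closure_subset], rule image_eqI[of _ ?g "Pm w" ?B, OF a b])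
  qed
qed

lemma G_bounded:
  assumes mu: "Re \<mu> < 0"
  obtains C where "C \<ge> 0" "\<And>y. norm (G \<mu> y) \<le> C * norm y"
proof -
  obtain K where K: "compact K" "\<And>y. norm y \<le> 1 \<Longrightarrow> G \<mu> y \<in> K" using G_compact[OF mu, of 1] by blast
  obtain C where C: "\<And>x. x \<in> K \<Longrightarrow> norm x \<le> C" using compact_imp_bounded[OF K(1)] by (auto simp: bounded_iff)
  have C0: "C \<ge> 0" using C[OF K(2)[of 0]] norm_ge_zero order_trans by (metis norm_zero zero_le_one)
  have "norm (G \<mu> y) \<le> C * norm y" for y
  proof (cases "y = 0")
    case True
    then show ?thesis by (simp add: clinear_map_zero[OF clinear_G[OF mu]])
  next
    case False
    have "norm (G \<mu> ((1 / norm y) *\<^sub>R y)) \<le> C" using False by (intro C K(2)) simp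
    then show ?thesis using False by (simp add: clinear_map_scaleR[OF clinear_G[OF mu]] divide_le_eq mult.commute)
  qed
  then show ?thesis using that C0 by blast
qed

text \<open>Boundedness has to be asked for: along a general filter, unlike for sequences, weak
  convergence does not imply it.\<close>

lemma G_weak_to_norm:
  assumes mu: "Re \<mu> < 0" and U: "ultra U" and w: "weak_lim f l U" and b: "eventually (\<lambda>i. norm (f i) \<le> r) U"
  shows "((\<lambda>i. G \<mu> (f i)) \<longlongrightarrow> G \<mu> l) U"
proof -
  obtain C where C: "\<And>y. norm (G \<mu> y) \<le> C * norm y" using G_bounded[OF mu] by blast
  obtain K where K: "compact K" "\<And>y. norm y \<le> r \<Longrightarrow> G \<mu> y \<in> K" using G_compact[OF mu, of r] by blast
  show ?thesis
  proof (rule weak_lim_compact[OF U _ K(1)])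
    show "weak_lim (\<lambda>i. G \<mu> (f i)) (G \<mu> l) U" by (rule weak_lim_clinear[OF clinear_G[OF mu] C w])
    show "eventually (\<lambda>i. G \<mu> (f i) \<in> K) U" using b by eventually_elim (rule K(2))
  qed
qed

text \<open>The operators \<open>n R(-n)\<close> are contractions, and on \<open>Dm\<close> the
  error is \<open>y - n R(-n) y = R(-n) A22 y\<close>, of order \<open>1/n\<close>; density of
  \<open>Dm\<close> does the rest. \<open>Suc n\<close> keeps the resolvent point in the left
  half-plane.\<close>

lemma mR_strong_limit:
  assumes "Pm g = g"
  shows "(\<lambda>n. of_real (real (Suc n)) *\<^sub>C R (- of_real (real (Suc n))) g) \<longlonglongrightarrow> g"
proof (rule LIMSEQ_I)
  fix e :: real assume e: "e > 0"
  let ?C = "\<lambda>n g. of_real (real (Suc n)) *\<^sub>C R (- of_real (real (Suc n))) g"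
  have mu: "Re (- of_real (real (Suc n))) < 0" for n by simp
  have contr: "norm (?C n h) \<le> norm h" for n h
  proof -
    have "norm (?C n h) = real (Suc n) * norm (R (- of_real (real (Suc n))) h)" by (simp only: norm_scaleC norm_of_real abs_of_nat)
    also have "\<dots> \<le> real (Suc n) * ((1 / real (Suc n)) * norm h)"
      using norm_R_le'[OF mu[of n], of h] by (intro mult_left_mono) (simp_all add: add.commute)
    also have "\<dots> = norm h" by (simp del: of_nat_Suc)
    finally show ?thesis .
  qed
  obtain y where y: "y \<in> Dm" "norm (g - y) < e / 4" using dense_Dm[OF assms, of "e / 4"] e by auto
  obtain N where N: "4 * norm (A y) / e < real N" using reals_Archimedean2 by blast
  have "norm (?C n g - g) < e" if n: "n \<ge> N" for n
  proof -
    have "y - ?C n y = R (- of_real (real (Suc n))) (Pm (A y))"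
    proof -
      have "y = R (- of_real (real (Suc n))) (Pm (A y) - (- of_real (real (Suc n))) *\<^sub>C y)"
        using R_cancel[OF mu[of n] y(1)] by simp
      also have "\<dots> = R (- of_real (real (Suc n))) (Pm (A y)) + ?C n y"
        by (simp only: clinear_mapD(2,4)[OF clinear_R[OF mu[of n]]]) (simp del: of_nat_Suc)
      finally show ?thesis by (simp only: diff_eq_eq)
    qed
    then have "norm (y - ?C n y) \<le> norm (A y) / real (Suc n)"
      using norm_R_le'[OF mu[of n], of "Pm (A y)"] norm_Pm_le[of "A y"] divide_right_mono[OF norm_Pm_le[of "A y"], of "real (Suc n)"]
      by (simp del: of_nat_Suc)
    also have "\<dots> < e / 4"
    proof -
      have "4 * norm (A y) / e < real (Suc n)" using N n by simp
      then show ?thesis using e by (simp add: field_simps del: of_nat_Suc)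
    qed
    finally have 1: "norm (y - ?C n y) < e / 4" .
    have "?C n (g - y) = ?C n g - ?C n y"
      by (simp only: clinear_mapD(4)[OF clinear_R[OF mu[of n]]] cvs.scale_right_diff_distrib)
    then have "?C n g - g = ?C n (g - y) - (y - ?C n y) - (g - y)"
      by (simp del: of_nat_Suc)
    then have "norm (?C n g - g) \<le> norm (?C n (g - y)) + norm (y - ?C n y) + norm (g - y)"
      using norm_triangle_ineq4[of "?C n (g - y) - (y - ?C n y)" "g - y"] norm_triangle_ineq4[of "?C n (g - y)" "y - ?C n y"]
      by (simp del: of_nat_Suc)
    then show ?thesis using contr[of n "g - y"] 1 y(2) e by linarith
  qed
  then show "\<exists>no. \<forall>n\<ge>no. norm (?C n g - g) < e" by blast
qed

end

section \<open>Finite sections\<close>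

text \<open>The defect form \<open>(x,y) - (C x, C y)\<close> of a contraction is
  semidefinite.\<close>

lemma contraction_Cauchy_Schwarz:
  fixes C :: "'a::cinner_space \<Rightarrow> 'a"
  assumes C: "clinear_map C" "\<And>x. norm (C x) \<le> norm x"
  shows "(cmod (cinner z g - cinner (C z) (C g)))\<^sup>2 \<le> ((norm z)\<^sup>2 - (norm (C z))\<^sup>2) * ((norm g)\<^sup>2 - (norm (C g))\<^sup>2)"
proof -
  have pos: "0 \<le> (norm x)\<^sup>2 - (norm (C x))\<^sup>2" for x using C(2)[of x] by simp
  have "(cmod (cinner g z - cinner (C g) (C z)))\<^sup>2 \<le> ((norm z)\<^sup>2 - (norm (C z))\<^sup>2) * ((norm g)\<^sup>2 - (norm (C g))\<^sup>2)"
  proof (rule semi_inner_Cauchy_Schwarz)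
    fix c
    have "(norm (z + c *\<^sub>C g))\<^sup>2 = (norm z)\<^sup>2 + 2 * Re (c * cinner g z) + (cmod c)\<^sup>2 * (norm g)\<^sup>2" for z g :: 'a
      by (subst norm_add_sq) (simp add: Re_cinner_commute[of z] cinner_scaleC_left norm_scaleC power_mult_distrib)
    from this[of z g] this[of "C z" "C g"] pos[of "z + c *\<^sub>C g"]
    show "0 \<le> (norm z)\<^sup>2 - (norm (C z))\<^sup>2 + 2 * Re (c * (cinner g z - cinner (C g) (C z)))
        + (cmod c)\<^sup>2 * ((norm g)\<^sup>2 - (norm (C g))\<^sup>2)"
      by (simp add: clinear_mapD(1,2)[OF C(1)] right_diff_distrib)
  qed (rule pos)+
  moreover have "cinner g z - cinner (C g) (C z) = cnj (cinner z g - cinner (C z) (C g))"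
    using cinner_commute[of g z] cinner_commute[of "C g" "C z"] by simp
  ultimately show ?thesis by (simp only: complex_mod_cnj)
qed

context j_dissipative
begin

text \<open>Otherwise unit vectors \<open>z n\<close> satisfy
  \<open>|G(\<mu> n) z n| > \<delta>\<close>. The resolvent identity rewrites these vectors as
  \<open>G(-1) (T n)\<close> with bounded \<open>T n\<close>. Once \<open>T n\<close> tends weakly
  to zero, compactness of \<open>G(-1)\<close> gives the contradiction.\<close>

lemma G_small:
  assumes "\<delta> > 0"
  obtains m :: real where "m > 0" "\<And>y. norm (G (- of_real m) y) \<le> \<delta> * norm y"
proof -
  have "\<exists>m>0. \<forall>y. norm (G (- of_real m) y) \<le> \<delta> * norm y"
  proof (rule ccontr)
    assume neg: "\<not> ?thesis"
    define \<mu> where "\<mu> n = - complex_of_real (real (Suc n))" for n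
    have mu: "Re (\<mu> n) < 0" for n by (simp add: \<mu>_def)
    have ex: "\<exists>z. Pm z = z \<and> norm z = 1 \<and> norm (G (\<mu> n) z) > \<delta>" for n
    proof -
      obtain y where y: "norm (G (\<mu> n) y) > \<delta> * norm y"
        using neg unfolding \<mu>_def by (metis not_le of_nat_0_less_iff zero_less_Suc)
      have GPm: "G (\<mu> n) (Pm y) = G (\<mu> n) y" by (simp add: G_def R_Pm)
      have "\<delta> * norm (Pm y) \<le> \<delta> * norm y" using assms norm_Pm_le by (intro mult_left_mono) auto
      then have less: "norm (G (\<mu> n) (Pm y)) > \<delta> * norm (Pm y)" using y GPm by simp
      then have nz: "norm (Pm y) > 0"
        using clinear_map_zero[OF clinear_G[OF mu[of n]]] by (cases "Pm y = 0") auto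
      define z where "z = (1 / norm (Pm y)) *\<^sub>R Pm y"
      have "norm (G (\<mu> n) z) = norm (G (\<mu> n) (Pm y)) / norm (Pm y)"
        by (simp add: z_def clinear_map_scaleR[OF clinear_G[OF mu[of n]]])
      also have "\<dots> > \<delta>" using less nz by (simp add: less_divide_eq)
      finally show ?thesis using nz by (intro exI[of _ z]) (simp add: z_def Pm_simps)
    qed
    then have "\<forall>n. \<exists>z. Pm z = z \<and> norm z = 1 \<and> norm (G (\<mu> n) z) > \<delta>" by blast
    from choice[OF this] obtain z where z: "\<And>n. Pm (z n) = z n" "\<And>n. norm (z n) = 1" "\<And>n. norm (G (\<mu> n) (z n)) > \<delta>"
      by blast
    define C where "C n g = complex_of_real (real (Suc n)) *\<^sub>C R (\<mu> n) g" for n g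
    have linC: "clinear_map (C n)" for n
      unfolding C_def
      by (rule clinear_mapI)
        (simp_all add: clinear_mapD(1,2)[OF clinear_R[OF mu[of n]]] scaleC_add_right mult.commute del: of_nat_Suc)
    have normR: "norm (R (\<mu> n) h) \<le> (1 / real (Suc n)) * norm h" for n h
      using norm_R_le'[OF mu[of n], of h] by (simp add: \<mu>_def add.commute)
    have normC: "norm (C n h) \<le> norm h" for n h
    proof -
      have "norm (C n h) = real (Suc n) * norm (R (\<mu> n) h)" by (simp only: C_def norm_scaleC norm_of_real abs_of_nat)
      also have "\<dots> \<le> real (Suc n) * ((1 / real (Suc n)) * norm h)" by (intro mult_left_mono normR) simp
      also have "\<dots> = norm h" by (simp del: of_nat_Suc)
      finally show ?thesis .
    qed
    define T where "T n = z n - C n (z n) + R (\<mu> n) (z n)" for n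
    have GT: "G (\<mu> n) (z n) = G (-1) (T n)" for n
    proof -
      have "(\<mu> n - (-1)) *\<^sub>C R (\<mu> n) (z n) = R (\<mu> n) (z n) - C n (z n)"
        by (simp only: cvs.scale_left_diff_distrib \<mu>_def C_def) (simp add: scaleC_one del: of_nat_Suc)
      then have "z n + (\<mu> n - (-1)) *\<^sub>C R (\<mu> n) (z n) = T n" by (simp add: T_def)
      then show ?thesis using G_resolvent_identity[OF mu[of n], of "-1" "z n"] by simp
    qed
    have normT: "norm (T n) \<le> 3" for n
    proof -
      have "norm (R (\<mu> n) (z n)) \<le> 1"
        using normR[of n "z n"] z(2)[of n] by (simp add: divide_le_eq order_trans)
      then show ?thesis
        unfolding T_def using norm_triangle_ineq[of "z n - C n (z n)" "R (\<mu> n) (z n)"]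
          norm_triangle_ineq4[of "z n" "C n (z n)"] normC[of n "z n"] z(2)[of n] by linarith
    qed
    have weakT: "weak_lim T 0 sequentially"
      unfolding weak_lim_def
    proof
      fix g0
      define g where "g = Pm g0"
      have g: "Pm g = g" by (simp add: g_def)
      have "Pm (T n) = T n" for n
        by (simp add: T_def C_def Pm_simps z Pm_Dm[OF R_in[OF mu]])
      then have Tg: "cinner (T n) g0 = cinner (T n) g" for n
        using Pm_sa[of "T n" g0] by (simp add: g_def)
      have limC: "(\<lambda>n. C n g) \<longlonglongrightarrow> g" using mR_strong_limit[OF g] by (simp only: C_def \<mu>_def)
      \<comment> \<open>Weak convergence of \<open>z n - C n (z n)\<close> concerns the adjoint of
        \<open>C n\<close>, while only \<open>C n g \<rightarrow> g\<close> is known. Comparing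
        \<open>(z,g)\<close> with \<open>(C z, C g)\<close> bridges this: the defect inequality
        bounds the difference by the root of \<open>|g|^2 - |C n g|^2\<close>, which tends to
        zero.\<close>
      have bound: "cmod (cinner (T n) g) \<le> sqrt ((norm g)\<^sup>2 - (norm (C n g))\<^sup>2) + norm (C n g - g) + (1 / real (Suc n)) * norm g" for n
      proof -
        have "cinner (T n) g = (cinner (z n) g - cinner (C n (z n)) (C n g)) + cinner (C n (z n)) (C n g - g)
            + cinner (R (\<mu> n) (z n)) g"
          by (simp add: T_def cinner_simps)
        then have "cmod (cinner (T n) g) \<le> cmod (cinner (z n) g - cinner (C n (z n)) (C n g))
            + cmod (cinner (C n (z n)) (C n g - g)) + cmod (cinner (R (\<mu> n) (z n)) g)"
          by (metis norm_triangle_ineq order_trans add_right_mono)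
        moreover have "cmod (cinner (z n) g - cinner (C n (z n)) (C n g)) \<le> sqrt ((norm g)\<^sup>2 - (norm (C n g))\<^sup>2)"
        proof (rule real_le_rsqrt)
          have "(cmod (cinner (z n) g - cinner (C n (z n)) (C n g)))\<^sup>2
              \<le> ((norm (z n))\<^sup>2 - (norm (C n (z n)))\<^sup>2) * ((norm g)\<^sup>2 - (norm (C n g))\<^sup>2)"
            by (rule contraction_Cauchy_Schwarz[OF linC normC])
          also have "\<dots> \<le> 1 * ((norm g)\<^sup>2 - (norm (C n g))\<^sup>2)"
            using z(2)[of n] normC[of n g] by (intro mult_right_mono) auto
          finally show "(cmod (cinner (z n) g - cinner (C n (z n)) (C n g)))\<^sup>2 \<le> (norm g)\<^sup>2 - (norm (C n g))\<^sup>2" by simp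
        qed
        moreover have "cmod (cinner (C n (z n)) (C n g - g)) \<le> norm (C n g - g)"
        proof -
          have "cmod (cinner (C n (z n)) (C n g - g)) \<le> norm (C n (z n)) * norm (C n g - g)" by (rule cinner_Cauchy_Schwarz)
          also have "\<dots> \<le> 1 * norm (C n g - g)" using normC[of n "z n"] z(2)[of n] by (intro mult_right_mono) auto
          finally show ?thesis by simp
        qed
        moreover have "cmod (cinner (R (\<mu> n) (z n)) g) \<le> (1 / real (Suc n)) * norm g"
        proof -
          have "cmod (cinner (R (\<mu> n) (z n)) g) \<le> norm (R (\<mu> n) (z n)) * norm g" by (rule cinner_Cauchy_Schwarz)
          also have "\<dots> \<le> (1 / real (Suc n)) * norm g"
            using normR[of n "z n"] z(2)[of n] by (intro mult_right_mono) auto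
          finally show ?thesis .
        qed
        ultimately show ?thesis by linarith
      qed
      have "(\<lambda>n. sqrt ((norm g)\<^sup>2 - (norm (C n g))\<^sup>2) + norm (C n g - g) + (1 / real (Suc n)) * norm g)
          \<longlonglongrightarrow> sqrt ((norm g)\<^sup>2 - (norm g)\<^sup>2) + norm (g - g) + 0 * norm g"
        using LIMSEQ_inverse_real_of_nat
        by (intro tendsto_add tendsto_mult tendsto_real_sqrt tendsto_diff tendsto_power tendsto_norm tendsto_const limC)
          (simp add: inverse_eq_divide)
      then have "(\<lambda>n. sqrt ((norm g)\<^sup>2 - (norm (C n g))\<^sup>2) + norm (C n g - g) + (1 / real (Suc n)) * norm g) \<longlonglongrightarrow> 0"
        by simp
      then have "(\<lambda>n. cinner (T n) g) \<longlonglongrightarrow> 0"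
        by (rule Lim_null_comparison[rotated]) (use bound in auto)
      then show "(\<lambda>n. cinner (T n) g0) \<longlonglongrightarrow> cinner 0 g0" by (simp add: Tg)
    qed
    obtain U where U: "U \<le> sequentially" "ultra U" using ultra_exists[of sequentially] by auto
    have wU: "weak_lim T 0 U" using weakT U(1) by (auto simp: weak_lim_def intro: tendsto_mono)
    have "((\<lambda>n. G (-1) (T n)) \<longlongrightarrow> G (-1) 0) U"
      by (rule G_weak_to_norm[OF _ U(2) wU, of _ 3]) (simp_all add: normT)
    then have "((\<lambda>n. norm (G (-1) (T n))) \<longlongrightarrow> 0) U"
      by (auto simp: clinear_map_zero[OF clinear_G] intro: tendsto_norm_zero)
    moreover have "eventually (\<lambda>n. \<delta> \<le> norm (G (-1) (T n))) U"
      by (intro always_eventually allI less_imp_le) (use z(3) GT in simp)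
    moreover have "U \<noteq> bot" using U(2) by (simp add: ultra_def)
    ultimately have "\<delta> \<le> 0" by (rule tendsto_lowerbound)
    then show False using assms by simp
  qed
  then show ?thesis using that by blast
qed

text \<open>The compression \<open>Ai\<close> of \<open>A - \<epsilon> J\<close> is still unbounded,
  but \<open>J Ai + \<epsilon>\<close> is dissipative, so its inverse \<open>B\<close> is bounded by
  \<open>1/\<epsilon>\<close>, and \<open>B\<close> is again \<open>J\<close>-dissipative. A graph
  invariant under \<open>B\<close> is invariant under \<open>Ai\<close> because the action of
  \<open>B\<close> on it is injective on a finite-dimensional space, hence onto.\<close>

lemma finite_section:
  assumes X: "finite X" "X \<subseteq> Dp" and eps: "\<epsilon> > 0"
  shows "\<exists>K. clinear_map K \<and> (\<forall>x. norm (K x) \<le> norm x) \<and> (\<forall>x. K (proj (onb X) x) = K x)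
    \<and> (\<forall>x. K x \<in> Dm) \<and> (\<forall>x\<in>cvs.span (onb X). Pm (A (x + K x)) + of_real \<epsilon> *\<^sub>C K x
        = K (proj (onb X) (A (x + K x)) - of_real \<epsilon> *\<^sub>C x))"
proof -
  define E where "E = onb X"
  have oE: "orthonormal E" and sE: "cvs.span E = cvs.span X"
    using orthonormal_onb[OF X(1)] span_onb[OF X(1)] by (simp_all add: E_def)
  have spanDp: "cvs.span E \<subseteq> Dp" unfolding sE using X(2) Dp(1) by (intro cvs.span_minimal) (auto simp: csubspace_iff)
  have EDp: "E \<subseteq> Dp" using spanDp cvs.span_superset by blast
  have EPp: "E \<subseteq> range Pp" using EDp Dp(2) by blast
  \<comment> \<open>The lower row of \<open>A - \<epsilon> J\<close> contains
    \<open>A22 + \<epsilon>\<close>, so this choice makes \<open>R \<mu>\<close> exactly the inverse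
    needed for the elimination.\<close>
  define \<mu> where "\<mu> = - complex_of_real \<epsilon>"
  have mu: "Re \<mu> < 0" using eps by (simp add: \<mu>_def)
  have finE: "finite E" using oE by (simp add: orthonormal_def)
  \<comment> \<open>The Schur complement of the compression; it is injective on the
    finite-dimensional span because \<open>S\<close> is dissipative and
    \<open>\<epsilon> > 0\<close>.\<close>
  define T where "T x = proj E (S \<mu> x) - of_real \<epsilon> *\<^sub>C x" for x
  note sp = csubspace_span[of E]
  note dim = cdim_le_span[OF finE order_refl]
  have T_lin: "clinear_on (cvs.span E) T"
    unfolding clinear_on_def
  proof (intro conjI ballI allI)
    fix x y assume "x \<in> cvs.span E" "y \<in> cvs.span E"
    then have "x \<in> Dp" "y \<in> Dp" using spanDp by auto
    then show "T (x + y) = T x + T y"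
      by (simp add: T_def S_simps(1)[OF mu] clinear_mapD(1)[OF clinear_proj] scaleC_add_right)
  next
    fix c x assume "x \<in> cvs.span E"
    then have "x \<in> Dp" using spanDp by auto
    then show "T (c *\<^sub>C x) = c *\<^sub>C T x"
      by (simp add: T_def S_simps(3)[OF mu _ csubspace_zero[OF Dp(1)]] clinear_mapD(2)[OF clinear_proj]
          cvs.scale_right_diff_distrib mult.commute)
  qed
  have T_im: "T ` cvs.span E \<subseteq> cvs.span E"
    by (auto simp: T_def intro!: csubspace_diff[OF sp] csubspace_scale[OF sp] proj_in_span)
  have T_inj: "x = 0" if x: "x \<in> cvs.span E" "T x = 0" for x
  proof -
    have "cinner (proj E (S \<mu> x)) x = cinner (S \<mu> x) x" using proj_span[OF oE x(1)] by (simp add: proj_selfadjoint)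
    then have "Re (cinner (proj E (S \<mu> x)) x) \<le> 0" using S_dissipative[OF mu] x(1) spanDp by auto
    from dissipative_lower_bound[OF this, of "of_real \<epsilon>"] have "\<epsilon> * norm x \<le> 0" using x(2) by (simp add: T_def)
    then show ?thesis using eps by (simp add: mult_le_0_iff)
  qed
  define Ai where "Ai w = proj E (A w) + Pm (A w) - of_real \<epsilon> *\<^sub>C J w" for w
  define Pr where "Pr z = proj E z + Pm z" for z
  have Pr_parts: "Pp (Pr z) = proj E z" "Pm (Pr z) = Pm z" for z
    using span_subset_Pp[OF EPp proj_in_span[of E z]] Pm_range_Pp by (simp_all add: Pr_def Pp_simps Pm_simps)
  have Ai_parts: "Pp (Ai w) = proj E (A w) - of_real \<epsilon> *\<^sub>C Pp w" "Pm (Ai w) = Pm (A w) + of_real \<epsilon> *\<^sub>C Pm w" for w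
    using span_subset_Pp[OF EPp proj_in_span[of E "A w"]] Pm_range_Pp by (simp_all add: Ai_def Pp_simps Pm_simps)
  define W where "W = {w \<in> D. Pp w \<in> cvs.span E}"
  have W: "csubspace W"
    unfolding csubspace_def W_def
    by (auto simp: Pp_simps csubspace_zero[OF csubspace_D] csubspace_zero[OF sp] csubspace_add[OF csubspace_D]
        csubspace_add[OF sp] csubspace_scale[OF csubspace_D] csubspace_scale[OF sp])
  have Ai_lin: "clinear_on W Ai"
    unfolding clinear_on_def
    by (auto simp: Ai_def W_def A_simps clinear_mapD(1,2)[OF clinear_proj] Pm_simps J_simps scaleC_add_right
        cvs.scale_right_diff_distrib mult.commute)
  have Ai_diss: "Re (cinner (J (Ai w) + of_real \<epsilon> *\<^sub>C w) w) \<le> 0" if "w \<in> W" for w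
  proof -
    have "cinner (proj E (A w)) (Pp w) = cinner (Pp (A w)) (Pp w)"
      using proj_span[OF oE, of "Pp w"] that by (simp add: W_def proj_selfadjoint Pp_sa)
    then have "cinner (J (Ai w)) w = cinner (J (A w)) w
        - of_real \<epsilon> * (cinner (Pp w) (Pp w) + cinner (Pm w) (Pm w))"
      unfolding cinner_J_split Ai_parts by (simp add: cinner_simps algebra_simps)
    also have "cinner (Pp w) (Pp w) + cinner (Pm w) (Pm w) = cinner w w"
      by (simp only: norm_sq_split[of w] cinner_self of_real_add)
    finally have "cinner (J (Ai w) + of_real \<epsilon> *\<^sub>C w) w = cinner (J (A w)) w" by (simp add: cinner_simps)
    then show ?thesis using J_A_dissipative that by (simp add: W_def)
  qed
  have Ai_lower: "\<epsilon> * norm w \<le> norm (Ai w)" if "w \<in> W" for w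
  proof -
    have "Re (of_real \<epsilon>) * norm w \<le> norm (J (Ai w) + of_real \<epsilon> *\<^sub>C w - of_real \<epsilon> *\<^sub>C w)"
      by (rule dissipative_lower_bound[OF Ai_diss[OF that]])
    then show ?thesis by simp
  qed
  have Ai_inj: "w = w'" if "w \<in> W" "w' \<in> W" "Ai w = Ai w'" for w w'
  proof -
    have "\<epsilon> * norm (w - w') \<le> norm (Ai (w - w'))" by (rule Ai_lower[OF csubspace_diff[OF W that(1,2)]])
    also have "Ai (w - w') = 0" using that clinear_on_diff[OF Ai_lin W that(1,2)] by simp
    finally show ?thesis using eps by (simp add: mult_le_0_iff)
  qed
  have ex: "\<exists>w. w \<in> W \<and> Ai w = Pr z" for z
  proof -
    define h where "h = Pm z"
    have mem: "proj E z - proj E (G \<mu> h) \<in> cvs.span E" by (intro csubspace_diff[OF sp] proj_in_span)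
    obtain x where x: "x \<in> cvs.span E" "T x = proj E z - proj E (G \<mu> h)"
      by (rule inj_imp_surj_on[OF sp T_lin T_im dim T_inj mem])
    have xDp: "x \<in> Dp" using x(1) spanDp by blast
    define y where "y = R \<mu> h - F \<mu> x"
    have y: "y \<in> Dm" unfolding y_def by (intro csubspace_diff[OF Dm(1)] R_in[OF mu] F_in[OF mu])
    define q where "q = Pm (A (x + y)) - \<mu> *\<^sub>C y"
    have "R \<mu> h = R \<mu> q" using A_parts_R[OF mu xDp y] by (simp add: y_def q_def)
    then have "Pm h = Pm q" using R_eq[OF mu, of h] R_eq[OF mu, of q] by simp
    then have qh: "q = h" using Pm_Dm[OF y] by (simp add: q_def h_def Pm_simps)
    have PmA: "Pm (A (x + y)) = h + \<mu> *\<^sub>C y" using qh by (simp add: q_def algebra_simps)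
    have "Pp (A (x + y)) = S \<mu> x + G \<mu> h" using A_parts_Pp[OF mu xDp y] qh by (simp add: q_def)
    then have "proj E (A (x + y)) = proj E (S \<mu> x) + proj E (G \<mu> h)"
      using proj_Pp[OF EPp, of "A (x + y)"] by (simp add: clinear_mapD(1)[OF clinear_proj])
    also have "\<dots> = proj E z + of_real \<epsilon> *\<^sub>C x" using x(2) by (simp add: T_def algebra_simps)
    finally have PpA: "proj E (A (x + y)) = proj E z + of_real \<epsilon> *\<^sub>C x" .
    have parts: "Pp (x + y) = x" "Pm (x + y) = y"
      using Pp_Dp[OF xDp] Pm_Dp[OF xDp] Pp_Dm[OF y] Pm_Dm[OF y] by (simp_all add: Pp_simps Pm_simps)
    have "x + y \<in> W" using add_in_D[OF xDp y] x(1) by (simp add: W_def parts)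
    moreover have "Ai (x + y) = Pr z"
      unfolding Ai_def Pr_def PpA PmA J_def parts by (simp add: h_def \<mu>_def algebra_simps)
    ultimately show ?thesis by blast
  qed
  define B where "B z = (SOME w. w \<in> W \<and> Ai w = Pr z)" for z
  have B: "B z \<in> W" "Ai (B z) = Pr z" for z using someI_ex[OF ex[of z]] unfolding B_def by blast+
  have B_eq: "B z = w" if "w \<in> W" "Ai w = Pr z" for z w using Ai_inj[OF B(1) that(1)] B(2) that(2) by simp
  have B_lin: "clinear_map B"
  proof (rule clinear_mapI)
    show "B (x + y) = B x + B y" for x y
      by (rule B_eq[OF csubspace_add[OF W B(1) B(1)]])
        (simp add: clinear_on_add[OF Ai_lin W B(1) B(1)] B(2) Pr_def Pm_simps clinear_mapD(1)[OF clinear_proj])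
    show "B (c *\<^sub>C x) = c *\<^sub>C B x" for c x
      by (rule B_eq[OF csubspace_scale[OF W B(1)]])
        (simp add: clinear_on_scale[OF Ai_lin W B(1)] B(2) Pr_def Pm_simps clinear_mapD(2)[OF clinear_proj] scaleC_add_right)
  qed
  have Pr_norm: "norm (Pr z) \<le> norm z" for z
  proof -
    have "norm (proj E z) \<le> norm (Pp z)" using norm_proj_le[OF oE, of "Pp z"] proj_Pp[OF EPp, of z] by simp
    then have "(norm (Pr z))\<^sup>2 \<le> (norm z)\<^sup>2" unfolding norm_sq_split[of "Pr z"] norm_sq_split[of z] Pr_parts by (simp add: power_mono)
    then show ?thesis by (simp add: abs_le_square_iff[symmetric])
  qed
  have B_norm: "norm (B z) \<le> (1 / \<epsilon>) * norm z" for z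
    using Ai_lower[OF B(1), of z] Pr_norm[of z] eps by (simp add: B(2) field_simps)
  have B_im: "Pp (B z) \<in> cvs.span E" for z using B(1)[of z] by (simp add: W_def)
  have B_diss: "Re (cinner (J (B z)) z) \<le> 0" if "Pp z \<in> cvs.span E" for z
  proof -
    have "Pr z = z" using proj_Pp[OF EPp, of z] proj_span[OF oE that] Pp_Pm_add[of z] by (simp add: Pr_def)
    then have "cinner (J (B z)) z = cinner (B z) (J (Ai (B z)))" by (simp add: J_sa B(2))
    then have "Re (cinner (J (B z)) z) = Re (cinner (J (Ai (B z))) (B z))" by (simp add: Re_cinner_commute[of "B z"])
    moreover have "0 \<le> \<epsilon> * (norm (B z))\<^sup>2" using eps by simp
    ultimately show ?thesis using Ai_diss[OF B(1), of z] by (simp add: cinner_simps cinner_self)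
  qed
  have "\<exists>K. clinear_map K \<and> (\<forall>x. norm (K x) \<le> norm x) \<and> (\<forall>x. K (proj E x) = K x) \<and> (\<forall>x. Pm (K x) = K x)
    \<and> (\<forall>x\<in>cvs.span E. Pm (B (x + K x)) = K (Pp (B (x + K x))))"
    by (rule bounded_pontryagin[OF oE EPp B_lin B_norm B_im B_diss])
  then obtain K where K: "clinear_map K" "\<And>x. norm (K x) \<le> norm x" "\<And>x. K (proj E x) = K x" "\<And>x. Pm (K x) = K x"
    "\<And>x. x \<in> cvs.span E \<Longrightarrow> Pm (B (x + K x)) = K (Pp (B (x + K x)))"
    by (elim exE conjE) (metis (no_types, lifting))
  have PpK: "Pp (K x) = 0" for x using Pp_range_Pm[OF K(4)] .
  \<comment> \<open>The action of \<open>B\<close> on the graph of \<open>K\<close>, transported to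
    \<open>span E\<close>.\<close>
  define M where "M x = Pp (B (x + K x))" for x
  have M_lin: "clinear_on (cvs.span E) M"
    unfolding clinear_on_def
  proof (intro conjI ballI allI)
    fix x y
    have "x + y + K (x + y) = (x + K x) + (y + K y)" by (simp add: clinear_mapD(1)[OF K(1)])
    then show "M (x + y) = M x + M y" by (simp only: M_def clinear_mapD(1)[OF B_lin] Pp_simps)
  next
    fix c x
    have "c *\<^sub>C x + K (c *\<^sub>C x) = c *\<^sub>C (x + K x)" by (simp add: clinear_mapD(2)[OF K(1)] scaleC_add_right)
    then show "M (c *\<^sub>C x) = c *\<^sub>C M x" by (simp only: M_def clinear_mapD(2)[OF B_lin] Pp_simps)
  qed
  have M_im: "M ` cvs.span E \<subseteq> cvs.span E" using B_im by (auto simp: M_def)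
  have Pr_graph: "Pr (x + K x) = x + K x" if "x \<in> cvs.span E" for x
    using that K(4)[of x] Pm_range_Pp[OF span_subset_Pp[OF EPp that]] proj_span[OF oE that] orth_span_Pp[OF EPp, of "K x"]
    by (simp add: Pr_def Pm_simps clinear_mapD(1)[OF clinear_proj])
  have M_inj: "x = 0" if x: "x \<in> cvs.span E" "M x = 0" for x
  proof -
    have "Pm (B (x + K x)) = 0" using K(5)[OF x(1)] x(2) by (simp add: M_def clinear_map_zero[OF K(1)])
    then have "B (x + K x) = 0" using x(2) Pp_Pm_add[of "B (x + K x)"] by (simp add: M_def)
    then have "x + K x = 0" using B(2)[of "x + K x"] clinear_on_zero[OF Ai_lin W] Pr_graph[OF x(1)] by simp
    then have "Pp (x + K x) = 0" by (simp add: Pp_simps)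
    then show ?thesis by (simp add: Pp_simps PpK span_subset_Pp[OF EPp x(1)])
  qed
  have graph: "K x \<in> Dm \<and> Pm (A (x + K x)) + of_real \<epsilon> *\<^sub>C K x = K (proj E (A (x + K x)) - of_real \<epsilon> *\<^sub>C x)"
    if x: "x \<in> cvs.span E" for x
  proof -
    obtain x' where x': "x' \<in> cvs.span E" "M x' = x" by (rule inj_imp_surj_on[OF sp M_lin M_im dim M_inj x])
    have "B (x' + K x') = x + K x" using Pp_Pm_add[of "B (x' + K x')"] K(5)[OF x'(1)] x'(2) by (simp add: M_def)
    then have w: "x + K x \<in> W" "Ai (x + K x) = x' + K x'"
      using B[of "x' + K x'"] Pr_graph[OF x'(1)] by simp_all
    have parts: "Pp (z + K z) = z" "Pm (z + K z) = K z" if "z \<in> cvs.span E" for z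
      using span_subset_Pp[OF EPp that] Pm_range_Pp[OF span_subset_Pp[OF EPp that]] K(4)[of z] PpK[of z]
      by (simp_all add: Pp_simps Pm_simps)
    have "K x \<in> Dm" using w(1) parts[OF x] by (simp add: W_def in_D_iff)
    moreover have "proj E (A (x + K x)) - of_real \<epsilon> *\<^sub>C x = x'"
      using Ai_parts(1)[of "x + K x"] parts[OF x] parts[OF x'(1)] w(2) by simp
    moreover have "Pm (A (x + K x)) + of_real \<epsilon> *\<^sub>C K x = K x'"
      using Ai_parts(2)[of "x + K x"] parts[OF x] parts[OF x'(1)] w(2) by simp
    ultimately show ?thesis by simp
  qed
  have "K x \<in> Dm" for x using graph[OF proj_in_span[of E x]] K(3) by simp
  then show ?thesis
    using K(1-3) graph unfolding E_def[symmetric] by blast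
qed

end

section \<open>The limit of the angular operators\<close>

lemma solve_contraction:
  fixes T :: "'a::{cinner_space, complete_space} \<Rightarrow> 'a"
  assumes "0 \<le> c" "c < 1" "\<And>x y. norm (T x - T y) \<le> c * norm (x - y)"
  obtains v where "v + T v = g"
proof -
  have "dist (g - T x) (g - T y) \<le> c * dist x y" for x y
    using assms(3)[of x y] by (simp add: dist_norm norm_minus_commute)
  then have "\<exists>!x. g - T x = x" using banach_fix_type[OF assms(1,2), of "\<lambda>x. g - T x"] by blast
  then obtain x where "g - T x = x" by blast
  then have "x + T x = g" by (simp add: diff_eq_eq)
  then show ?thesis by (rule that)
qed

lemma Cauchy_if_lower_bound:
  fixes s :: "nat \<Rightarrow> 'a::{cinner_space, complete_space}" and f :: "nat \<Rightarrow> 'b::cinner_space"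
  assumes "c > 0" "\<And>i j. c * norm (s i - s j) \<le> norm (f i - f j)" "convergent f"
  obtains l where "s \<longlonglongrightarrow> l"
proof -
  have "Cauchy s"
  proof (rule metric_CauchyI)
    fix e :: real assume "0 < e"
    then obtain N where N: "\<And>i j. i \<ge> N \<Longrightarrow> j \<ge> N \<Longrightarrow> dist (f i) (f j) < c * e"
      using metric_CauchyD[OF convergent_Cauchy[OF assms(3)], of "c * e"] assms(1) by auto
    have "dist (s i) (s j) < e" if "i \<ge> N" "j \<ge> N" for i j
    proof -
      have "c * norm (s i - s j) < c * e" using N[OF that] assms(2)[of i j] by (simp add: dist_norm)
      then show ?thesis using assms(1) by (simp add: dist_norm)
    qed
    then show "\<exists>M. \<forall>i\<ge>M. \<forall>j\<ge>M. dist (s i) (s j) < e" by blast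
  qed
  then show ?thesis using that by (auto simp: Cauchy_convergent_iff convergent_def)
qed

context krein
begin

text \<open>If a nonnegative \<open>L'\<close> contains the graph and a vector \<open>z\<close>, it
  contains the difference of \<open>z\<close> and the graph point over \<open>Pp z\<close>. This
  lies in \<open>H\<^sup>-\<close>, so nonnegativity makes it zero.\<close>

lemma graph_max_nonneg:
  assumes K: "clinear_map K" "\<And>x. norm (K x) \<le> norm x" "\<And>x. Pm (K x) = K x"
  shows "max_nonneg_subspace J {z. Pm z = K (Pp z)}"
  unfolding max_nonneg_subspace_def nonneg_subspace_def closed_csubspace_def
proof (intro conjI allI impI ballI)
  let ?L = "{z. Pm z = K (Pp z)}"
  have blK: "bounded_linear K" by (rule bounded_linear_if_clinear[OF K(1), of 1]) (simp add: K(2))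
  show "csubspace ?L"
    unfolding csubspace_def by (auto simp: Pp_simps Pm_simps clinear_mapD(1,2,5)[OF K(1)])
  show "closed ?L"
    by (intro closed_Collect_eq continuous_intros bounded_linear.continuous_on[OF bounded_linear_Pm]
        bounded_linear.continuous_on[OF blK] bounded_linear.continuous_on[OF bounded_linear_Pp])
  show "0 \<le> Re (cinner (J z) z)" if "z \<in> ?L" for z
    using that K(2)[of "Pp z"] by (simp add: Re_J power_mono)
  fix L' assume "(csubspace L' \<and> closed L') \<and> (\<forall>x\<in>L'. 0 \<le> Re (cinner (J x) x))" and LL': "?L \<subseteq> L'"
  then have L': "csubspace L'" "\<And>x. x \<in> L' \<Longrightarrow> 0 \<le> Re (cinner (J x) x)" by auto
  have "z \<in> ?L" if z: "z \<in> L'" for z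
  proof -
    define w where "w = Pp z + K (Pp z)"
    have w: "Pp w = Pp z" "Pm w = K (Pp z)"
      using Pp_range_Pm[OF K(3)] by (simp_all add: w_def Pp_simps Pm_simps K(3))
    have "w \<in> ?L" by (simp add: w)
    then have "z - w \<in> L'" using csubspace_diff[OF L'(1) z] LL' by blast
    from L'(2)[OF this] have "Pm (z - w) = 0" by (simp add: Re_J Pp_simps w)
    then show ?thesis by (simp add: Pm_simps w)
  qed
  then show "L' = ?L" using LL' by blast
qed

end

section \<open>The closure of \<open>A\<close> and its relation to \<open>S\<close>\<close>

context j_dissipative
begin

text \<open>Dissipativity at \<open>u + c s n\<close> gives in the limit
  \<open>Re (J A u, u) + Re (c (J w, u)) \<le> 0\<close> for all complex \<open>c\<close>. The
  linear term must vanish, so \<open>J w\<close> is orthogonal to the dense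
  \<open>D\<close>.\<close>

lemma A_closable:
  assumes s: "\<And>n. s n \<in> D" "s \<longlonglongrightarrow> 0" "(\<lambda>n. A (s n)) \<longlonglongrightarrow> w"
  shows "w = 0"
proof -
  have orth: "cinner (J w) u = 0" if u: "u \<in> D" for u
  proof (rule Re_affine_bounded_imp_zero)
    fix c
    have "Re (cinner (J (A u + c *\<^sub>C w)) (u + c *\<^sub>C 0)) \<le> 0"
    proof (rule LIMSEQ_le_const2)
      show "(\<lambda>n. Re (cinner (J (A u + c *\<^sub>C A (s n))) (u + c *\<^sub>C s n))) \<longlonglongrightarrow> Re (cinner (J (A u + c *\<^sub>C w)) (u + c *\<^sub>C 0))"
        by (intro tendsto_Re tendsto_cinner bounded_linear.tendsto[OF bounded_linear_J] tendsto_add tendsto_scaleC tendsto_const s)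
      have "A (u + c *\<^sub>C s n) = A u + c *\<^sub>C A (s n)" for n
        using u s(1) by (simp add: A_simps csubspace_scale[OF csubspace_D])
      then show "\<exists>N. \<forall>n\<ge>N. Re (cinner (J (A u + c *\<^sub>C A (s n))) (u + c *\<^sub>C s n)) \<le> 0"
        using J_A_dissipative[OF csubspace_add[OF csubspace_D u csubspace_scale[OF csubspace_D s(1)]]] by metis
    qed
    then show "Re (cinner (J (A u)) u) + Re (c * cinner (J w) u) \<le> 0"
      by (simp add: J_simps cinner_simps)
  qed
  obtain h where h: "\<And>n. h n \<in> D" "h \<longlonglongrightarrow> J w" using dense_D[of "J w"] unfolding closure_sequential by blast
  have "(\<lambda>n. cinner (J w) (h n)) \<longlonglongrightarrow> cinner (J w) (J w)" by (intro tendsto_cinner h tendsto_const)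
  then have "cinner (J w) (J w) = 0" using orth[OF h(1)] by (simp add: LIMSEQ_const_iff)
  then have "J (J w) = J 0" by (simp add: cinner_eq_zero_iff)
  then show ?thesis by (simp add: J_simps)
qed

text \<open>The closure of \<open>A\<close> as a relation given by sequences; limits are handled
  here and only afterwards read as values of \<open>closure_op\<close>.\<close>

definition Acl :: "'a \<Rightarrow> 'a \<Rightarrow> bool" where
  "Acl z w \<longleftrightarrow> (\<exists>s. (\<forall>n. s n \<in> D) \<and> s \<longlonglongrightarrow> z \<and> (\<lambda>n. A (s n)) \<longlonglongrightarrow> w)"

lemma AclI: "(\<And>n. s n \<in> D) \<Longrightarrow> s \<longlonglongrightarrow> z \<Longrightarrow> (\<lambda>n. A (s n)) \<longlonglongrightarrow> w \<Longrightarrow> Acl z w"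
  unfolding Acl_def by blast

lemma AclE:
  assumes "Acl z w"
  obtains s where "\<And>n. s n \<in> D" "s \<longlonglongrightarrow> z" "(\<lambda>n. A (s n)) \<longlonglongrightarrow> w"
  using assms unfolding Acl_def by blast

lemma Acl_unique:
  assumes "Acl z w" "Acl z w'"
  shows "w = w'"
proof -
  obtain s where s: "\<And>n. s n \<in> D" "s \<longlonglongrightarrow> z" "(\<lambda>n. A (s n)) \<longlonglongrightarrow> w" using assms(1) by (rule AclE) blast
  obtain t where t: "\<And>n. t n \<in> D" "t \<longlonglongrightarrow> z" "(\<lambda>n. A (t n)) \<longlonglongrightarrow> w'" using assms(2) by (rule AclE) blast
  have "w - w' = 0"
  proof (rule A_closable)
    show "s n - t n \<in> D" for n by (rule csubspace_diff[OF csubspace_D s(1) t(1)])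
    show "(\<lambda>n. s n - t n) \<longlonglongrightarrow> 0" using tendsto_diff[OF s(2) t(2)] by simp
    show "(\<lambda>n. A (s n - t n)) \<longlonglongrightarrow> w - w'" using tendsto_diff[OF s(3) t(3)] by (simp add: A_simps s t)
  qed
  then show ?thesis by simp
qed

lemma Acl_closure: "(z, w) \<in> closure (graph D A) \<longleftrightarrow> Acl z w"
proof
  assume "(z, w) \<in> closure (graph D A)"
  then obtain f where f: "\<And>n. f n \<in> graph D A" "f \<longlonglongrightarrow> (z, w)" unfolding closure_sequential by blast
  have *: "fst (f n) \<in> D" "snd (f n) = A (fst (f n))" for n using f(1)[of n] by (auto simp: graph_def)
  show "Acl z w"
    by (rule AclI[of "\<lambda>n. fst (f n)"])
      (use *(1) tendsto_fst[OF f(2)] tendsto_snd[OF f(2)] in \<open>simp_all add: *(2)\<close>)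
next
  assume "Acl z w"
  then obtain s where s: "\<And>n. s n \<in> D" "s \<longlonglongrightarrow> z" "(\<lambda>n. A (s n)) \<longlonglongrightarrow> w" by (rule AclE) blast
  show "(z, w) \<in> closure (graph D A)"
    unfolding closure_sequential
    by (intro exI[of _ "\<lambda>n. (s n, A (s n))"] conjI allI tendsto_Pair s) (use s(1) in \<open>auto simp: graph_def\<close>)
qed

abbreviation DA where "DA \<equiv> closure_dom D A"
abbreviation cA where "cA \<equiv> closure_op D A"

lemma in_DA_iff: "z \<in> DA \<longleftrightarrow> (\<exists>w. Acl z w)"
  unfolding closure_dom_def by (force simp: Acl_closure[symmetric] image_iff)

lemma cA_eq: "Acl z w \<Longrightarrow> cA z = w"
  unfolding closure_op_def Acl_closure by (rule the_equality) (auto intro: Acl_unique)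

lemma Acl_cA: "z \<in> DA \<Longrightarrow> Acl z (cA z)"
  using cA_eq in_DA_iff by metis

lemma DA_I: "Acl z w \<Longrightarrow> z \<in> DA"
  using in_DA_iff by blast

lemma Acl_A: "z \<in> D \<Longrightarrow> Acl z (A z)"
  by (rule AclI[of "\<lambda>_. z"]) auto

lemma Acl_dissipative:
  assumes "Acl z w"
  shows "Re (cinner (J w) z) \<le> 0"
proof -
  obtain s where s: "\<And>n. s n \<in> D" "s \<longlonglongrightarrow> z" "(\<lambda>n. A (s n)) \<longlonglongrightarrow> w" using assms by (rule AclE) blast
  show ?thesis
  proof (rule LIMSEQ_le_const2)
    show "(\<lambda>n. Re (cinner (J (A (s n))) (s n))) \<longlonglongrightarrow> Re (cinner (J w) z)"
      by (intro tendsto_Re tendsto_cinner bounded_linear.tendsto[OF bounded_linear_J] s)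
    show "\<exists>N. \<forall>n\<ge>N. Re (cinner (J (A (s n))) (s n)) \<le> 0" using J_A_dissipative[OF s(1)] by blast
  qed
qed

lemma Acl_add:
  assumes "Acl z w" "Acl z' w'"
  shows "Acl (z + z') (w + w')"
proof -
  obtain s where s: "\<And>n. s n \<in> D" "s \<longlonglongrightarrow> z" "(\<lambda>n. A (s n)) \<longlonglongrightarrow> w" using assms(1) by (rule AclE) blast
  obtain t where t: "\<And>n. t n \<in> D" "t \<longlonglongrightarrow> z'" "(\<lambda>n. A (t n)) \<longlonglongrightarrow> w'" using assms(2) by (rule AclE) blast
  show ?thesis
    by (rule AclI[of "\<lambda>n. s n + t n"])
      (use tendsto_add[OF s(2) t(2)] tendsto_add[OF s(3) t(3)] in \<open>simp_all add: A_simps s t csubspace_add[OF csubspace_D]\<close>)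
qed

lemma Acl_scale:
  assumes "Acl z w"
  shows "Acl (c *\<^sub>C z) (c *\<^sub>C w)"
proof -
  obtain s where s: "\<And>n. s n \<in> D" "s \<longlonglongrightarrow> z" "(\<lambda>n. A (s n)) \<longlonglongrightarrow> w" using assms(1) by (rule AclE) blast
  show ?thesis
    by (rule AclI[of "\<lambda>n. c *\<^sub>C s n"])
      (use tendsto_scaleC[OF tendsto_const s(2)] tendsto_scaleC[OF tendsto_const s(3)]
        in \<open>simp_all add: A_simps s csubspace_scale[OF csubspace_D]\<close>)
qed

text \<open>As \<open>G\<close> is bounded, the upper row of \<open>A_parts\<close> shows that
  convergence of \<open>s n\<close> and \<open>A (s n)\<close> forces convergence of
  \<open>S\<close> on the plus components.\<close>

lemma Acl_S:
  assumes mu: "Re \<mu> < 0" and "Acl z w"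
  obtains x where "\<And>n. x n \<in> Dp" "x \<longlonglongrightarrow> Pp z" "(\<lambda>n. S \<mu> (x n)) \<longlonglongrightarrow> Pp w - G \<mu> (Pm w - \<mu> *\<^sub>C Pm z)"
proof -
  obtain s where s: "\<And>n. s n \<in> D" "s \<longlonglongrightarrow> z" "(\<lambda>n. A (s n)) \<longlonglongrightarrow> w" using assms(2) by (rule AclE) blast
  obtain C where C: "\<And>y. norm (G \<mu> y) \<le> C * norm y" using G_bounded[OF mu] by blast
  note blG = bounded_linear_if_clinear[OF clinear_G[OF mu] C]
  have parts: "Pp (s n) \<in> Dp" "Pm (s n) \<in> Dm" for n using s(1)[of n] by (simp_all add: in_D_iff)
  have "S \<mu> (Pp (s n)) = Pp (A (s n)) - G \<mu> (Pm (A (s n)) - \<mu> *\<^sub>C Pm (s n))" for n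
    using A_parts_Pp[OF mu parts, of n n] by (simp add: Pp_Pm_add)
  moreover have "(\<lambda>n. Pp (A (s n)) - G \<mu> (Pm (A (s n)) - \<mu> *\<^sub>C Pm (s n))) \<longlonglongrightarrow> Pp w - G \<mu> (Pm w - \<mu> *\<^sub>C Pm z)"
    by (intro tendsto_diff tendsto_Pp tendsto_Pm bounded_linear.tendsto[OF blG] tendsto_scaleC tendsto_const s)
  ultimately have "(\<lambda>n. S \<mu> (Pp (s n))) \<longlonglongrightarrow> Pp w - G \<mu> (Pm w - \<mu> *\<^sub>C Pm z)" by simp
  then show ?thesis using that[of "\<lambda>n. Pp (s n)"] parts tendsto_Pp[OF s(2)] by blast
qed

text \<open>\<open>K\<close> is the angular operator of an invariant graph of the section with index
  \<open>i\<close>; this packages the outcome of \<open>finite_section\<close>.\<close>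

definition section_angular :: "'a set \<times> real \<Rightarrow> ('a \<Rightarrow> 'a) \<Rightarrow> bool" where
  "section_angular i K \<longleftrightarrow> clinear_map K \<and> (\<forall>x. norm (K x) \<le> norm x) \<and> (\<forall>x. K (proj (onb (fst i)) x) = K x)
    \<and> (\<forall>x. K x \<in> Dm) \<and> (\<forall>x\<in>cvs.span (onb (fst i)). Pm (A (x + K x)) + of_real (snd i) *\<^sub>C K x
        = K (proj (onb (fst i)) (A (x + K x)) - of_real (snd i) *\<^sub>C x))"

end

text \<open>An index \<open>i = (X, \<epsilon>)\<close> selects the section of \<open>A - \<epsilon> J\<close> to \<open>span X \<oplus> H\<^sup>-\<close>. The ultrafilter \<open>U\<close>
  takes the place of diagonal subsequences. The bound \<open>1/8\<close> makes \<open>1 - G K\<close> invertible for every contraction \<open>K\<close>.\<close>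

locale limit_graph = j_dissipative Pp Pm Dp Dm A
  for Pp Pm :: "'a::{cinner_space, complete_space} \<Rightarrow> 'a" and Dp Dm A +
  fixes m :: real and U :: "('a set \<times> real) filter" and k :: "'a set \<times> real \<Rightarrow> 'a \<Rightarrow> 'a" and K :: "'a \<Rightarrow> 'a"
  assumes m_pos: "m > 0" and G8: "\<And>y. norm (G (- of_real m) y) \<le> (1/8) * norm y"
    and U: "ultra U" "\<And>x. x \<in> Dp \<Longrightarrow> eventually (\<lambda>i. x \<in> fst i) U"
      "eventually (\<lambda>i. finite (fst i) \<and> fst i \<subseteq> Dp) U"
      "eventually (\<lambda>i. 0 < snd i \<and> snd i < 1) U" "(snd \<longlongrightarrow> 0) U"
    and k: "eventually (\<lambda>i. section_angular i (k i)) U"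
    and K: "clinear_map K" "\<And>x. norm (K x) \<le> norm x" "\<And>x. weak_lim (\<lambda>i. k i x) (K x) U"

lemma (in j_dissipative) limit_graph_exists:
  "\<exists>m U k K. limit_graph Pp Pm Dp Dm A m U k K"
proof -
  obtain m :: real where m: "m > 0" "\<And>y. norm (G (- of_real m) y) \<le> (1/8) * norm y"
    using G_small[of "1/8"] by auto
  obtain U :: "('a set \<times> real) filter" where U: "ultra U" "\<And>x. x \<in> Dp \<Longrightarrow> eventually (\<lambda>i. x \<in> fst i) U"
      "eventually (\<lambda>i. finite (fst i) \<and> fst i \<subseteq> Dp) U"
      "eventually (\<lambda>i. 0 < snd i \<and> snd i < 1) U" "(snd \<longlongrightarrow> 0) U"
    using index_ultrafilter[of Dp] by blast
  have "eventually (\<lambda>i. \<exists>K. section_angular i K) U"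
    using U(3,4)
  proof eventually_elim
    case (elim i)
    then show ?case using finite_section[of "fst i" "snd i"] unfolding section_angular_def by blast
  qed
  then have k: "eventually (\<lambda>i. section_angular i (SOME K. section_angular i K)) U"
    by (simp add: some_eq_ex)
  define k where "k i = (SOME K. section_angular i K)" for i
  note k = k[folded k_def]
  have "eventually (\<lambda>i. clinear_map (k i) \<and> (\<forall>x. norm (k i x) \<le> norm x)) U"
    using k by eventually_elim (simp add: section_angular_def)
  from contraction_weak_limit[OF U(1) this]
  obtain K where K: "clinear_map K" "\<And>x. norm (K x) \<le> norm x" "\<And>x. weak_lim (\<lambda>i. k i x) (K x) U" by blast
  have "limit_graph Pp Pm Dp Dm A m U k K"
    by unfold_locales (use m U k K in blast)+
  then show ?thesis by blast
qed

section \<open>The weak limit of the angular operators and its invariant graph\<close>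

context limit_graph
begin

abbreviation \<mu> :: complex where "\<mu> \<equiv> - of_real m"

lemma mu: "Re \<mu> < 0" using m_pos by simp

lemma nb: "U \<noteq> bot" using U(1) by (simp add: ultra_def)

abbreviation P where "P i \<equiv> proj (onb (fst i))"

lemma k_contr: "eventually (\<lambda>i. clinear_map (k i) \<and> (\<forall>x. norm (k i x) \<le> norm x)) U"
  using k by eventually_elim (simp add: section_angular_def)

lemma E_props:
  assumes "finite (fst i)" "fst i \<subseteq> Dp"
  shows "orthonormal (onb (fst i))" "cvs.span (onb (fst i)) \<subseteq> Dp" "onb (fst i) \<subseteq> range Pp"
    "x \<in> fst i \<Longrightarrow> x \<in> cvs.span (onb (fst i))"
proof -
  show "orthonormal (onb (fst i))" by (rule orthonormal_onb[OF assms(1)])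
  show "cvs.span (onb (fst i)) \<subseteq> Dp"
    unfolding span_onb[OF assms(1)] using assms(2) Dp(1) by (intro cvs.span_minimal) (auto simp: csubspace_iff)
  then show "onb (fst i) \<subseteq> range Pp" using cvs.span_superset Dp(2) by blast
  show "x \<in> fst i \<Longrightarrow> x \<in> cvs.span (onb (fst i))" unfolding span_onb[OF assms(1)] by (rule cvs.span_base)
qed

lemma ev_in_span:
  assumes "x \<in> Dp"
  shows "eventually (\<lambda>i. x \<in> cvs.span (onb (fst i))) U"
  using U(2)[OF assms] U(3) by eventually_elim (use E_props in blast)

lemma Pm_K [simp]: "Pm (K x) = K x"
proof (rule weak_lim_unique[OF _ K(3) nb])
  have "weak_lim (\<lambda>i. Pm (k i x)) (Pm (K x)) U"
    by (rule weak_lim_clinear[OF clinear_Pm, of 1]) (simp_all add: norm_Pm_le K)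
  then show "weak_lim (\<lambda>i. k i x) (Pm (K x)) U"
    by (rule weak_lim_cong) (use k in eventually_elim, simp add: section_angular_def Pm_Dm)
qed

lemma Pp_K [simp]: "Pp (K x) = 0" by (rule Pp_range_Pm[OF Pm_K])

lemma bounded_linear_K: "bounded_linear K"
  by (rule bounded_linear_if_clinear[OF K(1), of 1]) (simp add: K)

lemma bounded_linear_G: "bounded_linear (G \<mu>)"
  by (rule bounded_linear_if_clinear[OF clinear_G[OF mu] G8])

lemmas tendsto_K = bounded_linear.tendsto[OF bounded_linear_K]
lemmas tendsto_G = bounded_linear.tendsto[OF bounded_linear_G]

lemma GK_bound: "norm (G \<mu> (K x)) \<le> (1/8) * norm x"
  using G8[of "K x"] K(2)[of x] by linarith

lemma P_tendsto: "((\<lambda>i. P i y) \<longlongrightarrow> Pp y) U"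
proof -
  have *: "((\<lambda>i. P i g) \<longlongrightarrow> g) U" if g: "Pp g = g" for g
  proof (rule tendstoI)
    fix e :: real assume "e > 0"
    then obtain x where x: "x \<in> Dp" "norm (g - x) < e" using dense_Dp[OF g] by blast
    show "eventually (\<lambda>i. dist (P i g) g < e) U"
      using ev_in_span[OF x(1)] U(3)
    proof eventually_elim
      case (elim i)
      have "norm (g - P i g) \<le> norm (g - x)" using elim E_props(1)[of i] norm_diff_proj_le_dist by blast
      then show ?case using x(2) by (simp add: dist_norm norm_minus_commute)
    qed
  qed
  show ?thesis
  proof (rule Lim_transform_eventually[OF *])
    show "Pp (Pp y) = Pp y" by simp
    show "eventually (\<lambda>i. P i (Pp y) = P i y) U"
      using U(3) by eventually_elim (rule proj_Pp, use E_props(3) in blast)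
  qed
qed

lemma P_tendsto_seq:
  assumes "(f \<longlongrightarrow> y) U"
  shows "((\<lambda>i. P i (f i)) \<longlongrightarrow> Pp y) U"
proof -
  have "((\<lambda>i. P i (f i - y)) \<longlongrightarrow> 0) U"
  proof (rule Lim_null_comparison)
    show "eventually (\<lambda>i. norm (P i (f i - y)) \<le> norm (f i - y)) U"
      using U(3) by eventually_elim (rule norm_proj_le, use E_props(1) in blast)
    show "((\<lambda>i. norm (f i - y)) \<longlongrightarrow> 0) U" by (rule tendsto_norm_zero) (use assms in \<open>simp add: LIM_zero\<close>)
  qed
  from tendsto_add[OF this P_tendsto[of y]] show ?thesis by (simp add: clinear_mapD(4)[OF clinear_proj])
qed

lemma Gk_tendsto: "((\<lambda>i. G \<mu> (k i x)) \<longlongrightarrow> G \<mu> (K x)) U"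
  by (rule G_weak_to_norm[where r = "norm x", OF mu U(1) K(3)]) (use k_contr in eventually_elim, simp)

lemma PGk_tendsto: "((\<lambda>i. P i (G \<mu> (k i x))) \<longlongrightarrow> G \<mu> (K x)) U"
  using P_tendsto_seq[OF Gk_tendsto[of x]] by simp

text \<open>The shift in \<open>v\<close> is fixed by the lower row: \<open>\<epsilon>\<close>
  enters the two rows with opposite signs, and only with \<open>\<mu> + \<epsilon>\<close> does the
  lower row become \<open>Pm (A (x + k i x)) - \<mu> *\<^sub>C k i x = k i v\<close>. In the upper
  row this adds up to \<open>\<mu> + 2 \<epsilon>\<close>.\<close>

lemma section_eq:
  assumes "x \<in> cvs.span (onb (fst i))" "section_angular i (k i)" "finite (fst i)" "fst i \<subseteq> Dp"
  defines "v \<equiv> P i (A (x + k i x)) - of_real (snd i) *\<^sub>C x - (\<mu> + of_real (snd i)) *\<^sub>C x"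
  shows section_R: "k i x + F \<mu> x = R \<mu> (k i v)"
    and section_v: "v = P i (S \<mu> x) + P i (G \<mu> (k i v)) - (\<mu> + 2 * of_real (snd i)) *\<^sub>C x"
proof -
  note sa = assms(2)[unfolded section_angular_def]
  have lin: "clinear_map (k i)" using sa by blast
  have xDp: "x \<in> Dp" using E_props(2)[OF assms(3,4)] assms(1) by blast
  have kDm: "k i x \<in> Dm" using sa by blast
  have "Pm (A (x + k i x)) + of_real (snd i) *\<^sub>C k i x = k i (P i (A (x + k i x)) - of_real (snd i) *\<^sub>C x)"
    using sa assms(1) by blast
  then have q: "Pm (A (x + k i x)) - \<mu> *\<^sub>C k i x = k i v"
    unfolding v_def clinear_mapD(2,4)[OF lin] by (simp add: scaleC_add_left cvs.scale_left_diff_distrib algebra_simps)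
  show "k i x + F \<mu> x = R \<mu> (k i v)" using A_parts_R[OF mu xDp kDm] q by simp
  have "Pp (A (x + k i x)) = S \<mu> x + G \<mu> (k i v)" using A_parts_Pp[OF mu xDp kDm] q by simp
  then have "P i (A (x + k i x)) = P i (S \<mu> x) + P i (G \<mu> (k i v))"
    using proj_Pp[OF E_props(3)[OF assms(3,4)], of "A (x + k i x)"] by (simp add: clinear_mapD(1)[OF clinear_proj])
  then have "v = P i (S \<mu> x) + P i (G \<mu> (k i v)) - of_real (snd i) *\<^sub>C x - (\<mu> + of_real (snd i)) *\<^sub>C x"
    unfolding v_def[symmetric] by (metis v_def)
  also have "\<dots> = P i (S \<mu> x) + P i (G \<mu> (k i v)) - (of_real (snd i) + (\<mu> + of_real (snd i))) *\<^sub>C x"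
    unfolding scaleC_add_left[of "of_real (snd i)" "\<mu> + of_real (snd i)" x] by (rule diff_diff_eq)
  also have "of_real (snd i) + (\<mu> + of_real (snd i)) = \<mu> + 2 * of_real (snd i)" by simp
  finally show "v = P i (S \<mu> x) + P i (G \<mu> (k i v)) - (\<mu> + 2 * of_real (snd i)) *\<^sub>C x" .
qed

lemma H_lower: "norm (v - G \<mu> (K v) - (w - G \<mu> (K w))) \<ge> (7/8) * norm (v - w)"
proof -
  have eq: "v - G \<mu> (K v) - (w - G \<mu> (K w)) = (v - w) - G \<mu> (K (v - w))"
    by (simp add: clinear_mapD(4)[OF K(1)] clinear_mapD(4)[OF clinear_G[OF mu]])
  show ?thesis unfolding eq using norm_triangle_ineq2[of "v - w" "G \<mu> (K (v - w))"] GK_bound[of "v - w"] by simp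
qed

lemma H_surj: obtains v where "v - G \<mu> (K v) = g"
proof -
  have "\<exists>v. v + (- G \<mu> (K v)) = g"
  proof (rule solve_contraction[of "1/8" "\<lambda>v. - G \<mu> (K v)" g])
    show "norm (- G \<mu> (K x) - - G \<mu> (K y)) \<le> 1/8 * norm (x - y)" for x y
      using GK_bound[of "x - y"]
      by (simp add: clinear_mapD(4)[OF K(1)] clinear_mapD(4)[OF clinear_G[OF mu]] norm_minus_commute)
  qed auto
  then show ?thesis using that by auto
qed

text \<open>First \<open>v\<close> is solved from the limit equation; then the vectors
  \<open>vi i\<close> of the sections are shown to approach it. From
  \<open>vi i - v = P i (G (k i (vi i - v))) + e i\<close> and the bound \<open>1/8\<close> follows
  \<open>|vi i - v| \<le> 2 |e i|\<close>. Thus \<open>k i (vi i)\<close> tends weakly to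
  \<open>K v\<close>, and \<open>R\<close> is weakly continuous.\<close>

lemma graph_eq:
  assumes x: "x \<in> Dp"
  obtains v where "v - G \<mu> (K v) = S \<mu> x - \<mu> *\<^sub>C x" "Pp v = v" "K x + F \<mu> x = R \<mu> (K v)"
proof -
  obtain v where v: "v - G \<mu> (K v) = S \<mu> x - \<mu> *\<^sub>C x" by (rule H_surj)
  have Ppv: "Pp v = v"
  proof -
    have eq: "v = G \<mu> (K v) + S \<mu> x - \<mu> *\<^sub>C x" using v by (simp add: algebra_simps)
    have "Pp v = Pp (G \<mu> (K v) + S \<mu> x - \<mu> *\<^sub>C x)" using eq by (rule arg_cong)
    also have "\<dots> = G \<mu> (K v) + S \<mu> x - \<mu> *\<^sub>C x" by (simp add: Pp_simps Pp_Dp[OF x])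
    also have "\<dots> = v" by (rule eq[symmetric])
    finally show ?thesis .
  qed
  define vi where "vi i = P i (A (x + k i x)) - of_real (snd i) *\<^sub>C x - (\<mu> + of_real (snd i)) *\<^sub>C x" for i
  \<comment> \<open>The residual of the fixed \<open>v\<close> in the equation of section
    \<open>i\<close>. Only here is compactness used: \<open>G (k i v)\<close> tends to
    \<open>G (K v)\<close> in norm.\<close>
  define e where "e i = (P i (S \<mu> x) - S \<mu> x) + (P i (G \<mu> (k i v)) - G \<mu> (K v)) - (2 * of_real (snd i)) *\<^sub>C x" for i
  have ev: "eventually (\<lambda>i. k i x + F \<mu> x = R \<mu> (k i (vi i)) \<and> norm (vi i - v) \<le> 2 * norm (e i)) U"
    using ev_in_span[OF x] k U(3)
  proof eventually_elim
    case (elim i)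
    have fin: "finite (fst i)" "fst i \<subseteq> Dp" using elim by auto
    have lin: "clinear_map (k i)" "\<And>x. norm (k i x) \<le> norm x" using elim(2) by (auto simp: section_angular_def)
    have r: "k i x + F \<mu> x = R \<mu> (k i (vi i))"
      using section_R[OF elim(1,2) fin] by (simp add: vi_def)
    have s: "vi i = P i (S \<mu> x) + P i (G \<mu> (k i (vi i))) - (\<mu> + 2 * of_real (snd i)) *\<^sub>C x"
      using section_v[OF elim(1,2) fin] by (simp only: vi_def)
    have alg: "a = ps + p - (mx + ex) \<Longrightarrow> b = gv + sx - mx \<Longrightarrow> a - b = (p - q) + ((ps - sx) + (q - gv) - ex)"
      for a b ps p mx ex gv sx q :: 'a by simp
    have "vi i - v = (P i (G \<mu> (k i (vi i))) - P i (G \<mu> (k i v))) + e i"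
      unfolding e_def
    proof (rule alg)
      show "vi i = P i (S \<mu> x) + P i (G \<mu> (k i (vi i))) - (\<mu> *\<^sub>C x + (2 * of_real (snd i)) *\<^sub>C x)"
        using s by (simp only: scaleC_add_left)
      show "v = G \<mu> (K v) + S \<mu> x - \<mu> *\<^sub>C x" using v by (simp add: algebra_simps)
    qed
    also have "P i (G \<mu> (k i (vi i))) - P i (G \<mu> (k i v)) = P i (G \<mu> (k i (vi i - v)))"
      by (simp only: clinear_mapD(4)[OF lin(1)] clinear_mapD(4)[OF clinear_G[OF mu]] clinear_mapD(4)[OF clinear_proj])
    finally have "vi i - v = P i (G \<mu> (k i (vi i - v))) + e i" .
    then have "norm (vi i - v) \<le> norm (P i (G \<mu> (k i (vi i - v)))) + norm (e i)" by (metis norm_triangle_ineq)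
    moreover have "norm (P i (G \<mu> (k i (vi i - v)))) \<le> (1/8) * norm (vi i - v)"
      using norm_proj_le[OF E_props(1)[OF fin], of "G \<mu> (k i (vi i - v))"] G8[of "k i (vi i - v)"] lin(2)[of "vi i - v"] by linarith
    ultimately have "norm (vi i - v) \<le> 2 * norm (e i)" using norm_ge_zero[of "e i"] by linarith
    then show ?case using r by simp
  qed
  have "(e \<longlongrightarrow> (S \<mu> x - S \<mu> x) + (G \<mu> (K v) - G \<mu> (K v)) - (2 * of_real 0) *\<^sub>C x) U"
    unfolding e_def using P_tendsto[of "S \<mu> x"] PGk_tendsto[of v] U(5)
    by (intro tendsto_add tendsto_diff tendsto_scaleC tendsto_mult tendsto_of_real tendsto_const) simp_all
  then have "((\<lambda>i. 2 * norm (e i)) \<longlongrightarrow> 0) U" by (auto intro!: tendsto_eq_intros)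
  then have "((\<lambda>i. vi i - v) \<longlongrightarrow> 0) U"
    by (rule Lim_null_comparison[rotated]) (use ev in eventually_elim, simp)
  then have lim: "(vi \<longlongrightarrow> v) U" by (simp add: LIM_zero_iff)
  have "weak_lim (\<lambda>i. k i (vi i)) (K v) U"
    by (rule weak_lim_contraction_seq[where K = k and k = K, OF K(3) lim k_contr])
  then have w1: "weak_lim (\<lambda>i. R \<mu> (k i (vi i))) (R \<mu> (K v)) U"
    by (rule weak_lim_clinear[OF clinear_R[OF mu] norm_R_le'[OF mu]])
  have "weak_lim (\<lambda>i. k i x + F \<mu> x) (K x + F \<mu> x) U"
    by (intro weak_lim_add K weak_lim_if_tendsto tendsto_const)
  then have "weak_lim (\<lambda>i. R \<mu> (k i (vi i))) (K x + F \<mu> x) U"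
    by (rule weak_lim_cong) (use ev in eventually_elim, simp)
  then have "K x + F \<mu> x = R \<mu> (K v)" using w1 nb by (rule weak_lim_unique)
  then show ?thesis using that v Ppv by blast
qed

text \<open>Over \<open>Dp\<close> the graph stays in \<open>D\<close>, because
  \<open>K x = R (K v) - F x\<close> lies in \<open>Dm\<close>; the invariance relation therefore
  holds for \<open>A\<close> itself before any closure is taken.\<close>

lemma A_graph:
  assumes x: "x \<in> Dp"
  obtains v where "v - G \<mu> (K v) = S \<mu> x - \<mu> *\<^sub>C x" "Pp v = v" "x + K x \<in> D" "A (x + K x) = \<mu> *\<^sub>C (x + K x) + v + K v"
proof -
  obtain v where v: "v - G \<mu> (K v) = S \<mu> x - \<mu> *\<^sub>C x" "Pp v = v" "K x + F \<mu> x = R \<mu> (K v)"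
    using graph_eq[OF x] by blast
  have "K x = R \<mu> (K v) - F \<mu> x" using v(3) by (simp add: algebra_simps)
  then have KDm: "K x \<in> Dm" using csubspace_diff[OF Dm(1) R_in[OF mu] F_in[OF mu]] by simp
  define q where "q = Pm (A (x + K x)) - \<mu> *\<^sub>C K x"
  have "R \<mu> (K v) = R \<mu> q" using A_parts_R[OF mu x KDm] v(3) by (simp add: q_def)
  then have "Pm (K v) = Pm q" using R_eq[OF mu, of "K v"] R_eq[OF mu, of q] by simp
  then have q: "q = K v" by (simp add: q_def Pm_simps)
  have "Pp (A (x + K x)) = S \<mu> x + G \<mu> (K v)" using A_parts_Pp[OF mu x KDm] q by (simp add: q_def)
  also have "\<dots> = v + \<mu> *\<^sub>C x" using v(1) by (simp add: algebra_simps)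
  finally have PpA: "Pp (A (x + K x)) = v + \<mu> *\<^sub>C x" .
  have PmA: "Pm (A (x + K x)) = K v + \<mu> *\<^sub>C K x" using q by (simp add: q_def algebra_simps)
  have "A (x + K x) = (v + \<mu> *\<^sub>C x) + (K v + \<mu> *\<^sub>C K x)"
    by (rule Pp_Pm_add[of "A (x + K x)", unfolded PpA PmA, symmetric])
  then show ?thesis using that[OF v(1,2) add_in_D[OF x KDm]] by (simp add: scaleC_add_right algebra_simps)
qed

definition L :: "'a set" where "L = {z. Pm z = K (Pp z)}"

lemma L_max_nonneg: "max_nonneg_subspace J L"
  unfolding L_def by (rule graph_max_nonneg[OF K(1,2) Pm_K])

lemma in_L: "Pp x = x \<Longrightarrow> x + K x \<in> L"
  by (simp add: L_def Pp_simps Pm_simps Pm_range_Pp)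

lemma csubspace_L: "csubspace L"
  using L_max_nonneg by (simp add: max_nonneg_subspace_def nonneg_subspace_def closed_csubspace_def)

lemma L_split: "z \<in> L \<Longrightarrow> z = Pp z + K (Pp z)"
  using Pp_Pm_add[of z] by (simp add: L_def)

text \<open>The lower bound of \<open>1 - G K\<close> turns convergence of \<open>S (x n)\<close>
  into convergence of the \<open>v n\<close>, so the graph of the closure of \<open>S\<close> lifts
  to the closure of \<open>A\<close> on \<open>L\<close>.\<close>

lemma S_Cauchy_graph:
  assumes x: "\<And>n. x n \<in> Dp" "x \<longlonglongrightarrow> x0" "(\<lambda>n. S \<mu> (x n)) \<longlonglongrightarrow> s"
  obtains v0 where "Pp v0 = v0" "v0 - G \<mu> (K v0) = s - \<mu> *\<^sub>C x0" "Acl (x0 + K x0) (\<mu> *\<^sub>C (x0 + K x0) + v0 + K v0)"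
proof -
  have "\<forall>n. \<exists>v. v - G \<mu> (K v) = S \<mu> (x n) - \<mu> *\<^sub>C x n \<and> Pp v = v \<and> x n + K (x n) \<in> D
      \<and> A (x n + K (x n)) = \<mu> *\<^sub>C (x n + K (x n)) + v + K v"
    using A_graph[OF x(1)] by metis
  from choice[OF this] obtain v where v: "\<And>n. v n - G \<mu> (K (v n)) = S \<mu> (x n) - \<mu> *\<^sub>C x n" "\<And>n. Pp (v n) = v n"
    "\<And>n. x n + K (x n) \<in> D" "\<And>n. A (x n + K (x n)) = \<mu> *\<^sub>C (x n + K (x n)) + v n + K (v n)" by blast
  have lim: "(\<lambda>n. S \<mu> (x n) - \<mu> *\<^sub>C x n) \<longlonglongrightarrow> s - \<mu> *\<^sub>C x0"
    by (intro tendsto_diff tendsto_scaleC tendsto_const x)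
  obtain v0 where v0: "v \<longlonglongrightarrow> v0"
  proof (rule Cauchy_if_lower_bound[of "7/8" v "\<lambda>n. S \<mu> (x n) - \<mu> *\<^sub>C x n"])
    show "7 / 8 * norm (v i - v j) \<le> norm (S \<mu> (x i) - \<mu> *\<^sub>C x i - (S \<mu> (x j) - \<mu> *\<^sub>C x j))" for i j
      using H_lower[of "v i" "v j"] by (simp only: v(1))
    show "convergent (\<lambda>n. S \<mu> (x n) - \<mu> *\<^sub>C x n)" using lim by (auto simp: convergent_def)
  qed auto
  show ?thesis
  proof (rule that)
    show "Pp v0 = v0" using tendsto_Pp[OF v0] v0 v(2) by (simp add: LIMSEQ_unique)
    have "(\<lambda>n. v n - G \<mu> (K (v n))) \<longlonglongrightarrow> v0 - G \<mu> (K v0)"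
      by (intro tendsto_diff v0 tendsto_G tendsto_K)
    then show "v0 - G \<mu> (K v0) = s - \<mu> *\<^sub>C x0" using lim unfolding v(1) by (rule LIMSEQ_unique)
    show "Acl (x0 + K x0) (\<mu> *\<^sub>C (x0 + K x0) + v0 + K v0)"
    proof (rule AclI[OF v(3)])
      show "(\<lambda>n. x n + K (x n)) \<longlonglongrightarrow> x0 + K x0" by (intro tendsto_add x tendsto_K)
      show "(\<lambda>n. A (x n + K (x n))) \<longlonglongrightarrow> \<mu> *\<^sub>C (x0 + K x0) + v0 + K v0"
        unfolding v(4) by (intro tendsto_add tendsto_scaleC tendsto_const x tendsto_K v0)
    qed
  qed
qed

text \<open>Conversely, every element of the closure of \<open>A\<close> over \<open>L\<close>
  arises in this way: project to \<open>S\<close>, lift again, and use that the closure is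
  single-valued.\<close>

lemma Acl_graph:
  assumes "z \<in> L" "Acl z w"
  obtains x s v where "\<And>n. x n \<in> Dp" "x \<longlonglongrightarrow> Pp z" "(\<lambda>n. S \<mu> (x n)) \<longlonglongrightarrow> s" "Pp v = v"
    "v - G \<mu> (K v) = s - \<mu> *\<^sub>C Pp z" "w = \<mu> *\<^sub>C z + v + K v"
proof -
  obtain x where x: "\<And>n. x n \<in> Dp" "x \<longlonglongrightarrow> Pp z" "(\<lambda>n. S \<mu> (x n)) \<longlonglongrightarrow> Pp w - G \<mu> (Pm w - \<mu> *\<^sub>C Pm z)"
    using Acl_S[OF mu assms(2)] by blast
  obtain v where v: "Pp v = v" "v - G \<mu> (K v) = Pp w - G \<mu> (Pm w - \<mu> *\<^sub>C Pm z) - \<mu> *\<^sub>C Pp z"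
    "Acl (Pp z + K (Pp z)) (\<mu> *\<^sub>C (Pp z + K (Pp z)) + v + K v)"
    using S_Cauchy_graph[OF x] by blast
  have "Acl z (\<mu> *\<^sub>C z + v + K v)" using v(3) L_split[OF assms(1)] by simp
  then have "w = \<mu> *\<^sub>C z + v + K v" using Acl_unique[OF assms(2)] by blast
  then show ?thesis using that x v(1,2) by blast
qed

lemma L_invariant: "invariant_subspace DA cA L"
  unfolding invariant_subspace_def
proof (intro conjI ballI subsetI)
  fix z assume z: "z \<in> L"
  have "Pp z \<in> closure Dp"
    unfolding closure_approachable using dense_Dp[of "Pp z"] by (metis Pp_Pp dist_norm norm_minus_commute)
  then obtain x where x: "\<And>n. x n \<in> Dp" "x \<longlonglongrightarrow> Pp z" unfolding closure_sequential by blast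
  have "x n + K (x n) \<in> DA \<inter> L" for n
    using A_graph[OF x(1)[of n]] Acl_A DA_I in_L[OF Pp_Dp[OF x(1)]] by (metis IntI)
  moreover have "(\<lambda>n. x n + K (x n)) \<longlonglongrightarrow> z"
    by (subst L_split[OF z]) (intro tendsto_add x tendsto_K)
  ultimately show "z \<in> closure (DA \<inter> L)"
    unfolding closure_sequential by (intro exI[of _ "\<lambda>n. x n + K (x n)"]) blast
next
  fix z assume z: "z \<in> DA \<inter> L"
  then obtain v where "Pp v = v" "cA z = \<mu> *\<^sub>C z + v + K v"
    using Acl_graph[of z "cA z"] Acl_cA[of z] by blast
  moreover have "\<mu> *\<^sub>C z + (v + K v) \<in> L" if "Pp v = v" for v
    using z that by (intro csubspace_add[OF csubspace_L] csubspace_scale[OF csubspace_L] in_L) auto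
  ultimately show "cA z \<in> L" by (simp only: add.assoc)
qed

end

section \<open>Determinants and the Hurwitz theorem along a filter\<close>

text \<open>Cauchy's estimate for the derivative on discs of radius \<open>d/4\<close> yields the
  factor \<open>4/d\<close>; \<open>C + 1\<close> appears because the values are placed in an open
  disc.\<close>

lemma bounded_holomorphic_Lipschitz:
  fixes f :: "complex \<Rightarrow> complex"
  assumes hol: "f holomorphic_on ball w d" and bdd: "\<And>z. z \<in> ball w d \<Longrightarrow> cmod (f z) \<le> C"
    and d: "d > 0" and z: "z \<in> ball w (d / 2)"
  shows "cmod (f z - f w) \<le> (4 * (C + 1) / d) * cmod (z - w)"
proof (rule field_differentiable_bound[of "ball w (d/2)" f "deriv f"])
  have sub: "ball w (d/2) \<subseteq> ball w d" using d by auto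
  show "(f has_field_derivative deriv f u) (at u within ball w (d/2))" if "u \<in> ball w (d/2)" for u
    using holomorphic_derivI[OF hol open_ball, of u] that sub by (auto intro: has_field_derivative_at_within)
  show "norm (deriv f u) \<le> 4 * (C + 1) / d" if u: "u \<in> ball w (d/2)" for u
  proof -
    have cb: "cball u (d/4) \<subseteq> ball w d"
    proof
      fix v assume "v \<in> cball u (d/4)"
      then show "v \<in> ball w d" using u d dist_triangle[of w v u] by auto
    qed
    have "cmod ((deriv ^^ 1) f u) \<le> fact 1 * (C + 1) / (d/4) ^ 1"
    proof (rule Cauchy_higher_deriv_bound)
      show "f holomorphic_on ball u (d/4)" using hol cb ball_subset_cball by (blast intro: holomorphic_on_subset)
      show "continuous_on (cball u (d/4)) f" using hol cb by (blast intro: holomorphic_on_imp_continuous_on holomorphic_on_subset)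
      show "f v \<in> ball 0 (C + 1)" if "v \<in> ball u (d/4)" for v
      proof -
        have "v \<in> ball w d" using that cb ball_subset_cball by blast
        then show ?thesis using bdd[of v] by simp
      qed
    qed (use d in auto)
    then show ?thesis by (simp add: mult.commute)
  qed
qed (use d z in auto)

text \<open>A uniform bound makes the family equi-Lipschitz, so pointwise convergence along the
  filter is uniform on the compact closure of \<open>T\<close>. Picking for each \<open>n\<close> an
  index with error below \<open>1/(n+1)\<close> produces a sequence to which the Hurwitz theorem
  applies; \<open>z1\<close> excludes the constant limit zero.\<close>

lemma hurwitz_filter:
  fixes f :: "'i \<Rightarrow> complex \<Rightarrow> complex"
  assumes S: "open S" and nb: "U \<noteq> bot"
    and hol: "eventually (\<lambda>i. f i holomorphic_on S \<and> (\<forall>z\<in>S. cmod (f i z) \<le> C)) U"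
    and lim: "\<And>z. z \<in> S \<Longrightarrow> ((\<lambda>i. f i z) \<longlongrightarrow> g z) U"
    and T: "open T" "connected T" "bounded T" "closure T \<subseteq> S"
    and nz: "eventually (\<lambda>i. \<forall>z\<in>T. f i z \<noteq> 0) U"
    and z1: "z1 \<in> T" "g z1 \<noteq> 0" and z: "z \<in> T"
  shows "g z \<noteq> 0"
proof -
  have cpt: "compact (closure T)" using T(3) by simp
  obtain d where d: "d > 0" "(\<Union>x\<in>closure T. ball x d) \<subseteq> S"
    using compact_subset_open_imp_ball_epsilon_subset[OF cpt S T(4)] by blast
  define B where "B = 4 * (\<bar>C\<bar> + 1) / d"
  have B: "B > 0" using d by (simp add: B_def)
  have lip: "cmod (f i u - f i w) \<le> B * cmod (u - w)"
    if "f i holomorphic_on S" "\<forall>z\<in>S. cmod (f i z) \<le> C" "w \<in> closure T" "u \<in> ball w (d/2)" for i u w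
    unfolding B_def
  proof (rule bounded_holomorphic_Lipschitz)
    show "f i holomorphic_on ball w d" using that d by (blast intro: holomorphic_on_subset)
    show "cmod (f i v) \<le> \<bar>C\<bar>" if "v \<in> ball w d" for v
    proof -
      have "v \<in> S" using that \<open>w \<in> closure T\<close> d by blast
      then show ?thesis using \<open>\<forall>z\<in>S. cmod (f i z) \<le> C\<close> by force
    qed
  qed (use d that in auto)
  have lipg: "cmod (g u - g w) \<le> B * cmod (u - w)" if w: "w \<in> closure T" and u: "u \<in> ball w (d/2)" for u w
  proof (rule tendsto_upperbound[OF _ _ nb])
    have "ball w d \<subseteq> S" using w d(2) by blast
    moreover have "u \<in> ball w d" "w \<in> ball w d" using u d(1) by auto
    ultimately have "u \<in> S" "w \<in> S" by blast+
    then show "((\<lambda>i. cmod (f i u - f i w)) \<longlongrightarrow> cmod (g u - g w)) U" by (intro tendsto_norm tendsto_diff lim)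
    show "eventually (\<lambda>i. cmod (f i u - f i w) \<le> B * cmod (u - w)) U"
      using hol by eventually_elim (use lip w u in blast)
  qed
  have unif: "eventually (\<lambda>i. \<forall>u\<in>closure T. cmod (f i u - g u) < \<eta>) U" if \<eta>: "\<eta> > 0" for \<eta>
  proof -
    \<comment> \<open>On a net of mesh \<open>r\<close> the two Lipschitz errors and the error at
      the net point are each at most \<open>\<eta>/4\<close>.\<close>
    define r where "r = min (d/2) (\<eta> / (4 * B))"
    have r: "r > 0" "r \<le> d/2" "B * r \<le> \<eta>/4" using d \<eta> B by (auto simp: r_def min_def field_simps)
    have cover: "closure T \<subseteq> (\<Union>x\<in>closure T. ball x r)" using r(1) by force
    obtain k where k: "k \<subseteq> closure T" "finite k" "closure T \<subseteq> (\<Union>x\<in>k. ball x r)"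
      by (rule compactE_image[OF cpt open_ball cover])
    have "eventually (\<lambda>i. \<forall>w\<in>k. cmod (f i w - g w) < \<eta>/4) U"
    proof (rule eventually_ball_finite[OF k(2)], intro ballI)
      fix w assume "w \<in> k"
      then have "((\<lambda>i. f i w) \<longlongrightarrow> g w) U" using k(1) T(4) by (intro lim) blast
      from tendstoD[OF this, of "\<eta>/4"] show "eventually (\<lambda>i. cmod (f i w - g w) < \<eta>/4) U"
        using \<eta> by (simp only: dist_norm divide_pos_pos zero_less_numeral)
    qed
    then show ?thesis
      using hol
    proof eventually_elim
      case (elim i)
      show ?case
      proof
        fix u assume "u \<in> closure T"
        then obtain w where w: "w \<in> k" "u \<in> ball w r" using k(3) by blast
        then have wT: "w \<in> closure T" and uw: "u \<in> ball w (d/2)" using k(1) r by auto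
        have "cmod (u - w) \<le> r" using w(2) by (simp add: dist_norm norm_minus_commute)
        then have "B * cmod (u - w) \<le> B * r" using B by (intro mult_left_mono) auto
        then have "cmod (f i u - f i w) \<le> \<eta>/4" "cmod (g u - g w) \<le> \<eta>/4"
          using lip[OF conjunct1[OF elim(2)] conjunct2[OF elim(2)] wT uw] lipg[OF wT uw] r(3) by linarith+
        moreover have "cmod (f i w - g w) < \<eta>/4" using elim(1) w(1) by blast
        moreover have "cmod (f i u - g u) \<le> cmod (f i u - f i w) + cmod (f i w - g w) + cmod (g u - g w)"
          using norm_triangle_ineq4[of "(f i u - f i w) + (f i w - g w)" "g u - g w"]
            norm_triangle_ineq[of "f i u - f i w" "f i w - g w"] by simp
        ultimately show "cmod (f i u - g u) < \<eta>" using \<eta> by linarith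
      qed
    qed
  qed
  have "\<exists>i. f i holomorphic_on S \<and> (\<forall>u\<in>T. f i u \<noteq> 0) \<and> (\<forall>u\<in>closure T. cmod (f i u - g u) < 1 / real (Suc n))" for n
  proof -
    have "eventually (\<lambda>i. f i holomorphic_on S \<and> (\<forall>u\<in>T. f i u \<noteq> 0) \<and> (\<forall>u\<in>closure T. cmod (f i u - g u) < 1 / real (Suc n))) U"
      using hol nz unif[of "1 / real (Suc n)"] by (simp add: eventually_conj_iff del: of_nat_Suc)
    then show ?thesis by (rule eventually_happens'[OF nb])
  qed
 then have "\<forall>n. \<exists>i. f i holomorphic_on S \<and> (\<forall>u\<in>T. f i u \<noteq> 0) \<and> (\<forall>u\<in>closure T. cmod (f i u - g u) < 1 / real (Suc n))"
    by blast
  from choice[OF this] obtain i where i: "\<And>n. f (i n) holomorphic_on S" "\<And>n u. u \<in> T \<Longrightarrow> f (i n) u \<noteq> 0"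
    "\<And>n u. u \<in> closure T \<Longrightarrow> cmod (f (i n) u - g u) < 1 / real (Suc n)" by blast
  have ul: "uniform_limit X (\<lambda>n. f (i n)) g sequentially" if "X \<subseteq> closure T" for X
  proof (rule uniform_limitI)
    fix e :: real assume "e > 0"
    then obtain N where N: "1 / real (Suc N) < e" using nat_approx_posE by blast
    have "dist (f (i n) u) (g u) < e" if "n \<ge> N" "u \<in> X" for n u
    proof -
      have "1 / real (Suc n) \<le> 1 / real (Suc N)" using that(1) by (simp add: frac_le)
      then show ?thesis using i(3)[of u n] that(2) \<open>X \<subseteq> closure T\<close> N by (auto simp: dist_norm)
    qed
    then show "eventually (\<lambda>n. \<forall>u\<in>X. dist (f (i n) u) (g u) < e) sequentially"
      unfolding eventually_sequentially by blast
  qed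
  have TS: "T \<subseteq> S" using T(4) closure_subset by blast
  have holT: "f (i n) holomorphic_on T" for n using i(1) TS by (rule holomorphic_on_subset)
  have holg: "g holomorphic_on T"
  proof (rule holomorphic_uniform_sequence[OF T(1) holT])
    fix x assume "x \<in> T"
    then obtain e where e: "e > 0" "cball x e \<subseteq> T" using T(1) open_contains_cball by blast
    then show "\<exists>d>0. cball x d \<subseteq> T \<and> uniform_limit (cball x d) (\<lambda>n. f (i n)) g sequentially"
      using ul[of "cball x e"] closure_subset[of T] by blast
  qed
  show ?thesis
  proof (cases "g constant_on T")
    case True
    then show ?thesis using z z1 unfolding constant_on_def by metis
  next
    case False
    show ?thesis
    proof (rule Hurwitz_no_zeros[OF T(1,2) holT holg _ False i(2) z])
      show "uniform_limit X (\<lambda>n. f (i n)) g sequentially" if "compact X" "X \<subseteq> T" for X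
        using that closure_subset[of T] by (intro ul) blast
    qed
  qed
qed

section \<open>Determinants of compressions to finite-dimensional subspaces\<close>

definition enum :: "'a set \<Rightarrow> nat \<Rightarrow> 'a" where
  "enum Z = (SOME e. bij_betw e {..<card Z} Z)"

lemma enum:
  assumes "finite Z"
  shows "bij_betw (enum Z) {..<card Z} Z"
proof -
  have "\<exists>e. bij_betw e {..<card Z} Z"
    using ex_bij_betw_nat_finite[OF assms] by (simp add: atLeast0LessThan)
  then show ?thesis unfolding enum_def by (rule someI_ex[of "\<lambda>e. bij_betw e {..<card Z} Z"])
qed

definition opdet :: "'a::cinner_space set \<Rightarrow> ('a \<Rightarrow> 'a) \<Rightarrow> complex" where
  "opdet Z \<Theta> = Determinant.det (Matrix.mat (card Z) (card Z) (\<lambda>(a, b). cinner (\<Theta> (enum Z b)) (enum Z a)))"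

text \<open>Through the Leibniz formula, holomorphy, limits and bounds of the determinant reduce to
  those of its entries.\<close>

lemma opdet_expand:
  "opdet Z \<Theta> = (\<Sum>p\<in>{p. p permutes {0..<card Z}}. signof p * (\<Prod>i = 0..<card Z. cinner (\<Theta> (enum Z (p i))) (enum Z i)))"
proof -
  let ?M = "Matrix.mat (card Z) (card Z) (\<lambda>(a, b). cinner (\<Theta> (enum Z b)) (enum Z a))"
  have "opdet Z \<Theta> = (\<Sum>p\<in>{p. p permutes {0..<card Z}}. signof p * (\<Prod>i = 0..<card Z. ?M $$ (i, p i)))"
    unfolding opdet_def by (rule det_def') simp
  also have "\<dots> = (\<Sum>p\<in>{p. p permutes {0..<card Z}}. signof p * (\<Prod>i = 0..<card Z. cinner (\<Theta> (enum Z (p i))) (enum Z i)))"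
  proof (intro sum.cong refl arg_cong2[where f = "(*)"] prod.cong)
    fix p i assume "p \<in> {p. p permutes {0..<card Z}}" "i \<in> {0..<card Z}"
    then have "i < card Z" "p i < card Z" using permutes_in_image[of p "{0..<card Z}" i] by auto
    then show "?M $$ (i, p i) = cinner (\<Theta> (enum Z (p i))) (enum Z i)" by simp
  qed
  finally show ?thesis .
qed

lemma enum_in: "finite Z \<Longrightarrow> i < card Z \<Longrightarrow> enum Z i \<in> Z"
  using enum[of Z] by (auto simp: bij_betw_def)

lemma opdet_holomorphic:
  assumes "finite Z" "\<And>x y. x \<in> Z \<Longrightarrow> y \<in> Z \<Longrightarrow> (\<lambda>z. cinner (\<Theta> z x) y) holomorphic_on S"
  shows "(\<lambda>z. opdet Z (\<Theta> z)) holomorphic_on S"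
  unfolding opdet_expand
proof (intro holomorphic_on_sum holomorphic_on_mult holomorphic_on_const holomorphic_on_prod)
  fix p i assume "p \<in> {p. p permutes {0..<card Z}}" "i \<in> {0..<card Z}"
  then have "i < card Z" "p i < card Z" using permutes_in_image[of p "{0..<card Z}" i] by auto
  then show "(\<lambda>z. cinner (\<Theta> z (enum Z (p i))) (enum Z i)) holomorphic_on S"
    using assms enum_in by blast
qed

lemma opdet_tendsto:
  assumes "finite Z" "\<And>x y. x \<in> Z \<Longrightarrow> y \<in> Z \<Longrightarrow> ((\<lambda>i. cinner (\<Theta> i x) y) \<longlongrightarrow> cinner (\<Theta>' x) y) F"
  shows "((\<lambda>i. opdet Z (\<Theta> i)) \<longlongrightarrow> opdet Z \<Theta>') F"
  unfolding opdet_expand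
proof (intro tendsto_sum tendsto_mult tendsto_const tendsto_prod)
  fix p i assume "p \<in> {p. p permutes {0..<card Z}}" "i \<in> {0..<card Z}"
  then have "i < card Z" "p i < card Z" using permutes_in_image[of p "{0..<card Z}" i] by auto
  then show "((\<lambda>n. cinner (\<Theta> n (enum Z (p i))) (enum Z i)) \<longlongrightarrow> cinner (\<Theta>' (enum Z (p i))) (enum Z i)) F"
    using assms enum_in by blast
qed

lemma opdet_bound:
  fixes \<Theta> :: "'a::cinner_space \<Rightarrow> 'a"
  assumes "finite Z" "\<And>x y. x \<in> Z \<Longrightarrow> y \<in> Z \<Longrightarrow> cmod (cinner (\<Theta> x) y) \<le> b"
  shows "cmod (opdet Z \<Theta>) \<le> real (card {p. p permutes {0..<card Z}}) * b ^ card Z"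
proof -
  have "cmod (opdet Z \<Theta>) \<le> (\<Sum>p\<in>{p. p permutes {0..<card Z}}. b ^ card Z)"
    unfolding opdet_expand
  proof (rule order_trans[OF norm_sum sum_mono])
    fix p assume p: "p \<in> {p. p permutes {0..<card Z}}"
    have "cmod (signof p) = 1" by (simp add: sign_def)
    then have "cmod (signof p * (\<Prod>i = 0..<card Z. cinner (\<Theta> (enum Z (p i))) (enum Z i)))
        = (\<Prod>i = 0..<card Z. cmod (cinner (\<Theta> (enum Z (p i))) (enum Z i)))"
      by (simp add: norm_mult prod_norm)
    also have "\<dots> \<le> (\<Prod>i = 0..<card Z. b)"
    proof (rule prod_mono, intro conjI norm_ge_zero)
      fix i assume "i \<in> {0..<card Z}"
      then have "i < card Z" "p i < card Z" using p permutes_in_image[of p "{0..<card Z}" i] by auto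
      then show "cmod (cinner (\<Theta> (enum Z (p i))) (enum Z i)) \<le> b" using assms enum_in by blast
    qed
    finally show "cmod (signof p * (\<Prod>i = 0..<card Z. cinner (\<Theta> (enum Z (p i))) (enum Z i))) \<le> b ^ card Z" by simp
  qed
  then show ?thesis by simp
qed

lemma opdet_eq_0_iff:
  fixes \<Theta> :: "'a::cinner_space \<Rightarrow> 'a"
  assumes Z: "orthonormal Z" and lin: "clinear_on (cvs.span Z) \<Theta>" and im: "\<Theta> ` cvs.span Z \<subseteq> cvs.span Z"
  shows "opdet Z \<Theta> = 0 \<longleftrightarrow> (\<exists>x\<in>cvs.span Z. x \<noteq> 0 \<and> \<Theta> x = 0)"
proof -
  define n where "n = card Z"
  define e where "e = enum Z"
  let ?M = "Matrix.mat n n (\<lambda>(a, b). cinner (\<Theta> (e b)) (e a))"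
  have fin: "finite Z" using Z by (simp add: orthonormal_def)
  have bij: "bij_betw e {..<n} Z" using enum[OF fin] by (simp add: e_def n_def)
  have eZ: "e i \<in> Z" if "i < n" for i using enum_in[OF fin] that by (simp add: e_def n_def)
  have ee: "cinner (e b) (e a) = (if b = a then 1 else 0)" if "a < n" "b < n" for a b
    using Z eZ[OF that(1)] eZ[OF that(2)] that bij_betw_imp_inj_on[OF bij] by (auto simp: orthonormal_def inj_on_def)
  define lc where "lc c = (\<Sum>b<n. c b *\<^sub>C e b)" for c :: "nat \<Rightarrow> complex"
  note sp = csubspace_span[of Z]
  have lc_in: "lc c \<in> cvs.span Z" for c
    unfolding lc_def using eZ by (intro csubspace_sum[OF sp] csubspace_scale[OF sp] cvs.span_base) auto
  have \<Theta>_lc: "\<Theta> (lc c) = (\<Sum>b<n. c b *\<^sub>C \<Theta> (e b))" for c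
  proof -
    have "\<Theta> (lc c) = (\<Sum>b<n. \<Theta> (c b *\<^sub>C e b))"
      unfolding lc_def using eZ by (intro clinear_on_sum[OF lin sp] csubspace_scale[OF sp] cvs.span_base) auto
    also have "\<dots> = (\<Sum>b<n. c b *\<^sub>C \<Theta> (e b))"
      using eZ by (intro sum.cong refl clinear_on_scale[OF lin sp] cvs.span_base) auto
    finally show ?thesis .
  qed
  have coord: "cinner (lc c) (e a) = c a" if "a < n" for c a
  proof -
    have "cinner (lc c) (e a) = (\<Sum>b<n. if b = a then c b else 0)"
      unfolding lc_def cinner_sum_left cinner_scaleC_left using ee[OF that] by (intro sum.cong) auto
    then show ?thesis using that by simp
  qed
  have zero_iff: "y = 0 \<longleftrightarrow> (\<forall>a<n. cinner y (e a) = 0)" if "y \<in> cvs.span Z" for y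
  proof
    assume *: "\<forall>a<n. cinner y (e a) = 0"
    have "cinner y z = 0" if "z \<in> Z" for z
      using * bij that unfolding bij_betw_def by auto
    then have "proj Z y = 0" by (simp add: proj_def)
    then show "y = 0" using proj_span[OF Z \<open>y \<in> cvs.span Z\<close>] by simp
  qed simp
  have mulv: "?M *\<^sub>v vec n c = 0\<^sub>v n \<longleftrightarrow> \<Theta> (lc c) = 0" for c
  proof -
    have row: "vec_index (?M *\<^sub>v vec n c) a = cinner (\<Theta> (lc c)) (e a)" if "a < n" for a
      using that unfolding \<Theta>_lc cinner_sum_left cinner_scaleC_left
      by (simp add: scalar_prod_def atLeast0LessThan mult.commute)
    have "?M *\<^sub>v vec n c = 0\<^sub>v n \<longleftrightarrow> (\<forall>a<n. vec_index (?M *\<^sub>v vec n c) a = 0)"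
    proof
      show "?M *\<^sub>v vec n c = 0\<^sub>v n" if "\<forall>a<n. vec_index (?M *\<^sub>v vec n c) a = 0"
        using that by (intro eq_vecI) simp_all
    qed simp
    also have "\<dots> \<longleftrightarrow> (\<forall>a<n. cinner (\<Theta> (lc c)) (e a) = 0)" using row by simp
    also have "\<dots> \<longleftrightarrow> \<Theta> (lc c) = 0" using zero_iff[of "\<Theta> (lc c)"] im lc_in[of c] by blast
    finally show ?thesis .
  qed
  have "opdet Z \<Theta> = 0 \<longleftrightarrow> (\<exists>v. v \<in> carrier_vec n \<and> v \<noteq> 0\<^sub>v n \<and> ?M *\<^sub>v v = 0\<^sub>v n)"
    unfolding opdet_def n_def[symmetric] e_def[symmetric] by (rule det_0_iff_vec_prod_zero) simp
  also have "\<dots> \<longleftrightarrow> (\<exists>x\<in>cvs.span Z. x \<noteq> 0 \<and> \<Theta> x = 0)"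
  proof
    assume "\<exists>v. v \<in> carrier_vec n \<and> v \<noteq> 0\<^sub>v n \<and> ?M *\<^sub>v v = 0\<^sub>v n"
    then obtain v where v: "v \<in> carrier_vec n" "v \<noteq> 0\<^sub>v n" "?M *\<^sub>v v = 0\<^sub>v n" by blast
    have vv: "v = vec n (\<lambda>i. vec_index v i)" using v(1) by (intro eq_vecI) auto
    then have "\<Theta> (lc (\<lambda>i. vec_index v i)) = 0" using v(3) mulv[of "\<lambda>i. vec_index v i"] by simp
    moreover have "lc (\<lambda>i. vec_index v i) \<noteq> 0"
    proof
      assume "lc (\<lambda>i. vec_index v i) = 0"
      then have "vec_index v a = 0" if "a < n" for a using coord[OF that, of "\<lambda>i. vec_index v i"] by simp
      then have "v = 0\<^sub>v n" using v(1) by (intro eq_vecI) auto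
      then show False using v(2) by simp
    qed
    ultimately show "\<exists>x\<in>cvs.span Z. x \<noteq> 0 \<and> \<Theta> x = 0" using lc_in by blast
  next
    assume "\<exists>x\<in>cvs.span Z. x \<noteq> 0 \<and> \<Theta> x = 0"
    then obtain x where x: "x \<in> cvs.span Z" "x \<noteq> 0" "\<Theta> x = 0" by blast
    define c where "c b = cinner x (e b)" for b
    have "x = lc c"
    proof -
      have "x = (\<Sum>z\<in>Z. cinner x z *\<^sub>C z)" using proj_span[OF Z x(1)] by (simp add: proj_def)
      also have "\<dots> = lc c" unfolding lc_def c_def by (rule sum.reindex_bij_betw[OF bij, symmetric])
      finally show ?thesis .
    qed
    then have "?M *\<^sub>v vec n c = 0\<^sub>v n" using mulv[of c] x(3) by simp
    moreover have "vec n c \<noteq> 0\<^sub>v n"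
    proof
      assume eq: "vec n c = 0\<^sub>v n"
      have "cinner x (e a) = 0" if "a < n" for a using arg_cong[OF eq, of "\<lambda>v. vec_index v a"] that by (simp add: c_def)
      then show False using zero_iff[OF x(1)] x(2) by simp
    qed
    ultimately show "\<exists>v. v \<in> carrier_vec n \<and> v \<noteq> 0\<^sub>v n \<and> ?M *\<^sub>v v = 0\<^sub>v n" by (intro exI[of _ "vec n c"]) auto
  qed
  finally show ?thesis .
qed

lemma finite_dim_bounded_below:
  fixes \<Theta> :: "'a::cinner_space \<Rightarrow> 'a"
  assumes Z: "orthonormal Z" and lin: "clinear_on (cvs.span Z) \<Theta>" and im: "\<Theta> ` cvs.span Z \<subseteq> cvs.span Z"
    and inj: "\<And>x. x \<in> cvs.span Z \<Longrightarrow> \<Theta> x = 0 \<Longrightarrow> x = 0"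
  obtains c where "c \<ge> 0" "\<forall>x\<in>cvs.span Z. norm x \<le> c * norm (\<Theta> x)"
proof -
  have fin: "finite Z" using Z by (simp add: orthonormal_def)
  note sp = csubspace_span[of Z]
  have "\<exists>w. w \<in> cvs.span Z \<and> \<Theta> w = z" if "z \<in> Z" for z
    using inj_imp_surj_on[OF sp lin im cdim_le_span[OF fin order_refl] inj cvs.span_base[OF that]] by blast
  then obtain w where w: "\<And>z. z \<in> Z \<Longrightarrow> w z \<in> cvs.span Z" "\<And>z. z \<in> Z \<Longrightarrow> \<Theta> (w z) = z" by metis
  have "norm x \<le> (\<Sum>z\<in>Z. norm (w z)) * norm (\<Theta> x)" if x: "x \<in> cvs.span Z" for x
  proof -
    let ?y = "\<Sum>z\<in>Z. cinner (\<Theta> x) z *\<^sub>C w z"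
    have y: "?y \<in> cvs.span Z" using w(1) by (intro csubspace_sum[OF sp] csubspace_scale[OF sp]) auto
    have "\<Theta> ?y = (\<Sum>z\<in>Z. \<Theta> (cinner (\<Theta> x) z *\<^sub>C w z))"
      using w(1) by (intro clinear_on_sum[OF lin sp] csubspace_scale[OF sp]) auto
    also have "\<dots> = (\<Sum>z\<in>Z. cinner (\<Theta> x) z *\<^sub>C z)"
      using w by (intro sum.cong refl) (simp add: clinear_on_scale[OF lin sp])
    also have "\<dots> = \<Theta> x" using proj_span[OF Z, of "\<Theta> x"] im x by (auto simp: proj_def)
    finally have "\<Theta> (x - ?y) = 0" using clinear_on_diff[OF lin sp x y] by simp
    then have "x = ?y" using inj[OF csubspace_diff[OF sp x y]] by simp
    then have "norm x \<le> (\<Sum>z\<in>Z. norm (cinner (\<Theta> x) z *\<^sub>C w z))" by (metis norm_sum)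
    also have "\<dots> \<le> (\<Sum>z\<in>Z. norm (w z) * norm (\<Theta> x))"
    proof (rule sum_mono)
      fix z assume "z \<in> Z"
      then have "norm z = 1" using Z norm_eq_sqrt_cinner[of z] by (simp add: orthonormal_def)
      then have "cmod (cinner (\<Theta> x) z) \<le> norm (\<Theta> x)" using cinner_Cauchy_Schwarz[of "\<Theta> x" z] by simp
      then show "norm (cinner (\<Theta> x) z *\<^sub>C w z) \<le> norm (w z) * norm (\<Theta> x)"
        unfolding norm_scaleC mult.commute[of "norm (w z)"] by (rule mult_right_mono) simp
    qed
    also have "\<dots> = (\<Sum>z\<in>Z. norm (w z)) * norm (\<Theta> x)" by (simp add: sum_distrib_right)
    finally show ?thesis .
  qed
  then show ?thesis using that[of "\<Sum>z\<in>Z. norm (w z)"] by (simp add: sum_nonneg)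
qed

text \<open>For an affine pencil, \<open>x l - x l0 = - (l - l0) y l\<close>, where
  \<open>y l\<close> solves \<open>M l (y l) = B (x l0)\<close>. The difference quotient of
  \<open>\<phi> (x l)\<close> is therefore \<open>- \<phi> (y l)\<close>, and the same identity with
  the uniform lower bound makes \<open>y\<close> continuous at \<open>l0\<close>.\<close>

lemma pencil_holomorphic:
  fixes M :: "complex \<Rightarrow> 'a::cinner_space \<Rightarrow> 'a" and \<phi> :: "'a \<Rightarrow> complex"
  assumes S: "open S" and W: "csubspace W" and c: "c > 0"
    and lower: "\<And>l u. l \<in> S \<Longrightarrow> u \<in> W \<Longrightarrow> c * norm u \<le> norm (M l u)"
    and lin: "\<And>l. l \<in> S \<Longrightarrow> clinear_on W (M l)"
    and pencil: "\<And>l l' u. u \<in> W \<Longrightarrow> M l u - M l' u = (l - l') *\<^sub>C B u"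
    and B: "\<And>u. u \<in> W \<Longrightarrow> B u \<in> W"
    and surj: "\<And>l g. l \<in> S \<Longrightarrow> g \<in> W \<Longrightarrow> \<exists>u\<in>W. M l u = g"
    and x: "\<And>l. l \<in> S \<Longrightarrow> x l \<in> W" "\<And>l. l \<in> S \<Longrightarrow> M l (x l) = e"
    and \<phi>: "\<And>u v. u \<in> W \<Longrightarrow> v \<in> W \<Longrightarrow> \<phi> (u - v) = \<phi> u - \<phi> v" "\<And>a u. u \<in> W \<Longrightarrow> \<phi> (a *\<^sub>C u) = a * \<phi> u"
      "\<And>u. u \<in> W \<Longrightarrow> cmod (\<phi> u) \<le> b * norm u"
  shows "(\<lambda>l. \<phi> (x l)) holomorphic_on S"
  unfolding holomorphic_on_open[OF S]
proof (intro ballI)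
  fix l0 assume l0: "l0 \<in> S"
  have inj: "u = v" if "l \<in> S" "u \<in> W" "v \<in> W" "M l u = M l v" for l u v
  proof -
    have "c * norm (u - v) \<le> norm (M l (u - v))" by (rule lower[OF that(1) csubspace_diff[OF W that(2,3)]])
    then show ?thesis using c that clinear_on_diff[OF lin[OF that(1)] W that(2,3)] by (simp add: mult_le_0_iff)
  qed
  have "\<forall>l. \<exists>u. l \<in> S \<longrightarrow> u \<in> W \<and> M l u = B (x l0)" using surj B x(1)[OF l0] by blast
  from choice[OF this] obtain y where y: "\<And>l. l \<in> S \<Longrightarrow> y l \<in> W" "\<And>l. l \<in> S \<Longrightarrow> M l (y l) = B (x l0)" by blast
  have step: "u' - u = - ((l - l0) *\<^sub>C v)"
    if l: "l \<in> S" and u: "u \<in> W" "M l0 u = g" and u': "u' \<in> W" "M l u' = g" and v: "v \<in> W" "M l v = B u" for l u u' v g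
  proof (rule inj[OF l])
    show "u' - u \<in> W" by (rule csubspace_diff[OF W u'(1) u(1)])
    show "- ((l - l0) *\<^sub>C v) \<in> W" by (rule csubspace_neg[OF W csubspace_scale[OF W v(1)]])
    have "M l (u' - u) = - (M l u - M l0 u)" using clinear_on_diff[OF lin[OF l] W u'(1) u(1)] u(2) u'(2) by simp
    also have "\<dots> = - ((l - l0) *\<^sub>C B u)" using pencil[OF u(1)] by simp
    also have "\<dots> = M l (- ((l - l0) *\<^sub>C v))"
      by (simp add: clinear_on_neg[OF lin[OF l] W csubspace_scale[OF W v(1)]] clinear_on_scale[OF lin[OF l] W v(1)] v(2))
    finally show "M l (u' - u) = M l (- ((l - l0) *\<^sub>C v))" .
  qed
  define k where "k = norm (B (y l0)) / c"
  have ylim: "norm (y l - y l0) \<le> cmod (l - l0) * k" if l: "l \<in> S" for l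
  proof -
    obtain v where v: "v \<in> W" "M l v = B (y l0)" using surj[OF l B[OF y(1)[OF l0]]] by blast
    have "norm (y l - y l0) = cmod (l - l0) * norm v"
      using step[OF l y(1)[OF l0] y(2)[OF l0] y(1)[OF l] y(2)[OF l] v] by (simp add: norm_scaleC)
    also have "norm v \<le> k" using lower[OF l v(1)] c by (simp add: k_def v(2) field_simps)
    finally show ?thesis by (simp add: mult_left_mono)
  qed
  have quot: "(\<phi> (x l) - \<phi> (x l0)) / (l - l0) = - \<phi> (y l)" if l: "l \<in> S" "l \<noteq> l0" for l
  proof -
    have "\<phi> (x l) - \<phi> (x l0) = \<phi> (x l - x l0)" using \<phi>(1) x(1) l l0 by simp
    also have "x l - x l0 = (- (l - l0)) *\<^sub>C y l"
      using step[OF l(1) x(1)[OF l0] x(2)[OF l0] x(1)[OF l(1)] x(2)[OF l(1)] y(1)[OF l(1)] y(2)[OF l(1)]] by (simp only: cvs.scale_minus_left)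
    finally show ?thesis using \<phi>(2)[OF y(1)[OF l(1)], of "- (l - l0)"] l(2) by (simp add: field_simps)
  qed
  have "((\<lambda>l. - \<phi> (y l)) \<longlongrightarrow> - \<phi> (y l0)) (at l0)"
  proof (rule tendsto_minus, rule LIM_zero_cancel, rule Lim_null_comparison)
    show "eventually (\<lambda>l. norm (\<phi> (y l) - \<phi> (y l0)) \<le> \<bar>b\<bar> * (cmod (l - l0) * k)) (at l0)"
      using eventually_at_in_open'[OF S l0]
    proof eventually_elim
      case (elim l)
      have "norm (\<phi> (y l) - \<phi> (y l0)) \<le> b * norm (y l - y l0)"
        unfolding \<phi>(1)[OF y(1)[OF elim] y(1)[OF l0], symmetric]
        by (rule \<phi>(3)[OF csubspace_diff[OF W y(1)[OF elim] y(1)[OF l0]]])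
      also have "\<dots> \<le> \<bar>b\<bar> * norm (y l - y l0)" by (intro mult_right_mono) auto
      also have "\<dots> \<le> \<bar>b\<bar> * (cmod (l - l0) * k)" by (intro mult_left_mono ylim elim) auto
      finally show ?case .
    qed
    have "((\<lambda>l. \<bar>b\<bar> * (cmod (l - l0) * k)) \<longlongrightarrow> \<bar>b\<bar> * (cmod (l0 - l0) * k)) (at l0)" by (intro tendsto_intros)
    then show "((\<lambda>l. \<bar>b\<bar> * (cmod (l - l0) * k)) \<longlongrightarrow> 0) (at l0)" by simp
  qed
  then have "((\<lambda>l. (\<phi> (x l) - \<phi> (x l0)) / (l - l0)) \<longlongrightarrow> - \<phi> (y l0)) (at l0)"
  proof (rule Lim_transform_eventually)
    show "eventually (\<lambda>l. - \<phi> (y l) = (\<phi> (x l) - \<phi> (x l0)) / (l - l0)) (at l0)"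
      using eventually_at_in_open[OF S l0] by eventually_elim (use quot in auto)
  qed
  then show "\<exists>f'. ((\<lambda>l. \<phi> (x l)) has_field_derivative f') (at l0)"
    unfolding has_field_derivative_iff by blast
qed

section \<open>The spectral window\<close>

context limit_graph
begin

text \<open>The closure of \<open>S \<mu>\<close> as a relation.\<close>

definition Sr :: "'a \<Rightarrow> 'a \<Rightarrow> bool" where
  "Sr x s \<longleftrightarrow> (\<exists>f. (\<forall>n. f n \<in> Dp) \<and> f \<longlonglongrightarrow> x \<and> (\<lambda>n. S \<mu> (f n)) \<longlonglongrightarrow> s)"

lemma SrI: "(\<And>n. f n \<in> Dp) \<Longrightarrow> f \<longlonglongrightarrow> x \<Longrightarrow> (\<lambda>n. S \<mu> (f n)) \<longlonglongrightarrow> s \<Longrightarrow> Sr x s"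
  unfolding Sr_def by blast

lemma SrE:
  assumes "Sr x s"
  obtains f where "\<And>n. f n \<in> Dp" "f \<longlonglongrightarrow> x" "(\<lambda>n. S \<mu> (f n)) \<longlonglongrightarrow> s"
  using assms unfolding Sr_def by blast

lemma Sr_S: "x \<in> Dp \<Longrightarrow> Sr x (S \<mu> x)"
  by (rule SrI[of "\<lambda>_. x"]) auto

lemma Sr_add:
  assumes "Sr x s" "Sr y t"
  shows "Sr (x + y) (s + t)"
proof -
  obtain f where f: "\<And>n. f n \<in> Dp" "f \<longlonglongrightarrow> x" "(\<lambda>n. S \<mu> (f n)) \<longlonglongrightarrow> s" using assms(1) by (rule SrE) blast
  obtain g where g: "\<And>n. g n \<in> Dp" "g \<longlonglongrightarrow> y" "(\<lambda>n. S \<mu> (g n)) \<longlonglongrightarrow> t" using assms(2) by (rule SrE) blast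
  show ?thesis
    by (rule SrI[of "\<lambda>n. f n + g n"])
      (use tendsto_add[OF f(2) g(2)] tendsto_add[OF f(3) g(3)] in \<open>simp_all add: S_simps(1)[OF mu] f g csubspace_add[OF Dp(1)]\<close>)
qed

lemma Sr_scale:
  assumes "Sr x s"
  shows "Sr (c *\<^sub>C x) (c *\<^sub>C s)"
proof -
  obtain f where f: "\<And>n. f n \<in> Dp" "f \<longlonglongrightarrow> x" "(\<lambda>n. S \<mu> (f n)) \<longlonglongrightarrow> s" using assms(1) by (rule SrE) blast
  show ?thesis
    by (rule SrI[of "\<lambda>n. c *\<^sub>C f n"])
      (use tendsto_scaleC[OF tendsto_const f(2)] tendsto_scaleC[OF tendsto_const f(3)]
        in \<open>simp_all add: S_simps(3)[OF mu f(1) f(1)] f csubspace_scale[OF Dp(1)]\<close>)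
qed

lemma Sr_diff: "Sr x s \<Longrightarrow> Sr y t \<Longrightarrow> Sr (x - y) (s - t)"
  using Sr_add[of x s "- y" "- t"] Sr_scale[of y t "-1"] by (simp add: scaleC_minus_one[symmetric])

lemma Sr_Pp:
  assumes "Sr x s"
  shows "Pp x = x" "Pp s = s"
proof -
  obtain f where f: "\<And>n. f n \<in> Dp" "f \<longlonglongrightarrow> x" "(\<lambda>n. S \<mu> (f n)) \<longlonglongrightarrow> s" using assms(1) by (rule SrE) blast
  show "Pp x = x" using tendsto_Pp[OF f(2)] f(2) by (simp add: Pp_Dp f(1) LIMSEQ_unique)
  show "Pp s = s" using tendsto_Pp[OF f(3)] f(3) by (simp add: LIMSEQ_unique)
qed

lemma Sr_dissipative:
  assumes "Sr x s"
  shows "Re (cinner s x) \<le> 0"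
proof -
  obtain f where f: "\<And>n. f n \<in> Dp" "f \<longlonglongrightarrow> x" "(\<lambda>n. S \<mu> (f n)) \<longlonglongrightarrow> s" using assms(1) by (rule SrE) blast
  show ?thesis
  proof (rule LIMSEQ_le_const2)
    show "(\<lambda>n. Re (cinner (S \<mu> (f n)) (f n))) \<longlonglongrightarrow> Re (cinner s x)" by (intro tendsto_Re tendsto_cinner f)
    show "\<exists>N. \<forall>n\<ge>N. Re (cinner (S \<mu> (f n)) (f n)) \<le> 0" using S_dissipative[OF mu f(1)] by blast
  qed
qed

text \<open>Cover the compact image of the unit ball by balls of radius \<open>\<delta>/2\<close>
  and move their centres, by less than \<open>\<delta>/2\<close>, into \<open>Dp\<close>. Taking
  them from \<open>Dp\<close> puts the chosen subspace inside all sufficiently large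
  sections.\<close>

lemma G_finite_rank_approx:
  assumes "\<delta> > 0"
  obtains X where "finite X" "X \<subseteq> Dp" "\<And>w. norm (G \<mu> w - proj (onb X) (G \<mu> w)) \<le> \<delta> * norm w"
proof -
  obtain C where C: "compact C" "\<And>y. norm y \<le> 1 \<Longrightarrow> G \<mu> y \<in> C" using G_compact[OF mu, of 1] by blast
  have cover: "C \<subseteq> (\<Union>c\<in>C. ball c (\<delta>/2))" using assms by force
  obtain C' where C': "C' \<subseteq> C" "finite C'" "C \<subseteq> (\<Union>c\<in>C'. ball c (\<delta>/2))"
    by (rule compactE_image[OF C(1) open_ball cover])
  have "\<forall>c. \<exists>x. x \<in> Dp \<and> norm (Pp c - x) < \<delta>/2" using dense_Dp[of "Pp _" "\<delta>/2"] assms by (metis Pp_Pp half_gt_zero)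
  from choice[OF this] obtain h where h: "\<And>c. h c \<in> Dp" "\<And>c. norm (Pp c - h c) < \<delta>/2" by blast
  let ?X = "h ` C'"
  have fin: "finite ?X" using C' by simp
  note oX = orthonormal_onb[OF fin]
  have 1: "norm (G \<mu> w - proj (onb ?X) (G \<mu> w)) \<le> \<delta>" if w: "norm w \<le> 1" for w
  proof -
    obtain c where c: "c \<in> C'" "norm (G \<mu> w - c) < \<delta>/2"
      using C(2)[OF w] C'(3) by (auto simp: dist_norm norm_minus_commute)
    have "h c \<in> cvs.span (onb ?X)" unfolding span_onb[OF fin] using c(1) by (intro cvs.span_base) blast
    then have "norm (G \<mu> w - proj (onb ?X) (G \<mu> w)) \<le> norm (G \<mu> w - h c)" by (rule norm_diff_proj_le_dist[OF oX])
    also have "\<dots> \<le> norm (Pp (G \<mu> w - c)) + norm (Pp c - h c)"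
      using norm_triangle_ineq[of "Pp (G \<mu> w - c)" "Pp c - h c"] by (simp add: Pp_simps)
    also have "\<dots> \<le> \<delta>" using norm_Pp_le[of "G \<mu> w - c"] c(2) h(2)[of c] by linarith
    finally show ?thesis .
  qed
  show ?thesis
  proof (rule that[OF fin])
    show "?X \<subseteq> Dp" using h by blast
    fix w
    show "norm (G \<mu> w - proj (onb ?X) (G \<mu> w)) \<le> \<delta> * norm w"
    proof (cases "w = 0")
      case True
      then show ?thesis by (simp add: clinear_map_zero[OF clinear_G[OF mu]] clinear_map_zero[OF clinear_proj])
    next
      case False
      let ?w = "(1 / norm w) *\<^sub>R w"
      have "norm (G \<mu> ?w - proj (onb ?X) (G \<mu> ?w)) \<le> \<delta>" using False by (intro 1) simp
      also have "G \<mu> ?w - proj (onb ?X) (G \<mu> ?w) = (1 / norm w) *\<^sub>R (G \<mu> w - proj (onb ?X) (G \<mu> w))"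
        by (simp only: clinear_mapD(7)[OF clinear_G[OF mu]] clinear_mapD(7)[OF clinear_proj] scaleR_diff_right)
      finally show ?thesis using False by (simp add: divide_le_eq)
    qed
  qed
qed

end

text \<open>On \<open>Om\<close> the compact \<open>G\<close> is split into the finite-rank part \<open>proj Z \<circ> G\<close> and a remainder \<open>Q\<close> so small that
  \<open>M0 l = S - l + (l - \<mu>) Q K\<close> stays invertible with inverse \<open>x0 l\<close>; then \<open>S - l + (l - \<mu>) G K\<close> is invertible iff
  \<open>Th l = 1 + (l - \<mu>) proj Z G K x0 l\<close> is so on \<open>span Z\<close>. \<open>Mi\<close>, \<open>xi\<close>, \<open>Thi\<close> are the counterparts for the
  finite sections.\<close>

locale spectral_window = limit_graph Pp Pm Dp Dm A m U k K
  for Pp Pm :: "'a::{cinner_space, complete_space} \<Rightarrow> 'a" and Dp Dm A m U k K +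
  fixes r \<kappa> :: real and Om :: "complex set" and Z :: "'a set"
  assumes r: "r > 0" and kap: "\<kappa> > 0" and Om: "open Om"
    and Om_Re: "\<And>l. l \<in> Om \<Longrightarrow> Re l > r"
    and Om_bound: "\<And>l e. l \<in> Om \<Longrightarrow> 0 \<le> e \<Longrightarrow> e \<le> 1 \<Longrightarrow> cmod (l + of_real m - of_real e) \<le> \<kappa>"
    and Z: "orthonormal Z" "Z \<subseteq> range Pp" "eventually (\<lambda>i. cvs.span Z \<subseteq> cvs.span (onb (fst i))) U"
    and Z_approx: "\<And>w. norm (G (- of_real m) w - proj Z (G (- of_real m) w)) \<le> r / (2 * \<kappa>) * norm w"
    and Sr_surj: "\<And>l g. Re l > 0 \<Longrightarrow> Pp g = g \<Longrightarrow> \<exists>x s. Sr x s \<and> s - l *\<^sub>C x = g"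
begin

definition Q :: "'a \<Rightarrow> 'a" where "Q w = G \<mu> w - proj Z (G \<mu> w)"

lemma Om_bound0: "l \<in> Om \<Longrightarrow> cmod (l - \<mu>) \<le> \<kappa>"
  using Om_bound[of l 0] by simp

lemma clinear_Q: "clinear_map Q"
  by (rule clinear_mapI)
    (simp_all add: Q_def clinear_mapD(1,2)[OF clinear_G[OF mu]] clinear_mapD(1,2)[OF clinear_proj] cvs.scale_right_diff_distrib)

lemma norm_Q: "norm (Q w) \<le> r / (2 * \<kappa>) * norm w"
  using Z_approx by (simp add: Q_def)

lemma Pp_span_Z: "x \<in> cvs.span Z \<Longrightarrow> Pp x = x"
  by (rule span_subset_Pp[OF Z(2)])

lemma Pp_Q: "Pp (Q w) = Q w"
  by (simp add: Q_def Pp_simps Pp_span_Z[OF proj_in_span])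

lemma bounded_linear_Q: "bounded_linear Q"
  by (rule bounded_linear_if_clinear[OF clinear_Q norm_Q])

text \<open>The tolerance \<open>r / (2 \<kappa>)\<close> is tuned so that, after the factor of size
  at most \<open>\<kappa>\<close>, the remainder uses up half of the resolvent bound
  \<open>r\<close>. The case \<open>e = 0\<close> is for the limit, \<open>e = snd i\<close> for the
  sections.\<close>

lemma perturbation_bound:
  fixes w x y :: 'a
  assumes "l \<in> Om" "0 \<le> e" "e \<le> 1" "norm w \<le> norm x" "norm y \<le> norm (Q w)"
  shows "norm ((l - \<mu> - of_real e) *\<^sub>C y) \<le> r / 2 * norm x"
proof -
  have "norm ((l - \<mu> - of_real e) *\<^sub>C y) = cmod (l - \<mu> - of_real e) * norm y" by (rule norm_scaleC)
  also have "\<dots> \<le> \<kappa> * (r / (2 * \<kappa>) * norm w)"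
    using Om_bound[OF assms(1-3)] order_trans[OF assms(5) norm_Q] kap by (intro mult_mono) auto
  also have "\<dots> = r / 2 * norm w" using kap by simp
  also have "\<dots> \<le> r / 2 * norm x" using assms(4) r by (intro mult_left_mono) auto
  finally show ?thesis .
qed

text \<open>The image \<open>s\<close> of \<open>x\<close> under the closure of \<open>S\<close> is
  passed as a second argument, since that closure is a relation.\<close>

definition M0 :: "complex \<Rightarrow> 'a \<Rightarrow> 'a \<Rightarrow> 'a" where
  "M0 l x s = s - l *\<^sub>C x + (l - \<mu>) *\<^sub>C Q (K x)"

lemma M0_add: "M0 l (x + y) (s + t) = M0 l x s + M0 l y t"
  by (simp add: M0_def clinear_mapD(1)[OF K(1)] clinear_mapD(1)[OF clinear_Q] scaleC_add_right)

lemma M0_diff: "M0 l (x - y) (s - t) = M0 l x s - M0 l y t"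
  by (simp add: M0_def clinear_mapD(4)[OF K(1)] clinear_mapD(4)[OF clinear_Q] cvs.scale_right_diff_distrib)

lemma M0_scale: "M0 l (c *\<^sub>C x) (c *\<^sub>C s) = c *\<^sub>C M0 l x s"
  by (simp add: M0_def clinear_mapD(2)[OF K(1)] clinear_mapD(2)[OF clinear_Q] scaleC_add_right
      cvs.scale_right_diff_distrib mult.commute)

lemma M0_lower:
  assumes "l \<in> Om" "Sr x s"
  shows "r / 2 * norm x \<le> norm (M0 l x s)"
proof -
  have "r * norm x \<le> Re l * norm x" using Om_Re[OF assms(1)] by (intro mult_right_mono) auto
  also have "\<dots> \<le> norm (s - l *\<^sub>C x)" by (rule dissipative_lower_bound[OF Sr_dissipative[OF assms(2)]])
  finally have 1: "r * norm x \<le> norm (s - l *\<^sub>C x)" .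
  have 2: "norm ((l - \<mu>) *\<^sub>C Q (K x)) \<le> r / 2 * norm x"
    using perturbation_bound[OF assms(1), of 0 "K x" x "Q (K x)"] K(2) by simp
  have "norm (s - l *\<^sub>C x) \<le> norm (M0 l x s) + norm ((l - \<mu>) *\<^sub>C Q (K x))"
    using norm_triangle_ineq4[of "M0 l x s" "(l - \<mu>) *\<^sub>C Q (K x)"] by (simp add: M0_def)
  then show ?thesis using 1 2 by linarith
qed

lemma M0_surj:
  assumes l: "l \<in> Om" and g: "Pp g = g"
  shows "\<exists>x s. Sr x s \<and> M0 l x s = g"
proof -
  have Rel: "Re l > 0" using Om_Re[OF l] r by linarith
  have "\<forall>y. \<exists>x s. Sr x s \<and> s - l *\<^sub>C x = Pp y" using Sr_surj[OF Rel] by simp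
  then have "\<forall>y. \<exists>x. \<exists>s. Sr x s \<and> s - l *\<^sub>C x = Pp y" by blast
  from choice[OF this] obtain h where h: "\<And>y. \<exists>s. Sr (h y) s \<and> s - l *\<^sub>C h y = Pp y" by blast
  \<comment> \<open>Solving \<open>s - l x = y\<close> first and treating the remainder as a
    perturbation of the identity makes \<open>T\<close> a contraction with constant
    \<open>1/2\<close>.\<close>
  define T where "T y = (l - \<mu>) *\<^sub>C Q (K (h y))" for y
  have "norm (T y - T y') \<le> (1/2) * norm (y - y')" for y y'
  proof -
    obtain s s' where s: "Sr (h y) s" "s - l *\<^sub>C h y = Pp y" "Sr (h y') s'" "s' - l *\<^sub>C h y' = Pp y'" using h by blast
    have "r * norm (h y - h y') \<le> Re l * norm (h y - h y')" using Om_Re[OF l] by (intro mult_right_mono) auto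
    also have "\<dots> \<le> norm ((s - s') - l *\<^sub>C (h y - h y'))"
      by (rule dissipative_lower_bound[OF Sr_dissipative[OF Sr_diff[OF s(1,3)]]])
    also have "(s - s') - l *\<^sub>C (h y - h y') = (s - l *\<^sub>C h y) - (s' - l *\<^sub>C h y')"
      by (simp add: cvs.scale_right_diff_distrib)
    also have "\<dots> = Pp (y - y')" unfolding s(2,4) by (simp add: Pp_simps)
    also have "norm \<dots> \<le> norm (y - y')" by (rule norm_Pp_le)
    finally have *: "r * norm (h y - h y') \<le> norm (y - y')" .
    have "T y - T y' = (l - \<mu> - of_real 0) *\<^sub>C Q (K (h y - h y'))"
      by (simp add: T_def clinear_mapD(4)[OF K(1)] clinear_mapD(4)[OF clinear_Q] cvs.scale_right_diff_distrib)
    then have "norm (T y - T y') \<le> r / 2 * norm (h y - h y')"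
      using perturbation_bound[OF l order_refl, of "K (h y - h y')" "h y - h y'" "Q (K (h y - h y'))"] K(2) by simp
    then show ?thesis using * by linarith
  qed
  then obtain v where v: "v + T v = g" using solve_contraction[of "1/2" T g] by auto
  have "Pp v = v"
  proof -
    have "v = g - T v" using v by (simp add: algebra_simps)
    moreover have "Pp (g - T v) = g - T v" by (simp add: T_def Pp_simps Pp_Q g)
    ultimately show ?thesis by simp
  qed
  then obtain s where s: "Sr (h v) s" "s - l *\<^sub>C h v = v" using h[of v] by auto
  have "M0 l (h v) s = g" using v by (simp add: M0_def s(2) T_def)
  then show ?thesis using s(1) by blast
qed

definition x0 :: "complex \<Rightarrow> 'a \<Rightarrow> 'a" where
  "x0 l g = (SOME x. \<exists>s. Sr x s \<and> M0 l x s = g)"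

lemma x0:
  assumes "l \<in> Om" "Pp g = g"
  obtains s where "Sr (x0 l g) s" "M0 l (x0 l g) s = g"
  using someI_ex[OF M0_surj[OF assms]] unfolding x0_def by blast

lemma x0_eq:
  assumes l: "l \<in> Om" and "Sr x s"
  shows "x0 l (M0 l x s) = x"
proof -
  have "Pp (M0 l x s) = M0 l x s" using Sr_Pp[OF assms(2)] by (simp add: M0_def Pp_simps Pp_Q)
  then obtain t where t: "Sr (x0 l (M0 l x s)) t" "M0 l (x0 l (M0 l x s)) t = M0 l x s" using x0[OF l] by blast
  have "r / 2 * norm (x0 l (M0 l x s) - x) \<le> norm (M0 l (x0 l (M0 l x s) - x) (t - s))"
    by (rule M0_lower[OF l Sr_diff[OF t(1) assms(2)]])
  then have "r / 2 * norm (x0 l (M0 l x s) - x) \<le> 0" by (simp add: M0_diff t(2))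
  then show ?thesis using r by (simp add: mult_le_0_iff)
qed

lemma x0_add:
  assumes "l \<in> Om" "Pp g = g" "Pp h = h"
  shows "x0 l (g + h) = x0 l g + x0 l h"
proof -
  obtain s where s: "Sr (x0 l g) s" "M0 l (x0 l g) s = g" using x0[OF assms(1,2)] by blast
  obtain t where t: "Sr (x0 l h) t" "M0 l (x0 l h) t = h" using x0[OF assms(1,3)] by blast
  show ?thesis using x0_eq[OF assms(1) Sr_add[OF s(1) t(1)]] by (simp add: M0_add s(2) t(2))
qed

lemma x0_scale:
  assumes "l \<in> Om" "Pp g = g"
  shows "x0 l (c *\<^sub>C g) = c *\<^sub>C x0 l g"
proof -
  obtain s where s: "Sr (x0 l g) s" "M0 l (x0 l g) s = g" using x0[OF assms] by blast
  show ?thesis using x0_eq[OF assms(1) Sr_scale[OF s(1), of c]] by (simp add: M0_scale s(2))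
qed

definition Th :: "complex \<Rightarrow> 'a \<Rightarrow> 'a" where
  "Th l e = e + (l - \<mu>) *\<^sub>C proj Z (G \<mu> (K (x0 l e)))"

lemma Th_lin:
  assumes "l \<in> Om"
  shows "clinear_on (cvs.span Z) (Th l)"
  unfolding clinear_on_def Th_def
  by (simp add: Pp_span_Z x0_add[OF assms] x0_scale[OF assms] clinear_mapD(1,2)[OF K(1)]
      clinear_mapD(1,2)[OF clinear_G[OF mu]] clinear_mapD(1,2)[OF clinear_proj] scaleC_add_right mult.commute)

lemma Th_im: "Th l ` cvs.span Z \<subseteq> cvs.span Z"
  unfolding Th_def
  by (auto intro!: csubspace_add[OF csubspace_span] csubspace_scale[OF csubspace_span] proj_in_span)

definition gd :: "'a set \<times> real \<Rightarrow> bool" where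
  "gd i \<longleftrightarrow> section_angular i (k i) \<and> finite (fst i) \<and> fst i \<subseteq> Dp \<and> 0 < snd i \<and> snd i < 1
    \<and> cvs.span Z \<subseteq> cvs.span (onb (fst i))"

lemma ev_gd: "eventually gd U"
  using k U(3,4) Z(3) by eventually_elim (simp add: gd_def)

lemma gdD:
  assumes "gd i"
  shows "section_angular i (k i)" "finite (fst i)" "fst i \<subseteq> Dp" "0 < snd i" "snd i < 1"
    "cvs.span Z \<subseteq> cvs.span (onb (fst i))" "clinear_map (k i)" "\<And>x. norm (k i x) \<le> norm x"
    "orthonormal (onb (fst i))" "\<And>x. x \<in> cvs.span (onb (fst i)) \<Longrightarrow> x \<in> Dp"
proof -
  show "section_angular i (k i)" "finite (fst i)" "fst i \<subseteq> Dp" "0 < snd i" "snd i < 1"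
    "cvs.span Z \<subseteq> cvs.span (onb (fst i))" using assms by (simp_all add: gd_def)
  then show "clinear_map (k i)" "\<And>x. norm (k i x) \<le> norm x" by (simp_all add: section_angular_def)
  show "orthonormal (onb (fst i))" "\<And>x. x \<in> cvs.span (onb (fst i)) \<Longrightarrow> x \<in> Dp"
    using E_props(1,2)[of i] assms by (auto simp: gd_def)
qed

text \<open>The factor \<open>l - \<mu> - \<epsilon>\<close> comes from \<open>section_eq\<close>:
  with \<open>a = v + (\<mu> + \<epsilon>) x\<close>, the vector
  \<open>(1 - P G k) (a - l x)\<close> equals \<open>P S x - \<epsilon> x - l x + (l - \<mu> -
  \<epsilon>) P G k x\<close>. Here \<open>G\<close> is replaced by its small part
  \<open>Q\<close>.\<close>

definition Mi :: "'a set \<times> real \<Rightarrow> complex \<Rightarrow> 'a \<Rightarrow> 'a" where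
  "Mi i l x = (P i (S \<mu> x) - of_real (snd i) *\<^sub>C x) - l *\<^sub>C x + (l - \<mu> - of_real (snd i)) *\<^sub>C P i (Q (k i x))"

context
  fixes i assumes gd: "gd i"
begin

abbreviation "W \<equiv> cvs.span (onb (fst i))"

lemma Mi_im: "x \<in> W \<Longrightarrow> Mi i l x \<in> W"
  unfolding Mi_def
  by (intro csubspace_add[OF csubspace_span] csubspace_diff[OF csubspace_span] csubspace_scale[OF csubspace_span] proj_in_span)

lemma Mi_lin: "clinear_on W (Mi i l)"
  unfolding clinear_on_def
proof (intro conjI ballI allI)
  fix x y assume "x \<in> W" "y \<in> W"
  then show "Mi i l (x + y) = Mi i l x + Mi i l y"
    by (simp add: Mi_def S_simps(1)[OF mu] gdD(10)[OF gd] clinear_mapD(1)[OF clinear_proj] clinear_mapD(1)[OF clinear_Q]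
        clinear_mapD(1)[OF gdD(7)[OF gd]] scaleC_add_right)
next
  fix c x assume "x \<in> W"
  then show "Mi i l (c *\<^sub>C x) = c *\<^sub>C Mi i l x"
    by (simp add: Mi_def S_simps(3)[OF mu _ csubspace_zero[OF Dp(1)]] gdD(10)[OF gd] clinear_mapD(2)[OF clinear_proj]
        clinear_mapD(2)[OF clinear_Q] clinear_mapD(2)[OF gdD(7)[OF gd]] scaleC_add_right cvs.scale_right_diff_distrib mult.commute)
qed

lemma Mi_lower:
  assumes "l \<in> Om" "x \<in> W"
  shows "r / 2 * norm x \<le> norm (Mi i l x)"
proof -
  let ?t = "P i (S \<mu> x) - of_real (snd i) *\<^sub>C x"
  have "cinner (P i (S \<mu> x)) x = cinner (S \<mu> x) x" using proj_span[OF gdD(9)[OF gd] assms(2)] by (simp add: proj_selfadjoint)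
  then have "Re (cinner ?t x) = Re (cinner (S \<mu> x) x) - snd i * (norm x)\<^sup>2"
    by (simp add: cinner_simps cinner_self)
  moreover have "0 \<le> snd i * (norm x)\<^sup>2" using gdD(4)[OF gd] by simp
  ultimately have "Re (cinner ?t x) \<le> 0"
    using S_dissipative[OF mu gdD(10)[OF gd assms(2)]] by linarith
  from dissipative_lower_bound[OF this, of l] have 1: "Re l * norm x \<le> norm (?t - l *\<^sub>C x)" .
  have "r * norm x \<le> Re l * norm x" using Om_Re[OF assms(1)] by (intro mult_right_mono) auto
  moreover have 2: "norm ((l - \<mu> - of_real (snd i)) *\<^sub>C P i (Q (k i x))) \<le> r / 2 * norm x"
    using gdD(4,5)[OF gd] gdD(8)[OF gd, of x] norm_proj_le[OF gdD(9)[OF gd], of "Q (k i x)"]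
    by (intro perturbation_bound[OF assms(1), where w = "k i x"]) auto
  moreover have "norm (?t - l *\<^sub>C x) \<le> norm (Mi i l x) + norm ((l - \<mu> - of_real (snd i)) *\<^sub>C P i (Q (k i x)))"
    using norm_triangle_ineq4[of "Mi i l x" "(l - \<mu> - of_real (snd i)) *\<^sub>C P i (Q (k i x))"]
    unfolding Mi_def add_diff_cancel_right' .
  ultimately show ?thesis using 1 by linarith
qed

lemma Mi_inj:
  assumes "l \<in> Om" "x \<in> W" "Mi i l x = 0"
  shows "x = 0"
  using Mi_lower[OF assms(1,2)] r by (simp add: assms(3) mult_le_0_iff)

lemma dim_W: "cdim_le W (card (onb (fst i)))"
  using gdD(9)[OF gd] by (intro cdim_le_span) (auto simp: orthonormal_def)

lemma Mi_surj:
  assumes "l \<in> Om" "g \<in> W"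
  shows "\<exists>x\<in>W. Mi i l x = g"
proof -
  have im: "Mi i l ` W \<subseteq> W" using Mi_im by blast
  obtain x where "x \<in> W" "Mi i l x = g"
    by (rule inj_imp_surj_on[OF csubspace_span Mi_lin im dim_W Mi_inj[OF assms(1)] assms(2)])
  then show ?thesis by blast
qed

text \<open>A kernel vector makes \<open>y = a - l x\<close> a fixed point of \<open>P G k\<close>,
  which has norm at most \<open>1/8\<close>; so \<open>a = l x\<close> and \<open>x + k x\<close> is
  an eigenvector of the section. Dissipativity gives \<open>Re l (|x|^2 - |k x|^2) + \<epsilon>
  (|x|^2 + |k x|^2) \<le> 0\<close>. This is the origin of the nonvanishing determinants.\<close>

lemma section_injective:
  assumes l: "Re l \<ge> 0" and x: "x \<in> W"
    and eq: "(P i (S \<mu> x) - of_real (snd i) *\<^sub>C x) - l *\<^sub>C x + (l - \<mu> - of_real (snd i)) *\<^sub>C P i (G \<mu> (k i x)) = 0"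
  shows "x = 0"
proof -
  define e where "e = complex_of_real (snd i)"
  define z where "z = x + k i x"
  define a where "a = P i (A z) - e *\<^sub>C x"
  define v where "v = a - (\<mu> + e) *\<^sub>C x"
  define y where "y = v + (\<mu> + e - l) *\<^sub>C x"
  have xDp: "x \<in> Dp" by (rule gdD(10)[OF gd x])
  have sa: "Pm (A z) + e *\<^sub>C k i x = k i a" "k i x \<in> Dm"
    using gdD(1)[OF gd] x by (auto simp: section_angular_def a_def z_def e_def)
  have v: "v = P i (S \<mu> x) + P i (G \<mu> (k i v)) - (\<mu> + 2 * e) *\<^sub>C x"
    using section_v[OF x gdD(1-3)[OF gd]] by (simp only: v_def a_def z_def e_def)
  have "P i (G \<mu> (k i y)) = P i (G \<mu> (k i v)) + (\<mu> + e - l) *\<^sub>C P i (G \<mu> (k i x))"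
    by (simp only: y_def clinear_mapD(1,2)[OF gdD(7)[OF gd]] clinear_mapD(1,2)[OF clinear_G[OF mu]] clinear_mapD(1,2)[OF clinear_proj])
  also have "P i (G \<mu> (k i v)) = v - P i (S \<mu> x) + (\<mu> + 2 * e) *\<^sub>C x" using v by (simp add: algebra_simps)
  also have "(\<mu> + e - l) *\<^sub>C P i (G \<mu> (k i x)) = - ((l - \<mu> - e) *\<^sub>C P i (G \<mu> (k i x)))"
    by (simp only: cvs.scale_minus_left[symmetric]) (simp add: algebra_simps)
  also have "(l - \<mu> - e) *\<^sub>C P i (G \<mu> (k i x)) = - (P i (S \<mu> x) - e *\<^sub>C x - l *\<^sub>C x)"
    using eq by (simp only: e_def add_eq_0_iff minus_minus)
  also have "v - P i (S \<mu> x) + (\<mu> + 2 * e) *\<^sub>C x + - (- (P i (S \<mu> x) - e *\<^sub>C x - l *\<^sub>C x)) = v + ((\<mu> + 2 * e) *\<^sub>C x - e *\<^sub>C x - l *\<^sub>C x)"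
    by simp
  also have "(\<mu> + 2 * e) *\<^sub>C x - e *\<^sub>C x - l *\<^sub>C x = (\<mu> + e - l) *\<^sub>C x"
    by (simp only: cvs.scale_left_diff_distrib[symmetric]) (simp add: algebra_simps)
  finally have "P i (G \<mu> (k i y)) = y" by (simp only: y_def)
  then have "norm y \<le> norm (G \<mu> (k i y))" using norm_proj_le[OF gdD(9)[OF gd], of "G \<mu> (k i y)"] by simp
  then have "norm y \<le> (1/8) * norm y" using G8[of "k i y"] gdD(8)[OF gd, of y] by linarith
  then have "y = 0" by simp
  then have al: "a = l *\<^sub>C x"
    by (simp add: y_def v_def scaleC_add_left cvs.scale_left_diff_distrib)
  have parts: "Pp z = x" "Pm z = k i x"
    using Pp_Dp[OF xDp] Pm_Dp[OF xDp] Pm_Dm[OF sa(2)] Pp_Dm[OF sa(2)] by (simp_all add: z_def Pp_simps Pm_simps)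
  have "cinner (P i (A z)) x = cinner (Pp (A z)) x"
    using proj_span[OF gdD(9)[OF gd] x] Pp_Dp[OF xDp] by (simp add: proj_selfadjoint Pp_sa)
  then have c1: "cinner (Pp (A z)) x = (l + e) * cinner x x"
  proof -
    have "P i (A z) = (l + e) *\<^sub>C x" using al by (simp add: a_def scaleC_add_left algebra_simps)
    then show ?thesis using \<open>cinner (P i (A z)) x = _\<close> by (simp add: cinner_simps)
  qed
  have "Pm (A z) = (l - e) *\<^sub>C k i x"
    using sa(1) al by (simp add: clinear_mapD(2)[OF gdD(7)[OF gd]] cvs.scale_left_diff_distrib algebra_simps)
  then have c2: "cinner (Pm (A z)) (k i x) = (l - e) * cinner (k i x) (k i x)" by (simp add: cinner_simps)
  have "z \<in> D" unfolding z_def by (rule add_in_D[OF xDp sa(2)])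
  from J_A_dissipative[OF this]
  have "Re ((l + e) * of_real ((norm x)\<^sup>2) - (l - e) * of_real ((norm (k i x))\<^sup>2)) \<le> 0"
    unfolding cinner_J_split parts c1 c2 cinner_self .
  then have "(Re l + snd i) * (norm x)\<^sup>2 - (Re l - snd i) * (norm (k i x))\<^sup>2 \<le> 0" by (simp add: e_def)
  moreover have "Re l * ((norm x)\<^sup>2 - (norm (k i x))\<^sup>2) \<ge> 0"
    using l gdD(8)[OF gd, of x] by (simp add: power_mono)
  moreover have "snd i * (norm (k i x))\<^sup>2 \<ge> 0" using gdD(4)[OF gd] by simp
  ultimately have "snd i * (norm x)\<^sup>2 \<le> 0" by (simp add: algebra_simps)
  then show ?thesis using gdD(4)[OF gd] by (simp add: mult_le_0_iff)
qed

end

section \<open>Inverses and reduced matrices of the sections, and their limits\<close>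

definition xi :: "'a set \<times> real \<Rightarrow> complex \<Rightarrow> 'a \<Rightarrow> 'a" where
  "xi i l g = (SOME x. x \<in> cvs.span (onb (fst i)) \<and> Mi i l x = g)"

lemma xi:
  assumes "gd i" "l \<in> Om" "g \<in> cvs.span (onb (fst i))"
  shows "xi i l g \<in> cvs.span (onb (fst i))" "Mi i l (xi i l g) = g"
  using someI_ex[of "\<lambda>x. x \<in> cvs.span (onb (fst i)) \<and> Mi i l x = g"] Mi_surj[OF assms] unfolding xi_def by blast+

lemma xi_eq:
  assumes gd: "gd i" and l: "l \<in> Om" and x: "x \<in> cvs.span (onb (fst i))"
  shows "xi i l (Mi i l x) = x"
proof -
  note y = xi[OF gd l Mi_im[OF gd x, of l]]
  have "Mi i l (xi i l (Mi i l x) - x) = 0" using y x by (simp add: clinear_on_diff[OF Mi_lin[OF gd] csubspace_span])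
  then have "xi i l (Mi i l x) - x = 0" by (rule Mi_inj[OF gd l csubspace_diff[OF csubspace_span y(1) x]])
  then show ?thesis by simp
qed

lemma xi_norm:
  assumes "gd i" "l \<in> Om" "g \<in> cvs.span (onb (fst i))"
  shows "norm (xi i l g) \<le> 2 / r * norm g"
  using Mi_lower[OF assms(1,2) xi(1)[OF assms]] r by (simp add: xi(2)[OF assms] field_simps)

definition Thi :: "'a set \<times> real \<Rightarrow> complex \<Rightarrow> 'a \<Rightarrow> 'a" where
  "Thi i l e = e + (l - \<mu> - of_real (snd i)) *\<^sub>C proj Z (G \<mu> (k i (xi i l e)))"

lemma Thi_props:
  assumes gd: "gd i" and l: "l \<in> Om"
  shows Thi_lin: "clinear_on (cvs.span Z) (Thi i l)" and Thi_im: "Thi i l ` cvs.span Z \<subseteq> cvs.span Z"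
    and Thi_inj: "e \<in> cvs.span Z \<Longrightarrow> Thi i l e = 0 \<Longrightarrow> e = 0"
proof -
  note ZW = gdD(6)[OF gd]
  have add: "xi i l (g + h) = xi i l g + xi i l h" if "g \<in> cvs.span Z" "h \<in> cvs.span Z" for g h
  proof -
    have "g \<in> cvs.span (onb (fst i))" "h \<in> cvs.span (onb (fst i))" using that ZW by auto
    then show ?thesis
      using xi_eq[OF gd l csubspace_add[OF csubspace_span], of "xi i l g" "xi i l h"]
      by (simp add: xi[OF gd l] clinear_on_add[OF Mi_lin[OF gd] csubspace_span])
  qed
  have scale: "xi i l (c *\<^sub>C g) = c *\<^sub>C xi i l g" if "g \<in> cvs.span Z" for c g
  proof -
    have "g \<in> cvs.span (onb (fst i))" using that ZW by auto
    then show ?thesis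
      using xi_eq[OF gd l csubspace_scale[OF csubspace_span], of "xi i l g" c]
      by (simp add: xi[OF gd l] clinear_on_scale[OF Mi_lin[OF gd] csubspace_span])
  qed
  show "clinear_on (cvs.span Z) (Thi i l)"
    unfolding clinear_on_def Thi_def
    by (simp add: add scale clinear_mapD(1,2)[OF gdD(7)[OF gd]]
        clinear_mapD(1,2)[OF clinear_G[OF mu]] clinear_mapD(1,2)[OF clinear_proj] scaleC_add_right mult.commute)
  show "Thi i l ` cvs.span Z \<subseteq> cvs.span Z"
    unfolding Thi_def
    by (auto intro!: csubspace_add[OF csubspace_span] csubspace_scale[OF csubspace_span] proj_in_span)
  show "e = 0" if e: "e \<in> cvs.span Z" "Thi i l e = 0"
  proof -
    have eW: "e \<in> cvs.span (onb (fst i))" using e(1) ZW by blast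
    define x where "x = xi i l e"
    have x: "x \<in> cvs.span (onb (fst i))" "Mi i l x = e" using xi[OF gd l eW] by (simp_all add: x_def)
    \<comment> \<open>\<open>span Z\<close> lies inside the section, so \<open>P i\<close> fixes the
      finite-rank part and the small and finite-rank terms recombine to
      \<open>P i (G (k i x))\<close>.\<close>
    have "proj Z (G \<mu> (k i x)) \<in> cvs.span (onb (fst i))" using proj_in_span[of Z] ZW by blast
    then have PQ: "P i (Q (k i x)) = P i (G \<mu> (k i x)) - proj Z (G \<mu> (k i x))"
      by (simp add: Q_def clinear_mapD(4)[OF clinear_proj] proj_span[OF gdD(9)[OF gd]])
    have "e + (l - \<mu> - of_real (snd i)) *\<^sub>C proj Z (G \<mu> (k i x)) = 0" using e(2) by (simp only: Thi_def x_def)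
    then have "(P i (S \<mu> x) - of_real (snd i) *\<^sub>C x) - l *\<^sub>C x + (l - \<mu> - of_real (snd i)) *\<^sub>C P i (G \<mu> (k i x)) = 0"
      unfolding x(2)[symmetric] Mi_def PQ by (simp only: cvs.scale_right_diff_distrib) (simp only: add.assoc diff_add_cancel)
    then have "x = 0" using section_injective[OF gd _ x(1), of l] Om_Re[OF l] r by simp
    then show ?thesis using x(2) clinear_on_zero[OF Mi_lin[OF gd] csubspace_span] by simp
  qed
qed

lemma Thi_holomorphic:
  assumes gd: "gd i" and e: "e \<in> cvs.span Z"
  shows "(\<lambda>l. cinner (Thi i l e) y) holomorphic_on Om"
proof -
  let ?\<phi> = "\<lambda>x. cinner (proj Z (G \<mu> (k i x))) y"
  have eW: "e \<in> cvs.span (onb (fst i))" using e gdD(6)[OF gd] by blast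
  have "(\<lambda>l. ?\<phi> (xi i l e)) holomorphic_on Om"
  proof (rule pencil_holomorphic[where M = "Mi i" and W = "cvs.span (onb (fst i))" and c = "r/2"
        and B = "\<lambda>u. - u + P i (Q (k i u))" and e = e and b = "1/8 * norm y" and x = "\<lambda>l. xi i l e" and \<phi> = ?\<phi>])
    show "open Om" by (rule Om)
    show "csubspace (cvs.span (onb (fst i)))" by (rule csubspace_span)
    show "r / 2 > 0" using r by simp
    show "Mi i l u - Mi i l' u = (l - l') *\<^sub>C (- u + P i (Q (k i u)))" for l l' u
      unfolding Mi_def by (simp add: scaleC_add_right cvs.scale_left_diff_distrib algebra_simps)
    show "- u + P i (Q (k i u)) \<in> cvs.span (onb (fst i))" if "u \<in> cvs.span (onb (fst i))" for u
      by (rule csubspace_add[OF csubspace_span csubspace_neg[OF csubspace_span that] proj_in_span])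
    show "?\<phi> (u - v) = ?\<phi> u - ?\<phi> v" for u v
      by (simp only: clinear_mapD(4)[OF gdD(7)[OF gd]] clinear_mapD(4)[OF clinear_G[OF mu]] clinear_mapD(4)[OF clinear_proj] cinner_diff_left)
    show "?\<phi> (a *\<^sub>C u) = a * ?\<phi> u" for a u
      by (simp only: clinear_mapD(2)[OF gdD(7)[OF gd]] clinear_mapD(2)[OF clinear_G[OF mu]] clinear_mapD(2)[OF clinear_proj] cinner_scaleC_left)
    show "cmod (?\<phi> u) \<le> 1/8 * norm y * norm u" for u
    proof -
      have "norm (proj Z (G \<mu> (k i u))) \<le> 1/8 * norm u"
        using norm_proj_le[OF Z(1), of "G \<mu> (k i u)"] G8[of "k i u"] gdD(8)[OF gd, of u] by linarith
      then have "norm (proj Z (G \<mu> (k i u))) * norm y \<le> 1/8 * norm u * norm y" by (intro mult_right_mono) auto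
      then show ?thesis using cinner_Cauchy_Schwarz[of "proj Z (G \<mu> (k i u))" y] by (simp add: mult_ac)
    qed
  qed (use Mi_lower[OF gd] Mi_lin[OF gd] Mi_surj[OF gd] xi[OF gd _ eW] in auto)
  then have "(\<lambda>l. cinner e y + (l - \<mu> - of_real (snd i)) * ?\<phi> (xi i l e)) holomorphic_on Om"
    by (intro holomorphic_intros)
  then show ?thesis by (simp only: Thi_def cinner_add_left cinner_scaleC_left)
qed

lemma norm_Z: "z \<in> Z \<Longrightarrow> norm z = 1"
  using Z(1) norm_eq_sqrt_cinner[of z] by (simp add: orthonormal_def)

lemma Thi_bound:
  assumes gd: "gd i" and l: "l \<in> Om" and e: "e \<in> Z" and y: "y \<in> Z"
  shows "cmod (cinner (Thi i l e) y) \<le> 1 + \<kappa> * (1/8 * (2 / r))"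
proof -
  have eW: "e \<in> cvs.span (onb (fst i))" using cvs.span_base[OF e] gdD(6)[OF gd] by blast
  have "norm (proj Z (G \<mu> (k i (xi i l e)))) \<le> 1/8 * norm (xi i l e)"
    using norm_proj_le[OF Z(1), of "G \<mu> (k i (xi i l e))"] G8[of "k i (xi i l e)"] gdD(8)[OF gd, of "xi i l e"] by linarith
  also have "\<dots> \<le> 1/8 * (2 / r)" using xi_norm[OF gd l eW] norm_Z[OF e] by (intro mult_left_mono) auto
  finally have 1: "norm (proj Z (G \<mu> (k i (xi i l e)))) \<le> 1/8 * (2 / r)" .
  have "norm ((l - \<mu> - of_real (snd i)) *\<^sub>C proj Z (G \<mu> (k i (xi i l e)))) \<le> \<kappa> * (1/8 * (2 / r))"
    unfolding norm_scaleC using Om_bound[OF l, of "snd i"] gdD(4,5)[OF gd] 1 kap by (intro mult_mono) auto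
  then have "norm (Thi i l e) \<le> 1 + \<kappa> * (1/8 * (2 / r))"
    unfolding Thi_def using norm_triangle_ineq[of e "(l - \<mu> - of_real (snd i)) *\<^sub>C proj Z (G \<mu> (k i (xi i l e)))"] norm_Z[OF e]
    by linarith
  then show ?thesis using cinner_Cauchy_Schwarz[of "Thi i l e" y] norm_Z[OF y] by simp
qed

lemma Mi_tendsto:
  assumes x: "x \<in> Dp"
  shows "((\<lambda>i. Mi i l x) \<longlongrightarrow> M0 l x (S \<mu> x)) U"
proof -
  have "((\<lambda>i. Q (k i x)) \<longlongrightarrow> Q (K x)) U"
    unfolding Q_def by (intro tendsto_diff Gk_tendsto bounded_linear.tendsto[OF bounded_linear_proj[OF Z(1)]])
  then have q: "((\<lambda>i. P i (Q (k i x))) \<longlongrightarrow> Q (K x)) U" using P_tendsto_seq[of "\<lambda>i. Q (k i x)" "Q (K x)"] by (simp add: Pp_Q)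
  have s: "((\<lambda>i. P i (S \<mu> x)) \<longlongrightarrow> S \<mu> x) U" using P_tendsto[of "S \<mu> x"] by simp
  have "((\<lambda>i. Mi i l x) \<longlongrightarrow> (S \<mu> x - of_real 0 *\<^sub>C x) - l *\<^sub>C x + (l - \<mu> - of_real 0) *\<^sub>C Q (K x)) U"
    unfolding Mi_def by (intro tendsto_add tendsto_diff tendsto_scaleC tendsto_of_real tendsto_const U(5) q s)
  then show ?thesis by (simp add: M0_def)
qed

text \<open>Convergence of inverses from a uniform lower bound: approximate \<open>x0 l g\<close> by
  \<open>f n\<close> in \<open>Dp\<close>, where \<open>Mi i l\<close> converges to
  \<open>M0 l\<close>. The tolerance \<open>r \<eta> / 12\<close>, used twice and divided by
  \<open>r / 2\<close>, contributes \<open>\<eta>/3\<close>.\<close>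

lemma xi_tendsto:
  assumes l: "l \<in> Om" and g: "g \<in> cvs.span Z"
  shows "((\<lambda>i. xi i l g) \<longlongrightarrow> x0 l g) U"
proof (rule tendstoI)
  fix \<eta> :: real assume \<eta>: "\<eta> > 0"
  obtain s where s: "Sr (x0 l g) s" "M0 l (x0 l g) s = g" using x0[OF l Pp_span_Z[OF g]] by blast
  obtain f where f: "\<And>n. f n \<in> Dp" "f \<longlonglongrightarrow> x0 l g" "(\<lambda>n. S \<mu> (f n)) \<longlonglongrightarrow> s" using s(1) by (rule SrE) blast
  have "(\<lambda>n. M0 l (f n) (S \<mu> (f n))) \<longlonglongrightarrow> M0 l (x0 l g) s"
    unfolding M0_def
    by (intro tendsto_add tendsto_diff tendsto_scaleC tendsto_const f bounded_linear.tendsto[OF bounded_linear_Q] tendsto_K)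
  then have lim: "(\<lambda>n. M0 l (f n) (S \<mu> (f n))) \<longlonglongrightarrow> g" by (simp add: s(2))
  have r\<eta>: "r * \<eta> / 12 > 0" "\<eta> / 3 > 0" using r \<eta> by auto
  have "eventually (\<lambda>n. dist (f n) (x0 l g) < \<eta> / 3 \<and> dist (M0 l (f n) (S \<mu> (f n))) g < r * \<eta> / 12) sequentially"
    using tendstoD[OF f(2) r\<eta>(2)] tendstoD[OF lim r\<eta>(1)] by (rule eventually_conj)
  then obtain n where n: "dist (f n) (x0 l g) < \<eta> / 3" "dist (M0 l (f n) (S \<mu> (f n))) g < r * \<eta> / 12"
    using eventually_happens'[OF sequentially_bot] by blast
  show "eventually (\<lambda>i. dist (xi i l g) (x0 l g) < \<eta>) U"
    using ev_gd ev_in_span[OF f(1)[of n]] tendstoD[OF Mi_tendsto[OF f(1)[of n], of l] r\<eta>(1)]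
  proof eventually_elim
    case (elim i)
    have gW: "g \<in> cvs.span (onb (fst i))" using g gdD(6)[OF elim(1)] by blast
    note x = xi[OF elim(1) l gW]
    have "r / 2 * norm (xi i l g - f n) \<le> norm (Mi i l (xi i l g - f n))"
      by (rule Mi_lower[OF elim(1) l csubspace_diff[OF csubspace_span x(1) elim(2)]])
    also have "Mi i l (xi i l g - f n) = g - Mi i l (f n)"
      by (simp add: clinear_on_diff[OF Mi_lin[OF elim(1)] csubspace_span x(1) elim(2)] x(2))
    also have "norm (g - Mi i l (f n)) \<le> r * \<eta> / 12 + r * \<eta> / 12"
    proof -
      have "norm (g - M0 l (f n) (S \<mu> (f n))) < r * \<eta> / 12" using n(2) by (metis dist_commute dist_norm)
      moreover have "norm (M0 l (f n) (S \<mu> (f n)) - Mi i l (f n)) < r * \<eta> / 12" using elim(3) by (metis dist_commute dist_norm)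
      moreover have "norm (g - Mi i l (f n)) \<le> norm (g - M0 l (f n) (S \<mu> (f n))) + norm (M0 l (f n) (S \<mu> (f n)) - Mi i l (f n))"
        using norm_triangle_ineq[of "g - M0 l (f n) (S \<mu> (f n))" "M0 l (f n) (S \<mu> (f n)) - Mi i l (f n)"] by simp
      ultimately show ?thesis by linarith
    qed
    finally have "r * norm (xi i l g - f n) \<le> r * (\<eta> / 3)" by (simp add: mult_ac)
    then have "norm (xi i l g - f n) \<le> \<eta> / 3" using r by (simp only: mult_le_cancel_left_pos)
    then show ?case
      using norm_triangle_ineq[of "xi i l g - f n" "f n - x0 l g"] n(1) \<eta> by (simp add: dist_norm)
  qed
qed

text \<open>The vectors \<open>xi i l e\<close> converge in norm, their images under
  \<open>k i\<close> and \<open>G\<close> weakly, and \<open>proj Z\<close> makes the last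
  convergence strong.\<close>

lemma Thi_tendsto:
  assumes l: "l \<in> Om" and e: "e \<in> cvs.span Z"
  shows "((\<lambda>i. cinner (Thi i l e) y) \<longlongrightarrow> cinner (Th l e) y) U"
proof -
  have w: "weak_lim (\<lambda>i. k i (xi i l e)) (K (x0 l e)) U"
    by (rule weak_lim_contraction_seq[where K = k and k = K, OF K(3) xi_tendsto[OF l e] k_contr])
  have "weak_lim (\<lambda>i. G \<mu> (k i (xi i l e))) (G \<mu> (K (x0 l e))) U"
    by (rule weak_lim_clinear[OF clinear_G[OF mu] G8 w])
  then have p: "((\<lambda>i. proj Z (G \<mu> (k i (xi i l e)))) \<longlongrightarrow> proj Z (G \<mu> (K (x0 l e)))) U" by (rule weak_lim_proj)
  have "((\<lambda>i. cinner (Thi i l e) y) \<longlongrightarrow> cinner (e + (l - \<mu> - of_real 0) *\<^sub>C proj Z (G \<mu> (K (x0 l e)))) y) U"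
    unfolding Thi_def by (intro tendsto_cinner tendsto_add tendsto_diff tendsto_scaleC tendsto_of_real tendsto_const U(5) p)
  then show ?thesis by (simp add: Th_def)
qed

lemma Th_inj:
  assumes T: "open T" "connected T" "bounded T" "closure T \<subseteq> Om" and mT: "of_real m \<in> T"
    and l: "l \<in> T" and e: "e \<in> cvs.span Z" "Th l e = 0"
  shows "e = 0"
proof -
  have finZ: "finite Z" using Z(1) by (simp add: orthonormal_def)
  have TOm: "T \<subseteq> Om" using T(4) closure_subset by blast
  have det_iff: "opdet Z (Th l) = 0 \<longleftrightarrow> (\<exists>x\<in>cvs.span Z. x \<noteq> 0 \<and> Th l x = 0)" if "l \<in> Om" for l
    by (rule opdet_eq_0_iff[OF Z(1) Th_lin[OF that] Th_im])
  have "opdet Z (Th l) \<noteq> 0"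
  proof (rule hurwitz_filter[OF Om nb _ _ T _ mT _ l, where f = "\<lambda>i l. opdet Z (Thi i l)"])
    show "eventually (\<lambda>i. (\<lambda>l. opdet Z (Thi i l)) holomorphic_on Om
        \<and> (\<forall>l\<in>Om. cmod (opdet Z (Thi i l)) \<le> real (card {p. p permutes {0..<card Z}}) * (1 + \<kappa> * (1/8 * (2 / r))) ^ card Z)) U"
      using ev_gd
    proof eventually_elim
      case (elim i)
      have "(\<lambda>l. opdet Z (Thi i l)) holomorphic_on Om"
        by (rule opdet_holomorphic[OF finZ Thi_holomorphic[OF elim cvs.span_base]])
      moreover have "cmod (opdet Z (Thi i l)) \<le> real (card {p. p permutes {0..<card Z}}) * (1 + \<kappa> * (1/8 * (2 / r))) ^ card Z"
        if "l \<in> Om" for l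
        by (rule opdet_bound[OF finZ Thi_bound[OF elim that]])
      ultimately show ?case by blast
    qed
    show "((\<lambda>i. opdet Z (Thi i l)) \<longlongrightarrow> opdet Z (Th l)) U" if "l \<in> Om" for l
      by (rule opdet_tendsto[OF finZ Thi_tendsto[OF that cvs.span_base]])
    show "eventually (\<lambda>i. \<forall>l\<in>T. opdet Z (Thi i l) \<noteq> 0) U"
      using ev_gd
    proof eventually_elim
      case (elim i)
      show ?case
      proof
        fix l assume "l \<in> T"
        then have l: "l \<in> Om" using TOm by blast
        show "opdet Z (Thi i l) \<noteq> 0"
          unfolding opdet_eq_0_iff[OF Z(1) Thi_lin[OF elim l] Thi_im[OF elim l]] using Thi_inj[OF elim l] by blast
      qed
    qed
    \<comment> \<open>The base point for Hurwitz: a kernel vector gives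
      \<open>m |u| \<le> 2 m |G (K u)| \<le> (m/4) |u|\<close>, so \<open>u = 0\<close> and the
      kernel vector vanishes with it.\<close>
    show "opdet Z (Th (of_real m)) \<noteq> 0"
    proof
      have mOm: "of_real m \<in> Om" using mT TOm by blast
      assume "opdet Z (Th (of_real m)) = 0"
      then obtain x where x: "x \<in> cvs.span Z" "x \<noteq> 0" "Th (of_real m) x = 0" using det_iff[OF mOm] by blast
      obtain s where s: "Sr (x0 (of_real m) x) s" "M0 (of_real m) (x0 (of_real m) x) s = x"
        using x0[OF mOm Pp_span_Z[OF x(1)]] by blast
      define u where "u = x0 (of_real m) x"
      have "s - of_real m *\<^sub>C u + (of_real m - \<mu>) *\<^sub>C G \<mu> (K u) = M0 (of_real m) u s + (of_real m - \<mu>) *\<^sub>C proj Z (G \<mu> (K u))"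
        unfolding M0_def Q_def cvs.scale_right_diff_distrib[of "of_real m - \<mu>"] by (simp only: add.assoc diff_add_cancel)
      also have "\<dots> = Th (of_real m) x" using s(2) by (simp only: Th_def u_def)
      finally have "s - of_real m *\<^sub>C u = - ((of_real m - \<mu>) *\<^sub>C G \<mu> (K u))" using x(3) by (simp only: add_eq_0_iff2)
      then have "norm (s - of_real m *\<^sub>C u) = cmod (of_real m - \<mu>) * norm (G \<mu> (K u))" by (simp only: norm_minus_cancel norm_scaleC)
      also have "of_real m - \<mu> = of_real (2 * m)" by simp
      also have "cmod (of_real (2 * m)) * norm (G \<mu> (K u)) \<le> (2 * m) * ((1/8) * norm u)"
        using GK_bound[of u] m_pos by (intro mult_mono) auto
      finally have "m * norm u \<le> (2 * m) * ((1/8) * norm u)"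
        using dissipative_lower_bound[OF Sr_dissipative[OF s(1)[folded u_def]], of "of_real m"] by simp
      then have "m * norm u \<le> 0" by (simp add: algebra_simps)
      then have "u = 0" using m_pos by (simp add: mult_le_0_iff)
      then have "Th (of_real m) x = x"
        by (simp add: Th_def u_def[symmetric] clinear_mapD(5)[OF K(1)] clinear_mapD(5)[OF clinear_G[OF mu]] clinear_mapD(5)[OF clinear_proj])
      then show False using x by simp
    qed
  qed
  then show ?thesis using det_iff[of l] l TOm e by blast
qed

text \<open>Both claims reduce to \<open>Th l\<close> on \<open>span Z\<close>. For surjectivity,
  solve with \<open>M0\<close> and correct by \<open>x0 l e\<close>, where \<open>Th l e\<close>
  cancels the finite-rank term left over.\<close>

lemma window_bijective:
  assumes T: "open T" "connected T" "bounded T" "closure T \<subseteq> Om" and mT: "of_real m \<in> T" and lT: "l \<in> T"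
  shows window_lower: "\<exists>c\<ge>0. \<forall>x s. Sr x s \<longrightarrow> norm x \<le> c * norm (s - l *\<^sub>C x + (l - \<mu>) *\<^sub>C G \<mu> (K x))"
    and window_surj: "Pp g = g \<Longrightarrow> \<exists>x s. Sr x s \<and> s - l *\<^sub>C x + (l - \<mu>) *\<^sub>C G \<mu> (K x) = g"
proof -
  have l: "l \<in> Om" using lT T(4) closure_subset by blast
  have split: "s - l *\<^sub>C x + (l - \<mu>) *\<^sub>C G \<mu> (K x) = M0 l x s + (l - \<mu>) *\<^sub>C proj Z (G \<mu> (K x))" for x s
    unfolding M0_def Q_def cvs.scale_right_diff_distrib[of "l - \<mu>"] by (simp only: add.assoc diff_add_cancel)
  note inj = Th_inj[OF T mT lT]
  have pin: "(l - \<mu>) *\<^sub>C proj Z w \<in> cvs.span Z" for w by (intro csubspace_scale[OF csubspace_span] proj_in_span)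
  obtain c where c: "c \<ge> 0" "\<forall>e\<in>cvs.span Z. norm e \<le> c * norm (Th l e)"
    by (rule finite_dim_bounded_below[OF Z(1) Th_lin[OF l] Th_im inj])
  show "\<exists>c\<ge>0. \<forall>x s. Sr x s \<longrightarrow> norm x \<le> c * norm (s - l *\<^sub>C x + (l - \<mu>) *\<^sub>C G \<mu> (K x))"
  proof (intro exI[of _ "2 / r * (c * (\<kappa> * (1/8 * (2/r))) + 1)"] conjI allI impI)
    show "0 \<le> 2 / r * (c * (\<kappa> * (1/8 * (2/r))) + 1)" using r c(1) kap by simp
    fix x s assume xs: "Sr x s"
    define p where "p = M0 l x s + (l - \<mu>) *\<^sub>C proj Z (G \<mu> (K x))"
    \<comment> \<open>If \<open>p\<close> were zero, \<open>x\<close> would be \<open>x0 l e\<close>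
      and \<open>Th l e\<close> would vanish. In general \<open>x\<close> differs from
      \<open>x0 l e\<close> by \<open>O(p)\<close>, hence \<open>Th l e = O(p)\<close>, and
      invertibility of \<open>Th l\<close> bounds \<open>e\<close>.\<close>
    define e where "e = - ((l - \<mu>) *\<^sub>C proj Z (G \<mu> (K x)))"
    have e: "e \<in> cvs.span Z" unfolding e_def by (rule csubspace_neg[OF csubspace_span pin])
    have M0x: "M0 l x s = p + e" by (simp add: p_def e_def)
    obtain t where t: "Sr (x0 l e) t" "M0 l (x0 l e) t = e" using x0[OF l Pp_span_Z[OF e]] by blast
    have "r / 2 * norm (x0 l e - x) \<le> norm (M0 l (x0 l e - x) (t - s))" by (rule M0_lower[OF l Sr_diff[OF t(1) xs]])
    also have "M0 l (x0 l e - x) (t - s) = - p" by (simp add: M0_diff t(2) M0x)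
    finally have d: "norm (x0 l e - x) \<le> 2 / r * norm p" using r by (simp add: field_simps)
    have "Th l e = (l - \<mu>) *\<^sub>C proj Z (G \<mu> (K (x0 l e - x)))"
      by (simp add: Th_def e_def clinear_mapD(4)[OF K(1)] clinear_mapD(4)[OF clinear_G[OF mu]] clinear_mapD(4)[OF clinear_proj]
          cvs.scale_right_diff_distrib)
    then have "norm (Th l e) = cmod (l - \<mu>) * norm (proj Z (G \<mu> (K (x0 l e - x))))" by (simp only: norm_scaleC)
    also have "\<dots> \<le> \<kappa> * (1/8 * (2 / r * norm p))"
    proof (rule mult_mono[OF Om_bound0[OF l]])
      show "norm (proj Z (G \<mu> (K (x0 l e - x)))) \<le> 1/8 * (2 / r * norm p)"
        using norm_proj_le[OF Z(1), of "G \<mu> (K (x0 l e - x))"] GK_bound[of "x0 l e - x"] d by linarith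
    qed (use kap in auto)
    finally have "norm e \<le> c * (\<kappa> * (1/8 * (2 / r * norm p)))"
      using bspec[OF c(2) e] c(1) by (meson mult_left_mono order_trans)
    moreover have "r / 2 * norm x \<le> norm (p + e)" using M0_lower[OF l xs] by (simp only: M0x)
    then have "norm x \<le> 2 / r * (norm p + norm e)"
      using norm_triangle_ineq[of p e] r by (simp add: field_simps)
    ultimately have "norm x \<le> 2 / r * (norm p + c * (\<kappa> * (1/8 * (2 / r * norm p))))"
      using r by (meson add_left_mono divide_nonneg_nonneg less_imp_le mult_left_mono order_trans zero_le_numeral)
    also have "\<dots> = 2 / r * (c * (\<kappa> * (1/8 * (2/r))) + 1) * norm p" by (simp add: algebra_simps)
    finally show "norm x \<le> 2 / r * (c * (\<kappa> * (1/8 * (2/r))) + 1) * norm (s - l *\<^sub>C x + (l - \<mu>) *\<^sub>C G \<mu> (K x))"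
      by (simp only: split p_def)
  qed
  show "\<exists>x s. Sr x s \<and> s - l *\<^sub>C x + (l - \<mu>) *\<^sub>C G \<mu> (K x) = g" if g: "Pp g = g"
  proof -
    obtain x s where x: "Sr x s" "M0 l x s = g" using M0_surj[OF l g] by blast
    have mem: "- ((l - \<mu>) *\<^sub>C proj Z (G \<mu> (K x))) \<in> cvs.span Z" by (rule csubspace_neg[OF csubspace_span pin])
    have finZ: "finite Z" using Z(1) by (simp add: orthonormal_def)
    obtain e where e: "e \<in> cvs.span Z" "Th l e = - ((l - \<mu>) *\<^sub>C proj Z (G \<mu> (K x)))"
      by (rule inj_imp_surj_on[OF csubspace_span Th_lin[OF l] Th_im cdim_le_span[OF finZ order_refl] inj mem])
    obtain t where t: "Sr (x0 l e) t" "M0 l (x0 l e) t = e" using x0[OF l Pp_span_Z[OF e(1)]] by blast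
    have "M0 l (x + x0 l e) (s + t) + (l - \<mu>) *\<^sub>C proj Z (G \<mu> (K (x + x0 l e)))
        = g + (Th l e + (l - \<mu>) *\<^sub>C proj Z (G \<mu> (K x)))"
      by (simp add: M0_add x(2) t(2) Th_def clinear_mapD(1)[OF K(1)] clinear_mapD(1)[OF clinear_G[OF mu]]
          clinear_mapD(1)[OF clinear_proj] scaleC_add_right)
    also have "\<dots> = g" by (simp add: e(2))
    finally show ?thesis using Sr_add[OF x(1) t(1)] split by metis
  qed
qed

end

section \<open>The restriction to the invariant subspace\<close>

context krein
begin

lemma nonneg_contraction:
  assumes "nonneg_subspace J L" "z \<in> L"
  shows "norm (Pm z) \<le> norm (Pp z)"
  using assms unfolding nonneg_subspace_def Re_J by (auto simp: abs_le_square_iff[symmetric])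

lemma max_nonneg_Pp_surj:
  assumes L: "max_nonneg_subspace J L" and h: "Pp h = h"
  shows "\<exists>z\<in>L. Pp z = h"
proof (rule ccontr)
  assume no: "\<not> ?thesis"
  have nn: "nonneg_subspace J L" using L by (simp add: max_nonneg_subspace_def)
  have Ls: "csubspace L" and Lc: "closed L" using nn by (auto simp: nonneg_subspace_def closed_csubspace_def)
  have "closed (Pp ` L)"
    unfolding closed_sequential_limits
  proof (intro allI impI, elim conjE)
    fix f y assume f: "\<forall>n. f n \<in> Pp ` L" "f \<longlonglongrightarrow> y"
    then have "\<forall>n. \<exists>z. z \<in> L \<and> f n = Pp z" by blast
    from choice[OF this] obtain z where z: "\<And>n. z n \<in> L" "\<And>n. f n = Pp (z n)" by blast
    obtain z0 where z0: "z \<longlonglongrightarrow> z0"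
    proof (rule Cauchy_if_lower_bound[of "1/2" z f])
      fix i j
      have "norm (Pm (z i - z j)) \<le> norm (Pp (z i - z j))"
        by (rule nonneg_contraction[OF nn csubspace_diff[OF Ls z(1) z(1)]])
      moreover have "norm (z i - z j) \<le> norm (Pp (z i - z j)) + norm (Pm (z i - z j))"
        using norm_triangle_ineq[of "Pp (z i - z j)" "Pm (z i - z j)"] by (simp add: Pp_Pm_add)
      ultimately show "1 / 2 * norm (z i - z j) \<le> norm (f i - f j)" by (simp add: z(2) Pp_simps)
    qed (use f in \<open>auto simp: convergent_def\<close>)
    have "z0 \<in> L" by (rule closed_sequentially[OF Lc z(1) z0])
    moreover have "y = Pp z0" using tendsto_Pp[OF z0] f(2) by (simp add: z(2)[symmetric] LIMSEQ_unique)
    ultimately show "y \<in> Pp ` L" by blast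
  qed
  moreover have "csubspace (Pp ` L)"
    by (rule csubspace_image[OF Ls]) (simp add: clinear_on_def Pp_simps)
  ultimately have "closed_csubspace (Pp ` L)" by (simp add: closed_csubspace_def)
  moreover have "h \<notin> Pp ` L" using no by blast
  ultimately obtain u where u: "u \<in> Pp ` L" "\<And>y. y \<in> Pp ` L \<Longrightarrow> cinner y (h - u) = 0" "h - u \<noteq> 0"
    using proper_closed_subspace_orth by metis
  define g where "g = h - u"
  have Ppg: "Pp g = g" using u(1) h by (auto simp: g_def Pp_simps)
  have gg: "cinner g g \<noteq> 0" using u(3) by (simp add: g_def cinner_eq_zero_iff)
  have Lg: "cinner z g = 0" if "z \<in> L" for z
    using u(2)[of "Pp z"] that Pp_sa[of z g] Ppg by (simp add: g_def)
  define c where "c w = cinner w g / cinner g g" for w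
  \<comment> \<open>The sum of \<open>L\<close> and the line through \<open>g\<close>, described by
    a continuous coefficient functional so that closedness is immediate.\<close>
  define L2 where "L2 = {w. w - c w *\<^sub>C g \<in> L}"
  have "nonneg_subspace J L2"
    unfolding nonneg_subspace_def closed_csubspace_def
  proof (intro conjI ballI)
    show "csubspace L2"
      unfolding csubspace_def
    proof (intro conjI ballI allI)
      show "0 \<in> L2" using csubspace_zero[OF Ls] by (simp add: L2_def c_def)
      fix x assume x: "x \<in> L2"
      show "a *\<^sub>C x \<in> L2" for a
      proof -
        have "a *\<^sub>C x - c (a *\<^sub>C x) *\<^sub>C g = a *\<^sub>C (x - c x *\<^sub>C g)"
          by (simp add: c_def cinner_simps cvs.scale_right_diff_distrib)
        then show ?thesis using csubspace_scale[OF Ls, of "x - c x *\<^sub>C g" a] x by (simp add: L2_def)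
      qed
      fix y assume y: "y \<in> L2"
      have eq: "x + y - c (x + y) *\<^sub>C g = (x - c x *\<^sub>C g) + (y - c y *\<^sub>C g)"
        by (simp add: c_def cinner_simps add_divide_distrib scaleC_add_left)
      show "x + y \<in> L2"
        unfolding L2_def mem_Collect_eq eq by (rule csubspace_add[OF Ls]) (use x y in \<open>simp_all add: L2_def\<close>)
    qed
    show "closed L2"
      unfolding closed_sequential_limits
    proof (intro allI impI, elim conjE)
      fix f w assume f: "\<forall>n. f n \<in> L2" "f \<longlonglongrightarrow> w"
      have "(\<lambda>n. f n - c (f n) *\<^sub>C g) \<longlonglongrightarrow> w - c w *\<^sub>C g"
        unfolding c_def by (intro tendsto_diff tendsto_scaleC tendsto_divide tendsto_cinner tendsto_const f gg)
      then have "w - c w *\<^sub>C g \<in> L" using closed_sequentially[OF Lc, of "\<lambda>n. f n - c (f n) *\<^sub>C g"] f(1) by (auto simp: L2_def)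
      then show "w \<in> L2" by (simp add: L2_def)
    qed
    fix w assume "w \<in> L2"
    then have z: "w - c w *\<^sub>C g \<in> L" by (simp add: L2_def)
    have ow: "Pm w = Pm (w - c w *\<^sub>C g)" by (simp add: Pm_simps Pm_range_Pp[OF Ppg])
    have "Pp w = Pp (w - c w *\<^sub>C g) + c w *\<^sub>C g" by (simp add: Pp_simps Ppg)
    moreover have "cinner (Pp (w - c w *\<^sub>C g)) (c w *\<^sub>C g) = 0" using Lg[OF z] by (simp add: Pp_sa Pp_simps Ppg cinner_simps)
    ultimately have "(norm (Pp w))\<^sup>2 = (norm (Pp (w - c w *\<^sub>C g)))\<^sup>2 + (norm (c w *\<^sub>C g))\<^sup>2"
      using norm_add_sq[of "Pp (w - c w *\<^sub>C g)" "c w *\<^sub>C g"] by simp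
    then have "(norm (Pp (w - c w *\<^sub>C g)))\<^sup>2 \<le> (norm (Pp w))\<^sup>2" by simp
    moreover have "(norm (Pm w))\<^sup>2 \<le> (norm (Pp (w - c w *\<^sub>C g)))\<^sup>2"
      unfolding ow by (rule power_mono[OF nonneg_contraction[OF nn z]]) simp
    ultimately show "0 \<le> Re (cinner (J w) w)" by (simp add: Re_J)
  qed
  moreover have "L \<subseteq> L2" using Lg by (auto simp: L2_def c_def)
  ultimately have "L2 = L" using L unfolding max_nonneg_subspace_def by blast
  moreover have "g \<in> L2" using gg csubspace_zero[OF Ls] by (simp add: L2_def c_def scaleC_one)
  ultimately show False using Lg[of g] gg by simp
qed

lemma max_nonneg_angular:
  assumes L: "max_nonneg_subspace J L"
  obtains K where "clinear_map K" "\<And>x. norm (K x) \<le> norm x" "\<And>z. z \<in> L \<Longrightarrow> Pm z = K (Pp z)"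
    "\<And>h. Pp h = h \<Longrightarrow> h + K h \<in> L" "\<And>x. Pp (K x) = 0"
proof -
  have nn: "nonneg_subspace J L" using L by (simp add: max_nonneg_subspace_def)
  have Ls: "csubspace L" using nn by (auto simp: nonneg_subspace_def closed_csubspace_def)
  have "\<forall>x. \<exists>z. z \<in> L \<and> Pp z = Pp x" using max_nonneg_Pp_surj[OF L] by (metis Pp_Pp)
  from choice[OF this] obtain f where f: "\<And>x. f x \<in> L" "\<And>x. Pp (f x) = Pp x" by blast
  have uniq: "Pm z = Pm (f x)" if "z \<in> L" "Pp z = Pp x" for z x
    using nonneg_contraction[OF nn csubspace_diff[OF Ls that(1) f(1)[of x]]] by (simp add: Pp_simps Pm_simps that(2) f(2))
  show ?thesis
  proof (rule that[of "\<lambda>x. Pm (f x)"])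
    show "clinear_map (\<lambda>x. Pm (f x))"
    proof (rule clinear_mapI)
      show "Pm (f (x + y)) = Pm (f x) + Pm (f y)" for x y
        using uniq[OF csubspace_add[OF Ls f(1) f(1)], of x y "x + y"] by (simp add: Pp_simps Pm_simps f(2))
      show "Pm (f (c *\<^sub>C x)) = c *\<^sub>C Pm (f x)" for c x
        using uniq[OF csubspace_scale[OF Ls f(1)], of c x "c *\<^sub>C x"] by (simp add: Pp_simps Pm_simps f(2))
    qed
    show "norm (Pm (f x)) \<le> norm x" for x
      using nonneg_contraction[OF nn f(1)[of x]] norm_Pp_le[of x] by (simp add: f(2))
    show "Pm z = Pm (f (Pp z))" if "z \<in> L" for z by (rule uniq[OF that]) simp
    show "h + Pm (f h) \<in> L" if "Pp h = h" for h using Pp_Pm_add[of "f h"] f[of h] that by simp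
  qed simp
qed

end

section \<open>Surjectivity for the closures of \<open>S\<close> and \<open>A\<close>, and the
  resolvent of the restriction\<close>

context limit_graph
begin

lemma Sr_of_seq:
  assumes l: "Re l > 0" and x: "\<And>n. x n \<in> Dp" "(\<lambda>n. S \<mu> (x n) - l *\<^sub>C x n) \<longlonglongrightarrow> g"
  shows "\<exists>x s. Sr x s \<and> s - l *\<^sub>C x = g"
proof -
  obtain x0 where x0: "x \<longlonglongrightarrow> x0"
  proof (rule Cauchy_if_lower_bound[OF l, of x "\<lambda>n. S \<mu> (x n) - l *\<^sub>C x n"])
    fix i j
    have "Re l * norm (x i - x j) \<le> norm (S \<mu> (x i - x j) - l *\<^sub>C (x i - x j))"
      by (rule dissipative_lower_bound[OF S_dissipative[OF mu csubspace_diff[OF Dp(1) x(1) x(1)]]])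
    also have "S \<mu> (x i - x j) - l *\<^sub>C (x i - x j) = (S \<mu> (x i) - l *\<^sub>C x i) - (S \<mu> (x j) - l *\<^sub>C x j)"
      by (simp add: S_simps(2)[OF mu x(1) x(1)] cvs.scale_right_diff_distrib)
    finally show "Re l * norm (x i - x j) \<le> norm (S \<mu> (x i) - l *\<^sub>C x i - (S \<mu> (x j) - l *\<^sub>C x j))" .
  qed (use x(2) in \<open>auto simp: convergent_def\<close>)
  have "(\<lambda>n. (S \<mu> (x n) - l *\<^sub>C x n) + l *\<^sub>C x n) \<longlonglongrightarrow> g + l *\<^sub>C x0"
    by (intro tendsto_add x(2) tendsto_scaleC tendsto_const x0)
  then have "Sr x0 (g + l *\<^sub>C x0)" by (intro SrI[OF x(1) x0]) simp
  then show ?thesis by (intro exI[of _ x0] exI[of _ "g + l *\<^sub>C x0"]) simp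
qed

text \<open>Because \<open>\<mu> = - m\<close>, the lower row of \<open>(J A - m) z\<close> is
  \<open>- q\<close> with the \<open>q\<close> of \<open>A_parts\<close>. If
  \<open>(J A - m) (z n)\<close> tends to \<open>g\<close> in \<open>H\<^sup>+\<close>, then
  \<open>q n\<close> tends to zero and the upper row is \<open>(S - m) (Pp (z n))\<close> up to
  \<open>G (q n)\<close>.\<close>

lemma Sr_surj_m:
  assumes md: "m_dissipative_in UNIV DA (\<lambda>z. Pp (cA z) - Pm (cA z))" and g: "Pp g = g"
  shows "\<exists>x s. Sr x s \<and> s - of_real m *\<^sub>C x = g"
proof -
  let ?R = "(\<lambda>z. J (A z) - of_real m *\<^sub>C z) ` D"
  have U: "closed_csubspace (UNIV :: 'a set)" by (simp add: closed_csubspace_def csubspace_UNIV)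
  have "g \<in> closure ((\<lambda>z. Pp (cA z) - Pm (cA z) - of_real m *\<^sub>C z) ` DA)"
    by (rule m_dissipative_range_dense[OF U md]) (use m_pos in auto)
  moreover have "(\<lambda>z. Pp (cA z) - Pm (cA z) - of_real m *\<^sub>C z) ` DA \<subseteq> closure ?R"
  proof (rule image_subsetI)
    fix z assume "z \<in> DA"
    from Acl_cA[OF this] obtain s where s: "\<And>n. s n \<in> D" "s \<longlonglongrightarrow> z" "(\<lambda>n. A (s n)) \<longlonglongrightarrow> cA z"
      by (rule AclE) blast
    have "(\<lambda>n. J (A (s n)) - of_real m *\<^sub>C s n) \<longlonglongrightarrow> J (cA z) - of_real m *\<^sub>C z"
      by (intro tendsto_diff bounded_linear.tendsto[OF bounded_linear_J] tendsto_scaleC tendsto_const s)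
    then show "Pp (cA z) - Pm (cA z) - of_real m *\<^sub>C z \<in> closure ?R"
      unfolding closure_sequential J_def[symmetric]
      by (intro exI[of _ "\<lambda>n. J (A (s n)) - of_real m *\<^sub>C s n"]) (use s(1) in auto)
  qed
  ultimately have "g \<in> closure ?R" using closure_minimal[OF _ closed_closure] by blast
  then obtain f where f: "\<forall>n. f n \<in> ?R" "f \<longlonglongrightarrow> g" unfolding closure_sequential by blast
  then have "\<forall>n. \<exists>z. z \<in> D \<and> f n = J (A z) - of_real m *\<^sub>C z" by blast
  from choice[OF this] obtain z where z: "\<And>n. z n \<in> D" "\<And>n. f n = J (A (z n)) - of_real m *\<^sub>C z n" by blast
  have parts: "Pp (z n) \<in> Dp" "Pm (z n) \<in> Dm" for n using z(1)[of n] by (simp_all add: in_D_iff)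
  define q where "q n = Pm (A (z n)) - \<mu> *\<^sub>C Pm (z n)" for n
  have "q = (\<lambda>n. - Pm (f n))" by (rule ext) (simp add: q_def z(2) Pm_simps)
  then have "q \<longlonglongrightarrow> - Pm g" using tendsto_minus[OF tendsto_Pm[OF f(2)]] by simp
  then have q: "q \<longlonglongrightarrow> 0" using Pm_range_Pp[OF g] by simp
  have "Pp (f n) - G \<mu> (q n) = S \<mu> (Pp (z n)) - of_real m *\<^sub>C Pp (z n)" for n
    using A_parts_Pp[OF mu parts, of n n] by (simp add: q_def z(2) Pp_simps Pp_Pm_add)
  moreover have "(\<lambda>n. Pp (f n) - G \<mu> (q n)) \<longlonglongrightarrow> Pp g - G \<mu> 0"
    by (intro tendsto_diff tendsto_Pp f tendsto_G q)
  ultimately have "(\<lambda>n. S \<mu> (Pp (z n)) - of_real m *\<^sub>C Pp (z n)) \<longlonglongrightarrow> g"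
    by (simp add: g clinear_mapD(5)[OF clinear_G[OF mu]])
  then show ?thesis by (intro Sr_of_seq[of "of_real m" "\<lambda>n. Pp (z n)"]) (use m_pos parts in auto)
qed

text \<open>If the range at \<open>l\<close> is not dense, some \<open>h\<close> is orthogonal to it
  and \<open>h \<mapsto> - cnj l h\<close> is a dissipative extension. Solving at \<open>m\<close>
  for the value which that extension takes at \<open>h\<close> forces \<open>x = h\<close>; so
  \<open>h\<close> lies in the domain and \<open>Re l = 0\<close>.\<close>

lemma Sr_surj_all:
  assumes onto: "\<And>g. Pp g = g \<Longrightarrow> \<exists>x s. Sr x s \<and> s - of_real m *\<^sub>C x = g"
    and l: "Re l > 0" and g: "Pp g = g"
  shows "\<exists>x s. Sr x s \<and> s - l *\<^sub>C x = g"
proof (cases "g \<in> closure ((\<lambda>x. S \<mu> x - l *\<^sub>C x) ` Dp)")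
  case True
  then obtain f where f: "\<forall>n. f n \<in> (\<lambda>x. S \<mu> x - l *\<^sub>C x) ` Dp" "f \<longlonglongrightarrow> g" unfolding closure_sequential by blast
  then have "\<forall>n. \<exists>x. x \<in> Dp \<and> f n = S \<mu> x - l *\<^sub>C x" by blast
  from choice[OF this] obtain x where x: "\<And>n. x n \<in> Dp" "\<And>n. f n = S \<mu> (x n) - l *\<^sub>C x n" by blast
  have "f = (\<lambda>n. S \<mu> (x n) - l *\<^sub>C x n)" using x(2) by blast
  then show ?thesis using Sr_of_seq[of l x g, OF l x(1)] f(2) by simp
next
  case False
  let ?R = "(\<lambda>x. S \<mu> x - l *\<^sub>C x) ` Dp"
  have R: "csubspace ?R"
    by (rule csubspace_image[OF Dp(1)])
      (auto simp: clinear_on_def S_simps(1)[OF mu] S_simps(3)[OF mu _ csubspace_zero[OF Dp(1)]] scaleC_add_right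
        cvs.scale_right_diff_distrib mult.commute)
  obtain u where u: "u \<in> closure ?R" "\<And>h. h \<in> closure ?R \<Longrightarrow> cinner h (g - u) = 0" "g - u \<noteq> 0"
    using proper_closed_subspace_orth[OF csubspace_closure[OF R] False] by metis
  define h where "h = g - u"
  have "Pp u = u"
  proof -
    have "closed {x. Pp x = x}"
      by (intro closed_Collect_eq continuous_intros bounded_linear.continuous_on[OF bounded_linear_Pp])
    moreover have "?R \<subseteq> {x. Pp x = x}" by (auto simp: Pp_simps Pp_Dp)
    ultimately show ?thesis using closure_minimal[of ?R "{x. Pp x = x}"] u(1) by blast
  qed
  then have h: "Pp h = h" using g by (simp add: h_def Pp_simps)
  have orth: "cinner s h = l * cinner x h" if "Sr x s" for x s
  proof -
    obtain f where f: "\<And>n. f n \<in> Dp" "f \<longlonglongrightarrow> x" "(\<lambda>n. S \<mu> (f n)) \<longlonglongrightarrow> s" using \<open>Sr x s\<close> by (rule SrE) blast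
    have "(\<lambda>n. cinner (S \<mu> (f n) - l *\<^sub>C f n) h) \<longlonglongrightarrow> cinner (s - l *\<^sub>C x) h"
      by (intro tendsto_cinner tendsto_diff tendsto_scaleC tendsto_const f)
    moreover have "cinner (S \<mu> (f n) - l *\<^sub>C f n) h = 0" for n
      unfolding h_def using f(1)[of n] closure_subset[of ?R] by (intro u(2)) blast
    ultimately have "cinner (s - l *\<^sub>C x) h = 0" by (simp add: LIMSEQ_const_iff)
    then show ?thesis by (simp add: cinner_simps)
  qed
  have "Pp (- (cnj l *\<^sub>C h) - of_real m *\<^sub>C h) = - (cnj l *\<^sub>C h) - of_real m *\<^sub>C h" by (simp add: Pp_simps h)
  from onto[OF this] obtain x s where xs: "Sr x s" "s - of_real m *\<^sub>C x = - (cnj l *\<^sub>C h) - of_real m *\<^sub>C h" by blast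
  have "cinner (s + cnj l *\<^sub>C h) (x - h) = cinner s x + (cnj (l * cinner x h) - l * cinner x h) - cnj l * of_real ((norm h)\<^sup>2)"
    using cinner_commute[of h x] by (simp add: cinner_simps orth[OF xs(1)] cinner_self[of h] algebra_simps)
  then have "Re (cinner (s + cnj l *\<^sub>C h) (x - h)) = Re (cinner s x) - Re l * (norm h)\<^sup>2" by simp
  then have "Re (cinner (s + cnj l *\<^sub>C h) (x - h)) \<le> 0" using Sr_dissipative[OF xs(1)] l
    by (smt (verit) mult_nonneg_nonneg zero_le_power2)
  from dissipative_lower_bound[OF this, of "of_real m"]
  have "m * norm (x - h) \<le> norm ((s - of_real m *\<^sub>C x) + cnj l *\<^sub>C h + of_real m *\<^sub>C h)"
    by (simp add: cvs.scale_right_diff_distrib algebra_simps)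
  also have "\<dots> = 0" unfolding xs(2) by simp
  finally have "x = h" using m_pos by (simp add: mult_le_0_iff)
  then have "s = - (cnj l *\<^sub>C h)" using xs(2) by (simp add: algebra_simps)
  then have "- (cnj l) * of_real ((norm h)\<^sup>2) = l * of_real ((norm h)\<^sup>2)"
    using orth[OF xs(1)] \<open>x = h\<close> by (simp add: cinner_simps cinner_self)
  moreover have "complex_of_real ((norm h)\<^sup>2) \<noteq> 0" using u(3) by (simp add: h_def)
  ultimately have "- (cnj l) = l" using mult_right_cancel by blast
  then have "Re l = 0" by (simp add: complex_eq_iff)
  then show ?thesis using l by simp
qed

text \<open>For \<open>z\<close> in \<open>L\<close> put \<open>y = Pp ((cA - l) z)\<close>; then
  \<open>(1 - G K) y\<close> is the operator treated by the spectral window. The norm of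
  \<open>1 - G K\<close> contributes \<open>9/8\<close>, the passage from \<open>Pp z\<close> to
  \<open>z\<close> a factor \<open>2\<close>.\<close>

lemma resolvent_of_restriction:
  assumes onto: "\<And>l g. Re l > 0 \<Longrightarrow> Pp g = g \<Longrightarrow> \<exists>x s. Sr x s \<and> s - l *\<^sub>C x = g" and l: "Re l > 0"
  shows "l \<in> resolvent_set_in L (DA \<inter> L) cA"
proof -
  \<comment> \<open>\<open>T\<close> is a half-disc containing both \<open>l\<close> and
    \<open>m\<close>: their real parts exceed \<open>2 r\<close>, and \<open>\<rho> - 1\<close>
    exceeds both moduli. The margins put its closure inside \<open>Om\<close>;
    \<open>\<kappa>\<close> bounds \<open>l - \<mu> - e\<close> there for all \<open>e\<close> up to
    \<open>1\<close>.\<close>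
  define r where "r = min (Re l) m / 4"
  define \<rho> where "\<rho> = cmod l + m + 2"
  define \<kappa> where "\<kappa> = \<rho> + m + 1"
  define Om where "Om = {z. r < Re z} \<inter> ball 0 \<rho>"
  define T where "T = {z. 2 * r < Re z} \<inter> ball 0 (\<rho> - 1)"
  have r: "r > 0" "4 * r \<le> Re l" "4 * r \<le> m" using l m_pos by (auto simp: r_def)
  have \<rho>: "\<rho> > 0" "cmod l < \<rho> - 1" "m < \<rho> - 1" using m_pos by (auto simp: \<rho>_def add_pos_nonneg add_nonneg_pos)
  have \<kappa>: "\<kappa> > 0" using \<rho>(1) m_pos by (simp add: \<kappa>_def)
  obtain X where X: "finite X" "X \<subseteq> Dp" "\<And>w. norm (G \<mu> w - proj (onb X) (G \<mu> w)) \<le> r / (2 * \<kappa>) * norm w"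
    using G_finite_rank_approx[of "r / (2 * \<kappa>)"] r(1) \<kappa> by (metis divide_pos_pos mult_pos_pos zero_less_numeral)
  have sw: "spectral_window Pp Pm Dp Dm A m U k K r \<kappa> Om (onb X)"
  proof (unfold_locales)
    show "0 < r" "0 < \<kappa>" by fact+
    show "open Om" unfolding Om_def by (intro open_Int open_halfspace_Re_gt open_ball)
    show "r < Re l" if "l \<in> Om" for l using that by (simp add: Om_def)
    show "cmod (l + of_real m - of_real e) \<le> \<kappa>" if "l \<in> Om" "0 \<le> e" "e \<le> 1" for l e
    proof -
      have "cmod (l + of_real m - of_real e) \<le> cmod l + cmod (of_real m) + cmod (of_real e)"
        using norm_triangle_ineq4[of "l + of_real m" "of_real e"] norm_triangle_ineq[of l "of_real m"] by linarith
      then show ?thesis using that m_pos by (simp add: Om_def \<kappa>_def)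
    qed
    show "orthonormal (onb X)" by (rule orthonormal_onb[OF X(1)])
    show "onb X \<subseteq> range Pp" using E_props(3)[of "(X, 0)"] X(1,2) by simp
    show "eventually (\<lambda>i. cvs.span (onb X) \<subseteq> cvs.span (onb (fst i))) U"
    proof -
      have "eventually (\<lambda>i. \<forall>x\<in>X. x \<in> fst i) U"
        using U(2) X(2) by (intro eventually_ball_finite[OF X(1)]) blast
      then show ?thesis
        using U(3)
      proof eventually_elim
        case (elim i)
        then show ?case unfolding span_onb[OF X(1)] span_onb[OF conjunct1[OF elim(2)]] by (intro cvs.span_mono) blast
      qed
    qed
    show "norm (G (- of_real m) w - proj (onb X) (G (- of_real m) w)) \<le> r / (2 * \<kappa>) * norm w" for w by (rule X(3))
    show "\<exists>x s. Sr x s \<and> s - l *\<^sub>C x = g" if "Re l > 0" "Pp g = g" for l g by (rule onto[OF that])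
  qed
  have T: "open T" "connected T" "bounded T" "closure T \<subseteq> Om"
  proof -
    show "open T" unfolding T_def by (intro open_Int open_halfspace_Re_gt open_ball)
    show "connected T" unfolding T_def by (intro convex_connected convex_Int convex_halfspace_Re_gt convex_ball)
    show "bounded T" unfolding T_def by (intro bounded_Int) simp
    have "T \<subseteq> {z. Re z \<ge> 2 * r} \<inter> cball 0 (\<rho> - 1)" by (auto simp: T_def)
    then have "closure T \<subseteq> {z. Re z \<ge> 2 * r} \<inter> cball 0 (\<rho> - 1)"
      by (intro closure_minimal closed_Int closed_halfspace_Re_ge closed_cball)
    also have "\<dots> \<subseteq> Om" using r(1) by (auto simp: Om_def)
    finally show "closure T \<subseteq> Om" .
  qed
  have mT: "of_real m \<in> T" using r \<rho> m_pos by (simp add: T_def)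
  have lT: "l \<in> T" using r \<rho> by (simp add: T_def)
  obtain c where c: "c \<ge> 0" "\<And>x s. Sr x s \<Longrightarrow> norm x \<le> c * norm (s - l *\<^sub>C x + (l - \<mu>) *\<^sub>C G \<mu> (K x))"
    using spectral_window.window_lower[OF sw T mT lT] by blast
  have surj: "\<exists>x s. Sr x s \<and> s - l *\<^sub>C x + (l - \<mu>) *\<^sub>C G \<mu> (K x) = g" if "Pp g = g" for g
    by (rule spectral_window.window_surj[OF sw T mT lT that])
  have lower: "norm z \<le> (2 * (c * (9/8))) * norm (cA z - l *\<^sub>C z)" if z: "z \<in> DA \<inter> L" for z
  proof -
    obtain x s v where x: "\<And>n. x n \<in> Dp" "x \<longlonglongrightarrow> Pp z" "(\<lambda>n. S \<mu> (x n)) \<longlonglongrightarrow> s" and v: "Pp v = v"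
      "v - G \<mu> (K v) = s - \<mu> *\<^sub>C Pp z" "cA z = \<mu> *\<^sub>C z + v + K v"
      using Acl_graph[of z "cA z"] z Acl_cA by (metis IntD1 IntD2)
    define y where "y = v - (l - \<mu>) *\<^sub>C Pp z"
    have Sr: "Sr (Pp z) s" by (rule SrI[OF x])
    have "y - G \<mu> (K y) = (v - G \<mu> (K v)) - ((l - \<mu>) *\<^sub>C Pp z - (l - \<mu>) *\<^sub>C G \<mu> (K (Pp z)))"
      by (simp add: y_def clinear_mapD(2,4)[OF K(1)] clinear_mapD(2,4)[OF clinear_G[OF mu]])
    also have "\<dots> = s - l *\<^sub>C Pp z + (l - \<mu>) *\<^sub>C G \<mu> (K (Pp z))"
      unfolding v(2) by (simp add: cvs.scale_left_diff_distrib scaleC_add_left)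
    finally have yeq: "y - G \<mu> (K y) = s - l *\<^sub>C Pp z + (l - \<mu>) *\<^sub>C G \<mu> (K (Pp z))" .
    have "Pp (cA z - l *\<^sub>C z) = y" using v(1) by (simp add: v(3) y_def Pp_simps cvs.scale_left_diff_distrib scaleC_add_left)
    then have ny: "norm y \<le> norm (cA z - l *\<^sub>C z)" using norm_Pp_le[of "cA z - l *\<^sub>C z"] by simp
    have "norm (y - G \<mu> (K y)) \<le> (9/8) * norm y" using norm_triangle_ineq4[of y "G \<mu> (K y)"] GK_bound[of y] by linarith
    then have "norm (y - G \<mu> (K y)) \<le> (9/8) * norm (cA z - l *\<^sub>C z)" using ny by linarith
    then have "norm (Pp z) \<le> c * ((9/8) * norm (cA z - l *\<^sub>C z))"
      using c(2)[OF Sr] c(1) unfolding yeq by (meson mult_left_mono order_trans)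
    moreover have "norm z \<le> norm (Pp z) + norm (K (Pp z))" using L_split[of z] z norm_triangle_ineq[of "Pp z" "K (Pp z)"] by auto
    ultimately show ?thesis using K(2)[of "Pp z"] by (simp add: algebra_simps)
  qed
  have linDA: "cA (z - z') = cA z - cA z'" "z - z' \<in> DA \<inter> L" if "z \<in> DA \<inter> L" "z' \<in> DA \<inter> L" for z z'
  proof -
    have "Acl (z + (-1) *\<^sub>C z') (cA z + (-1) *\<^sub>C cA z')" using that Acl_cA by (intro Acl_add Acl_scale) auto
    then have *: "Acl (z - z') (cA z - cA z')" by (simp add: scaleC_minus_one[symmetric])
    then show "cA (z - z') = cA z - cA z'" by (rule cA_eq)
    show "z - z' \<in> DA \<inter> L" using DA_I[OF *] csubspace_diff[OF csubspace_L] that by blast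
  qed
  have "bij_betw (\<lambda>x. cA x - l *\<^sub>C x) (DA \<inter> L) L"
    unfolding bij_betw_def
  proof (intro conjI equalityI subsetI inj_onI)
    fix z z' assume z: "z \<in> DA \<inter> L" "z' \<in> DA \<inter> L" and eq: "cA z - l *\<^sub>C z = cA z' - l *\<^sub>C z'"
    have "cA (z - z') - l *\<^sub>C (z - z') = (cA z - l *\<^sub>C z) - (cA z' - l *\<^sub>C z')"
      by (simp add: linDA(1)[OF z] cvs.scale_right_diff_distrib)
    then have "norm (z - z') \<le> 0" using lower[OF linDA(2)[OF z]] by (simp add: eq)
    then show "z = z'" by simp
  next
    fix t assume "t \<in> (\<lambda>x. cA x - l *\<^sub>C x) ` (DA \<inter> L)"
    then show "t \<in> L"
      using L_invariant by (auto simp: invariant_subspace_def intro!: csubspace_diff[OF csubspace_L] csubspace_scale[OF csubspace_L])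
  next
    fix t assume t: "t \<in> L"
    define y where "y = Pp t"
    have ty: "t = y + K y" using L_split[OF t] by (simp add: y_def)
    have "Pp (y - G \<mu> (K y)) = y - G \<mu> (K y)" by (simp add: y_def Pp_simps)
    from surj[OF this] obtain x s where xs: "Sr x s" "s - l *\<^sub>C x + (l - \<mu>) *\<^sub>C G \<mu> (K x) = y - G \<mu> (K y)" by blast
    obtain f where f: "\<And>n. f n \<in> Dp" "f \<longlonglongrightarrow> x" "(\<lambda>n. S \<mu> (f n)) \<longlonglongrightarrow> s" using xs(1) by (rule SrE) blast
    obtain v where v: "Pp v = v" "v - G \<mu> (K v) = s - \<mu> *\<^sub>C x" "Acl (x + K x) (\<mu> *\<^sub>C (x + K x) + v + K v)"
      using S_Cauchy_graph[OF f] by blast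
    have "(v - (l - \<mu>) *\<^sub>C x) - G \<mu> (K (v - (l - \<mu>) *\<^sub>C x)) = (v - G \<mu> (K v)) - ((l - \<mu>) *\<^sub>C x - (l - \<mu>) *\<^sub>C G \<mu> (K x))"
      by (simp add: clinear_mapD(2,4)[OF K(1)] clinear_mapD(2,4)[OF clinear_G[OF mu]])
    also have "\<dots> = s - l *\<^sub>C x + (l - \<mu>) *\<^sub>C G \<mu> (K x)"
      unfolding v(2) by (simp add: cvs.scale_left_diff_distrib scaleC_add_left)
    also have "\<dots> = y - G \<mu> (K y)" by (rule xs(2))
    finally have "v - (l - \<mu>) *\<^sub>C x = y" using H_lower[of "v - (l - \<mu>) *\<^sub>C x" y] by simp
    then have vy: "v = y + (l - \<mu>) *\<^sub>C x" by (simp add: diff_eq_eq)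
    have "cA (x + K x) - l *\<^sub>C (x + K x) = t"
      unfolding cA_eq[OF v(3)] vy ty
      by (simp add: clinear_mapD(1,2)[OF K(1)] scaleC_add_right scaleC_add_left cvs.scale_left_diff_distrib)
    then show "t \<in> (\<lambda>x. cA x - l *\<^sub>C x) ` (DA \<inter> L)"
      using DA_I[OF v(3)] in_L[OF Sr_Pp(1)[OF xs(1)]] by (intro image_eqI[of _ _ "x + K x"]) auto
  qed
  then show ?thesis unfolding resolvent_set_in_def using lower by blast
qed

text \<open>The given \<open>L'\<close> has its own angular operator \<open>K'\<close>. Solving
  \<open>(cA - m) z = h + K' h\<close> in \<open>L'\<close> yields
  \<open>(S - m) x + G (K' (h + 2 m x)) = h\<close>. It remains to find \<open>h\<close> for which
  the left part equals the prescribed \<open>g\<close>, a fixed point problem in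
  \<open>h\<close>.\<close>

lemma Sr_surj_converse:
  assumes L': "max_nonneg_subspace J L'" "invariant_subspace DA cA L'"
    and sp: "spectrum_in L' (DA \<inter> L') cA \<subseteq> {z. Re z \<le> 0}" and g: "Pp g = g"
  shows "\<exists>x s. Sr x s \<and> s - of_real m *\<^sub>C x = g"
proof -
  obtain K' where K': "clinear_map K'" "\<And>x. norm (K' x) \<le> norm x" "\<And>z. z \<in> L' \<Longrightarrow> Pm z = K' (Pp z)"
    "\<And>h. Pp h = h \<Longrightarrow> h + K' h \<in> L'" "\<And>x. Pp (K' x) = 0"
    using max_nonneg_angular[OF L'(1)] by blast
  have GK': "norm (G \<mu> (K' x)) \<le> (1/8) * norm x" for x using G8[of "K' x"] K'(2)[of x] by linarith
  have "of_real m \<in> resolvent_set_in L' (DA \<inter> L') cA"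
    using sp m_pos unfolding spectrum_in_def by force
  then have bij: "bij_betw (\<lambda>x. cA x - of_real m *\<^sub>C x) (DA \<inter> L') L'" by (simp add: resolvent_set_in_def)
  have ex: "\<exists>x s. Sr x s \<and> s - of_real m *\<^sub>C x + G \<mu> (K' (h + of_real (2 * m) *\<^sub>C x)) = h" if h: "Pp h = h" for h
  proof -
    have "h + K' h \<in> (\<lambda>x. cA x - of_real m *\<^sub>C x) ` (DA \<inter> L')" using bij K'(4)[OF h] by (simp add: bij_betw_def)
    then obtain z where "h + K' h = cA z - of_real m *\<^sub>C z" "z \<in> DA \<inter> L'" by (rule imageE)
    then have z: "z \<in> DA" "z \<in> L'" "cA z - of_real m *\<^sub>C z = h + K' h" by simp_all
    have cz: "cA z \<in> L'" using L'(2) z by (simp add: invariant_subspace_def)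
    obtain x where x: "\<And>n. x n \<in> Dp" "x \<longlonglongrightarrow> Pp z" "(\<lambda>n. S \<mu> (x n)) \<longlonglongrightarrow> Pp (cA z) - G \<mu> (Pm (cA z) - \<mu> *\<^sub>C Pm z)"
      using Acl_S[OF mu Acl_cA[OF z(1)]] by blast
    have ph: "Pp (cA z) = h + of_real m *\<^sub>C Pp z"
      using arg_cong[OF z(3), of Pp] by (simp add: Pp_simps h K'(5) diff_eq_eq)
    have "Pm (cA z) - \<mu> *\<^sub>C Pm z = K' (h + of_real (2 * m) *\<^sub>C Pp z)"
      unfolding K'(3)[OF cz] K'(3)[OF z(2)] ph
      by (simp add: clinear_mapD(1,2)[OF K'(1)] scaleC_add_left[symmetric] add.assoc)
    then show ?thesis using SrI[OF x] ph
      by (intro exI[of _ "Pp z"] exI[of _ "Pp (cA z) - G \<mu> (Pm (cA z) - \<mu> *\<^sub>C Pm z)"]) simp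
  qed
  have "\<forall>h. \<exists>x. \<exists>s. Sr x s \<and> s - of_real m *\<^sub>C x + G \<mu> (K' (Pp h + of_real (2 * m) *\<^sub>C x)) = Pp h"
    using ex by (metis Pp_Pp)
  from choice[OF this] obtain X where X: "\<And>h. \<exists>s. Sr (X h) s \<and> s - of_real m *\<^sub>C X h + G \<mu> (K' (Pp h + of_real (2 * m) *\<^sub>C X h)) = Pp h"
    by blast
  define T where "T h = - G \<mu> (K' (Pp h + of_real (2 * m) *\<^sub>C X h))" for h
  have "norm (T h - T h') \<le> 1/2 * norm (h - h')" for h h'
  proof -
    have "\<exists>s. Sr (X h) s \<and> s - of_real m *\<^sub>C X h = Pp h + T h" for h
      using X[of h] by (simp add: T_def eq_diff_eq)
    then obtain s s' where s: "Sr (X h) s" "s - of_real m *\<^sub>C X h = Pp h + T h" "Sr (X h') s'" "s' - of_real m *\<^sub>C X h' = Pp h' + T h'"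
      by blast
    define x where "x = X h - X h'"
    have Td: "T h - T h' = - G \<mu> (K' (Pp (h - h') + of_real (2 * m) *\<^sub>C x))"
      by (simp add: T_def x_def clinear_mapD(1,2,4)[OF K'(1)] clinear_mapD(1,2,4)[OF clinear_G[OF mu]] Pp_simps
          cvs.scale_right_diff_distrib)
    have "norm (T h - T h') \<le> (1/8) * norm (Pp (h - h') + of_real (2 * m) *\<^sub>C x)"
      unfolding Td norm_minus_cancel by (rule GK')
    also have "norm (Pp (h - h') + of_real (2 * m) *\<^sub>C x) \<le> norm (h - h') + 2 * (m * norm x)"
      using norm_triangle_ineq[of "Pp (h - h')" "of_real (2 * m) *\<^sub>C x"] norm_Pp_le[of "h - h'"] m_pos by (simp add: norm_scaleC norm_mult)
    finally have 1: "norm (T h - T h') \<le> (1/8) * (norm (h - h') + 2 * (m * norm x))" by simp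
    have "m * norm x \<le> norm ((s - s') - of_real m *\<^sub>C x)"
      using dissipative_lower_bound[OF Sr_dissipative[OF Sr_diff[OF s(1,3)]], of "of_real m"] by (simp add: x_def)
    also have "(s - s') - of_real m *\<^sub>C x = (s - of_real m *\<^sub>C X h) - (s' - of_real m *\<^sub>C X h')"
      by (simp add: x_def cvs.scale_right_diff_distrib)
    also have "\<dots> = Pp (h - h') + (T h - T h')" unfolding s(2,4) by (simp add: Pp_simps)
    also have "norm (Pp (h - h') + (T h - T h')) \<le> norm (h - h') + norm (T h - T h')"
      using norm_triangle_ineq[of "Pp (h - h')" "T h - T h'"] norm_Pp_le[of "h - h'"] by linarith
    \<comment> \<open>With \<open>N = |T h - T h'|\<close> and \<open>d = |h - h'|\<close> the two
      estimates combine to \<open>N \<le> (1/8) (d + 2 (d + N))\<close>, that is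
      \<open>N \<le> d/2\<close>.\<close>
    finally show ?thesis using 1 by argo
  qed
  then obtain h where h: "h + T h = g" using solve_contraction[of "1/2" T g] by auto
  have "Pp h = h"
  proof -
    have "h = g - T h" using h by (simp add: algebra_simps)
    moreover have "Pp (g - T h) = g - T h" by (simp add: T_def Pp_simps g)
    ultimately show ?thesis by simp
  qed
  obtain s where s: "Sr (X h) s" "s - of_real m *\<^sub>C X h + G \<mu> (K' (Pp h + of_real (2 * m) *\<^sub>C X h)) = Pp h" using X by blast
  have "s - of_real m *\<^sub>C X h = Pp h + T h" using s(2) by (simp add: T_def eq_diff_eq)
  then have "s - of_real m *\<^sub>C X h = g" using h \<open>Pp h = h\<close> by simp
  then show ?thesis using s(1) by blast
qed

text \<open>Prescribing \<open>q = - Pm t\<close> and setting \<open>y n = R q - F (f n)\<close>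
  satisfies the lower row exactly for every \<open>n\<close>, and the upper row holds in the limit.
  Convergence of \<open>z n\<close> is drawn from the lower bound \<open>m\<close> of
  \<open>J A - m\<close>.\<close>

lemma Acl_surj:
  assumes onto: "\<And>g. Pp g = g \<Longrightarrow> \<exists>x s. Sr x s \<and> s - of_real m *\<^sub>C x = g"
  shows "\<exists>z w. Acl z w \<and> J w - of_real m *\<^sub>C z = t"
proof -
  define q where "q = - Pm t"
  have Pmq: "Pm q = q" by (simp add: q_def Pm_simps)
  obtain x s where xs: "Sr x s" "s - of_real m *\<^sub>C x = Pp t - G \<mu> q" using onto[of "Pp t - G \<mu> q"] by (auto simp: Pp_simps)
  obtain f where f: "\<And>n. f n \<in> Dp" "f \<longlonglongrightarrow> x" "(\<lambda>n. S \<mu> (f n)) \<longlonglongrightarrow> s" using xs(1) by (rule SrE) blast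
  define y where "y n = R \<mu> q - F \<mu> (f n)" for n
  have y: "y n \<in> Dm" for n unfolding y_def by (rule csubspace_diff[OF Dm(1) R_in[OF mu] F_in[OF mu]])
  define z where "z n = f n + y n" for n
  have zD: "z n \<in> D" for n unfolding z_def by (rule add_in_D[OF f(1) y])
  have JA: "J (A (z n)) - of_real m *\<^sub>C z n = (S \<mu> (f n) - of_real m *\<^sub>C f n) + G \<mu> q - q" for n
  proof -
    define q' where "q' = Pm (A (z n)) - \<mu> *\<^sub>C y n"
    have "R \<mu> q = R \<mu> q'" using A_parts_R[OF mu f(1) y, of n n] by (simp add: y_def q'_def z_def)
    then have "Pm q = Pm q'" using R_eq[OF mu, of q] R_eq[OF mu, of q'] by simp
    then have q': "q' = q" using Pm_Dm[OF y] Pmq by (simp add: q'_def Pm_simps)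
    have "Pp (A (z n)) = S \<mu> (f n) + G \<mu> q" using A_parts_Pp[OF mu f(1) y, of n n] q' by (simp add: q'_def z_def)
    moreover have "Pm (A (z n)) = q + \<mu> *\<^sub>C y n" using q' by (simp add: q'_def algebra_simps)
    ultimately show ?thesis by (simp add: J_def z_def scaleC_add_right)
  qed
  have lim: "(\<lambda>n. J (A (z n)) - of_real m *\<^sub>C z n) \<longlonglongrightarrow> t"
  proof -
    have "(\<lambda>n. (S \<mu> (f n) - of_real m *\<^sub>C f n) + G \<mu> q - q) \<longlonglongrightarrow> (s - of_real m *\<^sub>C x) + G \<mu> q - q"
      by (intro tendsto_add tendsto_diff tendsto_scaleC tendsto_const f)
    moreover have "(s - of_real m *\<^sub>C x) + G \<mu> q - q = t" unfolding xs(2) using Pp_Pm_add[of t] by (simp add: q_def)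
    ultimately show ?thesis unfolding JA by simp
  qed
  obtain z0 where z0: "z \<longlonglongrightarrow> z0"
  proof (rule Cauchy_if_lower_bound[OF m_pos, of z "\<lambda>n. J (A (z n)) - of_real m *\<^sub>C z n"])
    fix i j
    have "Re (of_real m) * norm (z i - z j) \<le> norm (J (A (z i - z j)) - of_real m *\<^sub>C (z i - z j))"
      by (rule dissipative_lower_bound[OF J_A_dissipative[OF csubspace_diff[OF csubspace_D zD zD]]])
    then show "m * norm (z i - z j) \<le> norm (J (A (z i)) - of_real m *\<^sub>C z i - (J (A (z j)) - of_real m *\<^sub>C z j))"
      by (simp add: A_simps(2)[OF zD zD] J_simps cvs.scale_right_diff_distrib algebra_simps)
  qed (use lim in \<open>auto simp: convergent_def\<close>)
  have "(\<lambda>n. J ((J (A (z n)) - of_real m *\<^sub>C z n) + of_real m *\<^sub>C z n)) \<longlonglongrightarrow> J (t + of_real m *\<^sub>C z0)"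
    by (intro bounded_linear.tendsto[OF bounded_linear_J] tendsto_add tendsto_scaleC tendsto_const lim z0)
  then have "Acl z0 (J (t + of_real m *\<^sub>C z0))" by (intro AclI[OF zD z0]) simp
  then show ?thesis by (intro exI[of _ z0] exI[of _ "J (t + of_real m *\<^sub>C z0)"]) simp
qed

text \<open>\<open>J cA - m\<close> is onto, while every dissipative extension minus
  \<open>m\<close> is injective; hence no vector can be added to the domain.\<close>

lemma m_dissipative_closure:
  assumes onto: "\<And>g. Pp g = g \<Longrightarrow> \<exists>x s. Sr x s \<and> s - of_real m *\<^sub>C x = g"
  shows "m_dissipative_in UNIV DA (\<lambda>z. Pp (cA z) - Pm (cA z))"
  unfolding m_dissipative_in_def J_def[symmetric]
proof (intro conjI notI)
  show "dissipative_in UNIV DA (\<lambda>z. J (cA z))"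
    unfolding dissipative_in_def operator_in_def
  proof (intro conjI ballI)
    show "csubspace DA"
      unfolding csubspace_def
      by (intro conjI ballI allI DA_I[OF Acl_A[OF csubspace_zero[OF csubspace_D]]] DA_I[OF Acl_add[OF Acl_cA Acl_cA]]
          DA_I[OF Acl_scale[OF Acl_cA]])
    show "clinear_on DA (\<lambda>z. J (cA z))"
      unfolding clinear_on_def
      using cA_eq[OF Acl_add[OF Acl_cA Acl_cA]] cA_eq[OF Acl_scale[OF Acl_cA]] by (simp add: J_simps)
    show "Re (cinner (J (cA z)) z) \<le> 0" if "z \<in> DA" for z by (rule Acl_dissipative[OF Acl_cA[OF that]])
  qed auto
  assume "\<exists>D' T'. dissipative_in UNIV D' T' \<and> DA \<subset> D' \<and> (\<forall>x\<in>DA. T' x = J (cA x))"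
  then obtain D' T' where d: "dissipative_in UNIV D' T'" and sub: "DA \<subset> D'" and eq: "\<And>x. x \<in> DA \<Longrightarrow> T' x = J (cA x)" by blast
  obtain x where x: "x \<in> D'" "x \<notin> DA" using sub by blast
  obtain z w where z: "Acl z w" "J w - of_real m *\<^sub>C z = T' x - of_real m *\<^sub>C x" using Acl_surj[OF onto] by blast
  have zDA: "z \<in> DA" by (rule DA_I[OF z(1)])
  then have zD': "z \<in> D'" using sub by blast
  have "T' (x - z) = T' x - J w"
    using clinear_on_diff[OF dissipative_inD(3,2)[OF d] x(1) zD'] eq[OF zDA] cA_eq[OF z(1)] by simp
  then have "T' (x - z) - of_real m *\<^sub>C (x - z) = (T' x - of_real m *\<^sub>C x) - (J w - of_real m *\<^sub>C z)"
    by (simp add: cvs.scale_right_diff_distrib)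
  then have "T' (x - z) - of_real m *\<^sub>C (x - z) = 0" unfolding z(2) by simp
  then have "m * norm (x - z) \<le> 0"
    using dissipative_lower_bound[OF dissipative_inD(5)[OF d csubspace_diff[OF dissipative_inD(2)[OF d] x(1) zD']], of "of_real m"] by simp
  then have "x = z" using m_pos by (simp add: mult_le_0_iff)
  then show False using x(2) zDA by simp
qed

end

theorem theorem2p1:
  fixes Pp Pm :: "'a::{cinner_space, complete_space} \<Rightarrow> 'a"
    and Dp Dm :: "'a set"
    and A :: "'a \<Rightarrow> 'a"
  assumes sep: "separable_space TYPE('a)"
    and proj_p: "orth_proj Pp" and proj_m: "orth_proj Pm"
    and compl: "\<forall>x. Pp x + Pm x = x"
    and inf_p: "infinite_dim (range Pp)" and inf_m: "infinite_dim (range Pm)"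
    and Dp: "csubspace Dp" "Dp \<subseteq> range Pp"
    and Dm: "csubspace Dm" "Dm \<subseteq> range Pm"
    and A_lin: "clinear_on {x + y | x y. x \<in> Dp \<and> y \<in> Dm} A"
    and dense: "closure {x + y | x y. x \<in> Dp \<and> y \<in> Dm} = UNIV"
    and J_diss: "dissipative_in UNIV {x + y | x y. x \<in> Dp \<and> y \<in> Dm}
                   (\<lambda>x. Pp (A x) - Pm (A x))"
    and cond_i: "m_dissipative_in (range Pm) Dm (\<lambda>x. - Pm (A x))"
    and cond_ii: "\<exists>\<mu>. Re \<mu> < 0 \<and> (\<exists>C. \<forall>x\<in>Dp.
                     norm (resolvent_op Dm (\<lambda>y. Pm (A y)) \<mu> (Pm (A x))) \<le> C * norm x)"
    and cond_iii: "\<exists>\<mu>. Re \<mu> < 0 \<and>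
                     compact_op_on (range Pm) (\<lambda>y. Pp (A (resolvent_op Dm (\<lambda>z. Pm (A z)) \<mu> y)))"
  shows "(\<exists>L. max_nonneg_subspace (\<lambda>x. Pp x - Pm x) L \<and>
              invariant_subspace (closure_dom {x + y | x y. x \<in> Dp \<and> y \<in> Dm} A)
                                 (closure_op {x + y | x y. x \<in> Dp \<and> y \<in> Dm} A) L)
       \<and> (m_dissipative_in UNIV (closure_dom {x + y | x y. x \<in> Dp \<and> y \<in> Dm} A)
             (\<lambda>x. Pp (closure_op {x + y | x y. x \<in> Dp \<and> y \<in> Dm} A x)
                 - Pm (closure_op {x + y | x y. x \<in> Dp \<and> y \<in> Dm} A x))
          \<longleftrightarrow>
          (\<exists>L. max_nonneg_subspace (\<lambda>x. Pp x - Pm x) L \<and>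
              invariant_subspace (closure_dom {x + y | x y. x \<in> Dp \<and> y \<in> Dm} A)
                                 (closure_op {x + y | x y. x \<in> Dp \<and> y \<in> Dm} A) L \<and>
              spectrum_in L (closure_dom {x + y | x y. x \<in> Dp \<and> y \<in> Dm} A \<inter> L)
                            (closure_op {x + y | x y. x \<in> Dp \<and> y \<in> Dm} A)
                \<subseteq> {z. Re z \<le> 0}))"
proof -
  interpret j: j_dissipative Pp Pm Dp Dm A
    by unfold_locales (fact proj_p proj_m compl Dp Dm A_lin dense J_diss cond_i cond_iii)+
  obtain m U k K where lg: "limit_graph Pp Pm Dp Dm A m U k K" using j.limit_graph_exists by blast
  interpret l: limit_graph Pp Pm Dp Dm A m U k K by (rule lg)
  have J: "(\<lambda>x. Pp x - Pm x) = j.J" by (simp add: fun_eq_iff j.J_def)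
  have D: "{x + y | x y. x \<in> Dp \<and> y \<in> Dm} = j.D" by (simp add: j.D_def)
  have "m_dissipative_in UNIV j.DA (\<lambda>x. Pp (j.cA x) - Pm (j.cA x)) \<longleftrightarrow>
    (\<exists>L. max_nonneg_subspace j.J L \<and> invariant_subspace j.DA j.cA L \<and> spectrum_in L (j.DA \<inter> L) j.cA \<subseteq> {z. Re z \<le> 0})"
  proof
    assume md: "m_dissipative_in UNIV j.DA (\<lambda>x. Pp (j.cA x) - Pm (j.cA x))"
    have "z \<in> resolvent_set_in l.L (j.DA \<inter> l.L) j.cA" if "Re z > 0" for z
      by (rule l.resolvent_of_restriction[OF l.Sr_surj_all[OF l.Sr_surj_m[OF md]] that])
    then have "spectrum_in l.L (j.DA \<inter> l.L) j.cA \<subseteq> {z. Re z \<le> 0}" unfolding spectrum_in_def by force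
    then show "\<exists>L. max_nonneg_subspace j.J L \<and> invariant_subspace j.DA j.cA L \<and> spectrum_in L (j.DA \<inter> L) j.cA \<subseteq> {z. Re z \<le> 0}"
      using l.L_max_nonneg l.L_invariant by blast
  next
    assume "\<exists>L. max_nonneg_subspace j.J L \<and> invariant_subspace j.DA j.cA L \<and> spectrum_in L (j.DA \<inter> L) j.cA \<subseteq> {z. Re z \<le> 0}"
    then obtain L where L: "max_nonneg_subspace j.J L" "invariant_subspace j.DA j.cA L"
      "spectrum_in L (j.DA \<inter> L) j.cA \<subseteq> {z. Re z \<le> 0}" by blast
    show "m_dissipative_in UNIV j.DA (\<lambda>x. Pp (j.cA x) - Pm (j.cA x))"
      by (rule l.m_dissipative_closure[OF l.Sr_surj_converse[OF L]])
  qed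
  then show ?thesis unfolding J D using l.L_max_nonneg l.L_invariant by blast
qed

end
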